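(* Let $\Gamma$ be a finite simplicial graph and $G_\Gamma$ the associated right-angled Artin group. Then, for all $q\ge0$, $$\Sigma^q(G_\Gamma,\mathbb{R})=\Big(\bigcup_{i\le q}\mathcal{R}^i_1(G_\Gamma,\mathbb{R})\Big)^{c},$$ where $(\cdot)^c$ denotes the complement in $\mathrm{Hom}(G_\Gamma,\mathbb{R})=H^1(G_\Gamma,\mathbb{R})$.
   Context: $G_\Gamma$ has a generator $v$ for each vertex $v$ of $\Gamma$, and a relation $vw=wv$ for each edge $\{v,w\}$ of $\Gamma$. For a commutative ring $R$ with $1\ne0$ and a finitely generated group $G$, $\Sigma^q(G,R)$ is the set of non-zero homomorphisms $\chi\colon G\to\mathbb{R}$ such that the trivial module $R$ is of type $\mathrm{FP}_q$ over the monoid ring $RG_\chi$, where $G_\chi=\{g\in G\mid\chi(g)\ge0\}$. (A module over a ring is of type $\mathrm{FP}_q$ if it has a projective resolution $P_\bullet$ with $P_i$ finitely generated for $i\le q$.) Here $R=\mathbb{R}$. With $A=H^*(G,\mathbb{R})$, $\mathcal{R}^i_1(G,\mathbb{R})=\{a\in A^1\mid H^i(A,\cdot a)\ne0\}$, where $(A,\cdot a)$ is the cochain complex $A^0\to A^1\to A^2\to\cdots$ with differential multiplication by $a$. *)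

theory Defs
  imports
    Complex_Main
    "HOL-Algebra.Coset"
    "HOL-Algebra.Module"
    "Graph_Theory.Digraph"
begin

section \<open>Group presentations and right-angled Artin groups\<close>

text \<open>
  A letter \<open>(s, True)\<close> stands for the generator \<open>s\<close>, and \<open>(s, False)\<close> for its formal inverse.
\<close>

type_synonym 's word = "('s \<times> bool) list"

definition words :: "'s set \<Rightarrow> 's word set" where
  "words S = lists (S \<times> UNIV)"

inductive_set presentation_cong :: "'s set \<Rightarrow> ('s word \<times> 's word) set \<Rightarrow> ('s word \<times> 's word) set"
  for S :: "'s set" and Rel :: "('s word \<times> 's word) set"
where
  refl: "w \<in> words S \<Longrightarrow> (w, w) \<in> presentation_cong S Rel"
| sym: "(u, w) \<in> presentation_cong S Rel \<Longrightarrow> (w, u) \<in> presentation_cong S Rel"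
| trans: "(u, v) \<in> presentation_cong S Rel \<Longrightarrow> (v, w) \<in> presentation_cong S Rel
    \<Longrightarrow> (u, w) \<in> presentation_cong S Rel"
| cancel: "u \<in> words S \<Longrightarrow> w \<in> words S \<Longrightarrow> s \<in> S
    \<Longrightarrow> (u @ [(s, b), (s, \<not> b)] @ w, u @ w) \<in> presentation_cong S Rel"
| rel: "u \<in> words S \<Longrightarrow> w \<in> words S \<Longrightarrow> (l, r) \<in> Rel \<Longrightarrow> l \<in> words S \<Longrightarrow> r \<in> words S
    \<Longrightarrow> (u @ l @ w, u @ r @ w) \<in> presentation_cong S Rel"

definition presented_group :: "'s set \<Rightarrow> ('s word \<times> 's word) set \<Rightarrow> 's word set monoid" where
  "presented_group S Rel =
    \<lparr>carrier = words S // presentation_cong S Rel,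
     mult = (\<lambda>X Y. \<Union>x\<in>X. \<Union>y\<in>Y. presentation_cong S Rel `` {x @ y}),
     one = presentation_cong S Rel `` {[]}\<rparr>"

text \<open>
  In \<^locale>\<open>graph\<close>, an edge between \<open>v\<close> and \<open>w\<close> is represented by a pair of opposite arcs.
\<close>

definition raag :: "('v, 'e) pre_digraph \<Rightarrow> 'v word set monoid" where
  "raag \<Gamma> = presented_group (verts \<Gamma>)
     {([(v, True), (w, True)], [(w, True), (v, True)]) | v w. v \<rightarrow>\<^bsub>\<Gamma>\<^esub> w}"


section \<open>Modules over a not necessarily commutative ring, and type FP\<close>

text \<open>
  The library locale \<^locale>\<open>module\<close> demands a commutative ring of scalars. The ring multiplication
  and unit fields of a \<^typ>\<open>('r, 'm) module\<close> record play no role for modules.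
\<close>

locale left_module = R?: ring R + M?: abelian_group M
  for R (structure) and M :: "('r, 'm, 'z) module_scheme" (structure) +
  assumes smult_closed:
      "\<lbrakk>a \<in> carrier R; x \<in> carrier M\<rbrakk> \<Longrightarrow> a \<odot>\<^bsub>M\<^esub> x \<in> carrier M"
    and smult_l_distr:
      "\<lbrakk>a \<in> carrier R; b \<in> carrier R; x \<in> carrier M\<rbrakk>
        \<Longrightarrow> (a \<oplus>\<^bsub>R\<^esub> b) \<odot>\<^bsub>M\<^esub> x = a \<odot>\<^bsub>M\<^esub> x \<oplus>\<^bsub>M\<^esub> b \<odot>\<^bsub>M\<^esub> x"
    and smult_r_distr:
      "\<lbrakk>a \<in> carrier R; x \<in> carrier M; y \<in> carrier M\<rbrakk>
        \<Longrightarrow> a \<odot>\<^bsub>M\<^esub> (x \<oplus>\<^bsub>M\<^esub> y) = a \<odot>\<^bsub>M\<^esub> x \<oplus>\<^bsub>M\<^esub> a \<odot>\<^bsub>M\<^esub> y"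
    and smult_assoc1:
      "\<lbrakk>a \<in> carrier R; b \<in> carrier R; x \<in> carrier M\<rbrakk>
        \<Longrightarrow> (a \<otimes>\<^bsub>R\<^esub> b) \<odot>\<^bsub>M\<^esub> x = a \<odot>\<^bsub>M\<^esub> (b \<odot>\<^bsub>M\<^esub> x)"
    and smult_one:
      "x \<in> carrier M \<Longrightarrow> \<one>\<^bsub>R\<^esub> \<odot>\<^bsub>M\<^esub> x = x"

definition linear_maps ::
    "('r, 'y) ring_scheme \<Rightarrow> ('r, 'm, 'z) module_scheme \<Rightarrow> ('r, 'n, 'w) module_scheme \<Rightarrow> ('m \<Rightarrow> 'n) set"
where
  "linear_maps R M N = {f \<in> carrier M \<rightarrow> carrier N.
     (\<forall>x\<in>carrier M. \<forall>y\<in>carrier M. f (x \<oplus>\<^bsub>M\<^esub> y) = f x \<oplus>\<^bsub>N\<^esub> f y) \<and>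
     (\<forall>a\<in>carrier R. \<forall>x\<in>carrier M. f (a \<odot>\<^bsub>M\<^esub> x) = a \<odot>\<^bsub>N\<^esub> f x)}"

definition finitely_generated_module ::
    "('r, 'y) ring_scheme \<Rightarrow> ('r, 'm, 'z) module_scheme \<Rightarrow> bool"
where
  "finitely_generated_module R M \<longleftrightarrow> (\<exists>B. finite B \<and> B \<subseteq> carrier M \<and>
     (\<forall>x\<in>carrier M. \<exists>c\<in>B \<rightarrow> carrier R. x = (\<Oplus>\<^bsub>M\<^esub>b\<in>B. c b \<odot>\<^bsub>M\<^esub> b)))"

definition free_module :: "('r, 'y) ring_scheme \<Rightarrow> 'b set \<Rightarrow> ('r, 'b \<Rightarrow> 'r) module" where
  "free_module R X =
    \<lparr>carrier = {f. (\<forall>x. f x \<in> carrier R) \<and> {x. f x \<noteq> \<zero>\<^bsub>R\<^esub>} \<subseteq> X \<and> finite {x. f x \<noteq> \<zero>\<^bsub>R\<^esub>}},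
     mult = undefined, one = undefined,
     zero = (\<lambda>x. \<zero>\<^bsub>R\<^esub>), add = (\<lambda>f g x. f x \<oplus>\<^bsub>R\<^esub> g x),
     smult = (\<lambda>a f x. a \<otimes>\<^bsub>R\<^esub> f x)\<rparr>"

text \<open>
  Projective means: direct summand of a free module. A basis \<open>X\<close> inside the type of \<open>P\<close> suffices,
  since a summand of any free module is also a summand of the free module on its own carrier.
\<close>

definition projective_module ::
    "('r, 'y) ring_scheme \<Rightarrow> ('r, 'm, 'z) module_scheme \<Rightarrow> bool"
where
  "projective_module R P \<longleftrightarrow> left_module R P \<and>
     (\<exists>(X :: 'm set) \<iota> \<pi>. \<iota> \<in> linear_maps R P (free_module R X) \<and>
        \<pi> \<in> linear_maps R (free_module R X) P \<and> (\<forall>x\<in>carrier P. \<pi> (\<iota> x) = x))"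

text \<open>The resolution is \<open>\<dots> \<rightarrow> P 2 \<rightarrow> P 1 \<rightarrow> P 0 \<rightarrow> M \<rightarrow> 0\<close>, with \<open>d n\<close> mapping \<open>P (n + 1)\<close> to \<open>P n\<close>.\<close>

definition projective_resolution ::
    "('r, 'y) ring_scheme \<Rightarrow> ('r, 'm, 'z) module_scheme \<Rightarrow>
     (nat \<Rightarrow> ('r, 'p) module) \<Rightarrow> (nat \<Rightarrow> 'p \<Rightarrow> 'p) \<Rightarrow> ('p \<Rightarrow> 'm) \<Rightarrow> bool"
where
  "projective_resolution R M P d \<epsilon> \<longleftrightarrow>
     (\<forall>n. projective_module R (P n)) \<and>
     \<epsilon> \<in> linear_maps R (P 0) M \<and>
     (\<forall>n. d n \<in> linear_maps R (P (n + 1)) (P n)) \<and>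
     \<epsilon> ` carrier (P 0) = carrier M \<and>
     d 0 ` carrier (P 1) = {x \<in> carrier (P 0). \<epsilon> x = \<zero>\<^bsub>M\<^esub>} \<and>
     (\<forall>n. d (n + 1) ` carrier (P (n + 2)) = {x \<in> carrier (P (n + 1)). d n x = \<zero>\<^bsub>P n\<^esub>})"

text \<open>
  HOL cannot quantify over types, so the modules of the resolution are placed in one type.
  The type \<open>('r + 'm) list\<close> is infinite and at least as large as \<open>'r\<close> and \<open>'m\<close>, which makes this no
  restriction: given any projective resolution finitely generated up to degree \<open>q\<close>, one may replace
  its part above degree \<open>q\<close> by free modules on successive kernels, and then all modules have
  cardinality at most that of \<open>('r + 'm) list\<close>.
\<close>

definition type_FP ::
    "nat \<Rightarrow> ('r, 'y) ring_scheme \<Rightarrow> ('r, 'm, 'z) module_scheme \<Rightarrow> bool"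
where
  "type_FP q R M \<longleftrightarrow> left_module R M \<and>
     (\<exists>(P :: nat \<Rightarrow> ('r, ('r + 'm) list) module) d \<epsilon>.
        projective_resolution R M P d \<epsilon> \<and> (\<forall>i\<le>q. finitely_generated_module R (P i)))"


section \<open>Characters and the invariants \<open>\<Sigma>\<^sup>q\<close>\<close>

definition real_additive_group :: "real monoid" where
  "real_additive_group = \<lparr>carrier = UNIV, mult = (+), one = 0\<rparr>"

text \<open>
  \<open>Hom(G, \<real>)\<close>; extensionality makes a homomorphism determined by its values on the carrier.
\<close>

definition characters :: "('g, 'x) monoid_scheme \<Rightarrow> ('g \<Rightarrow> real) set" where
  "characters G = hom G real_additive_group \<inter> extensional (carrier G)"

definition monoid_ring :: "('g, 'x) monoid_scheme \<Rightarrow> ('g \<Rightarrow> 'k :: comm_ring_1) ring" where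
  "monoid_ring G =
    \<lparr>carrier = {f. {g. f g \<noteq> 0} \<subseteq> carrier G \<and> finite {g. f g \<noteq> 0}},
     mult = (\<lambda>f h x. \<Sum>(y, z) \<in> {(y, z). f y \<noteq> 0 \<and> h z \<noteq> 0 \<and> y \<otimes>\<^bsub>G\<^esub> z = x}. f y * h z),
     one = (\<lambda>x. if x = \<one>\<^bsub>G\<^esub> then 1 else 0),
     zero = (\<lambda>x. 0), add = (\<lambda>f h x. f x + h x)\<rparr>"

text \<open>The coefficient ring as a module on which every monoid element acts as the identity.\<close>

definition trivial_module :: "('g \<Rightarrow> 'k :: comm_ring_1, 'k) module" where
  "trivial_module =
    \<lparr>carrier = UNIV, mult = (*), one = 1, zero = 0, add = (+),
     smult = (\<lambda>f r. (\<Sum>g | f g \<noteq> 0. f g) * r)\<rparr>"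

definition nonneg_submonoid :: "('g, 'x) monoid_scheme \<Rightarrow> ('g \<Rightarrow> real) \<Rightarrow> ('g, 'x) monoid_scheme" where
  "nonneg_submonoid G \<chi> = G\<lparr>carrier := {g \<in> carrier G. \<chi> g \<ge> 0}\<rparr>"

definition Sigma_invariant :: "nat \<Rightarrow> ('g, 'x) monoid_scheme \<Rightarrow> ('g \<Rightarrow> real) set" where
  "Sigma_invariant q G = {\<chi> \<in> characters G. (\<exists>g\<in>carrier G. \<chi> g \<noteq> 0) \<and>
     type_FP q (monoid_ring (nonneg_submonoid G \<chi>)) (trivial_module :: ('g \<Rightarrow> real, real) module)}"


section \<open>Real group cohomology and its resonance varieties\<close>

text \<open>A cochain complex consists of abelian groups \<open>C n\<close> and differentials \<open>d n\<close> from \<open>C n\<close> to \<open>C (n + 1)\<close>.\<close>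

definition cocycles :: "(nat \<Rightarrow> 'a monoid) \<Rightarrow> (nat \<Rightarrow> 'a \<Rightarrow> 'a) \<Rightarrow> nat \<Rightarrow> 'a set" where
  "cocycles C d n = kernel (C n) (C (n + 1)) (d n)"

definition coboundaries :: "(nat \<Rightarrow> 'a monoid) \<Rightarrow> (nat \<Rightarrow> 'a \<Rightarrow> 'a) \<Rightarrow> nat \<Rightarrow> 'a set" where
  "coboundaries C d n = (case n of 0 \<Rightarrow> {\<one>\<^bsub>C 0\<^esub>} | Suc m \<Rightarrow> d m ` carrier (C m))"

definition cohomology :: "(nat \<Rightarrow> 'a monoid) \<Rightarrow> (nat \<Rightarrow> 'a \<Rightarrow> 'a) \<Rightarrow> nat \<Rightarrow> 'a set monoid" where
  "cohomology C d n = (C n)\<lparr>carrier := cocycles C d n\<rparr> Mod coboundaries C d n"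

text \<open>
  Inhomogeneous cochains with trivial real coefficients: functions on \<open>n\<close>-tuples of group elements,
  extended by zero to all other lists.
\<close>

definition tuples :: "('g, 'x) monoid_scheme \<Rightarrow> nat \<Rightarrow> 'g list set" where
  "tuples G n = {xs. length xs = n \<and> set xs \<subseteq> carrier G}"

definition cochains :: "('g, 'x) monoid_scheme \<Rightarrow> nat \<Rightarrow> ('g list \<Rightarrow> real) monoid" where
  "cochains G n =
    \<lparr>carrier = {f. \<forall>xs. xs \<notin> tuples G n \<longrightarrow> f xs = 0},
     mult = (\<lambda>f h xs. f xs + h xs), one = (\<lambda>xs. 0)\<rparr>"

definition codifferential ::
    "('g, 'x) monoid_scheme \<Rightarrow> nat \<Rightarrow> ('g list \<Rightarrow> real) \<Rightarrow> 'g list \<Rightarrow> real"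
where
  "codifferential G n f xs =
    (if xs \<in> tuples G (n + 1)
     then f (tl xs)
        + (\<Sum>i<n. (-1) ^ (i + 1) * f (take i xs @ [xs ! i \<otimes>\<^bsub>G\<^esub> xs ! (i + 1)] @ drop (i + 2) xs))
        + (-1) ^ (n + 1) * f (butlast xs)
     else 0)"

definition group_cohomology :: "('g, 'x) monoid_scheme \<Rightarrow> nat \<Rightarrow> ('g list \<Rightarrow> real) set monoid" where
  "group_cohomology G = cohomology (cochains G) (codifferential G)"

definition cup_cochain ::
    "('g, 'x) monoid_scheme \<Rightarrow> nat \<Rightarrow> nat \<Rightarrow> ('g list \<Rightarrow> real) \<Rightarrow> ('g list \<Rightarrow> real) \<Rightarrow> 'g list \<Rightarrow> real"
where
  "cup_cochain G m n f h xs =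
    (if xs \<in> tuples G (m + n) then f (take m xs) * h (drop m xs) else 0)"

text \<open>
  Products of representatives of two cohomology classes lie in a single coset of the coboundaries,
  so the union below is that coset.
\<close>

definition cup ::
    "('g, 'x) monoid_scheme \<Rightarrow> nat \<Rightarrow> nat \<Rightarrow>
     ('g list \<Rightarrow> real) set \<Rightarrow> ('g list \<Rightarrow> real) set \<Rightarrow> ('g list \<Rightarrow> real) set"
where
  "cup G m n X Y = (\<Union>f\<in>X. \<Union>h\<in>Y.
     coboundaries (cochains G) (codifferential G) (m + n) #>\<^bsub>cochains G (m + n)\<^esub> cup_cochain G m n f h)"

definition resonance_variety :: "nat \<Rightarrow> ('g, 'x) monoid_scheme \<Rightarrow> ('g list \<Rightarrow> real) set set" where
  "resonance_variety i G = {a \<in> carrier (group_cohomology G 1).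
     \<exists>x \<in> carrier (cohomology (group_cohomology G) (\<lambda>n b. cup G n 1 b a) i).
       x \<noteq> \<one>\<^bsub>cohomology (group_cohomology G) (\<lambda>n b. cup G n 1 b a) i\<^esub>}"

text \<open>
  The identification \<open>Hom(G, \<real>) = H\<^sup>1(G, \<real>)\<close>: a homomorphism is sent to the class of the 1-cocycle
  with the same values.
\<close>

definition character_class ::
    "('g, 'x) monoid_scheme \<Rightarrow> ('g \<Rightarrow> real) \<Rightarrow> ('g list \<Rightarrow> real) set"
where
  "character_class G \<chi> =
    coboundaries (cochains G) (codifferential G) 1 #>\<^bsub>cochains G 1\<^esub>
      (\<lambda>xs. if xs \<in> tuples G 1 then \<chi> (hd xs) else 0)"

end

theory Submission
  imports "Jordan_Normal_Form.Determinant" Defs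
begin

text \<open>
  Replace each generator \<open>v\<close> by its inverse where \<open>\<chi> v < 0\<close>. Functions on cliques with the differential
  \<open>cod\<close> given by multiplication with \<open>\<Sum>v. \<chi> v v\<^sup>*\<close> form a complex \<open>E\<close> isomorphic to \<open>(H\<^sup>*(G), \<chi>)\<close>:
  a cohomology class is determined by its values on the tori spanned by the cliques, products of dual
  characters realise all values, and the cup product with \<open>\<chi>\<close> becomes \<open>\<plusminus>cod\<close>. It remains to show that
  \<open>\<chi> \<in> \<Sigma>\<^sup>q\<close> if and only if \<open>E\<close> is exact in degrees at most \<open>q\<close>.

  The cubical chain complex \<open>C\<close> of the universal cover of the Salvetti complex resolves \<open>\<real>\<close> over \<open>\<real>G\<close>.
  If \<open>\<real>\<close> has type \<open>FP\<^sub>q\<close> over \<open>\<real>G\<^sub>\<chi>\<close>, a chain map from a finitely generated resolution to \<open>C\<close> has image in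
  some half space \<open>\<chi> \<ge> -N\<close> up to degree \<open>q\<close>, and after a translation the identity of \<open>C\<close> becomes homotopic
  to a map that moves all basis elements far up. Evaluating \<open>g\<close> at \<open>exp (- s \<chi> g)\<close> for large \<open>s\<close> makes this map
  smaller than the identity, so there is no harmonic form for the weights \<open>exp (- s \<chi> v) - 1\<close>, which have
  the same zeros as \<open>\<chi> v\<close>; exactness depends on these zeros only.

  Conversely, the boundary terms of \<open>C\<close> that stay at the base point, for the generators with \<open>\<chi> v > 0\<close>,
  form the dual of \<open>E\<close> for the weights \<open>-1\<close> and \<open>0\<close>. If \<open>E\<close> is exact, a contraction of this dual pushes
  chains upwards without changing their boundary, so the finitely generated free complex of chains
  over \<open>\<chi> \<ge> 0\<close> is acyclic in the required range.
\<close>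

section \<open>Weighted differentials on cliques\<close>

text \<open>The entries of the boundary of \<open>C\<close> are \<open>gam v - 1\<close>, and both
  kinds of weights come from them: evaluation gives \<open>exp (- s * \<chi> (gam v)) - 1\<close>,
  and the part that stays at the base point is \<open>-1\<close>. In the first direction a map
  pushing \<open>C\<close> upwards cannot be had by translation: left translation is not linear,
  right translation is not a chain map. The composite through the resolution is therefore defined on
  a half space reaching below 0, where each basis cube is \<open>t\<close> times another element.
  Linearity then gains \<open>\<chi> t\<close>, while the lower bound of the image was fixed before
  \<open>t\<close>. In the second direction the obstacle is a generator with
  \<open>\<chi> (gam v) = 0\<close>, whose boundary terms do not rise. The number of such generators
  in a cube is a second grading that makes the pushing terminate, provided that the contraction
  preserves it. An arbitrary contraction need not; the one built from the inverse Laplacian does,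
  and this is what Hodge theory on cliques is for.\<close>

lemma inverse_matrix_exists:
  fixes M :: "'a \<Rightarrow> 'a \<Rightarrow> real"
  assumes fin: "finite S"
    and inj: "\<And>x. (\<And>i. i \<in> S \<Longrightarrow> (\<Sum>j\<in>S. M i j * x j) = 0) \<Longrightarrow> \<forall>i\<in>S. x i = 0"
  obtains N where "\<And>i j. i \<in> S \<Longrightarrow> j \<in> S \<Longrightarrow> (\<Sum>k\<in>S. M i k * N k j) = of_bool (i = j)"
    and "\<And>i j. i \<in> S \<Longrightarrow> j \<in> S \<Longrightarrow> (\<Sum>k\<in>S. N i k * M k j) = of_bool (i = j)"
proof -
  define n where "n = card S"
  obtain e where e: "bij_betw e {0..<n} S"
    using ex_bij_betw_nat_finite[OF fin] n_def by blast
  define e' where "e' = the_inv_into {0..<n} e"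
  have e'_less: "e' i < n" if "i \<in> S" for i
    using bij_betw_the_inv_into[OF e] that unfolding e'_def bij_betw_def by auto
  have ee': "e (e' i) = i" if "i \<in> S" for i
    unfolding e'_def by (rule f_the_inv_into_f_bij_betw[OF e]) (use that in auto)
  have e'e: "e' (e i) = i" if "i < n" for i
    unfolding e'_def using e that by (intro the_inv_into_f_f) (auto simp: bij_betw_def)
  have eS: "e i \<in> S" if "i < n" for i using e that by (auto simp: bij_betw_def)
  have sum_e: "(\<Sum>i\<in>S. f i) = (\<Sum>i\<in>{0..<n}. f (e i))" for f :: "'a \<Rightarrow> real"
    by (rule sum.reindex_bij_betw[OF e, symmetric])
  define A where "A = mat n n (\<lambda>(i,j). M (e i) (e j))"
  have A: "A \<in> carrier_mat n n" by (simp add: A_def)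
  have "det A \<noteq> 0"
  proof
    assume "det A = 0"
    then obtain v where v: "v \<in> carrier_vec n" "v \<noteq> 0\<^sub>v n" "A *\<^sub>v v = 0\<^sub>v n"
      using det_0_iff_vec_prod_zero_field[OF A] by blast
    have "\<forall>i\<in>S. v $ (e' i) = 0"
    proof (rule inj)
      fix i assume i: "i \<in> S"
      have "(\<Sum>j\<in>S. M i j * v $ (e' j)) = (\<Sum>j\<in>{0..<n}. M i (e j) * v $ j)"
        unfolding sum_e by (intro sum.cong) (auto simp: e'e)
      also have "\<dots> = (A *\<^sub>v v) $ (e' i)"
        using e'_less[OF i] v(1) by (simp add: A_def scalar_prod_def ee'[OF i])
      finally show "(\<Sum>j\<in>S. M i j * v $ (e' j)) = 0" using v(3) e'_less[OF i] by simp
    qed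
    hence "v $ i = 0" if "i < n" for i using eS[OF that] e'e[OF that] by force
    hence "v = 0\<^sub>v n" using v(1) by (intro eq_vecI) auto
    thus False using v(2) by simp
  qed
  from det_non_zero_imp_unit[OF A this, of "()"]
  obtain B where B: "B \<in> carrier_mat n n" "A * B = 1\<^sub>m n" "B * A = 1\<^sub>m n"
    unfolding Units_def ring_mat_def by auto
  show thesis
  proof (rule that[of "\<lambda>i j. B $$ (e' i, e' j)"])
    fix i j assume ij: "i \<in> S" "j \<in> S"
    have eq: "e' i = e' j \<longleftrightarrow> i = j" using ij ee' by metis
    have "(\<Sum>k\<in>S. M i k * B $$ (e' k, e' j)) = (\<Sum>k\<in>{0..<n}. M i (e k) * B $$ (k, e' j))"
      unfolding sum_e by (intro sum.cong) (auto simp: e'e)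
    also have "\<dots> = (A * B) $$ (e' i, e' j)"
      using e'_less ij B(1) by (simp add: A_def scalar_prod_def ee')
    finally show "(\<Sum>k\<in>S. M i k * B $$ (e' k, e' j)) = of_bool (i = j)"
      using B(2) e'_less ij eq by simp
    have "(\<Sum>k\<in>S. B $$ (e' i, e' k) * M k j) = (\<Sum>k\<in>{0..<n}. B $$ (e' i, k) * M (e k) j)"
      unfolding sum_e by (intro sum.cong) (auto simp: e'e)
    also have "\<dots> = (B * A) $$ (e' i, e' j)"
      using e'_less ij B(1) by (simp add: A_def scalar_prod_def ee')
    finally show "(\<Sum>k\<in>S. B $$ (e' i, e' k) * M k j) = of_bool (i = j)"
      using B(3) e'_less ij eq by simp
  qed
qed

text \<open>The pair \<open>(v, w)\<close> cancels against \<open>(w, v)\<close>. Setting the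
  diagonal to zero makes the inner index set independent of \<open>v\<close>, so that the two sums
  can be exchanged.\<close>

lemma sum_antisym_zero:
  fixes f :: "'a \<Rightarrow> 'a \<Rightarrow> real"
  assumes "finite X" "\<And>v w. v \<in> X \<Longrightarrow> w \<in> X \<Longrightarrow> v \<noteq> w \<Longrightarrow> f v w = - f w v"
  shows "(\<Sum>v\<in>X. \<Sum>w\<in>X - {v}. f v w) = 0"
proof -
  define g where "g v w = (if w \<noteq> v then f v w else 0)" for v w
  have g: "(\<Sum>w\<in>X - {v}. f v w) = (\<Sum>w\<in>X. g v w)" for v
    unfolding g_def using assms(1) by (intro sum.mono_neutral_cong_left) auto
  have "(\<Sum>v\<in>X. \<Sum>w\<in>X. g v w) = (\<Sum>w\<in>X. \<Sum>v\<in>X. g v w)" by (rule sum.swap)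
  also have "\<dots> = (\<Sum>w\<in>X. \<Sum>v\<in>X. - g w v)"
  proof (intro sum.cong HOL.refl)
    fix v w assume "w \<in> X" "v \<in> X"
    thus "g v w = - g w v" using assms(2)[of v w] by (cases "v = w") (auto simp: g_def)
  qed
  also have "\<dots> = - (\<Sum>w\<in>X. \<Sum>v\<in>X. g w v)" by (simp add: sum_negf)
  finally show ?thesis unfolding g by linarith
qed

section \<open>Cliques and exterior signs\<close>

text \<open>The signs of an exterior algebra require a linear order of the vertices;
  \<open>idx\<close> provides it.\<close>

locale clique_complex =
  fixes V :: "'v set" and adj :: "'v \<Rightarrow> 'v \<Rightarrow> bool" and idx :: "'v \<Rightarrow> nat"
  assumes finite_V: "finite V"
    and inj_idx: "inj_on idx V"
    and adj_sym: "adj v w \<Longrightarrow> adj w v"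
    and adj_irrefl: "\<not> adj v v"
    and adj_V: "adj v w \<Longrightarrow> v \<in> V"
begin

definition clique :: "'v set \<Rightarrow> bool" where
  "clique \<sigma> \<longleftrightarrow> \<sigma> \<subseteq> V \<and> (\<forall>v\<in>\<sigma>. \<forall>w\<in>\<sigma>. v \<noteq> w \<longrightarrow> adj v w)"

definition cliques :: "nat \<Rightarrow> 'v set set" where
  "cliques n = {\<sigma>. clique \<sigma> \<and> card \<sigma> = n}"

text \<open>The sign of sorting \<open>v\<close> into the exterior monomial of \<sigma>: one
  transposition for each smaller vertex.\<close>

definition eps :: "'v \<Rightarrow> 'v set \<Rightarrow> real" where
  "eps v \<sigma> = (-1) ^ card {w \<in> \<sigma>. idx w < idx v}"

lemma clique_subset: "clique \<sigma> \<Longrightarrow> \<tau> \<subseteq> \<sigma> \<Longrightarrow> clique \<tau>"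
  unfolding clique_def by blast

lemma clique_V: "clique \<sigma> \<Longrightarrow> \<sigma> \<subseteq> V"
  unfolding clique_def by blast

lemma clique_finite: "clique \<sigma> \<Longrightarrow> finite \<sigma>"
  using clique_V finite_V finite_subset by blast

lemma clique_adj: "clique \<sigma> \<Longrightarrow> v \<in> \<sigma> \<Longrightarrow> w \<in> \<sigma> \<Longrightarrow> v \<noteq> w \<Longrightarrow> adj v w"
  unfolding clique_def by blast

lemma finite_cliques: "finite (cliques n)"
  by (rule finite_subset[of _ "Pow V"]) (auto simp: cliques_def clique_def finite_V)

lemma clique_empty: "clique {}"
  by (simp add: clique_def)

lemma cliques_0: "cliques 0 = {{}}"
  using clique_finite by (auto simp: cliques_def clique_empty)

lemma cliques_insert: "v \<notin> \<tau> \<Longrightarrow> insert v \<tau> \<in> cliques (Suc n) \<Longrightarrow> \<tau> \<in> cliques n"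
  using clique_subset[of "insert v \<tau>" \<tau>] clique_finite[of "insert v \<tau>"] by (auto simp: cliques_def)

lemma cliques_remove: "\<sigma> \<in> cliques (Suc n) \<Longrightarrow> v \<in> \<sigma> \<Longrightarrow> \<sigma> - {v} \<in> cliques n"
  using clique_subset[of \<sigma> "\<sigma> - {v}"] clique_finite[of \<sigma>] by (auto simp: cliques_def)

lemma eps_square: "eps v \<sigma> * eps v \<sigma> = 1"
  by (simp add: eps_def minus_one_power_iff)

lemma eps_nonzero: "eps v \<sigma> \<noteq> 0"
  by (simp add: eps_def)

lemma eps_insert:
  assumes "finite \<tau>" "w \<notin> \<tau>"
  shows "eps v (insert w \<tau>) = (if idx w < idx v then - eps v \<tau> else eps v \<tau>)"
proof -
  have "{u \<in> insert w \<tau>. idx u < idx v} =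
      (if idx w < idx v then insert w {u \<in> \<tau>. idx u < idx v} else {u \<in> \<tau>. idx u < idx v})"
    by auto
  thus ?thesis using assms by (auto simp: eps_def)
qed

lemma eps_swap:
  assumes "finite \<tau>" "v \<in> V" "w \<in> V" "v \<noteq> w" "v \<notin> \<tau>" "w \<notin> \<tau>"
  shows "eps v (insert w \<tau>) * eps w \<tau> = - (eps w (insert v \<tau>) * eps v \<tau>)"
proof -
  have "idx v \<noteq> idx w" using inj_idx assms by (auto dest: inj_onD)
  thus ?thesis using assms by (auto simp: eps_insert)
qed

text \<open>The common core of all arguments that a differential squares to zero. Removing two
  vertices in the two possible orders gives opposite signs, so a symmetric kernel \<open>B\<close>
  sums to zero. \<open>sum_cofaces_zero\<close> is the same for adding vertices; for cubes the
  symmetry of \<open>B\<close> expresses that generators commute.\<close>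

lemma sum_faces_zero:
  assumes "\<sigma> \<subseteq> V" "\<And>v w. v \<in> \<sigma> \<Longrightarrow> w \<in> \<sigma> \<Longrightarrow> v \<noteq> w \<Longrightarrow> B v w = B w v"
  shows "(\<Sum>v\<in>\<sigma>. \<Sum>w\<in>\<sigma> - {v}. eps v (\<sigma> - {v}) * eps w (\<sigma> - {v} - {w}) * B v w) = 0"
proof (rule sum_antisym_zero)
  show "finite \<sigma>" using assms(1) finite_V finite_subset by blast
  fix v w assume vw: "v \<in> \<sigma>" "w \<in> \<sigma>" "v \<noteq> w"
  have "eps v (insert w (\<sigma> - {v,w})) * eps w (\<sigma> - {v,w}) = - (eps w (insert v (\<sigma> - {v,w})) * eps v (\<sigma> - {v,w}))"
    by (rule eps_swap) (use vw \<open>finite \<sigma>\<close> assms(1) in auto)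
  moreover have "insert w (\<sigma> - {v,w}) = \<sigma> - {v}" "insert v (\<sigma> - {v,w}) = \<sigma> - {w}"
    "\<sigma> - {v} - {w} = \<sigma> - {v,w}" "\<sigma> - {w} - {v} = \<sigma> - {v,w}" using vw by auto
  ultimately show "eps v (\<sigma> - {v}) * eps w (\<sigma> - {v} - {w}) * B v w =
      - (eps w (\<sigma> - {w}) * eps v (\<sigma> - {w} - {v}) * B w v)"
    using assms(2)[OF vw] by simp
qed

lemma sum_cofaces_zero:
  assumes "\<tau> \<subseteq> V" "\<And>v w. v \<in> V - \<tau> \<Longrightarrow> w \<in> V - \<tau> \<Longrightarrow> v \<noteq> w \<Longrightarrow> B v w = B w v"
  shows "(\<Sum>v\<in>V - \<tau>. \<Sum>w\<in>V - insert v \<tau>. eps v \<tau> * eps w (insert v \<tau>) * B v w) = 0"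
proof -
  have "(\<Sum>v\<in>V - \<tau>. \<Sum>w\<in>V - \<tau> - {v}. eps v \<tau> * eps w (insert v \<tau>) * B v w) = 0"
  proof (rule sum_antisym_zero)
    show "finite (V - \<tau>)" using finite_V by blast
    fix v w assume vw: "v \<in> V - \<tau>" "w \<in> V - \<tau>" "v \<noteq> w"
    have "eps v (insert w \<tau>) * eps w \<tau> = - (eps w (insert v \<tau>) * eps v \<tau>)"
      by (rule eps_swap) (use vw assms(1) finite_V finite_subset in auto)
    thus "eps v \<tau> * eps w (insert v \<tau>) * B v w = - (eps w \<tau> * eps v (insert w \<tau>) * B w v)"
      using assms(2)[OF vw] by (simp add: mult.commute)
  qed
  moreover have "V - insert v \<tau> = V - \<tau> - {v}" for v by auto
  ultimately show ?thesis by simp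
qed

section \<open>The weighted complex and its transpose\<close>

definition cochain_space :: "nat \<Rightarrow> ('v set \<Rightarrow> real) set" where
  "cochain_space n = {y. \<forall>\<sigma>. \<sigma> \<notin> cliques n \<longrightarrow> y \<sigma> = 0}"

definition cod :: "('v \<Rightarrow> real) \<Rightarrow> ('v set \<Rightarrow> real) \<Rightarrow> 'v set \<Rightarrow> real" where
  "cod lam y \<sigma> = (if clique \<sigma> then \<Sum>v\<in>\<sigma>. eps v (\<sigma> - {v}) * lam v * y (\<sigma> - {v}) else 0)"

text \<open>The transpose of \<open>cod\<close>. No clique condition on
  \<open>insert v \<tau>\<close> is imposed, because the functions in \<open>cochain_space\<close>
  vanish off the cliques.\<close>

definition bd :: "('v \<Rightarrow> real) \<Rightarrow> ('v set \<Rightarrow> real) \<Rightarrow> 'v set \<Rightarrow> real" where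
  "bd lam x \<tau> = (\<Sum>v\<in>V - \<tau>. eps v \<tau> * lam v * x (insert v \<tau>))"

definition exact_at :: "('v \<Rightarrow> real) \<Rightarrow> nat \<Rightarrow> bool" where
  "exact_at lam n \<longleftrightarrow> (\<forall>y\<in>cochain_space n. cod lam y = (\<lambda>_. 0) \<longrightarrow>
     (case n of 0 \<Rightarrow> y = (\<lambda>_. 0) | Suc m \<Rightarrow> \<exists>z\<in>cochain_space m. y = cod lam z))"

lemma cochain_spaceD: "y \<in> cochain_space n \<Longrightarrow> \<sigma> \<notin> cliques n \<Longrightarrow> y \<sigma> = 0"
  by (simp add: cochain_space_def)

lemma cod_space: "y \<in> cochain_space n \<Longrightarrow> cod lam y \<in> cochain_space (Suc n)"
  unfolding cochain_space_def cod_def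
proof (clarsimp)
  fix \<sigma> assume y: "\<forall>\<sigma>. \<sigma> \<notin> cliques n \<longrightarrow> y \<sigma> = 0" and s: "\<sigma> \<notin> cliques (Suc n)" "clique \<sigma>"
  have "\<sigma> - {v} \<notin> cliques n" if "v \<in> \<sigma>" for v
    using s clique_finite[OF s(2)] that card_Suc_Diff1[of \<sigma> v] by (auto simp: cliques_def)
  thus "(\<Sum>v\<in>\<sigma>. eps v (\<sigma> - {v}) * lam v * y (\<sigma> - {v})) = 0"
    using y by (intro sum.neutral) auto
qed

lemma bd_space: "x \<in> cochain_space (Suc n) \<Longrightarrow> bd lam x \<in> cochain_space n"
  unfolding cochain_space_def bd_def
  using cliques_insert by (auto intro!: sum.neutral) blast

lemma bd_0: "x \<in> cochain_space 0 \<Longrightarrow> bd lam x = (\<lambda>_. 0)"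
  unfolding cochain_space_def bd_def cliques_0 by (auto intro!: sum.neutral)

text \<open>Counts the flags of a clique and one of its vertices in two ways, by the larger clique
  and by the remaining one. It yields the adjunction of \<open>cod\<close> and \<open>bd\<close>
  and, later, the passage from cubes to their faces in the comparison with the bar complex.\<close>

lemma sum_faces_reindex:
  "(\<Sum>\<sigma>\<in>cliques (Suc n). \<Sum>v\<in>\<sigma>. f v (\<sigma> - {v})) =
   (\<Sum>\<tau>\<in>cliques n. \<Sum>v\<in>{v \<in> V - \<tau>. insert v \<tau> \<in> cliques (Suc n)}. f v \<tau>)" for f :: "'v \<Rightarrow> 'v set \<Rightarrow> real"
proof -
  have "(\<Sum>\<sigma>\<in>cliques (Suc n). \<Sum>v\<in>\<sigma>. f v (\<sigma> - {v})) = (\<Sum>(\<sigma>,v)\<in>Sigma (cliques (Suc n)) (\<lambda>\<sigma>. \<sigma>). f v (\<sigma> - {v}))"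
    by (rule sum.Sigma) (use finite_cliques clique_finite in \<open>auto simp: cliques_def\<close>)
  also have "\<dots> = (\<Sum>(\<tau>,v)\<in>Sigma (cliques n) (\<lambda>\<tau>. {v \<in> V - \<tau>. insert v \<tau> \<in> cliques (Suc n)}). f v \<tau>)"
  proof (rule sum.reindex_bij_witness[of _ "\<lambda>(\<tau>,v). (insert v \<tau>, v)" "\<lambda>(\<sigma>,v). (\<sigma> - {v}, v)"], goal_cases)
    case (2 a)
    then obtain \<sigma> v where a: "a = (\<sigma>, v)" "\<sigma> \<in> cliques (Suc n)" "v \<in> \<sigma>" by auto
    moreover have "v \<in> V" using a clique_V by (auto simp: cliques_def)
    ultimately show ?case using cliques_remove[OF a(2,3)] by (simp add: insert_absorb)
  qed (auto simp: insert_absorb cliques_insert)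
  also have "\<dots> = (\<Sum>\<tau>\<in>cliques n. \<Sum>v\<in>{v \<in> V - \<tau>. insert v \<tau> \<in> cliques (Suc n)}. f v \<tau>)"
    by (rule sum.Sigma[symmetric]) (auto simp: finite_cliques finite_V)
  finally show ?thesis .
qed

lemma cod_bd_adjoint:
  assumes y: "y \<in> cochain_space n" and x: "x \<in> cochain_space (Suc n)"
  shows "(\<Sum>\<sigma>\<in>cliques (Suc n). cod lam y \<sigma> * x \<sigma>) = (\<Sum>\<tau>\<in>cliques n. y \<tau> * bd lam x \<tau>)"
proof -
  let ?f = "\<lambda>v \<tau>. eps v \<tau> * lam v * y \<tau> * x (insert v \<tau>)"
  have "(\<Sum>\<sigma>\<in>cliques (Suc n). cod lam y \<sigma> * x \<sigma>) =
     (\<Sum>\<sigma>\<in>cliques (Suc n). \<Sum>v\<in>\<sigma>. ?f v (\<sigma> - {v}))"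
    by (intro sum.cong) (auto simp: cod_def cliques_def sum_distrib_right insert_absorb intro!: sum.cong)
  also have "\<dots> = (\<Sum>\<tau>\<in>cliques n. \<Sum>v\<in>{v \<in> V - \<tau>. insert v \<tau> \<in> cliques (Suc n)}. ?f v \<tau>)"
    by (rule sum_faces_reindex)
  also have "\<dots> = (\<Sum>\<tau>\<in>cliques n. \<Sum>v\<in>V - \<tau>. ?f v \<tau>)"
    using x by (intro sum.cong sum.mono_neutral_left) (auto simp: finite_V cochain_space_def)
  finally show ?thesis by (simp add: bd_def sum_distrib_left mult_ac)
qed

lemma cod_cod: "cod lam (cod lam y) = (\<lambda>_. 0)"
proof
  fix \<sigma>
  show "cod lam (cod lam y) \<sigma> = 0"
  proof (cases "clique \<sigma>")
    case True
    hence "cod lam (cod lam y) \<sigma> = (\<Sum>v\<in>\<sigma>. \<Sum>w\<in>\<sigma> - {v}. eps v (\<sigma> - {v}) * eps w (\<sigma> - {v} - {w}) *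
        (lam v * lam w * y (\<sigma> - {v} - {w})))"
      using clique_subset[OF True] by (simp add: cod_def sum_distrib_left mult_ac)
    also have "\<dots> = 0"
    proof (rule sum_faces_zero)
      fix v w
      have "\<sigma> - {v} - {w} = \<sigma> - {w} - {v}" by auto
      thus "lam v * lam w * y (\<sigma> - {v} - {w}) = lam w * lam v * y (\<sigma> - {w} - {v})" by simp
    qed (rule clique_V[OF True])
    finally show ?thesis .
  qed (simp add: cod_def)
qed

lemma bd_bd:
  assumes "x \<in> cochain_space n"
  shows "bd lam (bd lam x) = (\<lambda>_. 0)"
proof
  fix \<tau>
  show "bd lam (bd lam x) \<tau> = 0"
  proof (cases "\<tau> \<subseteq> V")
    case True
    have "bd lam (bd lam x) \<tau> = (\<Sum>v\<in>V - \<tau>. \<Sum>w\<in>V - insert v \<tau>. eps v \<tau> * eps w (insert v \<tau>) *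
        (lam v * lam w * x (insert w (insert v \<tau>))))"
      by (simp add: bd_def sum_distrib_left mult_ac)
    also have "\<dots> = 0" by (rule sum_cofaces_zero[OF True]) (auto simp: insert_commute)
    finally show ?thesis .
  next
    case False
    hence "x (insert w (insert v \<tau>)) = 0" for v w
      using assms clique_V by (auto simp: cochain_space_def cliques_def)
    thus ?thesis by (simp add: bd_def)
  qed
qed

text \<open>Rescaling \<open>e\<^sub>\<sigma>\<close> by the product of the nonzero weights in \<open>\<sigma>\<close> conjugates the differential for
  \<open>lam\<close> into the one for the indicator of its support, so exactness only depends on that support.\<close>

lemma exact_at_support:
  assumes supp: "\<And>v. v \<in> V \<Longrightarrow> lam v = 0 \<longleftrightarrow> mu v = 0" and ex: "exact_at lam n"
  shows "exact_at mu n"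
proof -
  \<comment> \<open>The value 1 on the common zeros keeps \<open>r\<close> nonzero and still
    satisfies \<open>mu v = r v * lam v\<close>.\<close>
  define r where "r v = (if lam v = 0 then 1 else mu v / lam v)" for v
  define c where "c \<sigma> = (\<Prod>v\<in>\<sigma>. r v)" for \<sigma>
  have r: "r v \<noteq> 0" "mu v = r v * lam v" if "v \<in> V" for v
    using supp[OF that] by (auto simp: r_def)
  have c: "c \<sigma> \<noteq> 0" if "clique \<sigma>" for \<sigma>
    using r(1) clique_V[OF that] clique_finite[OF that] by (auto simp: c_def)
  have cr: "c \<sigma> = r v * c (\<sigma> - {v})" if "clique \<sigma>" "v \<in> \<sigma>" for \<sigma> v
    unfolding c_def using clique_finite[OF that(1)] that(2) by (rule prod.remove)
  have conj: "cod mu (\<lambda>\<sigma>. c \<sigma> * y \<sigma>) = (\<lambda>\<sigma>. c \<sigma> * cod lam y \<sigma>)" for y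
  proof
    fix \<sigma>
    show "cod mu (\<lambda>\<sigma>. c \<sigma> * y \<sigma>) \<sigma> = c \<sigma> * cod lam y \<sigma>"
    proof (cases "clique \<sigma>")
      case True
      have "eps v (\<sigma> - {v}) * mu v * (c (\<sigma> - {v}) * y (\<sigma> - {v}))
           = c \<sigma> * (eps v (\<sigma> - {v}) * lam v * y (\<sigma> - {v}))" if "v \<in> \<sigma>" for v
        using cr[OF True that] r(2)[of v] that clique_V[OF True] by auto
      thus ?thesis using True by (auto simp: cod_def sum_distrib_left intro: sum.cong)
    qed (simp add: cod_def)
  qed
  show ?thesis unfolding exact_at_def
  proof (intro ballI impI)
    fix y assume y: "y \<in> cochain_space n" "cod mu y = (\<lambda>_. 0)"
    define y' where "y' \<sigma> = y \<sigma> / c \<sigma>" for \<sigma>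
    have y': "y' \<in> cochain_space n" using y(1) by (auto simp: y'_def cochain_space_def)
    have yy': "y = (\<lambda>\<sigma>. c \<sigma> * y' \<sigma>)"
      using y(1) c by (auto simp: y'_def cochain_space_def cliques_def fun_eq_iff)
    have "cod lam y' = (\<lambda>_. 0)"
    proof
      fix \<sigma>
      show "cod lam y' \<sigma> = 0"
        using conj[of y'] y(2) c[of \<sigma>] yy' by (cases "clique \<sigma>") (auto simp: fun_eq_iff cod_def[of lam])
    qed
    hence *: "case n of 0 \<Rightarrow> y' = (\<lambda>_. 0) | Suc m \<Rightarrow> \<exists>z\<in>cochain_space m. y' = cod lam z"
      using ex y' by (auto simp: exact_at_def)
    show "case n of 0 \<Rightarrow> y = (\<lambda>_. 0) | Suc m \<Rightarrow> \<exists>z\<in>cochain_space m. y = cod mu z"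
    proof (cases n)
      case 0 thus ?thesis using * yy' by simp
    next
      case (Suc m)
      with * obtain z where z: "z \<in> cochain_space m" "y' = cod lam z" by auto
      have "y = cod mu (\<lambda>\<sigma>. c \<sigma> * z \<sigma>)" using yy' conj[of z] z(2) by simp
      moreover have "(\<lambda>\<sigma>. c \<sigma> * z \<sigma>) \<in> cochain_space m" using z(1) by (auto simp: cochain_space_def)
      ultimately show ?thesis using Suc by auto
    qed
  qed
qed

section \<open>Hodge theory in finite dimension\<close>

definition ip :: "nat \<Rightarrow> ('v set \<Rightarrow> real) \<Rightarrow> ('v set \<Rightarrow> real) \<Rightarrow> real" where
  "ip n x y = (\<Sum>\<sigma>\<in>cliques n. x \<sigma> * y \<sigma>)"

lemma ip_self_zero: "x \<in> cochain_space n \<Longrightarrow> ip n x x = 0 \<longleftrightarrow> x = (\<lambda>_. 0)"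
  unfolding ip_def by (subst sum_nonneg_eq_0_iff) (auto simp: finite_cliques cochain_space_def fun_eq_iff)

lemma ip_self_nonneg: "ip n x x \<ge> 0"
  unfolding ip_def by (intro sum_nonneg) auto

lemma ip_adjoint: "y \<in> cochain_space n \<Longrightarrow> x \<in> cochain_space (Suc n) \<Longrightarrow>
    ip (Suc n) (cod lam y) x = ip n y (bd lam x)"
  unfolding ip_def by (rule cod_bd_adjoint)

lemma ip_commute: "ip n x y = ip n y x"
  by (simp add: ip_def mult.commute)

lemma cod_sum: "cod lam (\<lambda>\<sigma>. \<Sum>i\<in>I. y i \<sigma> * c i) = (\<lambda>\<sigma>. \<Sum>i\<in>I. cod lam (y i) \<sigma> * c i)"
proof
  fix \<sigma>
  have "(\<Sum>v\<in>\<sigma>. eps v (\<sigma> - {v}) * lam v * (\<Sum>i\<in>I. y i (\<sigma> - {v}) * c i)) =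
     (\<Sum>v\<in>\<sigma>. \<Sum>i\<in>I. eps v (\<sigma> - {v}) * lam v * y i (\<sigma> - {v}) * c i)"
    by (simp add: sum_distrib_left mult.assoc)
  also have "\<dots> = (\<Sum>i\<in>I. \<Sum>v\<in>\<sigma>. eps v (\<sigma> - {v}) * lam v * y i (\<sigma> - {v}) * c i)" by (rule sum.swap)
  finally show "cod lam (\<lambda>\<sigma>. \<Sum>i\<in>I. y i \<sigma> * c i) \<sigma> = (\<Sum>i\<in>I. cod lam (y i) \<sigma> * c i)"
    by (simp add: cod_def sum_distrib_right)
qed

lemma bd_sum: "bd lam (\<lambda>\<sigma>. \<Sum>i\<in>I. y i \<sigma> * c i) = (\<lambda>\<sigma>. \<Sum>i\<in>I. bd lam (y i) \<sigma> * c i)"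
proof
  fix \<tau>
  have "(\<Sum>v\<in>V - \<tau>. eps v \<tau> * lam v * (\<Sum>i\<in>I. y i (insert v \<tau>) * c i)) =
     (\<Sum>v\<in>V - \<tau>. \<Sum>i\<in>I. eps v \<tau> * lam v * y i (insert v \<tau>) * c i)"
    by (simp add: sum_distrib_left mult.assoc)
  also have "\<dots> = (\<Sum>i\<in>I. \<Sum>v\<in>V - \<tau>. eps v \<tau> * lam v * y i (insert v \<tau>) * c i)" by (rule sum.swap)
  finally show "bd lam (\<lambda>\<sigma>. \<Sum>i\<in>I. y i \<sigma> * c i) \<tau> = (\<Sum>i\<in>I. bd lam (y i) \<tau> * c i)"
    by (simp add: bd_def sum_distrib_right)
qed

lemma cod_add: "cod lam (\<lambda>\<sigma>. x \<sigma> + y \<sigma>) = (\<lambda>\<sigma>. cod lam x \<sigma> + cod lam y \<sigma>)"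
  by (rule ext) (simp add: cod_def sum.distrib algebra_simps)

lemma bd_add: "bd lam (\<lambda>\<sigma>. x \<sigma> + y \<sigma>) = (\<lambda>\<sigma>. bd lam x \<sigma> + bd lam y \<sigma>)"
  by (rule ext) (simp add: bd_def sum.distrib algebra_simps)

lemma cod_zero [simp]: "cod lam (\<lambda>_. 0) = (\<lambda>_. 0)" by (simp add: cod_def fun_eq_iff)

definition laplace :: "('v \<Rightarrow> real) \<Rightarrow> ('v set \<Rightarrow> real) \<Rightarrow> 'v set \<Rightarrow> real" where
  "laplace lam x \<sigma> = cod lam (bd lam x) \<sigma> + bd lam (cod lam x) \<sigma>"

text \<open>The condition is symmetric in \<open>cod\<close> and \<open>bd\<close>. Passing through
  it turns exactness of the cochain complex into a contraction of the dual chain complex in the same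
  degrees.\<close>

definition no_harmonic :: "('v \<Rightarrow> real) \<Rightarrow> nat \<Rightarrow> bool" where
  "no_harmonic lam n \<longleftrightarrow> (\<forall>x\<in>cochain_space n. cod lam x = (\<lambda>_. 0) \<longrightarrow> bd lam x = (\<lambda>_. 0) \<longrightarrow> x = (\<lambda>_. 0))"

lemma cod_bd_space: "x \<in> cochain_space n \<Longrightarrow> cod lam (bd lam x) \<in> cochain_space n"
  by (cases n) (auto simp: bd_0 intro: cod_space bd_space, simp add: cochain_space_def)

lemma laplace_space: "x \<in> cochain_space n \<Longrightarrow> laplace lam x \<in> cochain_space n"
  using cod_bd_space[of x n lam] bd_space[OF cod_space[of x n lam]]
  by (auto simp: laplace_def cochain_space_def)

lemma laplace_sum: "laplace lam (\<lambda>\<sigma>. \<Sum>i\<in>I. y i \<sigma> * c i) = (\<lambda>\<sigma>. \<Sum>i\<in>I. laplace lam (y i) \<sigma> * c i)"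
  by (rule ext) (simp add: laplace_def cod_sum bd_sum sum.distrib distrib_right)

text \<open>For \<open>n = 0\<close> the index \<open>n - 1\<close> is again 0; this is harmless
  because \<open>bd lam x\<close> vanishes there.\<close>

lemma ip_laplace:
  assumes x: "x \<in> cochain_space n"
  shows "ip n x (laplace lam x) = ip (n - 1) (bd lam x) (bd lam x) + ip (Suc n) (cod lam x) (cod lam x)"
proof -
  have 1: "ip n x (bd lam (cod lam x)) = ip (Suc n) (cod lam x) (cod lam x)"
    using ip_adjoint[OF x cod_space[OF x]] by simp
  have 2: "ip n x (cod lam (bd lam x)) = ip (n - 1) (bd lam x) (bd lam x)"
  proof (cases n)
    case 0 thus ?thesis using bd_0 x by (simp add: ip_def)
  next
    case (Suc m)
    thus ?thesis using ip_adjoint[of "bd lam x" m x lam] bd_space[of x m lam] x by (simp add: ip_commute)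
  qed
  have "ip n x (laplace lam x) = ip n x (cod lam (bd lam x)) + ip n x (bd lam (cod lam x))"
    by (simp add: ip_def laplace_def algebra_simps sum.distrib)
  thus ?thesis using 1 2 by simp
qed

lemma laplace_injective:
  assumes "no_harmonic lam n" and x: "x \<in> cochain_space n" and "laplace lam x = (\<lambda>_. 0)"
  shows "x = (\<lambda>_. 0)"
proof -
  have "ip (n - 1) (bd lam x) (bd lam x) + ip (Suc n) (cod lam x) (cod lam x) = 0"
    using ip_laplace[OF x, of lam] assms(3) by (simp add: ip_def)
  hence "ip (n - 1) (bd lam x) (bd lam x) = 0" "ip (Suc n) (cod lam x) (cod lam x) = 0"
    using ip_self_nonneg[of "n - 1" "bd lam x"] ip_self_nonneg[of "Suc n" "cod lam x"] by linarith+
  moreover have "bd lam x \<in> cochain_space (n - 1)"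
    using x bd_0[of x lam] bd_space[of x "n - 1" lam] by (cases n) (auto simp: cochain_space_def)
  ultimately have "bd lam x = (\<lambda>_. 0)" "cod lam x = (\<lambda>_. 0)"
    using ip_self_zero cod_space[OF x] by auto
  thus ?thesis using assms by (auto simp: no_harmonic_def)
qed

text \<open>Rows outside the \<open>n\<close>-cliques are set to zero, so that every
  \<open>N\<close>, whatever its values elsewhere, defines a map into the cochain space.\<close>

definition apply_matrix :: "('v set \<Rightarrow> 'v set \<Rightarrow> real) \<Rightarrow> nat \<Rightarrow> ('v set \<Rightarrow> real) \<Rightarrow> 'v set \<Rightarrow> real" where
  "apply_matrix N n x \<sigma> = (\<Sum>\<tau>\<in>cliques n. (if \<sigma> \<in> cliques n then N \<sigma> \<tau> else 0) * x \<tau>)"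

lemma apply_matrix_space: "apply_matrix N n x \<in> cochain_space n"
  by (simp add: apply_matrix_def cochain_space_def)

lemma expand_basis:
  assumes "x \<in> cochain_space n"
  shows "x = (\<lambda>\<sigma>. \<Sum>\<tau>\<in>cliques n. of_bool (\<sigma> = \<tau>) * x \<tau>)"
proof
  fix \<sigma>
  have "(\<Sum>\<tau>\<in>cliques n. of_bool (\<sigma> = \<tau>) * x \<tau>) = (\<Sum>\<tau>\<in>cliques n. if \<tau> = \<sigma> then x \<tau> else 0)"
    by (intro sum.cong) auto
  also have "\<dots> = x \<sigma>"
    using assms by (auto simp: sum.delta finite_cliques cochain_space_def)
  finally show "x \<sigma> = (\<Sum>\<tau>\<in>cliques n. of_bool (\<sigma> = \<tau>) * x \<tau>)" by simp
qed

lemma basis_space: "\<tau> \<in> cliques n \<Longrightarrow> (\<lambda>\<sigma>. of_bool (\<sigma> = \<tau>)) \<in> cochain_space n"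
  by (auto simp: cochain_space_def)

text \<open>Without harmonic functions the Laplacian is an injective endomorphism of a
  finite-dimensional space. Both one-sided identities are recorded: the second is what makes the
  inverse inherit commutation with \<open>bd\<close> and with the grading
  \<open>dead\<close>.\<close>

lemma laplace_inverse:
  assumes "no_harmonic lam n"
  obtains N where "\<And>x. x \<in> cochain_space n \<Longrightarrow> laplace lam (apply_matrix N n x) = x"
    "\<And>x. x \<in> cochain_space n \<Longrightarrow> apply_matrix N n (laplace lam x) = x"
proof -
  define M where "M \<sigma> \<tau> = laplace lam (\<lambda>\<rho>. of_bool (\<rho> = \<tau>)) \<sigma>" for \<sigma> \<tau> :: "'v set"
  have M: "laplace lam x \<sigma> = (\<Sum>\<tau>\<in>cliques n. M \<sigma> \<tau> * x \<tau>)" if "x \<in> cochain_space n" for x \<sigma>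
    by (subst expand_basis[OF that], subst laplace_sum) (simp add: M_def)
  have inj: "\<forall>i\<in>cliques n. x i = 0"
    if x: "\<And>i. i \<in> cliques n \<Longrightarrow> (\<Sum>j\<in>cliques n. M i j * x j) = 0" for x
  proof -
    define x' where "x' \<sigma> = (if \<sigma> \<in> cliques n then x \<sigma> else 0)" for \<sigma>
    have x': "x' \<in> cochain_space n" by (simp add: x'_def cochain_space_def)
    have "laplace lam x' \<sigma> = 0" for \<sigma>
    proof (cases "\<sigma> \<in> cliques n")
      case True thus ?thesis using M[OF x'] x[OF True] by (simp add: x'_def)
    next
      case False thus ?thesis using laplace_space[OF x', of lam] by (auto simp: cochain_space_def)
    qed
    hence "x' = (\<lambda>_. 0)" using laplace_injective[OF assms x'] by auto
    thus ?thesis by (auto simp: x'_def fun_eq_iff split: if_splits)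
  qed
  obtain N where N: "\<And>i j. i \<in> cliques n \<Longrightarrow> j \<in> cliques n \<Longrightarrow> (\<Sum>k\<in>cliques n. M i k * N k j) = of_bool (i = j)"
     "\<And>i j. i \<in> cliques n \<Longrightarrow> j \<in> cliques n \<Longrightarrow> (\<Sum>k\<in>cliques n. N i k * M k j) = of_bool (i = j)"
    using inverse_matrix_exists[OF finite_cliques inj, of M] by blast
  have prod: "(\<Sum>k\<in>cliques n. A \<sigma> k * (\<Sum>\<tau>\<in>cliques n. B k \<tau> * x \<tau>)) = x \<sigma>"
    if x: "x \<in> cochain_space n" and s: "\<sigma> \<in> cliques n"
     and AB: "\<And>i j. i \<in> cliques n \<Longrightarrow> j \<in> cliques n \<Longrightarrow> (\<Sum>k\<in>cliques n. A i k * B k j) = of_bool (i = j)"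
    for A B :: "'v set \<Rightarrow> 'v set \<Rightarrow> real" and x \<sigma>
  proof -
    have "(\<Sum>k\<in>cliques n. A \<sigma> k * (\<Sum>\<tau>\<in>cliques n. B k \<tau> * x \<tau>)) =
      (\<Sum>k\<in>cliques n. \<Sum>\<tau>\<in>cliques n. A \<sigma> k * B k \<tau> * x \<tau>)"
      by (simp add: sum_distrib_left mult.assoc)
    also have "\<dots> = (\<Sum>\<tau>\<in>cliques n. \<Sum>k\<in>cliques n. A \<sigma> k * B k \<tau> * x \<tau>)" by (rule sum.swap)
    also have "\<dots> = (\<Sum>\<tau>\<in>cliques n. of_bool (\<sigma> = \<tau>) * x \<tau>)"
      by (intro sum.cong) (simp_all add: AB[OF s] flip: sum_distrib_right)
    also have "\<dots> = x \<sigma>" by (rule fun_cong[OF expand_basis[OF x], symmetric])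
    finally show ?thesis .
  qed
  show thesis
  proof (rule that[of N])
    fix x assume x: "x \<in> cochain_space n"
    show "laplace lam (apply_matrix N n x) = x"
    proof
      fix \<sigma>
      show "laplace lam (apply_matrix N n x) \<sigma> = x \<sigma>"
      proof (cases "\<sigma> \<in> cliques n")
        case True
        thus ?thesis using prod[OF x True N(1)] by (simp add: M[OF apply_matrix_space] apply_matrix_def)
      next
        case False
        thus ?thesis using laplace_space[OF apply_matrix_space, of lam N n x] x by (auto simp: cochain_space_def)
      qed
    qed
    show "apply_matrix N n (laplace lam x) = x"
    proof
      fix \<sigma>
      show "apply_matrix N n (laplace lam x) \<sigma> = x \<sigma>"
        using prod[OF x _ N(2), of \<sigma>] x
        by (cases "\<sigma> \<in> cliques n") (auto simp: M[OF x] apply_matrix_def cochain_space_def)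
    qed
  qed
qed

lemma exact_imp_no_harmonic:
  assumes "exact_at lam n" shows "no_harmonic lam n"
  unfolding no_harmonic_def
proof (intro ballI impI)
  fix x assume x: "x \<in> cochain_space n" "cod lam x = (\<lambda>_. 0)" "bd lam x = (\<lambda>_. 0)"
  hence *: "case n of 0 \<Rightarrow> x = (\<lambda>_. 0) | Suc m \<Rightarrow> \<exists>z\<in>cochain_space m. x = cod lam z"
    using assms by (auto simp: exact_at_def)
  show "x = (\<lambda>_. 0)"
  proof (cases n)
    case 0 thus ?thesis using * by simp
  next
    case (Suc m)
    then obtain z where z: "z \<in> cochain_space m" "x = cod lam z" using * by auto
    have "ip n x x = ip m z (bd lam x)" using ip_adjoint[of z m x lam] z x Suc by simp
    hence "ip n x x = 0" using x(3) by (simp add: ip_def)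
    thus ?thesis using ip_self_zero x(1) by blast
  qed
qed

text \<open>Solve \<open>laplace lam y = x\<close>. Applying \<open>cod\<close> to a closed
  \<open>x\<close> leaves \<open>cod (bd (cod y)) = 0\<close>, so \<open>bd (cod y)\<close> is
  orthogonal to itself, and \<open>x = cod (bd y)\<close> remains.\<close>

lemma no_harmonic_imp_exact:
  assumes "no_harmonic lam n" shows "exact_at lam n"
  unfolding exact_at_def
proof (intro ballI impI)
  fix x assume x: "x \<in> cochain_space n" "cod lam x = (\<lambda>_. 0)"
  obtain N where N: "\<And>x. x \<in> cochain_space n \<Longrightarrow> laplace lam (apply_matrix N n x) = x"
    by (rule laplace_inverse[OF assms]) blast
  define y where "y = apply_matrix N n x"
  have y: "y \<in> cochain_space n" "laplace lam y = x" using N x by (auto simp: y_def apply_matrix_space)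
  let ?u = "cod lam y"
  have u: "?u \<in> cochain_space (Suc n)" by (rule cod_space[OF y(1)])
  have "cod lam x = (\<lambda>\<sigma>. cod lam (cod lam (bd lam y)) \<sigma> + cod lam (bd lam ?u) \<sigma>)"
    unfolding y(2)[symmetric] laplace_def[abs_def] cod_add ..
  hence "cod lam (bd lam ?u) = (\<lambda>_. 0)" using x(2) by (simp add: cod_cod)
  hence "ip n (bd lam ?u) (bd lam ?u) = 0"
    using ip_adjoint[OF bd_space[OF u] u, of lam lam] by (simp add: ip_def)
  hence "bd lam ?u = (\<lambda>_. 0)" using ip_self_zero bd_space[OF u] by blast
  hence xy: "x = cod lam (bd lam y)" using y(2) by (auto simp: laplace_def fun_eq_iff)
  show "case n of 0 \<Rightarrow> x = (\<lambda>_. 0) | Suc m \<Rightarrow> \<exists>z\<in>cochain_space m. x = cod lam z"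
    using xy bd_0[of y lam] bd_space[of y _ lam] y(1) by (cases n) auto
qed

section \<open>The grading by vertices of weight zero and the contraction\<close>

text \<open>A vertex of weight zero is neither added by \<open>cod\<close> nor removed by
  \<open>bd\<close>, so the complex splits according to this number. For cubes it counts the
  directions that do not change the height.\<close>

definition dead :: "('v \<Rightarrow> real) \<Rightarrow> 'v set \<Rightarrow> nat" where
  "dead lam \<sigma> = card {v \<in> \<sigma>. lam v = 0}"

lemma dead_insert_zero: "lam v = 0 \<Longrightarrow> finite \<tau> \<Longrightarrow> v \<notin> \<tau> \<Longrightarrow> dead lam (insert v \<tau>) = Suc (dead lam \<tau>)"
proof -
  assume a: "lam v = 0" "finite \<tau>" "v \<notin> \<tau>"
  have "{u \<in> insert v \<tau>. lam u = 0} = insert v {u \<in> \<tau>. lam u = 0}" using a by auto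
  thus ?thesis using a by (simp add: dead_def)
qed

lemma dead_insert_nonzero: "lam v \<noteq> 0 \<Longrightarrow> dead lam (insert v \<tau>) = dead lam \<tau>"
  unfolding dead_def by (rule arg_cong[of _ _ card]) auto

lemma laplace_dead:
  fixes x :: "'v set \<Rightarrow> real"
  shows "laplace lam (\<lambda>\<sigma>. dead lam \<sigma> * x \<sigma>) = (\<lambda>\<sigma>. dead lam \<sigma> * laplace lam x \<sigma>)"
proof -
  have 1: "cod lam (\<lambda>\<sigma>. dead lam \<sigma> * x \<sigma>) = (\<lambda>\<sigma>. dead lam \<sigma> * cod lam x \<sigma>)" for x :: "'v set \<Rightarrow> real"
  proof
    fix \<sigma>
    have "eps v (\<sigma> - {v}) * lam v * (dead lam (\<sigma> - {v}) * x (\<sigma> - {v})) =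
       dead lam \<sigma> * (eps v (\<sigma> - {v}) * lam v * x (\<sigma> - {v}))" if "v \<in> \<sigma>" for v
      using dead_insert_nonzero[of lam v "\<sigma> - {v}"] that by (cases "lam v = 0") (auto simp: insert_absorb)
    hence "(\<Sum>v\<in>\<sigma>. eps v (\<sigma> - {v}) * lam v * (dead lam (\<sigma> - {v}) * x (\<sigma> - {v}))) =
       (\<Sum>v\<in>\<sigma>. dead lam \<sigma> * (eps v (\<sigma> - {v}) * lam v * x (\<sigma> - {v})))" by (rule sum.cong[OF HOL.refl])
    thus "cod lam (\<lambda>\<sigma>. dead lam \<sigma> * x \<sigma>) \<sigma> = dead lam \<sigma> * cod lam x \<sigma>"
      by (simp add: cod_def sum_distrib_left)
  qed
  have 2: "bd lam (\<lambda>\<sigma>. dead lam \<sigma> * x \<sigma>) = (\<lambda>\<sigma>. dead lam \<sigma> * bd lam x \<sigma>)" for x :: "'v set \<Rightarrow> real"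
  proof
    fix \<tau>
    have "eps v \<tau> * lam v * (dead lam (insert v \<tau>) * x (insert v \<tau>)) =
       dead lam \<tau> * (eps v \<tau> * lam v * x (insert v \<tau>))" for v
      using dead_insert_nonzero[of lam v \<tau>] by (cases "lam v = 0") auto
    hence "(\<Sum>v\<in>V - \<tau>. eps v \<tau> * lam v * (dead lam (insert v \<tau>) * x (insert v \<tau>))) =
       (\<Sum>v\<in>V - \<tau>. dead lam \<tau> * (eps v \<tau> * lam v * x (insert v \<tau>)))" by (intro sum.cong HOL.refl)
    thus "bd lam (\<lambda>\<sigma>. dead lam \<sigma> * x \<sigma>) \<tau> = dead lam \<tau> * bd lam x \<tau>"
      by (simp add: bd_def sum_distrib_left)
  qed
  show ?thesis unfolding laplace_def[abs_def] 1 2 by (simp add: algebra_simps)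
qed

text \<open>The inverse of an operator that commutes with the grading commutes with it too. For the
  column \<open>u\<close> of \<tau>, the functions \<open>dead lam \<rho> * u \<rho>\<close> and
  \<open>u \<rho> * dead lam \<tau>\<close> have the same Laplacian, hence agree; at \<sigma>, where
  \<open>u\<close> is nonzero, this compares the two numbers.\<close>

lemma laplace_inverse_dead:
  assumes "\<And>x. x \<in> cochain_space n \<Longrightarrow> laplace lam (apply_matrix N n x) = x"
    "\<And>x. x \<in> cochain_space n \<Longrightarrow> apply_matrix N n (laplace lam x) = x"
    and st: "\<sigma> \<in> cliques n" "\<tau> \<in> cliques n" and nz: "N \<sigma> \<tau> \<noteq> 0"
  shows "dead lam \<sigma> = dead lam \<tau>"
proof -
  let ?e = "\<lambda>\<rho>. of_bool (\<rho> = \<tau>) :: real"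
  define u where "u = apply_matrix N n ?e"
  have u: "u \<in> cochain_space n" by (simp add: u_def apply_matrix_space)
  have us: "u \<sigma> = N \<sigma> \<tau>"
    using st by (simp add: u_def apply_matrix_def finite_cliques of_bool_def if_distrib cong: if_cong)
  have lu: "laplace lam u = ?e"
    unfolding u_def by (rule assms(1)[OF basis_space[OF st(2)]])
  have "laplace lam (\<lambda>\<rho>. dead lam \<rho> * u \<rho>) = (\<lambda>\<rho>. dead lam \<rho> * ?e \<rho>)"
    unfolding laplace_dead lu ..
  moreover have "(\<lambda>\<rho>. dead lam \<rho> * ?e \<rho>) = (\<lambda>\<rho>. ?e \<rho> * dead lam \<tau>)" by auto
  moreover have "(\<lambda>\<rho>. ?e \<rho> * dead lam \<tau>) = laplace lam (\<lambda>\<rho>. u \<rho> * dead lam \<tau>)"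
    using laplace_sum[of lam "\<lambda>_. u" "\<lambda>_. dead lam \<tau>" "{()}"] lu by simp
  ultimately have eq: "laplace lam (\<lambda>\<rho>. dead lam \<rho> * u \<rho>) = laplace lam (\<lambda>\<rho>. u \<rho> * dead lam \<tau>)" by simp
  have "(\<lambda>\<rho>. dead lam \<rho> * u \<rho>) \<in> cochain_space n" "(\<lambda>\<rho>. u \<rho> * dead lam \<tau>) \<in> cochain_space n"
    using u by (auto simp: cochain_space_def)
  hence "(\<lambda>\<rho>. dead lam \<rho> * u \<rho>) = (\<lambda>\<rho>. u \<rho> * dead lam \<tau>)"
    using assms(2) eq by metis
  hence "dead lam \<sigma> * u \<sigma> = u \<sigma> * dead lam \<tau>" by (auto dest: fun_cong)
  thus ?thesis using us nz by simp
qed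

text \<open>\<open>S\<close> is \<open>cod\<close> after the inverse Laplacian. With
  \<open>x = laplace lam y\<close>, the first term is \<open>bd (cod y)\<close>; the inverse
  commutes with \<open>bd\<close>, so the second is \<open>cod (bd y)\<close>, and they add up to
  \<open>x\<close>. A single matrix serves all degrees, since the cardinality of the column index
  determines the degree.\<close>

lemma contraction:
  assumes ex: "\<And>i. i \<le> q \<Longrightarrow> exact_at lam i"
  obtains S where "\<And>\<sigma> \<tau>. S \<sigma> \<tau> \<noteq> 0 \<Longrightarrow> dead lam \<sigma> = dead lam \<tau> \<and> (\<exists>i\<le>q. \<tau> \<in> cliques i \<and> \<sigma> \<in> cliques (Suc i))"
    "\<And>i x \<sigma>. i \<le> q \<Longrightarrow> x \<in> cochain_space i \<Longrightarrow>
       bd lam (\<lambda>\<rho>. \<Sum>\<tau>\<in>Pow V. S \<rho> \<tau> * x \<tau>) \<sigma> + (\<Sum>\<tau>\<in>Pow V. S \<sigma> \<tau> * bd lam x \<tau>) = x \<sigma>"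
proof -
  have "\<exists>N. i \<le> q \<longrightarrow> (\<forall>x\<in>cochain_space i. laplace lam (apply_matrix N i x) = x) \<and>
      (\<forall>x\<in>cochain_space i. apply_matrix N i (laplace lam x) = x)" for i
  proof (cases "i \<le> q")
    case True
    show ?thesis
      by (rule laplace_inverse[OF exact_imp_no_harmonic[OF ex[OF True]]]) blast
  qed blast
  hence "\<exists>N. \<forall>i. i \<le> q \<longrightarrow> (\<forall>x\<in>cochain_space i. laplace lam (apply_matrix (N i) i x) = x) \<and>
      (\<forall>x\<in>cochain_space i. apply_matrix (N i) i (laplace lam x) = x)"
    by (rule choice[OF allI])
  then obtain N where N0: "\<forall>i. i \<le> q \<longrightarrow> (\<forall>x\<in>cochain_space i. laplace lam (apply_matrix (N i) i x) = x) \<and>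
      (\<forall>x\<in>cochain_space i. apply_matrix (N i) i (laplace lam x) = x)" ..
  have N: "\<And>i x. i \<le> q \<Longrightarrow> x \<in> cochain_space i \<Longrightarrow> laplace lam (apply_matrix (N i) i x) = x"
     "\<And>i x. i \<le> q \<Longrightarrow> x \<in> cochain_space i \<Longrightarrow> apply_matrix (N i) i (laplace lam x) = x"
    using N0 by simp_all
  define col where "col i \<tau> \<rho> = (if \<rho> \<in> cliques i then N i \<rho> \<tau> else 0)" for i \<tau> \<rho>
  have col: "col i \<tau> \<in> cochain_space i" for i \<tau> by (simp add: col_def cochain_space_def)
  define S where "S \<sigma> \<tau> = (if card \<tau> \<le> q \<and> clique \<tau> then cod lam (col (card \<tau>) \<tau>) \<sigma> else 0)" for \<sigma> \<tau>
  have S: "(\<Sum>\<tau>\<in>Pow V. S \<sigma> \<tau> * x \<tau>) = cod lam (apply_matrix (N i) i x) \<sigma>"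
    if "i \<le> q" "x \<in> cochain_space i" for i x \<sigma>
  proof -
    have "apply_matrix (N i) i x = (\<lambda>\<rho>. \<Sum>\<tau>\<in>cliques i. col i \<tau> \<rho> * x \<tau>)"
      by (auto simp: apply_matrix_def col_def)
    hence "cod lam (apply_matrix (N i) i x) \<sigma> = (\<Sum>\<tau>\<in>cliques i. cod lam (col i \<tau>) \<sigma> * x \<tau>)"
      by (simp add: cod_sum)
    also have "\<dots> = (\<Sum>\<tau>\<in>cliques i. S \<sigma> \<tau> * x \<tau>)"
      using that(1) by (intro sum.cong) (auto simp: S_def cliques_def)
    also have "\<dots> = (\<Sum>\<tau>\<in>Pow V. S \<sigma> \<tau> * x \<tau>)"
      using that(2) clique_V finite_V by (intro sum.mono_neutral_left) (auto simp: cliques_def cochain_space_def)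
    finally show ?thesis by simp
  qed
  show thesis
  proof (rule that[of S])
    fix \<sigma> \<tau> assume nz: "S \<sigma> \<tau> \<noteq> 0"
    define i where "i = card \<tau>"
    have i: "i \<le> q" "\<tau> \<in> cliques i" and nz': "cod lam (col i \<tau>) \<sigma> \<noteq> 0"
      using nz by (auto simp: S_def i_def cliques_def split: if_splits)
    hence s: "\<sigma> \<in> cliques (Suc i)" using cod_space[OF col, of lam i \<tau>] by (auto simp: cochain_space_def)
    \<comment> \<open>Only vertices of nonzero weight contribute to \<open>cod\<close>, and adding
      such a vertex leaves \<open>dead\<close> unchanged.\<close>
    have "\<exists>v\<in>\<sigma>. lam v \<noteq> 0 \<and> col i \<tau> (\<sigma> - {v}) \<noteq> 0"
    proof (rule ccontr)
      assume "\<not> ?thesis"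
      hence "(\<Sum>v\<in>\<sigma>. eps v (\<sigma> - {v}) * lam v * col i \<tau> (\<sigma> - {v})) = 0" by (intro sum.neutral) auto
      thus False using nz' by (auto simp: cod_def split: if_splits)
    qed
    then obtain v where v: "v \<in> \<sigma>" "lam v \<noteq> 0" "col i \<tau> (\<sigma> - {v}) \<noteq> 0" by blast
    hence "dead lam (\<sigma> - {v}) = dead lam \<tau>"
      using laplace_inverse_dead[OF N(1)[OF i(1)] N(2)[OF i(1)], of "\<sigma> - {v}" \<tau>] i(2)
      by (auto simp: col_def split: if_splits)
    moreover have "dead lam \<sigma> = dead lam (\<sigma> - {v})"
      using dead_insert_nonzero[of lam v "\<sigma> - {v}"] v(1,2) by (simp add: insert_absorb)
    ultimately show "dead lam \<sigma> = dead lam \<tau> \<and> (\<exists>i\<le>q. \<tau> \<in> cliques i \<and> \<sigma> \<in> cliques (Suc i))"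
      using i s by auto
  next
    fix i x \<sigma> assume i: "i \<le> q" and x: "x \<in> cochain_space i"
    let ?y = "apply_matrix (N i) i x"
    have y: "?y \<in> cochain_space i" by (rule apply_matrix_space)
    have lapy: "laplace lam ?y = x" by (rule N(1)[OF i x])
    have 2: "(\<Sum>\<tau>\<in>Pow V. S \<sigma> \<tau> * bd lam x \<tau>) = cod lam (bd lam ?y) \<sigma>"
    proof (cases i)
      case 0
      thus ?thesis using bd_0[of x lam] bd_0[of ?y lam] x y by simp
    next
      case (Suc m)
      have bdy: "bd lam ?y \<in> cochain_space m" and bx: "bd lam x \<in> cochain_space m"
        using y x bd_space Suc by auto
      have "bd lam x = (\<lambda>\<tau>. bd lam (cod lam (bd lam ?y)) \<tau> + bd lam (bd lam (cod lam ?y)) \<tau>)"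
        by (subst lapy[symmetric], unfold laplace_def[abs_def] bd_add) simp
      also have "\<dots> = laplace lam (bd lam ?y)"
        using bd_bd[OF cod_space[OF y, of lam], of lam] bd_bd[OF y, of lam]
        by (auto simp: laplace_def)
      finally have "apply_matrix (N m) m (bd lam x) = bd lam ?y" using N(2)[OF _ bdy] Suc i by simp
      thus ?thesis using S[OF _ bx, of \<sigma>] Suc i by simp
    qed
    have "bd lam (\<lambda>\<rho>. \<Sum>\<tau>\<in>Pow V. S \<rho> \<tau> * x \<tau>) \<sigma> = bd lam (cod lam ?y) \<sigma>"
      by (simp add: S[OF i x])
    thus "bd lam (\<lambda>\<rho>. \<Sum>\<tau>\<in>Pow V. S \<rho> \<tau> * x \<tau>) \<sigma> + (\<Sum>\<tau>\<in>Pow V. S \<sigma> \<tau> * bd lam x \<tau>) = x \<sigma>"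
      using 2 fun_cong[OF lapy, of \<sigma>] by (simp add: laplace_def)
  qed
qed

end

section \<open>Reduced words in right-angled Artin groups\<close>

lemma words_append_iff: "u @ w \<in> words S \<longleftrightarrow> u \<in> words S \<and> w \<in> words S"
  by (auto simp: words_def)

lemma presentation_cong_words: "(u, w) \<in> presentation_cong S Rel \<Longrightarrow> u \<in> words S \<and> w \<in> words S"
  by (induction rule: presentation_cong.induct) (auto simp: words_append_iff, auto simp: words_def)

lemma presentation_cong_context:
  assumes "(u, w) \<in> presentation_cong S Rel" "x \<in> words S" "y \<in> words S"
  shows "(x @ u @ y, x @ w @ y) \<in> presentation_cong S Rel"
  using assms
proof (induction rule: presentation_cong.induct)
  case (cancel u w s b)
  thus ?case using presentation_cong.cancel[of "x @ u" S "w @ y" s b Rel] by (simp add: words_append_iff)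
next
  case (rel u w l r)
  thus ?case using presentation_cong.rel[of "x @ u" S "w @ y" l r Rel] by (simp add: words_append_iff)
qed (auto intro: presentation_cong.intros simp: words_append_iff)

lemma presentation_cong_append:
  assumes "(u, u') \<in> presentation_cong S Rel" "(w, w') \<in> presentation_cong S Rel"
  shows "(u @ w, u' @ w') \<in> presentation_cong S Rel"
proof -
  have "(u @ w, u' @ w) \<in> presentation_cong S Rel"
    using presentation_cong_context[OF assms(1), of "[]" w] presentation_cong_words[OF assms(2)]
    by (simp add: words_def)
  moreover have "(u' @ w, u' @ w') \<in> presentation_cong S Rel"
    using presentation_cong_context[OF assms(2), of u' "[]"] presentation_cong_words[OF assms(1)]
    by (simp add: words_def)
  ultimately show ?thesis by (rule presentation_cong.trans)
qed

lemma equiv_presentation_cong: "equiv (words S) (presentation_cong S Rel)"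
proof (rule equivI)
  show "presentation_cong S Rel \<subseteq> words S \<times> words S" using presentation_cong_words by auto
  show "refl_on (words S) (presentation_cong S Rel)"
    by (auto simp: refl_on_def intro: presentation_cong.refl dest: presentation_cong_words)
  show "sym (presentation_cong S Rel)" by (auto simp: sym_def intro: presentation_cong.sym)
  show "trans (presentation_cong S Rel)" by (auto simp: trans_def intro: presentation_cong.trans)
qed

definition wcls :: "'s set \<Rightarrow> ('s word \<times> 's word) set \<Rightarrow> 's word \<Rightarrow> 's word set" where
  "wcls S Rel w = presentation_cong S Rel `` {w}"

lemma wcls_eq_iff: "u \<in> words S \<Longrightarrow> w \<in> words S \<Longrightarrow> wcls S Rel u = wcls S Rel w \<longleftrightarrow> (u, w) \<in> presentation_cong S Rel"
  unfolding wcls_def by (rule eq_equiv_class_iff[OF equiv_presentation_cong])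

lemma wcls_self: "w \<in> words S \<Longrightarrow> w \<in> wcls S Rel w"
  unfolding wcls_def by (simp add: presentation_cong.refl)

lemma carrier_presented_group: "carrier (presented_group S Rel) = wcls S Rel ` words S"
  by (auto simp: presented_group_def quotient_def wcls_def)

lemma mult_presented_group:
  assumes "x \<in> words S" "y \<in> words S"
  shows "wcls S Rel x \<otimes>\<^bsub>presented_group S Rel\<^esub> wcls S Rel y = wcls S Rel (x @ y)"
proof -
  have *: "wcls S Rel (x' @ y') = wcls S Rel (x @ y)"
    if "(x, x') \<in> presentation_cong S Rel" "(y, y') \<in> presentation_cong S Rel" for x' y'
    using presentation_cong_append[OF that] presentation_cong_words[OF presentation_cong_append[OF that]]
      wcls_eq_iff[of "x @ y" S "x' @ y'" Rel] by simp
  have "wcls S Rel x \<otimes>\<^bsub>presented_group S Rel\<^esub> wcls S Rel y =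
      (\<Union>x'\<in>wcls S Rel x. \<Union>y'\<in>wcls S Rel y. wcls S Rel (x' @ y'))"
    by (simp add: presented_group_def wcls_def)
  also have "\<dots> = (\<Union>x'\<in>wcls S Rel x. \<Union>y'\<in>wcls S Rel y. wcls S Rel (x @ y))"
    by (intro SUP_cong refl *) (simp_all add: wcls_def)
  also have "\<dots> = wcls S Rel (x @ y)"
    using wcls_self[OF assms(1), of Rel] wcls_self[OF assms(2), of Rel] by (simp add: SUP_constant) blast
  finally show ?thesis .
qed

lemma one_presented_group: "\<one>\<^bsub>presented_group S Rel\<^esub> = wcls S Rel []"
  by (simp add: presented_group_def wcls_def)

definition inv_letter :: "'s \<times> bool \<Rightarrow> 's \<times> bool" where
  "inv_letter a = (fst a, \<not> snd a)"

lemma inv_letter_simps [simp]: "inv_letter (inv_letter a) = a" "fst (inv_letter a) = fst a" "inv_letter a \<noteq> a" "a \<noteq> inv_letter a"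
  by (cases a; auto simp: inv_letter_def)+

lemma cancel_letters:
  assumes "fst a \<in> S"
  shows "wcls S Rel [a, inv_letter a] = wcls S Rel []"
  using presentation_cong.cancel[of "[]" S "[]" "fst a" "snd a" Rel] assms
  by (cases a, subst wcls_eq_iff) (auto simp: words_def inv_letter_def)

lemma group_presented_group: "group (presented_group S Rel)"
proof -
  let ?G = "presented_group S Rel"
  have nil: "[] \<in> words S" by (simp add: words_def)
  have inv: "\<exists>w'\<in>words S. wcls S Rel (w' @ w) = wcls S Rel []" if "w \<in> words S" for w
    using that
  proof (induction w)
    case (Cons a w)
    then obtain w' where w': "w' \<in> words S" "wcls S Rel (w' @ w) = wcls S Rel []"
      by (auto simp: words_def)
    have a: "fst a \<in> S" "w \<in> words S" "[a] \<in> words S" "[inv_letter a] \<in> words S" "[inv_letter a, a] \<in> words S"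
      using Cons.prems by (auto simp: words_def inv_letter_def)
    have "wcls S Rel (w' @ [inv_letter a, a] @ w) = wcls S Rel w' \<otimes>\<^bsub>?G\<^esub> (wcls S Rel [inv_letter a, a] \<otimes>\<^bsub>?G\<^esub> wcls S Rel w)"
      using a w' by (simp add: mult_presented_group words_append_iff del: append_Cons)
    also have "\<dots> = wcls S Rel []"
      using cancel_letters[of "inv_letter a" S Rel] a w' nil by (simp add: mult_presented_group)
    finally show ?case using a w' by (intro bexI[of _ "w' @ [inv_letter a]"]) (auto simp: words_append_iff)
  qed (auto simp: nil)
  show ?thesis
  proof (rule groupI)
    show "\<And>x. x \<in> carrier ?G \<Longrightarrow> \<exists>y\<in>carrier ?G. y \<otimes>\<^bsub>?G\<^esub> x = \<one>\<^bsub>?G\<^esub>"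
      using inv by (auto simp: carrier_presented_group mult_presented_group one_presented_group)
  qed (auto simp: carrier_presented_group mult_presented_group one_presented_group words_append_iff nil)
qed

section \<open>The right-angled Artin group and its letters\<close>

locale raag_setup = fixes \<Gamma> :: "('v, 'e) pre_digraph" and idx :: "'v \<Rightarrow> nat"
  assumes graph: "graph \<Gamma>" and inj_idx': "inj_on idx (verts \<Gamma>)"

sublocale raag_setup \<subseteq> clique_complex "verts \<Gamma>" "\<lambda>v w. v \<rightarrow>\<^bsub>\<Gamma>\<^esub> w" idx
proof -
  interpret graph \<Gamma> by (rule graph)
  show "clique_complex (verts \<Gamma>) (\<lambda>v w. v \<rightarrow>\<^bsub>\<Gamma>\<^esub> w) idx"
    using inj_idx' adj_not_same adj_in_verts(1) arcs_ends_symmetric[OF sym_arcs]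
    by unfold_locales auto
qed

context raag_setup begin

abbreviation V where "V \<equiv> verts \<Gamma>"
abbreviation adj where "adj v w \<equiv> v \<rightarrow>\<^bsub>\<Gamma>\<^esub> w"
abbreviation relators where
  "relators \<equiv> {([(v, True), (w, True)], [(w, True), (v, True)]) | v w. adj v w}"

definition G :: "'v word set monoid" where "G = raag \<Gamma>"
definition cls :: "'v word \<Rightarrow> 'v word set" where "cls = wcls V relators"
definition letter :: "'v \<times> bool \<Rightarrow> 'v word set" where "letter a = cls [a]"

lemma G_presented: "G = presented_group V relators"
  by (simp add: G_def raag_def)

sublocale G: group G
  unfolding G_presented by (rule group_presented_group)

lemma carrier_G: "carrier G = cls ` words V"
  by (simp add: G_presented carrier_presented_group cls_def)

lemma cls_mult: "x \<in> words V \<Longrightarrow> y \<in> words V \<Longrightarrow> cls x \<otimes>\<^bsub>G\<^esub> cls y = cls (x @ y)"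
  by (simp add: G_presented mult_presented_group cls_def)

lemma cls_Nil: "cls [] = \<one>\<^bsub>G\<^esub>"
  by (simp add: G_presented one_presented_group cls_def)

lemma letter_words: "fst a \<in> V \<Longrightarrow> [a] \<in> words V"
  by (cases a) (auto simp: words_def)

lemma letter_closed: "fst a \<in> V \<Longrightarrow> letter a \<in> carrier G"
  using letter_words by (auto simp: letter_def carrier_G)

lemma cls_snoc: "w \<in> words V \<Longrightarrow> fst a \<in> V \<Longrightarrow> cls (w @ [a]) = cls w \<otimes>\<^bsub>G\<^esub> letter a"
  by (simp add: letter_def cls_mult letter_words)

lemma letter_cancel: "fst a \<in> V \<Longrightarrow> letter a \<otimes>\<^bsub>G\<^esub> letter (inv_letter a) = \<one>\<^bsub>G\<^esub>"
  using cancel_letters[of a V relators] letter_words[of a] letter_words[of "inv_letter a"]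
  by (simp add: letter_def cls_mult cls_Nil[symmetric]) (simp add: cls_def)

lemma letter_inv: "fst a \<in> V \<Longrightarrow> letter (inv_letter a) = inv\<^bsub>G\<^esub> letter a"
  by (rule G.inv_equality[symmetric]) (use letter_cancel[of "inv_letter a"] letter_closed in auto)

lemma inv_commute:
  assumes "x \<in> carrier G" "y \<in> carrier G" "x \<otimes>\<^bsub>G\<^esub> y = y \<otimes>\<^bsub>G\<^esub> x"
  shows "inv\<^bsub>G\<^esub> x \<otimes>\<^bsub>G\<^esub> y = y \<otimes>\<^bsub>G\<^esub> inv\<^bsub>G\<^esub> x"
proof -
  have "inv\<^bsub>G\<^esub> x \<otimes>\<^bsub>G\<^esub> y = inv\<^bsub>G\<^esub> x \<otimes>\<^bsub>G\<^esub> (y \<otimes>\<^bsub>G\<^esub> x) \<otimes>\<^bsub>G\<^esub> inv\<^bsub>G\<^esub> x"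
    using assms(1,2) by (simp add: G.m_assoc)
  also have "\<dots> = y \<otimes>\<^bsub>G\<^esub> inv\<^bsub>G\<^esub> x"
    unfolding assms(3)[symmetric] using assms(1,2) by (simp add: G.m_assoc[symmetric])
  finally show ?thesis .
qed

text \<open>The relators concern positive letters only; \<open>inv_commute\<close> replaces one
  factor at a time by its inverse, which gives all four patterns of signs.\<close>

lemma letter_commute:
  assumes "adj (fst a) (fst b)"
  shows "letter a \<otimes>\<^bsub>G\<^esub> letter b = letter b \<otimes>\<^bsub>G\<^esub> letter a"
proof -
  obtain v s w t where ab: "a = (v, s)" "b = (w, t)" by fastforce
  hence vw: "v \<in> V" "w \<in> V" "adj v w" using assms adj_V[of v w] adj_V[OF adj_sym[of v w]] by auto
  have *: "letter (v, True) \<otimes>\<^bsub>G\<^esub> letter (w, True) = letter (w, True) \<otimes>\<^bsub>G\<^esub> letter (v, True)"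
  proof -
    have "([(v, True), (w, True)], [(w, True), (v, True)]) \<in> presentation_cong V relators"
      using presentation_cong.rel[of "[]" V "[]" "[(v, True), (w, True)]" "[(w, True), (v, True)]" relators] vw
      by (auto simp: words_def)
    thus ?thesis using vw letter_words[of "(v, True)"] letter_words[of "(w, True)"]
      by (simp add: letter_def cls_mult) (simp add: cls_def wcls_eq_iff words_def)
  qed
  have F: "letter (x, False) = inv\<^bsub>G\<^esub> letter (x, True)" if "x \<in> V" for x
    using letter_inv[of "(x, True)"] that by (simp add: inv_letter_def)
  have cl: "letter (v, True) \<in> carrier G" "letter (w, True) \<in> carrier G"
    using vw by (auto intro: letter_closed)
  have c1: "letter (v, False) \<otimes>\<^bsub>G\<^esub> letter (w, True) = letter (w, True) \<otimes>\<^bsub>G\<^esub> letter (v, False)"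
    unfolding F[OF vw(1)] by (rule inv_commute[OF cl *])
  have c2: "letter (w, False) \<otimes>\<^bsub>G\<^esub> letter (v, True) = letter (v, True) \<otimes>\<^bsub>G\<^esub> letter (w, False)"
    unfolding F[OF vw(2)] by (rule inv_commute[OF cl(2,1) *[symmetric]])
  have c3: "letter (v, False) \<otimes>\<^bsub>G\<^esub> letter (w, False) = letter (w, False) \<otimes>\<^bsub>G\<^esub> letter (v, False)"
    using inv_commute[OF cl(1) _ c2[symmetric]] letter_closed[of "(w, False)"] vw(2)
    unfolding F[OF vw(1)] by simp
  show ?thesis unfolding ab by (cases s; cases t) (simp_all only: * c1 c2 c3)
qed

text \<open>
  A reduced element is encoded by its projections to all pairs of non-adjacent vertices (the diagonal
  included), each stored with the last letter first. Right multiplication by a letter either cancels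
  against the heads of all projections involving its vertex or extends all of them.
\<close>

definition appl :: "'v \<times> bool \<Rightarrow> ('v \<Rightarrow> 'v \<Rightarrow> 'v word) \<Rightarrow> 'v \<Rightarrow> 'v \<Rightarrow> 'v word" where
  "appl a F x y = (if \<not> adj x y \<and> (x = fst a \<or> y = fst a) then a # F x y else F x y)"

definition rmv :: "'v \<times> bool \<Rightarrow> ('v \<Rightarrow> 'v \<Rightarrow> 'v word) \<Rightarrow> 'v \<Rightarrow> 'v \<Rightarrow> 'v word" where
  "rmv a F x y = (if \<not> adj x y \<and> (x = fst a \<or> y = fst a) then tl (F x y) else F x y)"

text \<open>The inverse of \<open>a\<close> can be shuffled to the end of a reduced word exactly
  when it is the last letter in every projection that sees its vertex. The case
  \<open>y = fst a\<close> guarantees that the condition is not vacuous.\<close>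

definition cancels :: "'v \<times> bool \<Rightarrow> ('v \<Rightarrow> 'v \<Rightarrow> 'v word) \<Rightarrow> bool" where
  "cancels a F \<longleftrightarrow> (\<forall>y. \<not> adj (fst a) y \<longrightarrow> F (fst a) y \<noteq> [] \<and> hd (F (fst a) y) = inv_letter a)"

definition act :: "'v \<times> bool \<Rightarrow> ('v \<Rightarrow> 'v \<Rightarrow> 'v word) \<Rightarrow> 'v \<Rightarrow> 'v \<Rightarrow> 'v word" where
  "act a F = (if cancels a F then rmv a F else appl a F)"

text \<open>Only extending steps are allowed, so a derivation is a reduced word for
  \<open>g\<close>. The restriction to such states is essential: on arbitrary families of lists,
  acting by a letter and then by its inverse may cancel twice and lose information.\<close>

inductive reach :: "'v word set \<Rightarrow> ('v \<Rightarrow> 'v \<Rightarrow> 'v word) \<Rightarrow> bool" where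
  start: "reach \<one>\<^bsub>G\<^esub> (\<lambda>_ _. [])"
| step: "reach g F \<Longrightarrow> fst a \<in> V \<Longrightarrow> \<not> cancels a F \<Longrightarrow> reach (g \<otimes>\<^bsub>G\<^esub> letter a) (appl a F)"

lemma reach_carrier: "reach g F \<Longrightarrow> g \<in> carrier G"
  by (induction rule: reach.induct) (auto intro: letter_closed)

lemma reach_sym: "reach g F \<Longrightarrow> F x y = F y x"
  by (induction rule: reach.induct) (auto simp: appl_def dest: adj_sym)

lemma cancels_adj:
  assumes "adj (fst a) (fst b)"
  shows "cancels a (appl b F) = cancels a F" "cancels a (rmv b F) = cancels a F"
proof -
  have "appl b F (fst a) y = F (fst a) y" "rmv b F (fst a) y = F (fst a) y" if "\<not> adj (fst a) y" for y
    using assms that adj_irrefl by (auto simp: appl_def rmv_def)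
  thus "cancels a (appl b F) = cancels a F" "cancels a (rmv b F) = cancels a F"
    by (simp_all add: cancels_def)
qed

lemma appl_rmv_adj:
  assumes "adj (fst a) (fst b)"
  shows "appl a (appl b F) = appl b (appl a F)" "rmv a (rmv b F) = rmv b (rmv a F)"
    "appl a (rmv b F) = rmv b (appl a F)"
  using assms adj_irrefl adj_sym by (auto simp: appl_def rmv_def fun_eq_iff)

lemma act_commute:
  assumes "adj (fst a) (fst b)"
  shows "act a (act b F) = act b (act a F)"
  using cancels_adj[OF assms] cancels_adj[OF adj_sym[OF assms]] appl_rmv_adj[OF assms]
    appl_rmv_adj[OF adj_sym[OF assms]] by (auto simp: act_def)

lemma rmv_appl: "rmv b (appl b' F) = F" if "fst b = fst b'"
  using that by (auto simp: rmv_def appl_def fun_eq_iff)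

text \<open>Induction along the reduced word. If its last letter \<open>b\<close> has the vertex of
  \<open>a\<close>, then it is the inverse of \<open>a\<close> and its removal undoes the last step.
  Otherwise \<open>b\<close> is adjacent to \<open>a\<close>, since it would else be the head of the
  projection to both vertices, and the two steps commute. The second conclusion ensures that the
  inverse letter then extends the state instead of cancelling again.\<close>

lemma reach_rmv:
  assumes "reach g F" "fst a \<in> V" "cancels a F"
  shows "reach (g \<otimes>\<^bsub>G\<^esub> letter a) (rmv a F) \<and> \<not> cancels (inv_letter a) (rmv a F)"
  using assms
proof (induction rule: reach.induct)
  case start
  thus ?case using adj_irrefl by (auto simp: cancels_def)
next
  case (step g F b)
  note g = reach_carrier[OF step.hyps(1)]
  show ?case
  proof (cases "fst b = fst a")
    case True
    hence b: "b = inv_letter a"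
      using step.prems(2) adj_irrefl by (auto simp: cancels_def appl_def)
    have "g \<otimes>\<^bsub>G\<^esub> letter b \<otimes>\<^bsub>G\<^esub> letter a = g"
      using letter_cancel[of b] step.prems(1) g letter_closed by (simp add: b G.m_assoc)
    thus ?thesis using step.hyps b rmv_appl[of a b] by simp
  next
    case False
    have ad: "adj (fst a) (fst b)"
    proof (rule ccontr)
      assume "\<not> adj (fst a) (fst b)"
      hence "hd (appl b F (fst a) (fst b)) = inv_letter a" using step.prems(2) by (auto simp: cancels_def)
      hence "b = inv_letter a" using \<open>\<not> adj (fst a) (fst b)\<close> by (simp add: appl_def)
      thus False using False by simp
    qed
    hence "cancels a F" using step.prems(2) cancels_adj by simp
    from step.IH[OF step.prems(1) this]
    have r: "reach (g \<otimes>\<^bsub>G\<^esub> letter a) (rmv a F)" "\<not> cancels (inv_letter a) (rmv a F)" by auto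
    have "reach (g \<otimes>\<^bsub>G\<^esub> letter a \<otimes>\<^bsub>G\<^esub> letter b) (appl b (rmv a F))"
      by (rule reach.step[OF r(1) step.hyps(2)]) (use step.hyps(3) cancels_adj[OF adj_sym[OF ad]] in simp)
    moreover have "g \<otimes>\<^bsub>G\<^esub> letter a \<otimes>\<^bsub>G\<^esub> letter b = g \<otimes>\<^bsub>G\<^esub> letter b \<otimes>\<^bsub>G\<^esub> letter a"
      using letter_commute[OF ad] g letter_closed step.prems(1) step.hyps(2) by (simp add: G.m_assoc)
    moreover have "appl b (rmv a F) = rmv a (appl b F)" by (rule appl_rmv_adj(3)[OF adj_sym[OF ad]])
    moreover have "\<not> cancels (inv_letter a) (appl b (rmv a F))"
      using r(2) cancels_adj(1)[of "inv_letter a" b] ad by simp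
    ultimately show ?thesis by simp
  qed
qed

lemma reach_act: "reach g F \<Longrightarrow> fst a \<in> V \<Longrightarrow> reach (g \<otimes>\<^bsub>G\<^esub> letter a) (act a F)"
  using reach_rmv reach.step by (auto simp: act_def)

lemma act_inv:
  assumes "reach g F" "fst a \<in> V"
  shows "act (inv_letter a) (act a F) = F"
proof (cases "cancels a F")
  case True
  have 1: "inv_letter a # tl (F (fst a) y) = F (fst a) y" if "\<not> adj (fst a) y" for y
    using True that by (metis cancels_def list.collapse)
  \<comment> \<open>\<open>cancels\<close> speaks about pairs with \<open>fst a\<close> in first
    place; symmetry of reachable states covers the others.\<close>
  have "inv_letter a # tl (F x y) = F x y" if "\<not> adj x y" "x = fst a \<or> y = fst a" for x y
    using that 1[of x] 1[of y] reach_sym[OF assms(1), of x y] adj_sym[of y x] by metis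
  hence "appl (inv_letter a) (rmv a F) = F"
    by (intro ext) (simp add: appl_def rmv_def)
  thus ?thesis using True reach_rmv[OF assms True] by (simp add: act_def)
next
  case False
  have "cancels (inv_letter a) (appl a F)" by (auto simp: cancels_def appl_def)
  thus ?thesis using False by (simp add: act_def rmv_appl)
qed

definition run :: "'v word \<Rightarrow> 'v \<Rightarrow> 'v \<Rightarrow> 'v word" where
  "run w = foldl (\<lambda>F a. act a F) (\<lambda>_ _. []) w"

lemma run_append: "run (u @ w) = foldl (\<lambda>F a. act a F) (run u) w"
  by (simp add: run_def)

lemma reach_run: "w \<in> words V \<Longrightarrow> reach (cls w) (run w)"
proof (induction w rule: rev_induct)
  case Nil thus ?case by (simp add: run_def cls_Nil reach.start)
next
  case (snoc a w)
  hence "w \<in> words V" "fst a \<in> V" by (auto simp: words_def)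
  thus ?case using snoc.IH reach_act by (simp add: cls_snoc run_append)
qed

text \<open>Cancellation is handled by \<open>act_inv\<close>, a relator by
  \<open>act_commute\<close>. Hence the final state is a function of the group element, which is
  what solves the word problem here.\<close>

lemma run_cong: "(u, w) \<in> presentation_cong V relators \<Longrightarrow> run u = run w"
proof (induction rule: presentation_cong.induct)
  case (cancel u w s b)
  thus ?case using act_inv[OF reach_run[OF cancel(1)], of "(s, b)"] by (simp add: run_append inv_letter_def)
next
  case (rel u w l r)
  then obtain x y where "l = [(x, True), (y, True)]" "r = [(y, True), (x, True)]" "adj x y" by blast
  thus ?case using act_commute[of "(x, True)" "(y, True)"] by (simp add: run_append)
qed auto

definition state :: "'v word set \<Rightarrow> 'v \<Rightarrow> 'v \<Rightarrow> 'v word" where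
  "state g = run (SOME w. w \<in> g)"

lemma state_cls: "w \<in> words V \<Longrightarrow> state (cls w) = run w"
proof -
  assume w: "w \<in> words V"
  have "(SOME w'. w' \<in> cls w) \<in> cls w"
    unfolding cls_def using wcls_self[OF w] by (rule someI)
  hence "(w, SOME w'. w' \<in> cls w) \<in> presentation_cong V relators" by (simp add: cls_def wcls_def)
  thus ?thesis by (simp add: state_def run_cong)
qed

lemma reach_state: "g \<in> carrier G \<Longrightarrow> reach g (state g)"
  by (auto simp: carrier_G state_cls reach_run)

lemma state_mult: "g \<in> carrier G \<Longrightarrow> fst a \<in> V \<Longrightarrow> state (g \<otimes>\<^bsub>G\<^esub> letter a) = act a (state g)"
proof -
  assume "g \<in> carrier G" and a: "fst a \<in> V"
  then obtain w where w: "w \<in> words V" "g = cls w" by (auto simp: carrier_G)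
  have "w @ [a] \<in> words V" using w a letter_words by (simp add: words_append_iff)
  thus ?thesis using w a by (simp add: cls_snoc[symmetric] state_cls run_append)
qed

section \<open>Last letters and word length\<close>

text \<open>Means that some reduced word for \<open>g\<close> ends in \<open>a\<close>, expressed as
  the possibility of cancelling against the opposite letter.\<close>

definition desc :: "'v word set \<Rightarrow> 'v \<times> bool \<Rightarrow> bool" where
  "desc g a \<longleftrightarrow> cancels (inv_letter a) (state g)"

text \<open>The word length: each letter of a reduced word occurs in exactly one diagonal
  projection, that of its own vertex.\<close>

definition len :: "'v word set \<Rightarrow> nat" where
  "len g = (\<Sum>x\<in>V. length (state g x x))"

lemma len_down:
  assumes "g \<in> carrier G" "fst a \<in> V" "desc g (inv_letter a)"
  shows "len g = Suc (len (g \<otimes>\<^bsub>G\<^esub> letter a))"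
proof -
  have c: "cancels a (state g)" using assms(3) by (simp add: desc_def)
  hence "state g (fst a) (fst a) \<noteq> []" using adj_irrefl by (auto simp: cancels_def)
  hence "length (state g x x) = length (rmv a (state g) x x) + (if x = fst a then 1 else 0)" for x
    using adj_irrefl by (auto simp: rmv_def)
  hence "len g = (\<Sum>x\<in>V. length (rmv a (state g) x x)) + (\<Sum>x\<in>V. if x = fst a then 1 else 0)"
    unfolding len_def by (simp only: sum.distrib)
  also have "\<dots> = Suc (\<Sum>x\<in>V. length (rmv a (state g) x x))"
    using assms(2) finite_V by (simp add: sum.delta)
  finally show ?thesis using c assms by (simp add: len_def state_mult act_def)
qed

lemma desc_up:
  assumes "g \<in> carrier G" "fst a \<in> V" "\<not> desc g (inv_letter a)"
  shows "desc (g \<otimes>\<^bsub>G\<^esub> letter a) a"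
  using assms by (auto simp: desc_def state_mult act_def cancels_def appl_def)

lemma mult_letter_inv:
  "g \<in> carrier G \<Longrightarrow> fst a \<in> V \<Longrightarrow> g \<otimes>\<^bsub>G\<^esub> letter a \<otimes>\<^bsub>G\<^esub> letter (inv_letter a) = g"
  by (simp add: G.m_assoc letter_closed letter_cancel)

lemma len_up:
  assumes "g \<in> carrier G" "fst a \<in> V" "\<not> desc g (inv_letter a)"
  shows "len (g \<otimes>\<^bsub>G\<^esub> letter a) = Suc (len g)"
  using len_down[of "g \<otimes>\<^bsub>G\<^esub> letter a" "inv_letter a"] desc_up[OF assms] assms
  by (simp add: mult_letter_inv letter_closed)

lemma desc_inv: "desc g a \<Longrightarrow> \<not> desc g (inv_letter a)"
  using adj_irrefl by (auto simp: desc_def cancels_def)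

text \<open>Two last letters at non-adjacent vertices would both have to be the head of the
  projection to these vertices.\<close>

lemma desc_adj:
  assumes "g \<in> carrier G" "desc g a" "desc g b" "fst a \<noteq> fst b"
  shows "adj (fst a) (fst b)"
proof (rule ccontr)
  assume n: "\<not> adj (fst a) (fst b)"
  hence n': "\<not> adj (fst b) (fst a)" using adj_sym by blast
  have "hd (state g (fst a) (fst b)) = a" "hd (state g (fst b) (fst a)) = b"
    using assms(2,3) n n' by (auto simp: desc_def cancels_def)
  thus False using reach_sym[OF reach_state[OF assms(1)], of "fst a" "fst b"] assms(4) by simp
qed

lemma desc_mult_adj:
  assumes "g \<in> carrier G" "fst b \<in> V" "adj (fst a) (fst b)"
  shows "desc (g \<otimes>\<^bsub>G\<^esub> letter b) a = desc g a"
  using assms cancels_adj[of "inv_letter a" b] by (auto simp: desc_def state_mult act_def)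

lemma desc_nonempty:
  assumes "g \<in> carrier G" "g \<noteq> \<one>\<^bsub>G\<^esub>"
  shows "\<exists>a. fst a \<in> V \<and> desc g a"
  using reach_state[OF assms(1)]
proof cases
  case start thus ?thesis using assms(2) by simp
next
  case (step g' F a)
  thus ?thesis by (intro exI[of _ a]) (auto simp: desc_def cancels_def appl_def)
qed

lemma desc_one: "\<not> desc \<one>\<^bsub>G\<^esub> a"
  using state_cls[of "[]"] adj_irrefl by (auto simp: desc_def cancels_def cls_Nil run_def words_def)

lemma len_zero:
  assumes "g \<in> carrier G" "len g = 0" shows "g = \<one>\<^bsub>G\<^esub>"
proof (rule ccontr)
  assume "g \<noteq> \<one>\<^bsub>G\<^esub>"
  then obtain a where a: "fst a \<in> V" "desc g a" using desc_nonempty assms(1) by blast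
  thus False using len_down[of g "inv_letter a"] assms by simp
qed

end

section \<open>The cubical resolution\<close>

text \<open>Integration of a test function. Identities between finitely supported functions are
  checked after pairing, where translations and products become substitutions in the test
  function.\<close>

definition pair :: "('g \<Rightarrow> real) \<Rightarrow> ('g \<Rightarrow> real) \<Rightarrow> real" where
  "pair f F = (\<Sum>g\<in>{g. f g \<noteq> 0}. f g * F g)"

lemma pair_superset: "finite A \<Longrightarrow> {g. f g \<noteq> 0} \<subseteq> A \<Longrightarrow> pair f F = (\<Sum>g\<in>A. f g * F g)"
  unfolding pair_def by (rule sum.mono_neutral_left) auto

lemma pair_add:
  assumes "finite {g. f g \<noteq> 0}" "finite {g. h g \<noteq> 0}"
  shows "pair (\<lambda>g. f g + h g) F = pair f F + pair h F"
proof -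
  let ?A = "{g. f g \<noteq> 0} \<union> {g. h g \<noteq> 0}"
  have A: "finite ?A" using assms by simp
  have "{g. f g + h g \<noteq> 0} \<subseteq> ?A" "{g. f g \<noteq> 0} \<subseteq> ?A" "{g. h g \<noteq> 0} \<subseteq> ?A" by auto
  thus ?thesis by (simp add: pair_superset[OF A] sum.distrib distrib_right del: Un_iff)
qed

lemma pair_zero [simp]: "pair (\<lambda>g. 0) F = 0"
  by (simp add: pair_def)

lemma pair_scale: "pair (\<lambda>g. c * f g) F = c * pair f F"
  by (cases "c = 0") (simp_all add: pair_def sum_distrib_left mult.assoc)

lemma pair_diff:
  assumes "finite {g. f g \<noteq> 0}" "finite {g. h g \<noteq> 0}"
  shows "pair (\<lambda>g. f g - h g) F = pair f F - pair h F"
  using pair_add[of f "\<lambda>g. (-1) * h g" F] assms pair_scale[of "-1" h F] by simp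

lemma pair_sum:
  assumes "finite A" "\<And>a. a \<in> A \<Longrightarrow> finite {g. f a g \<noteq> 0}"
  shows "pair (\<lambda>g. \<Sum>a\<in>A. f a g) F = (\<Sum>a\<in>A. pair (f a) F)"
  using assms
proof (induction A rule: finite_induct)
  case (insert a A)
  have "finite {g. (\<Sum>a\<in>A. f a g) \<noteq> 0}"
  proof (rule finite_subset)
    show "{g. (\<Sum>a\<in>A. f a g) \<noteq> 0} \<subseteq> (\<Union>a\<in>A. {g. f a g \<noteq> 0})"
      by (auto dest: sum.not_neutral_contains_not_neutral)
  qed (use insert in auto)
  thus ?case using insert by (simp add: pair_add)
qed simp

lemma pair_cong: "(\<And>g. f g \<noteq> 0 \<Longrightarrow> F g = F' g) \<Longrightarrow> pair f F = pair f F'"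
  unfolding pair_def by (intro sum.cong) auto

section \<open>Chains of cubes and their boundary\<close>

locale raag_signed = raag_setup \<Gamma> idx for \<Gamma> :: "('v, 'e) pre_digraph" and idx :: "'v \<Rightarrow> nat" +
  fixes sg :: "'v \<Rightarrow> bool"
begin

definition gam :: "'v \<Rightarrow> 'v word set" where "gam v = letter (v, sg v)"

lemma gam_closed: "v \<in> V \<Longrightarrow> gam v \<in> carrier G"
  by (simp add: gam_def letter_closed)

lemma inv_gam: "v \<in> V \<Longrightarrow> inv\<^bsub>G\<^esub> gam v = letter (v, \<not> sg v)"
  using letter_inv[of "(v, sg v)"] by (simp add: gam_def inv_letter_def)

lemma gam_commute: "adj v w \<Longrightarrow> gam v \<otimes>\<^bsub>G\<^esub> gam w = gam w \<otimes>\<^bsub>G\<^esub> gam v"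
  using letter_commute[of "(v, sg v)" "(w, sg w)"] by (simp add: gam_def)

lemma inv_gam_commute: "adj v w \<Longrightarrow> inv\<^bsub>G\<^esub> gam v \<otimes>\<^bsub>G\<^esub> inv\<^bsub>G\<^esub> gam w = inv\<^bsub>G\<^esub> gam w \<otimes>\<^bsub>G\<^esub> inv\<^bsub>G\<^esub> gam v"
  using adj_V[of v w] adj_V[OF adj_sym, of v w] letter_commute[of "(v, \<not> sg v)" "(w, \<not> sg w)"]
  by (simp add: inv_gam)

text \<open>\<open>x \<sigma> g\<close> is the coefficient of the cube spanned at the vertex \<open>g\<close> by the generators in \<open>\<sigma>\<close>.\<close>

definition chains :: "nat \<Rightarrow> ('v set \<Rightarrow> 'v word set \<Rightarrow> real) set" where
  "chains n = {x. (\<forall>\<sigma>. \<sigma> \<notin> cliques n \<longrightarrow> x \<sigma> = (\<lambda>_. 0)) \<and>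
     (\<forall>\<sigma>. {g. x \<sigma> g \<noteq> 0} \<subseteq> carrier G \<and> finite {g. x \<sigma> g \<noteq> 0})}"

text \<open>In direction \<open>v\<close> a cube has one face at its base point and one at the
  translate of the base point by \<open>gam v\<close>. The coefficient at \<open>g\<close> therefore
  receives the cube based at \<open>g\<close> times the inverse of \<open>gam v\<close>, positively,
  and the cube based at \<open>g\<close>, negatively. Acting on the right keeps the left action for
  the module structure.\<close>

definition dif :: "('v set \<Rightarrow> 'v word set \<Rightarrow> real) \<Rightarrow> 'v set \<Rightarrow> 'v word set \<Rightarrow> real" where
  "dif x \<tau> g = (if g \<in> carrier G then \<Sum>v\<in>V - \<tau>. eps v \<tau> *
     (x (insert v \<tau>) (g \<otimes>\<^bsub>G\<^esub> inv\<^bsub>G\<^esub> gam v) - x (insert v \<tau>) g) else 0)"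

lemma chainsD:
  assumes "x \<in> chains n"
  shows "\<sigma> \<notin> cliques n \<Longrightarrow> x \<sigma> g = 0" "g \<notin> carrier G \<Longrightarrow> x \<sigma> g = 0" "finite {g. x \<sigma> g \<noteq> 0}"
  using assms by (auto simp: chains_def)

lemma chainsI:
  assumes "\<And>\<sigma> g. \<sigma> \<notin> cliques n \<Longrightarrow> x \<sigma> g = 0" "\<And>\<sigma> g. g \<notin> carrier G \<Longrightarrow> x \<sigma> g = 0"
    "\<And>\<sigma>. finite {g. x \<sigma> g \<noteq> 0}"
  shows "x \<in> chains n"
  using assms by (auto simp: chains_def)

lemma chains_diff:
  assumes "x \<in> chains n" "y \<in> chains n"
  shows "(\<lambda>\<sigma> g. x \<sigma> g - y \<sigma> g) \<in> chains n"
proof (rule chainsI)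
  fix \<sigma>
  show "finite {g. x \<sigma> g - y \<sigma> g \<noteq> 0}"
    by (rule finite_subset[of _ "{g. x \<sigma> g \<noteq> 0} \<union> {g. y \<sigma> g \<noteq> 0}"]) (use assms chainsD(3) in auto)
qed (simp_all add: chainsD(1,2)[OF assms(1)] chainsD(1,2)[OF assms(2)])

lemma chains_zero: "(\<lambda>_ _. 0) \<in> chains n"
  by (rule chainsI) auto

lemma chains_add:
  assumes "x \<in> chains n" "y \<in> chains n"
  shows "(\<lambda>\<sigma> g. x \<sigma> g + y \<sigma> g) \<in> chains n"
  using chains_diff[OF assms(1) chains_diff[OF chains_zero assms(2)]] by simp

lemma chains_scale: "x \<in> chains n \<Longrightarrow> (\<lambda>\<sigma> g. c * x \<sigma> g) \<in> chains n"
proof (rule chainsI)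
  fix \<sigma> assume "x \<in> chains n"
  thus "finite {g. c * x \<sigma> g \<noteq> 0}"
    by (intro finite_subset[OF _ chainsD(3)[of x n \<sigma>]]) auto
qed (use chainsD in auto)

lemma dif_diff: "dif (\<lambda>\<sigma> g. x \<sigma> g - y \<sigma> g) \<tau> g = dif x \<tau> g - dif y \<tau> g"
  by (simp add: dif_def sum_subtractf right_diff_distrib)

lemma finite_shift:
  assumes "finite {g. f g \<noteq> 0}" "a \<in> carrier G" "\<And>g. g \<notin> carrier G \<Longrightarrow> f g = (0::real)"
  shows "finite {g \<in> carrier G. f (g \<otimes>\<^bsub>G\<^esub> a) \<noteq> 0}"
proof (rule finite_subset)
  show "{g \<in> carrier G. f (g \<otimes>\<^bsub>G\<^esub> a) \<noteq> 0} \<subseteq> (\<lambda>h. h \<otimes>\<^bsub>G\<^esub> inv\<^bsub>G\<^esub> a) ` {g. f g \<noteq> 0}"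
  proof
    fix g assume g: "g \<in> {g \<in> carrier G. f (g \<otimes>\<^bsub>G\<^esub> a) \<noteq> 0}"
    hence "g = g \<otimes>\<^bsub>G\<^esub> a \<otimes>\<^bsub>G\<^esub> inv\<^bsub>G\<^esub> a" using assms(2) by (simp add: G.m_assoc)
    thus "g \<in> (\<lambda>h. h \<otimes>\<^bsub>G\<^esub> inv\<^bsub>G\<^esub> a) ` {g. f g \<noteq> 0}" using g by blast
  qed
qed (use assms in auto)

lemma dif_chains:
  assumes x: "x \<in> chains (Suc n)"
  shows "dif x \<in> chains n"
proof (rule chainsI)
  fix \<tau> g assume "\<tau> \<notin> cliques n"
  hence "x (insert v \<tau>) h = 0" if "v \<notin> \<tau>" for v h
    using chainsD(1)[OF x] cliques_insert[OF that] by blast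
  thus "dif x \<tau> g = 0" by (simp add: dif_def)
next
  fix \<tau>
  have "{g. dif x \<tau> g \<noteq> 0} \<subseteq> (\<Union>v\<in>V. {g \<in> carrier G. x (insert v \<tau>) (g \<otimes>\<^bsub>G\<^esub> inv\<^bsub>G\<^esub> gam v) \<noteq> 0} \<union> {g. x (insert v \<tau>) g \<noteq> 0})"
  proof
    fix g assume "g \<in> {g. dif x \<tau> g \<noteq> 0}"
    hence g: "g \<in> carrier G" and "(\<Sum>v\<in>V - \<tau>. eps v \<tau> *
      (x (insert v \<tau>) (g \<otimes>\<^bsub>G\<^esub> inv\<^bsub>G\<^esub> gam v) - x (insert v \<tau>) g)) \<noteq> 0"
      by (auto simp: dif_def split: if_splits)
    then obtain v where "v \<in> V" "x (insert v \<tau>) (g \<otimes>\<^bsub>G\<^esub> inv\<^bsub>G\<^esub> gam v) - x (insert v \<tau>) g \<noteq> 0"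
      by (metis (no_types, lifting) DiffD1 mult_zero_right sum.neutral)
    thus "g \<in> (\<Union>v\<in>V. {g \<in> carrier G. x (insert v \<tau>) (g \<otimes>\<^bsub>G\<^esub> inv\<^bsub>G\<^esub> gam v) \<noteq> 0} \<union> {g. x (insert v \<tau>) g \<noteq> 0})"
      using g by (cases "x (insert v \<tau>) g = 0") auto
  qed
  moreover have "finite \<dots>"
    using finite_V finite_shift[OF chainsD(3)[OF x] _ chainsD(2)[OF x]] chainsD(3)[OF x] gam_closed by auto
  ultimately show "finite {g. dif x \<tau> g \<noteq> 0}" by (rule finite_subset)
qed (simp add: dif_def)

lemma dif_chains_0: "x \<in> chains 0 \<Longrightarrow> dif x \<tau> g = 0"
  using chainsD(1)[of x 0] by (auto simp: dif_def cliques_0 intro!: sum.neutral)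

lemma dif_dif:
  assumes x: "x \<in> chains n"
  shows "dif (dif x) \<tau> g = 0"
proof (cases "g \<in> carrier G \<and> \<tau> \<subseteq> V")
  case True
  hence g: "g \<in> carrier G" and t: "\<tau> \<subseteq> V" by auto
  define B where "B v w = x (insert w (insert v \<tau>)) (g \<otimes>\<^bsub>G\<^esub> inv\<^bsub>G\<^esub> gam v \<otimes>\<^bsub>G\<^esub> inv\<^bsub>G\<^esub> gam w)
     - x (insert w (insert v \<tau>)) (g \<otimes>\<^bsub>G\<^esub> inv\<^bsub>G\<^esub> gam v)
     - x (insert w (insert v \<tau>)) (g \<otimes>\<^bsub>G\<^esub> inv\<^bsub>G\<^esub> gam w) + x (insert w (insert v \<tau>)) g" for v w
  have "dif (dif x) \<tau> g = (\<Sum>v\<in>V - \<tau>. eps v \<tau> * (\<Sum>w\<in>V - insert v \<tau>. eps w (insert v \<tau>) * B v w))"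
    unfolding dif_def[of "dif x"] using g gam_closed
    by (auto simp: dif_def B_def sum_subtractf[symmetric] algebra_simps intro!: sum.cong)
  also have "\<dots> = (\<Sum>v\<in>V - \<tau>. \<Sum>w\<in>V - insert v \<tau>. eps v \<tau> * eps w (insert v \<tau>) * B v w)"
    by (simp add: sum_distrib_left mult.assoc)
  also have "\<dots> = 0"
  proof (rule sum_cofaces_zero[OF t])
    fix v w assume vw: "v \<in> V - \<tau>" "w \<in> V - \<tau>" "v \<noteq> w"
    \<comment> \<open>The point where commutation of adjacent generators enters; off the cliques all
      coefficients vanish.\<close>
    show "B v w = B w v"
    proof (cases "clique (insert w (insert v \<tau>))")
      case True
      hence "adj v w" using clique_adj vw by auto
      hence "g \<otimes>\<^bsub>G\<^esub> inv\<^bsub>G\<^esub> gam v \<otimes>\<^bsub>G\<^esub> inv\<^bsub>G\<^esub> gam w = g \<otimes>\<^bsub>G\<^esub> inv\<^bsub>G\<^esub> gam w \<otimes>\<^bsub>G\<^esub> inv\<^bsub>G\<^esub> gam v"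
        using g vw gam_closed inv_gam_commute by (simp add: G.m_assoc)
      thus ?thesis by (simp add: B_def insert_commute)
    next
      case False
      thus ?thesis using chainsD(1)[OF x] by (simp add: B_def insert_commute cliques_def)
    qed
  qed
  finally show ?thesis .
next
  case False
  have "x (insert w (insert v \<tau>)) h = 0" if "g \<in> carrier G" for v w h
  proof -
    have "\<not> clique (insert w (insert v \<tau>))" using False that clique_V by blast
    thus ?thesis using chainsD(1)[OF x] by (auto simp: cliques_def)
  qed
  thus ?thesis by (auto simp: dif_def intro!: sum.neutral)
qed

definition aug :: "('v set \<Rightarrow> 'v word set \<Rightarrow> real) \<Rightarrow> real" where
  "aug x = pair (x {}) (\<lambda>_. 1)"

lemma pair_shift:
  assumes "\<And>g. g \<notin> carrier G \<Longrightarrow> f g = 0" "a \<in> carrier G"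
  shows "pair (\<lambda>g. if g \<in> carrier G then f (g \<otimes>\<^bsub>G\<^esub> inv\<^bsub>G\<^esub> a) else 0) F = pair f (\<lambda>g. F (g \<otimes>\<^bsub>G\<^esub> a))"
  unfolding pair_def
proof (rule sum.reindex_bij_witness[of _ "\<lambda>h. h \<otimes>\<^bsub>G\<^esub> a" "\<lambda>g. g \<otimes>\<^bsub>G\<^esub> inv\<^bsub>G\<^esub> a"], goal_cases)
  case (4 b)
  hence "b \<in> carrier G" using assms(1) by auto
  thus ?case using 4 assms(2) by (simp add: G.m_assoc)
next
  case (3 b)
  hence "b \<in> carrier G" using assms(1) by auto
  thus ?case using 3 assms(2) by (simp add: G.m_assoc)
qed (use assms(2) in \<open>auto simp: G.m_assoc split: if_splits\<close>)

text \<open>The transpose of the boundary: the shift moves from the chain to the test function and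
  leaves its difference along \<open>gam v\<close>. Vanishing of the augmentation, linearity over
  the group ring, the evaluation at exponentials and the comparison with the bar complex are all
  read off from this formula.\<close>

lemma pair_dif:
  assumes x: "x \<in> chains n"
  shows "pair (dif x \<tau>) F = (\<Sum>v\<in>V - \<tau>. eps v \<tau> * pair (x (insert v \<tau>)) (\<lambda>g. F (g \<otimes>\<^bsub>G\<^esub> gam v) - F g))"
proof -
  let ?s = "\<lambda>v g. if g \<in> carrier G then x (insert v \<tau>) (g \<otimes>\<^bsub>G\<^esub> inv\<^bsub>G\<^esub> gam v) else 0"
  have fin: "finite {g. ?s v g \<noteq> 0}" if "v \<in> V" for v
    using finite_shift[OF chainsD(3)[OF x] _ chainsD(2)[OF x], of "inv\<^bsub>G\<^esub> gam v" "insert v \<tau>"] gam_closed[OF that]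
    by (auto elim: rev_finite_subset)
  have fin2: "finite {g. eps v \<tau> * (?s v g - x (insert v \<tau>) g) \<noteq> 0}" if "v \<in> V" for v
    by (rule finite_subset[of _ "{g. ?s v g \<noteq> 0} \<union> {g. x (insert v \<tau>) g \<noteq> 0}"])
       (use fin[OF that] chainsD(3)[OF x] in auto)
  have "dif x \<tau> = (\<lambda>g. \<Sum>v\<in>V - \<tau>. eps v \<tau> * (?s v g - x (insert v \<tau>) g))"
    using chainsD(2)[OF x] by (auto simp: dif_def fun_eq_iff)
  hence "pair (dif x \<tau>) F = (\<Sum>v\<in>V - \<tau>. pair (\<lambda>g. eps v \<tau> * (?s v g - x (insert v \<tau>) g)) F)"
    by (simp only:) (rule pair_sum, use fin2 finite_V in auto)
  also have "\<dots> = (\<Sum>v\<in>V - \<tau>. eps v \<tau> * pair (x (insert v \<tau>)) (\<lambda>g. F (g \<otimes>\<^bsub>G\<^esub> gam v) - F g))"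
  proof (rule sum.cong[OF HOL.refl])
    fix v assume v: "v \<in> V - \<tau>"
    have "pair (?s v) F = pair (x (insert v \<tau>)) (\<lambda>g. F (g \<otimes>\<^bsub>G\<^esub> gam v))"
      by (rule pair_shift) (use chainsD(2)[OF x] gam_closed v in auto)
    hence "pair (\<lambda>g. ?s v g - x (insert v \<tau>) g) F = pair (x (insert v \<tau>)) (\<lambda>g. F (g \<otimes>\<^bsub>G\<^esub> gam v)) - pair (x (insert v \<tau>)) F"
      using pair_diff[OF fin[of v] chainsD(3)[OF x, of "insert v \<tau>"], of F] v by simp
    also have "\<dots> = pair (x (insert v \<tau>)) (\<lambda>g. F (g \<otimes>\<^bsub>G\<^esub> gam v) - F g)"
      by (simp add: pair_def sum_subtractf[symmetric] algebra_simps)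
    finally show "pair (\<lambda>g. eps v \<tau> * (?s v g - x (insert v \<tau>) g)) F =
        eps v \<tau> * pair (x (insert v \<tau>)) (\<lambda>g. F (g \<otimes>\<^bsub>G\<^esub> gam v) - F g)"
      by (simp only: pair_scale)
  qed
  finally show ?thesis .
qed

lemma aug_dif: "x \<in> chains n \<Longrightarrow> aug (dif x) = 0"
  using pair_dif[of x n "{}" "\<lambda>_. 1"] by (simp add: aug_def) (simp add: pair_def)

text \<open>\<open>level g \<sigma>\<close> is the length of the longest vertex of the cube, its top vertex.\<close>

definition level :: "'v word set \<Rightarrow> 'v set \<Rightarrow> nat" where
  "level g \<sigma> = len g + card {v \<in> \<sigma>. \<not> desc g (v, \<not> sg v)}"

section \<open>Cubes with a common top vertex\<close>

definition vdesc :: "'v word set \<Rightarrow> 'v \<Rightarrow> bool" where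
  "vdesc g v \<longleftrightarrow> desc g (v, sg v) \<or> desc g (v, \<not> sg v)"

text \<open>If \<open>g\<close> ends in a letter at \<open>v\<close>, the cube at \<open>g\<close>
  is the outer \<open>v\<close>-face of a cube with one more direction and the same top vertex;
  \<open>lower_base g v\<close> is the base point of the latter. In the other direction,
  \<open>top_face\<close> gives the base point of the outer \<open>v\<close>-face of a cube at
  \<open>g\<close>. Up to \<open>eps\<close>, \<open>eta\<close> is the incidence sign of such a
  face.\<close>

definition lower_base :: "'v word set \<Rightarrow> 'v \<Rightarrow> 'v word set" where
  "lower_base g v = (if desc g (v, sg v) then g \<otimes>\<^bsub>G\<^esub> inv\<^bsub>G\<^esub> gam v else g)"

definition top_face :: "'v word set \<Rightarrow> 'v \<Rightarrow> 'v word set" where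
  "top_face g v = (if desc g (v, \<not> sg v) then g else g \<otimes>\<^bsub>G\<^esub> gam v)"

definition eta :: "'v word set \<Rightarrow> 'v \<Rightarrow> real" where
  "eta g v = (if desc g (v, sg v) then 1 else -1)"

definition span :: "'v word set \<Rightarrow> 'v set \<Rightarrow> 'v set" where
  "span g \<sigma> = \<sigma> \<union> {w \<in> V - \<sigma>. clique (insert w \<sigma>) \<and> vdesc g w}"

lemma inv_letter_pair [simp]: "inv_letter (v, b) = (v, \<not> b)"
  by (simp add: inv_letter_def)

lemma len_mult_gam:
  assumes "g \<in> carrier G" "v \<in> V"
  shows "desc g (v, \<not> sg v) \<Longrightarrow> len g = Suc (len (g \<otimes>\<^bsub>G\<^esub> gam v))"
    "\<not> desc g (v, \<not> sg v) \<Longrightarrow> len (g \<otimes>\<^bsub>G\<^esub> gam v) = Suc (len g)"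
    "\<not> desc g (v, \<not> sg v) \<Longrightarrow> desc (g \<otimes>\<^bsub>G\<^esub> gam v) (v, sg v)"
    "desc g (v, sg v) \<Longrightarrow> len g = Suc (len (g \<otimes>\<^bsub>G\<^esub> inv\<^bsub>G\<^esub> gam v))"
    "\<not> desc g (v, sg v) \<Longrightarrow> len (g \<otimes>\<^bsub>G\<^esub> inv\<^bsub>G\<^esub> gam v) = Suc (len g)"
    "\<not> desc g (v, sg v) \<Longrightarrow> desc (g \<otimes>\<^bsub>G\<^esub> inv\<^bsub>G\<^esub> gam v) (v, \<not> sg v)"
  using len_down[of g "(v, sg v)"] len_up[of g "(v, sg v)"] desc_up[of g "(v, sg v)"]
    len_down[of g "(v, \<not> sg v)"] len_up[of g "(v, \<not> sg v)"] desc_up[of g "(v, \<not> sg v)"] assms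
  by (simp_all add: gam_def[symmetric] inv_gam[symmetric])

lemma gam_inv_cancel:
  assumes "g \<in> carrier G" "v \<in> V"
  shows "g \<otimes>\<^bsub>G\<^esub> gam v \<otimes>\<^bsub>G\<^esub> inv\<^bsub>G\<^esub> gam v = g" "g \<otimes>\<^bsub>G\<^esub> inv\<^bsub>G\<^esub> gam v \<otimes>\<^bsub>G\<^esub> gam v = g"
  using assms gam_closed by (simp_all add: G.m_assoc)

lemma not_both: "desc g (v, sg v) \<Longrightarrow> \<not> desc g (v, \<not> sg v)"
  using desc_inv[of g "(v, sg v)"] by simp

lemma desc_inv_gam:
  assumes "g \<in> carrier G" "v \<in> V" "desc g (v, sg v)"
  shows "\<not> desc (g \<otimes>\<^bsub>G\<^esub> inv\<^bsub>G\<^esub> gam v) (v, \<not> sg v)"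
proof
  let ?h = "g \<otimes>\<^bsub>G\<^esub> inv\<^bsub>G\<^esub> gam v"
  assume d: "desc ?h (v, \<not> sg v)"
  have h: "?h \<in> carrier G" using assms gam_closed by simp
  show False using len_mult_gam(1)[OF h assms(2) d] len_mult_gam(4)[OF assms]
    by (simp add: gam_inv_cancel[OF assms(1,2)])
qed

lemma lower_base_closed: "g \<in> carrier G \<Longrightarrow> v \<in> V \<Longrightarrow> lower_base g v \<in> carrier G"
  by (simp add: lower_base_def gam_closed)

lemma top_face_closed: "g \<in> carrier G \<Longrightarrow> v \<in> V \<Longrightarrow> top_face g v \<in> carrier G"
  by (simp add: top_face_def gam_closed)

lemma top_face_lower_base:
  assumes "g \<in> carrier G" "v \<in> V" "vdesc g v"
  shows "top_face (lower_base g v) v = g"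
  using assms desc_inv_gam[of g v] gam_inv_cancel[of g v] not_both
  by (auto simp: top_face_def lower_base_def vdesc_def)

lemma vdesc_top_face: "g \<in> carrier G \<Longrightarrow> v \<in> V \<Longrightarrow> vdesc (top_face g v) v"
  using len_mult_gam(3)[of g v] by (auto simp: top_face_def vdesc_def)

lemma lower_base_top_face:
  assumes "g \<in> carrier G" "v \<in> V"
  shows "lower_base (top_face g v) v = g"
  using assms len_mult_gam(3)[of g v] gam_inv_cancel[of g v] not_both
  by (auto simp: top_face_def lower_base_def)

lemma desc_gam_adj:
  assumes "g \<in> carrier G" "adj w v"
  shows "desc (g \<otimes>\<^bsub>G\<^esub> gam v) (w, b) = desc g (w, b)" "desc (g \<otimes>\<^bsub>G\<^esub> inv\<^bsub>G\<^esub> gam v) (w, b) = desc g (w, b)"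
proof -
  have v: "v \<in> V" using adj_V[OF adj_sym[OF assms(2)]] .
  show "desc (g \<otimes>\<^bsub>G\<^esub> gam v) (w, b) = desc g (w, b)"
    using desc_mult_adj[OF assms(1), of "(v, sg v)" "(w, b)"] assms(2) v by (simp add: gam_def)
  show "desc (g \<otimes>\<^bsub>G\<^esub> inv\<^bsub>G\<^esub> gam v) (w, b) = desc g (w, b)"
    using desc_mult_adj[OF assms(1), of "(v, \<not> sg v)" "(w, b)"] assms(2) v by (simp add: inv_gam)
qed

lemma desc_lower_base:
  assumes "g \<in> carrier G" "adj w v"
  shows "desc (lower_base g v) (w, b) = desc g (w, b)" "desc (top_face g v) (w, b) = desc g (w, b)"
  using desc_gam_adj[OF assms] by (simp_all add: lower_base_def top_face_def)

lemma lower_base_top_face_commute: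
  assumes g: "g \<in> carrier G" and uv: "adj u v"
  shows "top_face (lower_base g v) u = lower_base (top_face g u) v"
proof -
  have uV: "u \<in> V" and vV: "v \<in> V" using adj_V[OF uv] adj_V[OF adj_sym[OF uv]] by auto
  have c: "gam u \<otimes>\<^bsub>G\<^esub> inv\<^bsub>G\<^esub> gam v = inv\<^bsub>G\<^esub> gam v \<otimes>\<^bsub>G\<^esub> gam u"
    using inv_commute[OF gam_closed[OF vV] gam_closed[OF uV] gam_commute[OF adj_sym[OF uv]]] by simp
  have "g \<otimes>\<^bsub>G\<^esub> inv\<^bsub>G\<^esub> gam v \<otimes>\<^bsub>G\<^esub> gam u = g \<otimes>\<^bsub>G\<^esub> gam u \<otimes>\<^bsub>G\<^esub> inv\<^bsub>G\<^esub> gam v"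
    using g uV vV gam_closed c by (simp add: G.m_assoc)
  thus ?thesis
    unfolding top_face_def[of "lower_base g v"] lower_base_def[of "top_face g u"]
      desc_lower_base(1)[OF g uv] desc_lower_base(2)[OF g adj_sym[OF uv]]
    by (simp add: top_face_def lower_base_def)
qed

lemma card_insert_filter:
  assumes "finite \<tau>" "v \<notin> \<tau>"
  shows "card {w \<in> insert v \<tau>. P w} = (if P v then 1 else 0) + card {w \<in> \<tau>. P w}"
proof -
  have "{w \<in> insert v \<tau>. P w} = (if P v then {v} else {}) \<union> {w \<in> \<tau>. P w}" by auto
  thus ?thesis using assms by auto
qed

text \<open>A new direction either adds longer corners, and the level rises by one, or, when chosen
  through \<open>lower_base\<close>, only shorter corners, and the top vertex stays. The
  contribution of the other directions does not change under the shift, because they are adjacent to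
  \<open>v\<close>.\<close>

lemma level_insert:
  assumes g: "g \<in> carrier G" and v: "v \<notin> \<tau>" and cl: "clique (insert v \<tau>)"
  shows "\<not> desc g (v, sg v) \<Longrightarrow> level (g \<otimes>\<^bsub>G\<^esub> inv\<^bsub>G\<^esub> gam v) (insert v \<tau>) = Suc (level g \<tau>)"
    "\<not> desc g (v, \<not> sg v) \<Longrightarrow> level g (insert v \<tau>) = Suc (level g \<tau>)"
    "vdesc g v \<Longrightarrow> level (lower_base g v) (insert v \<tau>) = level g \<tau>"
proof -
  have fin: "finite \<tau>" using clique_finite[OF cl] by simp
  have vV: "v \<in> V" using clique_V[OF cl] by simp
  have ad: "adj w v" if "w \<in> \<tau>" for w using clique_adj[OF cl] that v by auto
  have same: "{w \<in> \<tau>. \<not> desc (g \<otimes>\<^bsub>G\<^esub> inv\<^bsub>G\<^esub> gam v) (w, \<not> sg w)} = {w \<in> \<tau>. \<not> desc g (w, \<not> sg w)}"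
    using desc_gam_adj(2)[OF g ad] by auto
  show 1: "level (g \<otimes>\<^bsub>G\<^esub> inv\<^bsub>G\<^esub> gam v) (insert v \<tau>) = Suc (level g \<tau>)" if "\<not> desc g (v, sg v)"
    using len_mult_gam(5,6)[OF g vV that]
    unfolding level_def card_insert_filter[OF fin v] by (simp add: same)
  show 2: "level g (insert v \<tau>) = Suc (level g \<tau>)" if "\<not> desc g (v, \<not> sg v)"
    using that unfolding level_def card_insert_filter[OF fin v] by simp
  show "level (lower_base g v) (insert v \<tau>) = level g \<tau>" if "vdesc g v"
  proof (cases "desc g (v, sg v)")
    case True
    thus ?thesis using len_mult_gam(4)[OF g vV True] desc_inv_gam[OF g vV True]
      unfolding level_def card_insert_filter[OF fin v] by (simp add: lower_base_def same)
  next
    case False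
    thus ?thesis using that unfolding level_def card_insert_filter[OF fin v]
      by (simp add: lower_base_def vdesc_def)
  qed
qed

text \<open>Of the two cubes that meet the face in direction \<open>v\<close>, one that would have a
  higher level has coefficient zero, and at most one has the same level. So at the highest level the
  boundary is a simplicial one on the cubes with the same top vertex.\<close>

lemma dif_top:
  assumes x: "x \<in> chains n" and g: "g \<in> carrier G"
    and van: "\<And>h \<sigma>. h \<in> carrier G \<Longrightarrow> level h \<sigma> > level g \<tau> \<Longrightarrow> x \<sigma> h = 0"
  shows "dif x \<tau> g = (\<Sum>v\<in>V - \<tau>. eps v \<tau> * (if vdesc g v then eta g v * x (insert v \<tau>) (lower_base g v) else 0))"
proof -
  have "x (insert v \<tau>) (g \<otimes>\<^bsub>G\<^esub> inv\<^bsub>G\<^esub> gam v) - x (insert v \<tau>) g =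
     (if vdesc g v then eta g v * x (insert v \<tau>) (lower_base g v) else 0)" if v: "v \<in> V - \<tau>" for v
  proof (cases "clique (insert v \<tau>)")
    case False
    thus ?thesis using chainsD(1)[OF x] by (simp add: cliques_def)
  next
    case True
    have gc: "g \<otimes>\<^bsub>G\<^esub> inv\<^bsub>G\<^esub> gam v \<in> carrier G" using g v gam_closed by simp
    have 1: "x (insert v \<tau>) (g \<otimes>\<^bsub>G\<^esub> inv\<^bsub>G\<^esub> gam v) = 0" if "\<not> desc g (v, sg v)"
      by (rule van[OF gc]) (use level_insert(1)[OF g _ True that] v in simp)
    have 2: "x (insert v \<tau>) g = 0" if "\<not> desc g (v, \<not> sg v)"
      by (rule van[OF g]) (use level_insert(2)[OF g _ True that] v in simp)
    show ?thesis using 1 2 not_both[of g v] by (auto simp: vdesc_def eta_def lower_base_def)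
  qed
  thus ?thesis using g by (simp add: dif_def)
qed

lemma span_lower_base:
  assumes g: "g \<in> carrier G" and v: "v \<in> span g \<tau> - \<tau>"
  shows "span (lower_base g v) (insert v \<tau>) = span g \<tau>"
proof -
  have vV: "v \<in> V" "v \<notin> \<tau>" "clique (insert v \<tau>)" "vdesc g v" using v by (auto simp: span_def)
  have vd: "vdesc (lower_base g v) w = vdesc g w" if "adj w v" for w
    using desc_lower_base(1)[OF g that] by (simp add: vdesc_def)
  have "w \<in> span g \<tau>" if w: "w \<in> V - insert v \<tau>" "clique (insert w (insert v \<tau>))" "vdesc (lower_base g v) w" for w
  proof -
    have "adj w v" using clique_adj[OF w(2)] w(1) by auto
    moreover have "clique (insert w \<tau>)" by (rule clique_subset[OF w(2)]) auto
    ultimately show ?thesis using vd w by (auto simp: span_def)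
  qed
  moreover have "clique (insert w (insert v \<tau>)) \<and> vdesc (lower_base g v) w"
    if w: "w \<in> V - insert v \<tau>" "clique (insert w \<tau>)" "vdesc g w" for w
  proof -
    \<comment> \<open>Vertices of two different last letters are adjacent. Therefore admissible
      directions remain admissible together, and the cubes below one top vertex form a full
      simplex.\<close>
    have "\<exists>b. desc g (w, b)" "\<exists>b. desc g (v, b)" using w(3) vV(4) by (auto simp: vdesc_def)
    hence wv: "adj w v" using desc_adj[OF g, of "(w, _)" "(v, _)"] w(1) by auto
    have "clique (insert w (insert v \<tau>))"
      using w(2) vV(3) wv adj_sym by (auto simp: clique_def)
    thus ?thesis using vd[OF wv] w(3) by simp
  qed
  ultimately show ?thesis using vV unfolding span_def by blast
qed

lemma span_top_face:
  assumes g: "g \<in> carrier G" and u: "u \<in> \<tau>" and cl: "clique \<tau>"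
  shows "span (top_face g u) (\<tau> - {u}) = span g \<tau>" "u \<in> span (top_face g u) (\<tau> - {u})"
proof -
  have uV: "u \<in> V" using clique_V[OF cl] u by auto
  have i: "insert u (\<tau> - {u}) = \<tau>" using u by auto
  show *: "u \<in> span (top_face g u) (\<tau> - {u})"
    using uV cl vdesc_top_face[OF g uV] i by (simp add: span_def)
  show "span (top_face g u) (\<tau> - {u}) = span g \<tau>"
    using span_lower_base[OF top_face_closed[OF g uV], of u "\<tau> - {u}"] * i
    by (simp add: lower_base_top_face[OF g uV])
qed

definition pick :: "'v set \<Rightarrow> 'v" where "pick X = (SOME v. v \<in> X)"

text \<open>All cubes with the same top vertex \<open>t\<close> have the same \<open>span\<close>, the set of vertices of letters on
  which \<open>t\<close> can end. Coning off with the vertex picked in it contracts the part of the complex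
  with top vertex \<open>t\<close>.\<close>

definition cone :: "nat \<Rightarrow> nat \<Rightarrow> ('v set \<Rightarrow> 'v word set \<Rightarrow> real) \<Rightarrow> 'v set \<Rightarrow> 'v word set \<Rightarrow> real" where
  "cone n m x \<sigma> g = (let u = pick (span g \<sigma>) in
     if g \<in> carrier G \<and> \<sigma> \<in> cliques (Suc n) \<and> level g \<sigma> = m \<and> u \<in> \<sigma>
     then eps u (\<sigma> - {u}) * eta (top_face g u) u * x (\<sigma> - {u}) (top_face g u) else 0)"

lemma cone_chains:
  assumes x: "x \<in> chains n"
  shows "cone n m x \<in> chains (Suc n)"
proof (rule chainsI)
  fix \<sigma>
  show "finite {g. cone n m x \<sigma> g \<noteq> 0}"
  proof (cases "clique \<sigma>")
    case True
    have "{g. cone n m x \<sigma> g \<noteq> 0} \<subseteq> (\<Union>u\<in>\<sigma>. (\<lambda>h. lower_base h u) ` {h. x (\<sigma> - {u}) h \<noteq> 0})"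
    proof
      fix g assume "g \<in> {g. cone n m x \<sigma> g \<noteq> 0}"
      then obtain u where u: "u \<in> \<sigma>" "x (\<sigma> - {u}) (top_face g u) \<noteq> 0" "g \<in> carrier G"
        by (auto simp: cone_def Let_def split: if_splits)
      moreover have "g = lower_base (top_face g u) u"
        using lower_base_top_face[of g u] u clique_V[OF True] by auto
      ultimately show "g \<in> (\<Union>u\<in>\<sigma>. (\<lambda>h. lower_base h u) ` {h. x (\<sigma> - {u}) h \<noteq> 0})" by blast
    qed
    thus ?thesis by (rule finite_subset) (use clique_finite[OF True] chainsD(3)[OF x] in auto)
  qed (auto simp: cone_def cliques_def Let_def)
qed (auto simp: cone_def Let_def)

lemma cone_level: "cone n m x \<sigma> g \<noteq> 0 \<Longrightarrow> level g \<sigma> = m"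
  by (auto simp: cone_def Let_def split: if_splits)

lemma eta_lower_base: "g \<in> carrier G \<Longrightarrow> adj u v \<Longrightarrow> eta (lower_base g v) u = eta g u"
  "g \<in> carrier G \<Longrightarrow> adj u v \<Longrightarrow> eta (top_face g v) u = eta g u"
  using desc_lower_base by (simp_all add: eta_def)

lemma eta_square: "eta g v * eta g v = 1" by (simp add: eta_def)

text \<open>If the cone vertex \<open>u\<close> is not in \<tau>, only direction \<open>u\<close>
  contributes and the signs square to 1. If \<open>u\<close> is in \<tau>, all admissible directions
  contribute, and the cycle condition at the outer \<open>u\<close>-face evaluates their
  sum.\<close>

lemma dif_cone:
  assumes x: "x \<in> chains n" and cyc: "\<And>\<tau> g. dif x \<tau> g = 0"
    and van: "\<And>h \<sigma>. h \<in> carrier G \<Longrightarrow> level h \<sigma> > m \<Longrightarrow> x \<sigma> h = 0"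
    and g: "g \<in> carrier G" and t: "\<tau> \<in> cliques n" and lev: "level g \<tau> = m" and ne: "span g \<tau> \<noteq> {}"
  shows "dif (cone n m x) \<tau> g = x \<tau> g"
proof -
  have clt: "clique \<tau>" using t by (simp add: cliques_def)
  have tV: "\<tau> \<subseteq> V" by (rule clique_V[OF clt])
  have fint: "finite \<tau>" by (rule clique_finite[OF clt])
  define u where "u = pick (span g \<tau>)"
  have u: "u \<in> span g \<tau>" unfolding u_def pick_def using ne by (simp add: some_in_eq)
  have uV: "u \<in> V" using u tV by (auto simp: span_def)
  let ?N = "{v \<in> V - \<tau>. clique (insert v \<tau>) \<and> vdesc g v}"
  have N: "?N = span g \<tau> - \<tau>" by (auto simp: span_def)
  have cone_eq: "cone n m x (insert v \<tau>) (lower_base g v) =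
     (if u \<in> insert v \<tau> then eps u (insert v \<tau> - {u}) * eta (top_face (lower_base g v) u) u *
        x (insert v \<tau> - {u}) (top_face (lower_base g v) u) else 0)" if "v \<in> ?N" for v
  proof -
    have "span (lower_base g v) (insert v \<tau>) = span g \<tau>" by (rule span_lower_base[OF g]) (use that in \<open>simp add: span_def\<close>)
    moreover have "level (lower_base g v) (insert v \<tau>) = m" using level_insert(3)[OF g, of v \<tau>] that lev by simp
    moreover have "insert v \<tau> \<in> cliques (Suc n)" using that t fint by (auto simp: cliques_def)
    moreover have "lower_base g v \<in> carrier G" using lower_base_closed[OF g] that by simp
    ultimately show ?thesis by (simp add: cone_def Let_def u_def)
  qed
  have "dif (cone n m x) \<tau> g = (\<Sum>v\<in>V - \<tau>. eps v \<tau> *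
      (if vdesc g v then eta g v * cone n m x (insert v \<tau>) (lower_base g v) else 0))"
    by (rule dif_top[OF cone_chains[OF x] g]) (use cone_level lev in fastforce)
  also have "\<dots> = (\<Sum>v\<in>?N. eps v \<tau> * (eta g v * cone n m x (insert v \<tau>) (lower_base g v)))"
    using finite_V by (intro sum.mono_neutral_cong_right) (auto simp: cone_def cliques_def Let_def)
  also have "\<dots> = x \<tau> g"
  proof (cases "u \<in> \<tau>")
    case False
    hence uN: "u \<in> ?N" using u N by blast
    have "(\<Sum>v\<in>?N. eps v \<tau> * (eta g v * cone n m x (insert v \<tau>) (lower_base g v))) =
       (\<Sum>v\<in>{u}. eps v \<tau> * (eta g v * cone n m x (insert v \<tau>) (lower_base g v)))"
      by (rule sum.mono_neutral_right) (use finite_V uN False cone_eq in auto)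
    also have "\<dots> = eps u \<tau> * (eta g u * (eps u \<tau> * eta g u * x \<tau> g))"
      using cone_eq[OF uN] False uN top_face_lower_base[OF g uV] by simp
    also have "\<dots> = (eps u \<tau> * eps u \<tau>) * (eta g u * eta g u) * x \<tau> g" by (simp only: mult_ac)
    also have "\<dots> = x \<tau> g" by (simp add: eps_square eta_square)
    finally show ?thesis .
  next
    case True
    define \<rho> where "\<rho> = \<tau> - {u}"
    define h where "h = top_face g u"
    have h: "h \<in> carrier G" unfolding h_def by (rule top_face_closed[OF g uV])
    have tr: "\<tau> = insert u \<rho>" "u \<notin> \<rho>" using True by (auto simp: \<rho>_def)
    have levh: "level h \<rho> = m"
      using level_insert(3)[OF h tr(2)] clt vdesc_top_face[OF g uV] lower_base_top_face[OF g uV] lev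
      by (simp add: tr(1)[symmetric] h_def)
    have spanh: "span h \<rho> = span g \<tau>" unfolding h_def \<rho>_def by (rule span_top_face(1)[OF g True clt])
    let ?M = "{v \<in> V - \<rho>. clique (insert v \<rho>) \<and> vdesc h v}"
    have M: "?M = insert u ?N"
    proof -
      have "?M = span h \<rho> - \<rho>" by (auto simp: span_def)
      also have "\<dots> = insert u (span g \<tau> - \<tau>)" using spanh u tr by auto
      finally show ?thesis unfolding N .
    qed
    \<comment> \<open>The cycle condition one dimension lower; its term in direction
      \<open>u\<close> is the coefficient \<open>x \<tau> g\<close> that is to be recovered.\<close>
    have "0 = dif x \<rho> h" by (simp add: cyc)
    also have "\<dots> = (\<Sum>v\<in>V - \<rho>. eps v \<rho> * (if vdesc h v then eta h v * x (insert v \<rho>) (lower_base h v) else 0))"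
      by (rule dif_top[OF x h]) (use van levh in simp)
    also have "\<dots> = (\<Sum>v\<in>?M. eps v \<rho> * (eta h v * x (insert v \<rho>) (lower_base h v)))"
      using finite_V chainsD(1)[OF x] by (intro sum.mono_neutral_cong_right) (auto simp: cliques_def)
    also have "\<dots> = eps u \<rho> * (eta h u * x \<tau> g) + (\<Sum>v\<in>?N. eps v \<rho> * (eta h v * x (insert v \<rho>) (lower_base h v)))"
      unfolding M using finite_V True lower_base_top_face[OF g uV] by (simp add: tr(1)[symmetric] h_def)
    finally have S: "(\<Sum>v\<in>?N. eps v \<rho> * (eta h v * x (insert v \<rho>) (lower_base h v))) = - (eps u \<rho> * (eta h u * x \<tau> g))"
      by simp
    have "eps v \<tau> * (eta g v * cone n m x (insert v \<tau>) (lower_base g v)) =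
        - (eps u \<rho> * eta h u) * (eps v \<rho> * (eta h v * x (insert v \<rho>) (lower_base h v)))" if v: "v \<in> ?N" for v
    proof -
      have uv: "adj u v" "u \<noteq> v" using v True clique_adj[of "insert v \<tau>" u v] by auto
      have s: "eps v \<tau> * eps u (insert v \<rho>) = - (eps u \<rho> * eps v \<rho>)"
      proof -
        have ne: "idx u \<noteq> idx v" using inj_onD[OF inj_idx, of u v] uV uv v by auto
        have f: "finite \<rho>" "v \<notin> \<rho>" using fint v by (auto simp: \<rho>_def)
        have "eps v (insert u \<rho>) * eps u (insert v \<rho>) = - (eps u \<rho> * eps v \<rho>)"
          using ne by (auto simp: eps_insert[OF f(1) tr(2)] eps_insert[OF f])
        thus ?thesis by (simp only: tr(1)[symmetric])
      qed
      have i: "insert v \<tau> - {u} = insert v \<rho>" using uv tr by auto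
      have e1: "eta g v = eta h v" unfolding h_def using eta_lower_base(2)[OF g adj_sym[OF uv(1)]] by simp
      have e2: "top_face (lower_base g v) u = lower_base h v"
        unfolding h_def by (rule lower_base_top_face_commute[OF g uv(1)])
      have e3: "eta (lower_base h v) u = eta h u" by (rule eta_lower_base(1)[OF h uv(1)])
      have "eps v \<tau> * (eta g v * cone n m x (insert v \<tau>) (lower_base g v)) =
         eps v \<tau> * eps u (insert v \<rho>) * (eta h u * (eta h v * x (insert v \<rho>) (lower_base h v)))"
        using cone_eq[OF v] True by (simp add: i e1 e2 e3 mult_ac)
      also have "\<dots> = - (eps u \<rho> * eta h u) * (eps v \<rho> * (eta h v * x (insert v \<rho>) (lower_base h v)))"
        unfolding s by (simp add: mult_ac)
      finally show ?thesis .
    qed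
    hence "(\<Sum>v\<in>?N. eps v \<tau> * (eta g v * cone n m x (insert v \<tau>) (lower_base g v))) =
       (\<Sum>v\<in>?N. - (eps u \<rho> * eta h u) * (eps v \<rho> * (eta h v * x (insert v \<rho>) (lower_base h v))))"
      by (intro sum.cong HOL.refl)
    also have "\<dots> = - (eps u \<rho> * eta h u) * - (eps u \<rho> * (eta h u * x \<tau> g))"
      by (simp only: sum_distrib_left[symmetric] S)
    also have "\<dots> = (eps u \<rho> * eps u \<rho>) * (eta h u * eta h u) * x \<tau> g" by (simp add: mult_ac)
    also have "\<dots> = x \<tau> g" by (simp add: eps_square eta_square)
    finally show ?thesis .
  qed
  finally show ?thesis .
qed

lemma dif_cone_above:
  assumes "x \<in> chains n" "g \<in> carrier G" "level g \<tau> > m"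
  shows "dif (cone n m x) \<tau> g = 0"
proof -
  have z: "cone n m x \<sigma> h = 0" if "level h \<sigma> > m" for h \<sigma> using cone_level[of n m x \<sigma> h] that by auto
  have "dif (cone n m x) \<tau> g = (\<Sum>v\<in>V - \<tau>. eps v \<tau> *
      (if vdesc g v then eta g v * cone n m x (insert v \<tau>) (lower_base g v) else 0))"
    by (rule dif_top[OF cone_chains[OF assms(1)] assms(2)]) (use z assms(3) in auto)
  also have "\<dots> = 0"
  proof (rule sum.neutral, rule ballI)
    fix v assume v: "v \<in> V - \<tau>"
    show "eps v \<tau> * (if vdesc g v then eta g v * cone n m x (insert v \<tau>) (lower_base g v) else 0) = 0"
      using level_insert(3)[OF assms(2), of v \<tau>] z[of "lower_base g v" "insert v \<tau>"] assms(3) v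
        chainsD(1)[OF cone_chains[OF assms(1), of m], of "insert v \<tau>"]
      by (cases "clique (insert v \<tau>)") (auto simp: cliques_def)
  qed
  finally show ?thesis .
qed

text \<open>Subtracting the boundary of a cone removes the highest level of a cycle and creates
  nothing above it. A chain has finite support, so finitely many rounds lead to level 0, where only
  the vertex of the identity is left and the augmentation decides.\<close>

theorem chains_acyclic:
  assumes "x \<in> chains n" "\<And>\<tau> g. dif x \<tau> g = 0" "n = 0 \<Longrightarrow> aug x = 0"
  shows "\<exists>w\<in>chains (Suc n). dif w = x"
proof -
  have main: "\<exists>w\<in>chains (Suc n). dif w = x"
    if "x \<in> chains n" "\<And>\<tau> g. dif x \<tau> g = 0" "n = 0 \<Longrightarrow> aug x = 0"
      "\<And>h \<sigma>. h \<in> carrier G \<Longrightarrow> level h \<sigma> > m \<Longrightarrow> x \<sigma> h = 0" for m x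
    using that
  proof (induction m arbitrary: x)
    case 0
    have sup: "\<sigma> = {} \<and> h = \<one>\<^bsub>G\<^esub>" if "x \<sigma> h \<noteq> 0" for \<sigma> h
    proof -
      have h: "h \<in> carrier G" and s: "clique \<sigma>"
        using chainsD(1,2)[OF 0(1)] that by (auto simp: cliques_def)
      have "level h \<sigma> = 0" using 0(4)[OF h] that by (meson gr0I)
      hence "len h = 0" and c: "card {v \<in> \<sigma>. \<not> desc h (v, \<not> sg v)} = 0" by (auto simp: level_def)
      hence h1: "h = \<one>\<^bsub>G\<^esub>" using len_zero[OF h] by blast
      have "{v \<in> \<sigma>. \<not> desc h (v, \<not> sg v)} = \<sigma>" unfolding h1 using desc_one by auto
      thus ?thesis using c h1 clique_finite[OF s] by simp
    qed
    have "x \<sigma> h = 0" for \<sigma> h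
    proof (rule ccontr)
      assume nz: "x \<sigma> h \<noteq> 0"
      hence e: "\<sigma> = {}" "h = \<one>\<^bsub>G\<^esub>" using sup by auto
      have "{} \<in> cliques n" using chainsD(1)[OF 0(1)] nz e by auto
      hence n: "n = 0" by (simp add: cliques_def)
      have "aug x = (\<Sum>g\<in>{\<one>\<^bsub>G\<^esub>}. x {} g * 1)"
        unfolding aug_def by (rule pair_superset) (use sup in auto)
      thus False using 0(3)[OF n] nz e by simp
    qed
    hence "dif (\<lambda>_ _. 0) = x" by (auto simp: dif_def fun_eq_iff)
    thus ?case using chains_zero by blast
  next
    case (Suc m)
    let ?w = "cone n (Suc m) x"
    let ?y = "\<lambda>\<sigma> g. x \<sigma> g - dif ?w \<sigma> g"
    have w: "?w \<in> chains (Suc n)" by (rule cone_chains[OF Suc.prems(1)])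
    have dw: "dif ?w \<in> chains n" by (rule dif_chains[OF w])
    have y: "?y \<in> chains n" by (rule chains_diff[OF Suc.prems(1) dw])
    have "\<exists>w'\<in>chains (Suc n). dif w' = ?y"
    proof (rule Suc.IH[OF y])
      show "dif ?y \<tau> g = 0" for \<tau> g using Suc.prems(2) dif_dif[OF w] by (simp add: dif_diff)
      show "aug ?y = 0" if "n = 0"
        using Suc.prems(3)[OF that] aug_dif[OF w] pair_diff[OF chainsD(3)[OF Suc.prems(1)] chainsD(3)[OF dw]]
        by (simp add: aug_def)
    next
      fix h \<sigma> assume h: "h \<in> carrier G" and l: "level h \<sigma> > m"
      show "?y \<sigma> h = 0"
      proof (cases "\<sigma> \<in> cliques n")
        case False
        thus ?thesis using chainsD(1)[OF y] by blast
      next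
        case True
        show ?thesis
        proof (cases "level h \<sigma> = Suc m")
          case l': True
          \<comment> \<open>A cube of positive dimension spans its own directions; a single vertex
            of positive level is not the identity and hence has a last letter.\<close>
          have "span h \<sigma> \<noteq> {}"
          proof (cases "\<sigma> = {}")
            case True
            hence "h \<noteq> \<one>\<^bsub>G\<^esub>" using l' state_cls[of "[]"] by (auto simp: level_def len_def cls_Nil run_def words_def)
            then obtain v b where vb: "v \<in> V" "desc h (v, b)" using desc_nonempty[OF h] by force
            hence "vdesc h v" by (cases b; cases "sg v") (auto simp: vdesc_def)
            moreover have "clique {v}" using vb by (simp add: clique_def)
            ultimately have "v \<in> span h \<sigma>" using True vb by (simp add: span_def)
            thus ?thesis by blast
          qed (auto simp: span_def)
          thus ?thesis using dif_cone[OF Suc.prems(1,2,4) h True l'] by simp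
        next
          case False
          hence "level h \<sigma> > Suc m" using l by simp
          thus ?thesis using dif_cone_above[OF Suc.prems(1) h] Suc.prems(4)[OF h] by simp
        qed
      qed
    qed
    then obtain w' where w': "w' \<in> chains (Suc n)" "dif w' = ?y" by blast
    have "dif (\<lambda>\<sigma> g. w' \<sigma> g - (0 - ?w \<sigma> g)) \<tau> g = x \<tau> g" for \<tau> g
    proof -
      have "dif (\<lambda>\<sigma> g. 0 - ?w \<sigma> g) \<tau> g = - dif ?w \<tau> g"
        by (subst dif_diff) (simp add: dif_def)
      thus ?thesis by (subst dif_diff) (simp add: w'(2))
    qed
    moreover have "(\<lambda>\<sigma> g. w' \<sigma> g - (0 - ?w \<sigma> g)) \<in> chains (Suc n)"
      by (intro chains_diff w w' chains_zero)
    ultimately show ?case by (intro bexI[of _ "\<lambda>\<sigma> g. w' \<sigma> g - (0 - ?w \<sigma> g)"]) auto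
  qed
  define S where "S = (\<Union>\<sigma>\<in>cliques n. (\<lambda>g. level g \<sigma>) ` {g. x \<sigma> g \<noteq> 0})"
  have S: "finite S" unfolding S_def using finite_cliques chainsD(3)[OF assms(1)] by auto
  have "x \<sigma> h = 0" if "level h \<sigma> > Max (insert 0 S)" for h \<sigma>
  proof (rule ccontr)
    assume nz: "x \<sigma> h \<noteq> 0"
    hence "\<sigma> \<in> cliques n" using chainsD(1)[OF assms(1)] by blast
    hence "level h \<sigma> \<in> insert 0 S" using nz by (auto simp: S_def)
    thus False using that S Max_ge[of "insert 0 S" "level h \<sigma>"] by (meson finite_insert leD)
  qed
  thus ?thesis using main[OF assms, of "Max (insert 0 S)"] by blast
qed

end

section \<open>Modules and resolutions\<close>

lemma linear_mapsD:
  assumes "f \<in> linear_maps R M N"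
  shows "x \<in> carrier M \<Longrightarrow> f x \<in> carrier N"
    "x \<in> carrier M \<Longrightarrow> y \<in> carrier M \<Longrightarrow> f (x \<oplus>\<^bsub>M\<^esub> y) = f x \<oplus>\<^bsub>N\<^esub> f y"
    "a \<in> carrier R \<Longrightarrow> x \<in> carrier M \<Longrightarrow> f (a \<odot>\<^bsub>M\<^esub> x) = a \<odot>\<^bsub>N\<^esub> f x"
  using assms by (auto simp: linear_maps_def)

lemma linear_mapsI:
  assumes "\<And>x. x \<in> carrier M \<Longrightarrow> f x \<in> carrier N"
    "\<And>x y. x \<in> carrier M \<Longrightarrow> y \<in> carrier M \<Longrightarrow> f (x \<oplus>\<^bsub>M\<^esub> y) = f x \<oplus>\<^bsub>N\<^esub> f y"
    "\<And>a x. a \<in> carrier R \<Longrightarrow> x \<in> carrier M \<Longrightarrow> f (a \<odot>\<^bsub>M\<^esub> x) = a \<odot>\<^bsub>N\<^esub> f x"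
  shows "f \<in> linear_maps R M N"
  using assms by (auto simp: linear_maps_def)

lemma linear_maps_compose:
  "f \<in> linear_maps R M N \<Longrightarrow> g \<in> linear_maps R N K \<Longrightarrow> (\<lambda>x. g (f x)) \<in> linear_maps R M K"
  by (rule linear_mapsI) (auto simp: linear_mapsD)

lemma linear_map_zero:
  assumes "left_module R M" "left_module R N" "f \<in> linear_maps R M N"
  shows "f \<zero>\<^bsub>M\<^esub> = \<zero>\<^bsub>N\<^esub>"
proof -
  interpret M: left_module R M by fact
  interpret N: left_module R N by fact
  have "f \<zero>\<^bsub>M\<^esub> \<oplus>\<^bsub>N\<^esub> f \<zero>\<^bsub>M\<^esub> = f \<zero>\<^bsub>M\<^esub> \<oplus>\<^bsub>N\<^esub> \<zero>\<^bsub>N\<^esub>"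
    using linear_mapsD(1,2)[OF assms(3)] by (simp flip: linear_mapsD(2)[OF assms(3)])
  thus ?thesis using linear_mapsD(1)[OF assms(3)] by (simp del: N.r_zero)
qed

lemma linear_map_finsum:
  assumes "left_module R M" "left_module R N" "f \<in> linear_maps R M N" "finite A" "h \<in> A \<rightarrow> carrier M"
  shows "f (\<Oplus>\<^bsub>M\<^esub>a\<in>A. h a) = (\<Oplus>\<^bsub>N\<^esub>a\<in>A. f (h a))"
proof -
  interpret M: left_module R M by fact
  interpret N: left_module R N by fact
  show ?thesis using assms(4,5)
  proof (induction A rule: finite_induct)
    case empty
    show ?case using linear_map_zero[OF assms(1-3)] by simp
  next
    case (insert a A)
    have "h \<in> A \<rightarrow> carrier M" "h a \<in> carrier M" using insert.prems by auto
    moreover have "(\<lambda>a. f (h a)) \<in> A \<rightarrow> carrier N" "f (h a) \<in> carrier N"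
      using insert.prems linear_mapsD(1)[OF assms(3)] by auto
    ultimately show ?case using insert.hyps insert.IH
      by (simp add: M.finsum_insert N.finsum_insert linear_mapsD(2)[OF assms(3)])
  qed
qed

lemma (in left_module) smult_l_null: "x \<in> carrier M \<Longrightarrow> \<zero>\<^bsub>R\<^esub> \<odot>\<^bsub>M\<^esub> x = \<zero>\<^bsub>M\<^esub>"
proof -
  assume x: "x \<in> carrier M"
  have "\<zero>\<^bsub>R\<^esub> \<odot>\<^bsub>M\<^esub> x \<oplus>\<^bsub>M\<^esub> \<zero>\<^bsub>R\<^esub> \<odot>\<^bsub>M\<^esub> x = \<zero>\<^bsub>R\<^esub> \<odot>\<^bsub>M\<^esub> x \<oplus>\<^bsub>M\<^esub> \<zero>\<^bsub>M\<^esub>"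
    using x smult_l_distr[of "\<zero>\<^bsub>R\<^esub>" "\<zero>\<^bsub>R\<^esub>" x] smult_closed by simp
  thus ?thesis using x smult_closed by (simp del: M.r_zero)
qed

lemma (in left_module) smult_r_null: "a \<in> carrier R \<Longrightarrow> a \<odot>\<^bsub>M\<^esub> \<zero>\<^bsub>M\<^esub> = \<zero>\<^bsub>M\<^esub>"
proof -
  assume a: "a \<in> carrier R"
  have "a \<odot>\<^bsub>M\<^esub> \<zero>\<^bsub>M\<^esub> \<oplus>\<^bsub>M\<^esub> a \<odot>\<^bsub>M\<^esub> \<zero>\<^bsub>M\<^esub> = a \<odot>\<^bsub>M\<^esub> \<zero>\<^bsub>M\<^esub> \<oplus>\<^bsub>M\<^esub> \<zero>\<^bsub>M\<^esub>"
    using a smult_r_distr[of a "\<zero>\<^bsub>M\<^esub>" "\<zero>\<^bsub>M\<^esub>"] smult_closed by simp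
  thus ?thesis using a smult_closed by (simp del: M.r_zero)
qed

lemma (in left_module) smult_finsum:
  assumes "a \<in> carrier R" "finite A" "h \<in> A \<rightarrow> carrier M"
  shows "a \<odot>\<^bsub>M\<^esub> (\<Oplus>\<^bsub>M\<^esub>x\<in>A. h x) = (\<Oplus>\<^bsub>M\<^esub>x\<in>A. a \<odot>\<^bsub>M\<^esub> h x)"
  using assms(2,3)
proof (induction A rule: finite_induct)
  case empty
  show ?case using smult_r_null[OF assms(1)] by simp
next
  case (insert x A)
  have "h \<in> A \<rightarrow> carrier M" "h x \<in> carrier M" using insert.prems by auto
  moreover have "(\<lambda>x. a \<odot>\<^bsub>M\<^esub> h x) \<in> A \<rightarrow> carrier M" "a \<odot>\<^bsub>M\<^esub> h x \<in> carrier M"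
    using insert.prems smult_closed[OF assms(1)] by auto
  ultimately show ?case using insert.hyps insert.IH
    by (simp add: M.finsum_insert smult_r_distr[OF assms(1)])
qed

section \<open>Free modules and their universal property\<close>

lemma free_module_carrier:
  "f \<in> carrier (free_module R X) \<longleftrightarrow> (\<forall>x. f x \<in> carrier R) \<and> {x. f x \<noteq> \<zero>\<^bsub>R\<^esub>} \<subseteq> X \<and> finite {x. f x \<noteq> \<zero>\<^bsub>R\<^esub>}"
  by (simp add: free_module_def)

lemma free_module_memI:
  assumes "\<And>x. f x \<in> carrier R" "{x. f x \<noteq> \<zero>\<^bsub>R\<^esub>} \<subseteq> S" "S \<subseteq> X" "finite S"
  shows "f \<in> carrier (free_module R X)"
  using assms finite_subset unfolding free_module_carrier by blast

lemma free_module_simps: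
  "\<zero>\<^bsub>free_module R X\<^esub> = (\<lambda>x. \<zero>\<^bsub>R\<^esub>)" "f \<oplus>\<^bsub>free_module R X\<^esub> g = (\<lambda>x. f x \<oplus>\<^bsub>R\<^esub> g x)"
  "a \<odot>\<^bsub>free_module R X\<^esub> f = (\<lambda>x. a \<otimes>\<^bsub>R\<^esub> f x)"
  by (simp_all add: free_module_def)

lemma left_module_free_module:
  assumes "ring R" shows "left_module R (free_module R X)"
proof -
  interpret R: ring R by fact
  have mem: "f x \<in> carrier R" if "f \<in> carrier (free_module R X)" for f x
    using that by (simp add: free_module_carrier)
  have add: "f \<oplus>\<^bsub>free_module R X\<^esub> g \<in> carrier (free_module R X)"
    if "f \<in> carrier (free_module R X)" "g \<in> carrier (free_module R X)" for f g
    unfolding free_module_simps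
    by (rule free_module_memI[where S = "{x. f x \<noteq> \<zero>\<^bsub>R\<^esub>} \<union> {x. g x \<noteq> \<zero>\<^bsub>R\<^esub>}"])
      (use that in \<open>auto simp: free_module_carrier\<close>)
  have smult: "a \<odot>\<^bsub>free_module R X\<^esub> f \<in> carrier (free_module R X)"
    if "a \<in> carrier R" "f \<in> carrier (free_module R X)" for a f
    unfolding free_module_simps
    by (rule free_module_memI[where S = "{x. f x \<noteq> \<zero>\<^bsub>R\<^esub>}"])
      (use that in \<open>auto simp: free_module_carrier\<close>)
  have grp: "abelian_group (free_module R X)"
  proof (rule abelian_groupI)
    fix f assume f: "f \<in> carrier (free_module R X)"
    have "(\<lambda>x. \<ominus>\<^bsub>R\<^esub> f x) \<in> carrier (free_module R X)"
      by (rule free_module_memI[where S = "{x. f x \<noteq> \<zero>\<^bsub>R\<^esub>}"])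
        (use f in \<open>auto simp: free_module_carrier\<close>)
    thus "\<exists>g\<in>carrier (free_module R X). g \<oplus>\<^bsub>free_module R X\<^esub> f = \<zero>\<^bsub>free_module R X\<^esub>"
      by (intro bexI[of _ "\<lambda>x. \<ominus>\<^bsub>R\<^esub> f x"])
        (use f in \<open>auto simp: free_module_simps free_module_carrier R.l_neg\<close>)
  next
    show "\<zero>\<^bsub>free_module R X\<^esub> \<in> carrier (free_module R X)"
      unfolding free_module_simps by (rule free_module_memI[where S = "{}"]) auto
  next
    fix f g h assume "f \<in> carrier (free_module R X)" "g \<in> carrier (free_module R X)" "h \<in> carrier (free_module R X)"
    thus "f \<oplus>\<^bsub>free_module R X\<^esub> g \<oplus>\<^bsub>free_module R X\<^esub> h = f \<oplus>\<^bsub>free_module R X\<^esub> (g \<oplus>\<^bsub>free_module R X\<^esub> h)"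
      using mem by (simp add: free_module_simps R.a_assoc)
  next
    fix f g assume "f \<in> carrier (free_module R X)" "g \<in> carrier (free_module R X)"
    thus "f \<oplus>\<^bsub>free_module R X\<^esub> g = g \<oplus>\<^bsub>free_module R X\<^esub> f"
      using mem by (simp add: free_module_simps R.a_comm)
  next
    fix f assume "f \<in> carrier (free_module R X)"
    thus "\<zero>\<^bsub>free_module R X\<^esub> \<oplus>\<^bsub>free_module R X\<^esub> f = f"
      using mem by (simp add: free_module_simps)
  qed (rule add)
  interpret F: abelian_group "free_module R X" by fact
  show ?thesis
  proof (unfold_locales)
    fix a f assume "a \<in> carrier R" "f \<in> carrier (free_module R X)"
    thus "a \<odot>\<^bsub>free_module R X\<^esub> f \<in> carrier (free_module R X)" by (rule smult)
  qed (use mem in \<open>simp_all add: free_module_simps R.l_distr R.r_distr R.m_assoc\<close>)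
qed

definition unit_vec :: "('r, 'y) ring_scheme \<Rightarrow> 'b \<Rightarrow> 'b \<Rightarrow> 'r" where
  "unit_vec R x y = (if y = x then \<one>\<^bsub>R\<^esub> else \<zero>\<^bsub>R\<^esub>)"

lemma unit_vec_carrier: "ring R \<Longrightarrow> x \<in> X \<Longrightarrow> unit_vec R x \<in> carrier (free_module R X)"
proof -
  assume "ring R" "x \<in> X"
  then interpret R: ring R by simp
  show ?thesis
    by (rule free_module_memI[where S = "{x}"]) (use \<open>x \<in> X\<close> in \<open>auto simp: unit_vec_def\<close>)
qed

lemma free_module_restrict:
  assumes "ring R" "finite A" "A \<subseteq> X" "\<And>x. f x \<in> carrier R"
  shows "(\<Oplus>\<^bsub>free_module R X\<^esub>x\<in>A. f x \<odot>\<^bsub>free_module R X\<^esub> unit_vec R x) = (\<lambda>x. if x \<in> A then f x else \<zero>\<^bsub>R\<^esub>)"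
  using assms(2,3)
proof (induction A rule: finite_induct)
  case empty
  interpret F: left_module R "free_module R X" by (rule left_module_free_module[OF assms(1)])
  show ?case by (simp add: free_module_simps)
next
  case (insert a A)
  interpret F: left_module R "free_module R X" by (rule left_module_free_module[OF assms(1)])
  interpret R: ring R by fact
  have u: "f x \<odot>\<^bsub>free_module R X\<^esub> unit_vec R x \<in> carrier (free_module R X)" if "x \<in> insert a A" for x
    by (rule F.smult_closed[OF assms(4) unit_vec_carrier[OF assms(1)]]) (use that insert.prems in auto)
  have "(\<Oplus>\<^bsub>free_module R X\<^esub>x\<in>insert a A. f x \<odot>\<^bsub>free_module R X\<^esub> unit_vec R x) =
     f a \<odot>\<^bsub>free_module R X\<^esub> unit_vec R a \<oplus>\<^bsub>free_module R X\<^esub> (\<lambda>x. if x \<in> A then f x else \<zero>\<^bsub>R\<^esub>)"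
    using insert u by (subst F.finsum_insert) auto
  also have "\<dots> = (\<lambda>x. if x \<in> insert a A then f x else \<zero>\<^bsub>R\<^esub>)"
    using insert.hyps assms(4) by (auto simp: free_module_simps unit_vec_def)
  finally show ?case .
qed

lemma free_module_expand:
  assumes "ring R" "f \<in> carrier (free_module R X)"
  shows "f = (\<Oplus>\<^bsub>free_module R X\<^esub>x\<in>{x. f x \<noteq> \<zero>\<^bsub>R\<^esub>}. f x \<odot>\<^bsub>free_module R X\<^esub> unit_vec R x)"
  using assms(2) by (subst free_module_restrict[OF assms(1)]) (auto simp: free_module_carrier)

text \<open>The linear extension of \<open>m\<close> from the basis. The sum runs over the support
  of \<open>f\<close>, so infinite bases are allowed; free covers use them.\<close>

definition free_lift :: "('r, 'y) ring_scheme \<Rightarrow> ('r, 'n, 'w) module_scheme \<Rightarrow> ('b \<Rightarrow> 'n) \<Rightarrow> ('b \<Rightarrow> 'r) \<Rightarrow> 'n" where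
  "free_lift R N m f = (\<Oplus>\<^bsub>N\<^esub>x\<in>{x. f x \<noteq> \<zero>\<^bsub>R\<^esub>}. f x \<odot>\<^bsub>N\<^esub> m x)"

lemma free_lift_superset:
  assumes N: "left_module R N" and m: "m \<in> X \<rightarrow> carrier N" and f: "f \<in> carrier (free_module R X)"
    and A: "finite A" "{x. f x \<noteq> \<zero>\<^bsub>R\<^esub>} \<subseteq> A" "A \<subseteq> X"
  shows "free_lift R N m f = (\<Oplus>\<^bsub>N\<^esub>x\<in>A. f x \<odot>\<^bsub>N\<^esub> m x)"
proof -
  interpret N: left_module R N by fact
  show ?thesis unfolding free_lift_def
  proof (rule N.add.finprod_mono_neutral_cong_left[OF A(1,2)])
    show "\<And>i. i \<in> A - {x. f x \<noteq> \<zero>\<^bsub>R\<^esub>} \<Longrightarrow> f i \<odot>\<^bsub>N\<^esub> m i = \<zero>\<^bsub>N\<^esub>"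
      using N.smult_l_null m A by auto
    show "(\<lambda>x. f x \<odot>\<^bsub>N\<^esub> m x) \<in> A \<rightarrow> carrier N"
      by (intro funcsetI N.smult_closed) (use m A f in \<open>auto simp: free_module_carrier\<close>)
  qed simp
qed

lemma free_lift_linear:
  assumes N: "left_module R N" and m: "m \<in> X \<rightarrow> carrier N"
  shows "free_lift R N m \<in> linear_maps R (free_module R X) N"
proof -
  interpret N: left_module R N by fact
  interpret F: left_module R "free_module R X" by (rule left_module_free_module) unfold_locales
  have cl: "(\<lambda>x. f x \<odot>\<^bsub>N\<^esub> m x) \<in> A \<rightarrow> carrier N" if "f \<in> carrier (free_module R X)" "A \<subseteq> X" for f A
    by (intro funcsetI N.smult_closed) (use m that in \<open>auto simp: free_module_carrier\<close>)
  show ?thesis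
  proof (rule linear_mapsI)
    fix f assume f: "f \<in> carrier (free_module R X)"
    show "free_lift R N m f \<in> carrier N"
      unfolding free_lift_def by (rule N.finsum_closed, rule cl[OF f]) (use f in \<open>auto simp: free_module_carrier\<close>)
  next
    fix f g assume f: "f \<in> carrier (free_module R X)" and g: "g \<in> carrier (free_module R X)"
    let ?A = "{x. f x \<noteq> \<zero>\<^bsub>R\<^esub>} \<union> {x. g x \<noteq> \<zero>\<^bsub>R\<^esub>}"
    have A: "finite ?A" "?A \<subseteq> X" using f g by (auto simp: free_module_carrier)
    have fg: "f \<oplus>\<^bsub>free_module R X\<^esub> g \<in> carrier (free_module R X)" using f g by simp
    have sub: "{x. (f \<oplus>\<^bsub>free_module R X\<^esub> g) x \<noteq> \<zero>\<^bsub>R\<^esub>} \<subseteq> ?A" by (auto simp: free_module_simps)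
    have "free_lift R N m (f \<oplus>\<^bsub>free_module R X\<^esub> g) = (\<Oplus>\<^bsub>N\<^esub>x\<in>?A. (f \<oplus>\<^bsub>free_module R X\<^esub> g) x \<odot>\<^bsub>N\<^esub> m x)"
      by (rule free_lift_superset[OF N m fg A(1) sub A(2)])
    also have "\<dots> = (\<Oplus>\<^bsub>N\<^esub>x\<in>?A. f x \<odot>\<^bsub>N\<^esub> m x \<oplus>\<^bsub>N\<^esub> g x \<odot>\<^bsub>N\<^esub> m x)"
    proof (rule N.finsum_cong')
      fix x assume "x \<in> ?A"
      hence "x \<in> X" using A by auto
      thus "(f \<oplus>\<^bsub>free_module R X\<^esub> g) x \<odot>\<^bsub>N\<^esub> m x = f x \<odot>\<^bsub>N\<^esub> m x \<oplus>\<^bsub>N\<^esub> g x \<odot>\<^bsub>N\<^esub> m x"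
        using f g m by (auto simp: free_module_simps free_module_carrier intro!: N.smult_l_distr)
    qed (use cl[OF f A(2)] cl[OF g A(2)] in auto)
    also have "\<dots> = (\<Oplus>\<^bsub>N\<^esub>x\<in>?A. f x \<odot>\<^bsub>N\<^esub> m x) \<oplus>\<^bsub>N\<^esub> (\<Oplus>\<^bsub>N\<^esub>x\<in>?A. g x \<odot>\<^bsub>N\<^esub> m x)"
      by (rule N.finsum_addf[OF cl[OF f A(2)] cl[OF g A(2)]])
    also have "\<dots> = free_lift R N m f \<oplus>\<^bsub>N\<^esub> free_lift R N m g"
      using free_lift_superset[OF N m f A(1) _ A(2)] free_lift_superset[OF N m g A(1) _ A(2)] by simp
    finally show "free_lift R N m (f \<oplus>\<^bsub>free_module R X\<^esub> g) = free_lift R N m f \<oplus>\<^bsub>N\<^esub> free_lift R N m g" .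
  next
    fix a f assume a: "a \<in> carrier R" and f: "f \<in> carrier (free_module R X)"
    let ?A = "{x. f x \<noteq> \<zero>\<^bsub>R\<^esub>}"
    have A: "finite ?A" "?A \<subseteq> X" using f by (auto simp: free_module_carrier)
    have af: "a \<odot>\<^bsub>free_module R X\<^esub> f \<in> carrier (free_module R X)" by (rule F.smult_closed[OF a f])
    have sub: "{x. (a \<odot>\<^bsub>free_module R X\<^esub> f) x \<noteq> \<zero>\<^bsub>R\<^esub>} \<subseteq> ?A"
      using a by (auto simp: free_module_simps)
    have "free_lift R N m (a \<odot>\<^bsub>free_module R X\<^esub> f) = (\<Oplus>\<^bsub>N\<^esub>x\<in>?A. (a \<odot>\<^bsub>free_module R X\<^esub> f) x \<odot>\<^bsub>N\<^esub> m x)"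
      by (rule free_lift_superset[OF N m af A(1) sub A(2)])
    also have "\<dots> = (\<Oplus>\<^bsub>N\<^esub>x\<in>?A. a \<odot>\<^bsub>N\<^esub> (f x \<odot>\<^bsub>N\<^esub> m x))"
    proof (rule N.finsum_cong')
      fix x assume "x \<in> ?A"
      hence "x \<in> X" using A by auto
      thus "(a \<odot>\<^bsub>free_module R X\<^esub> f) x \<odot>\<^bsub>N\<^esub> m x = a \<odot>\<^bsub>N\<^esub> (f x \<odot>\<^bsub>N\<^esub> m x)"
        using f a m by (auto simp: free_module_simps free_module_carrier intro!: N.smult_assoc1)
    qed (use N.smult_closed[OF a] cl[OF f A(2)] in auto)
    also have "\<dots> = a \<odot>\<^bsub>N\<^esub> free_lift R N m f"
      unfolding free_lift_def by (rule N.smult_finsum[OF a A(1) cl[OF f A(2)], symmetric])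
    finally show "free_lift R N m (a \<odot>\<^bsub>free_module R X\<^esub> f) = a \<odot>\<^bsub>N\<^esub> free_lift R N m f" .
  qed
qed

lemma free_lift_unit_vec:
  assumes N: "left_module R N" and m: "m \<in> X \<rightarrow> carrier N" and x: "x \<in> X"
  shows "free_lift R N m (unit_vec R x) = m x"
proof -
  interpret N: left_module R N by fact
  have "free_lift R N m (unit_vec R x) = (\<Oplus>\<^bsub>N\<^esub>y\<in>{x}. unit_vec R x y \<odot>\<^bsub>N\<^esub> m y)"
    by (rule free_lift_superset[OF N m unit_vec_carrier]) (use x in \<open>auto simp: unit_vec_def intro: N.R.ring_axioms\<close>)
  also have "\<dots> = m x"
  proof -
    have mx: "m x \<in> carrier N" using m x by auto
    show ?thesis using mx N.smult_one[OF mx] by (simp add: unit_vec_def)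
  qed
  finally show ?thesis .
qed

lemma linear_map_free_eq:
  assumes N: "left_module R N" and g: "g \<in> linear_maps R (free_module R X) N"
    and f: "f \<in> carrier (free_module R X)"
  shows "g f = free_lift R N (\<lambda>x. g (unit_vec R x)) f"
proof -
  interpret N: left_module R N by fact
  have R: "ring R" by unfold_locales
  interpret F: left_module R "free_module R X" by (rule left_module_free_module[OF R])
  let ?A = "{x. f x \<noteq> \<zero>\<^bsub>R\<^esub>}"
  have A: "finite ?A" "?A \<subseteq> X" "\<And>x. f x \<in> carrier R" using f by (auto simp: free_module_carrier)
  have u: "unit_vec R x \<in> carrier (free_module R X)" if "x \<in> ?A" for x
    by (rule unit_vec_carrier[OF R]) (use A that in auto)
  have c: "(\<lambda>x. f x \<odot>\<^bsub>free_module R X\<^esub> unit_vec R x) \<in> ?A \<rightarrow> carrier (free_module R X)"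
    using F.smult_closed[OF A(3) u] by auto
  have "g f = (\<Oplus>\<^bsub>N\<^esub>x\<in>?A. g (f x \<odot>\<^bsub>free_module R X\<^esub> unit_vec R x))"
    unfolding linear_map_finsum[OF F.left_module_axioms N g A(1) c, symmetric]
    by (rule arg_cong[OF free_module_expand[OF R f]])
  also have "\<dots> = (\<Oplus>\<^bsub>N\<^esub>x\<in>?A. f x \<odot>\<^bsub>N\<^esub> g (unit_vec R x))"
    by (rule N.finsum_cong') (use linear_mapsD[OF g] u A N.smult_closed in auto)
  finally show ?thesis by (simp add: free_lift_def)
qed

section \<open>Lifting and comparison of resolutions\<close>

text \<open>Lift the values on a basis, extend linearly and restrict along \<open>\<iota>\<close>.
  The retraction is an explicit datum with a basis of any type, because the lemma is also applied to
  modules of chains, whose natural basis, the cliques, does not live in the type of their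
  elements.\<close>

lemma retract_lift:
  fixes P :: "('r, 'p, 'z) module_scheme" and X :: "'b set"
  assumes P: "left_module R P" and M: "left_module R M" and N: "left_module R N"
    and i: "\<iota> \<in> linear_maps R P (free_module R X)" and p: "\<pi> \<in> linear_maps R (free_module R X) P"
    and pi: "\<And>x. x \<in> carrier P \<Longrightarrow> \<pi> (\<iota> x) = x"
    and u: "u \<in> linear_maps R P N" and d: "d \<in> linear_maps R M N"
    and im: "\<And>x. x \<in> carrier P \<Longrightarrow> u x \<in> d ` carrier M"
  shows "\<exists>w\<in>linear_maps R P M. \<forall>x\<in>carrier P. d (w x) = u x"
proof -
  interpret P: left_module R P by fact
  have R: "ring R" by unfold_locales
  have "\<forall>x\<in>X. \<exists>m\<in>carrier M. d m = u (\<pi> (unit_vec R x))"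
    using im linear_mapsD(1)[OF p] unit_vec_carrier[OF R] by force
  then obtain m where m: "\<And>x. x \<in> X \<Longrightarrow> m x \<in> carrier M" "\<And>x. x \<in> X \<Longrightarrow> d (m x) = u (\<pi> (unit_vec R x))"
    by metis
  have mX: "m \<in> X \<rightarrow> carrier M" using m(1) by auto
  let ?w = "free_lift R M m"
  have w: "?w \<in> linear_maps R (free_module R X) M" by (rule free_lift_linear[OF M mX])
  have dw: "d (?w f) = u (\<pi> f)" if f: "f \<in> carrier (free_module R X)" for f
  proof -
    have "d (?w f) = free_lift R N (\<lambda>x. d (?w (unit_vec R x))) f"
      by (rule linear_map_free_eq[OF N linear_maps_compose[OF w d] f])
    also have "\<dots> = free_lift R N (\<lambda>x. u (\<pi> (unit_vec R x))) f"
    proof -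
      interpret N: left_module R N by fact
      show ?thesis unfolding free_lift_def[of R N]
      proof (rule N.finsum_cong')
        fix x assume "x \<in> {x. f x \<noteq> \<zero>\<^bsub>R\<^esub>}"
        hence "x \<in> X" using f by (auto simp: free_module_carrier)
        thus "f x \<odot>\<^bsub>N\<^esub> d (?w (unit_vec R x)) = f x \<odot>\<^bsub>N\<^esub> u (\<pi> (unit_vec R x))"
          using free_lift_unit_vec[OF M mX] m(2) by simp
      next
        show "(\<lambda>x. f x \<odot>\<^bsub>N\<^esub> u (\<pi> (unit_vec R x))) \<in> {x. f x \<noteq> \<zero>\<^bsub>R\<^esub>} \<rightarrow> carrier N"
          by (intro funcsetI N.smult_closed linear_mapsD(1)[OF linear_maps_compose[OF p u]] unit_vec_carrier[OF R])
            (use f in \<open>auto simp: free_module_carrier\<close>)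
      qed simp
    qed
    also have "\<dots> = u (\<pi> f)" by (rule linear_map_free_eq[OF N linear_maps_compose[OF p u] f, symmetric])
    finally show ?thesis .
  qed
  show ?thesis
  proof (intro bexI ballI)
    show "(\<lambda>x. ?w (\<iota> x)) \<in> linear_maps R P M" by (rule linear_maps_compose[OF i w])
    show "d (?w (\<iota> x)) = u x" if "x \<in> carrier P" for x
      using dw[OF linear_mapsD(1)[OF i that]] pi[OF that] by simp
  qed
qed

lemma projective_retract:
  fixes P :: "('r, 'p, 'z) module_scheme"
  assumes "projective_module R P"
  shows "\<exists>(X :: 'p set) \<iota> \<pi>. \<iota> \<in> linear_maps R P (free_module R X) \<and>
       \<pi> \<in> linear_maps R (free_module R X) P \<and> (\<forall>x\<in>carrier P. \<pi> (\<iota> x) = x)"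
  using assms unfolding projective_module_def by blast

text \<open>\<open>good\<close> records just what the next degree requires: compatibility with the
  augmentations in degree 0, and above it that cycles are mapped to cycles.\<close>

lemma comparison:
  fixes A :: "nat \<Rightarrow> ('r, 'a, 'z) module_scheme" and B :: "nat \<Rightarrow> ('r, 'b, 'w) module_scheme"
  assumes A: "\<And>n. left_module R (A n)" and B: "\<And>n. left_module R (B n)" and M: "left_module R M"
    and retract: "\<And>n. \<exists>(X :: 'c set) \<iota> \<pi>. \<iota> \<in> linear_maps R (A n) (free_module R X) \<and>
       \<pi> \<in> linear_maps R (free_module R X) (A n) \<and> (\<forall>x\<in>carrier (A n). \<pi> (\<iota> x) = x)"
    and eA: "eA \<in> linear_maps R (A 0) M" and eB: "eB \<in> linear_maps R (B 0) M"
    and dA: "\<And>n. dA n \<in> linear_maps R (A (Suc n)) (A n)" and dB: "\<And>n. dB n \<in> linear_maps R (B (Suc n)) (B n)"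
    and surj: "\<And>x. x \<in> carrier (A 0) \<Longrightarrow> eA x \<in> eB ` carrier (B 0)"
    and A0: "\<And>x. x \<in> carrier (A 1) \<Longrightarrow> eA (dA 0 x) = \<zero>\<^bsub>M\<^esub>"
    and AA: "\<And>n x. x \<in> carrier (A (Suc (Suc n))) \<Longrightarrow> dA n (dA (Suc n) x) = \<zero>\<^bsub>A n\<^esub>"
    and B0: "\<And>x. x \<in> carrier (B 0) \<Longrightarrow> eB x = \<zero>\<^bsub>M\<^esub> \<Longrightarrow> x \<in> dB 0 ` carrier (B 1)"
    and BB: "\<And>n x. x \<in> carrier (B (Suc n)) \<Longrightarrow> dB n x = \<zero>\<^bsub>B n\<^esub> \<Longrightarrow> x \<in> dB (Suc n) ` carrier (B (Suc (Suc n)))"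
  shows "\<exists>f. (\<forall>n. f n \<in> linear_maps R (A n) (B n)) \<and> (\<forall>x\<in>carrier (A 0). eB (f 0 x) = eA x) \<and>
     (\<forall>n. \<forall>x\<in>carrier (A (Suc n)). dB n (f (Suc n) x) = f n (dA n x))"
proof -
  define good where "good n f \<longleftrightarrow> f \<in> linear_maps R (A n) (B n) \<and>
    (case n of 0 \<Rightarrow> \<forall>x\<in>carrier (A 0). eB (f x) = eA x
       | Suc m \<Rightarrow> \<forall>x\<in>carrier (A n). dA m x = \<zero>\<^bsub>A m\<^esub> \<longrightarrow> dB m (f x) = \<zero>\<^bsub>B m\<^esub>)" for n f
  have "\<exists>f. \<forall>n. good n (f n) \<and> (\<forall>x\<in>carrier (A (Suc n)). dB n (f (Suc n) x) = f n (dA n x))"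
  proof (rule dependent_nat_choice)
    show "\<exists>f. good 0 f"
    proof -
      obtain X :: "'c set" and \<iota> \<pi> where r: "\<iota> \<in> linear_maps R (A 0) (free_module R X)"
        "\<pi> \<in> linear_maps R (free_module R X) (A 0)" "\<And>x. x \<in> carrier (A 0) \<Longrightarrow> \<pi> (\<iota> x) = x"
        using retract[of 0] by blast
      show ?thesis using retract_lift[OF A B M r eA eB surj] by (auto simp: good_def)
    qed
  next
    fix f n assume "good n f"
    hence f: "f \<in> linear_maps R (A n) (B n)" and f0: "n = 0 \<Longrightarrow> x \<in> carrier (A 0) \<Longrightarrow> eB (f x) = eA x"
      and fS: "n = Suc m \<Longrightarrow> x \<in> carrier (A n) \<Longrightarrow> dA m x = \<zero>\<^bsub>A m\<^esub> \<Longrightarrow> dB m (f x) = \<zero>\<^bsub>B m\<^esub>" for x m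
      by (auto simp: good_def)
    have im: "f (dA n x) \<in> dB n ` carrier (B (Suc n))" if x: "x \<in> carrier (A (Suc n))" for x
    proof (cases n)
      case 0
      have "dA 0 x \<in> carrier (A 0)" using linear_mapsD(1)[OF dA[of 0]] x 0 by simp
      thus ?thesis using B0[of "f (dA 0 x)"] f0[OF 0] A0[of x] x 0 linear_mapsD(1)[OF f] by simp
    next
      case (Suc m)
      have y: "dA n x \<in> carrier (A n)" by (rule linear_mapsD(1)[OF dA x])
      have "dB m (f (dA n x)) = \<zero>\<^bsub>B m\<^esub>" by (rule fS[OF Suc y]) (use AA[of x m] x Suc in simp)
      thus ?thesis using BB[of "f (dA n x)" m] linear_mapsD(1)[OF f y] Suc by simp
    qed
    obtain X :: "'c set" and \<iota> \<pi> where r: "\<iota> \<in> linear_maps R (A (Suc n)) (free_module R X)"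
      "\<pi> \<in> linear_maps R (free_module R X) (A (Suc n))" "\<And>x. x \<in> carrier (A (Suc n)) \<Longrightarrow> \<pi> (\<iota> x) = x"
      using retract[of "Suc n"] by blast
    obtain w where w: "w \<in> linear_maps R (A (Suc n)) (B (Suc n))" "\<forall>x\<in>carrier (A (Suc n)). dB n (w x) = f (dA n x)"
      using retract_lift[OF A B B r linear_maps_compose[OF dA f] dB im] by blast
    moreover have "good (Suc n) w" using w linear_map_zero[OF A B f] by (auto simp: good_def)
    ultimately show "\<exists>w. good (Suc n) w \<and> (\<forall>x\<in>carrier (A (Suc n)). dB n (w x) = f (dA n x))" by blast
  qed
  then obtain f where f: "\<And>n. good n (f n)"
    and fd: "\<And>n x. x \<in> carrier (A (Suc n)) \<Longrightarrow> dB n (f (Suc n) x) = f n (dA n x)"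
    by blast
  have "f n \<in> linear_maps R (A n) (B n)" for n using f[of n] by (simp add: good_def)
  moreover have "\<forall>x\<in>carrier (A 0). eB (f 0 x) = eA x" using f[of 0] by (simp add: good_def)
  ultimately show ?thesis using fd by blast
qed

lemma left_module_submodule:
  assumes P: "left_module R P" and sub: "A \<subseteq> carrier P" and z: "\<zero>\<^bsub>P\<^esub> \<in> A"
    and add: "\<And>x y. x \<in> A \<Longrightarrow> y \<in> A \<Longrightarrow> x \<oplus>\<^bsub>P\<^esub> y \<in> A"
    and neg: "\<And>x. x \<in> A \<Longrightarrow> \<exists>y\<in>A. y \<oplus>\<^bsub>P\<^esub> x = \<zero>\<^bsub>P\<^esub>"
    and smult: "\<And>a x. a \<in> carrier R \<Longrightarrow> x \<in> A \<Longrightarrow> a \<odot>\<^bsub>P\<^esub> x \<in> A"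
  shows "left_module R (P\<lparr>carrier := A\<rparr>)"
proof -
  interpret P: left_module R P by fact
  have c: "x \<in> A \<Longrightarrow> x \<in> carrier P" for x using sub by auto
  interpret K: abelian_group "P\<lparr>carrier := A\<rparr>"
    by (rule abelian_groupI) (use z add neg in \<open>auto simp: P.a_ac c\<close>)
  show ?thesis
    by unfold_locales (use smult in \<open>auto simp: c P.smult_l_distr P.smult_r_distr P.smult_assoc1 P.smult_one\<close>)
qed

section \<open>Moving modules between types\<close>

text \<open>\<open>type_FP\<close> asks for modules in one fixed type, so the modules of chains have
  to be recoded there along an injection \<phi>.\<close>

definition transport :: "('m \<Rightarrow> 'n) \<Rightarrow> ('r, 'm) module \<Rightarrow> ('r, 'n) module" where
  "transport \<phi> M = \<lparr>carrier = \<phi> ` carrier M, mult = undefined, one = undefined, zero = \<phi> \<zero>\<^bsub>M\<^esub>,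
     add = (\<lambda>x y. \<phi> (inv_into (carrier M) \<phi> x \<oplus>\<^bsub>M\<^esub> inv_into (carrier M) \<phi> y)),
     module.smult = (\<lambda>a x. \<phi> (a \<odot>\<^bsub>M\<^esub> inv_into (carrier M) \<phi> x))\<rparr>"

lemma transport_simps:
  assumes "inj_on \<phi> (carrier M)"
  shows "carrier (transport \<phi> M) = \<phi> ` carrier M" "\<zero>\<^bsub>transport \<phi> M\<^esub> = \<phi> \<zero>\<^bsub>M\<^esub>"
    "x \<in> carrier M \<Longrightarrow> y \<in> carrier M \<Longrightarrow> \<phi> x \<oplus>\<^bsub>transport \<phi> M\<^esub> \<phi> y = \<phi> (x \<oplus>\<^bsub>M\<^esub> y)"
    "x \<in> carrier M \<Longrightarrow> a \<odot>\<^bsub>transport \<phi> M\<^esub> \<phi> x = \<phi> (a \<odot>\<^bsub>M\<^esub> x)"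
  using assms by (simp_all add: transport_def)

lemma left_module_transport:
  assumes M: "left_module R M" and inj: "inj_on \<phi> (carrier M)"
  shows "left_module R (transport \<phi> M)"
proof -
  interpret M: left_module R M by fact
  note simps = transport_simps[OF inj]
  interpret T: abelian_group "transport \<phi> M"
  proof (rule abelian_groupI)
    fix x assume "x \<in> carrier (transport \<phi> M)"
    then obtain y where y: "y \<in> carrier M" "x = \<phi> y" by (auto simp: simps)
    show "\<exists>y\<in>carrier (transport \<phi> M). y \<oplus>\<^bsub>transport \<phi> M\<^esub> x = \<zero>\<^bsub>transport \<phi> M\<^esub>"
      by (rule bexI[of _ "\<phi> (\<ominus>\<^bsub>M\<^esub> y)"]) (use y in \<open>simp_all add: simps M.l_neg\<close>)
  qed (auto simp: simps M.a_ac)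
  show ?thesis
    by unfold_locales
      (auto simp: simps M.smult_closed M.smult_l_distr M.smult_r_distr M.smult_assoc1 M.smult_one)
qed

lemma transport_linear:
  assumes M: "left_module R M" and inj: "inj_on \<phi> (carrier M)"
  shows "\<phi> \<in> linear_maps R M (transport \<phi> M)"
    "inv_into (carrier M) \<phi> \<in> linear_maps R (transport \<phi> M) M"
proof -
  interpret M: left_module R M by fact
  note simps = transport_simps[OF inj]
  show "\<phi> \<in> linear_maps R M (transport \<phi> M)" by (rule linear_mapsI) (auto simp: simps)
  show "inv_into (carrier M) \<phi> \<in> linear_maps R (transport \<phi> M) M"
    by (rule linear_mapsI) (use inj in \<open>auto simp: simps M.smult_closed inv_into_f_f\<close>)
qed

lemma free_lift_compose_eq:
  assumes R: "ring R" and N: "left_module R N"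
    and g: "g \<in> linear_maps R (free_module R X) (free_module R X)"
    and u: "\<And>x. x \<in> X \<Longrightarrow> g (unit_vec R x) = unit_vec R x" and f: "f \<in> carrier (free_module R X)"
  shows "g f = f"
proof -
  interpret F: left_module R "free_module R X" by (rule left_module_free_module[OF R])
  have "g f = free_lift R (free_module R X) (\<lambda>x. g (unit_vec R x)) f"
    by (rule linear_map_free_eq[OF F.left_module_axioms g f])
  also have "\<dots> = (\<Oplus>\<^bsub>free_module R X\<^esub>x\<in>{x. f x \<noteq> \<zero>\<^bsub>R\<^esub>}. f x \<odot>\<^bsub>free_module R X\<^esub> unit_vec R x)"
    unfolding free_lift_def
  proof (rule F.finsum_cong')
    fix x assume "x \<in> {x. f x \<noteq> \<zero>\<^bsub>R\<^esub>}"
    thus "f x \<odot>\<^bsub>free_module R X\<^esub> g (unit_vec R x) = f x \<odot>\<^bsub>free_module R X\<^esub> unit_vec R x"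
      using u f by (auto simp: free_module_carrier)
  next
    show "(\<lambda>x. f x \<odot>\<^bsub>free_module R X\<^esub> unit_vec R x) \<in> {x. f x \<noteq> \<zero>\<^bsub>R\<^esub>} \<rightarrow> carrier (free_module R X)"
      by (intro funcsetI F.smult_closed unit_vec_carrier[OF R]) (use f in \<open>auto simp: free_module_carrier\<close>)
  qed simp
  also have "\<dots> = f" by (rule free_module_expand[OF R f, symmetric])
  finally show ?thesis .
qed

text \<open>Two injections occur: \<phi> recodes the elements, and \<kappa> relocates the basis,
  which \<open>projective_module\<close> wants inside the type of the module.\<close>

lemma projective_transport_free:
  fixes \<phi> :: "('b \<Rightarrow> 'r) \<Rightarrow> 'n" and \<kappa> :: "'b \<Rightarrow> 'n"
  assumes R: "ring R" and phi: "inj_on \<phi> (carrier (free_module R X))" and k: "inj_on \<kappa> X"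
  shows "projective_module R (transport \<phi> (free_module R X))"
proof -
  let ?F = "free_module R X" and ?F' = "free_module R (\<kappa> ` X)"
  have F: "left_module R ?F" and F': "left_module R ?F'" by (rule left_module_free_module[OF R])+
  define e where "e = free_lift R ?F' (\<lambda>x. unit_vec R (\<kappa> x))"
  define e' where "e' = free_lift R ?F (\<lambda>y. unit_vec R (inv_into X \<kappa> y))"
  have 1: "(\<lambda>x. unit_vec R (\<kappa> x)) \<in> X \<rightarrow> carrier ?F'"
    by (intro funcsetI unit_vec_carrier[OF R] imageI)
  have 2: "(\<lambda>y. unit_vec R (inv_into X \<kappa> y)) \<in> \<kappa> ` X \<rightarrow> carrier ?F"
    by (intro funcsetI unit_vec_carrier[OF R] inv_into_into)
  have e: "e \<in> linear_maps R ?F ?F'" unfolding e_def by (rule free_lift_linear[OF F' 1])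
  have e': "e' \<in> linear_maps R ?F' ?F" unfolding e'_def by (rule free_lift_linear[OF F 2])
  have "e' (e (unit_vec R x)) = unit_vec R x" if "x \<in> X" for x
    using that k by (simp add: e_def e'_def free_lift_unit_vec[OF F' 1] free_lift_unit_vec[OF F 2])
  hence ee: "e' (e f) = f" if "f \<in> carrier ?F" for f
    by (rule free_lift_compose_eq[OF R F linear_maps_compose[OF e e'] _ that])
  show ?thesis unfolding projective_module_def
  proof (intro conjI exI ballI)
    show "left_module R (transport \<phi> ?F)" by (rule left_module_transport[OF F phi])
    show "(\<lambda>x. e (inv_into (carrier ?F) \<phi> x)) \<in> linear_maps R (transport \<phi> ?F) ?F'"
      by (rule linear_maps_compose[OF transport_linear(2)[OF F phi] e])
    show "(\<lambda>x. \<phi> (e' x)) \<in> linear_maps R ?F' (transport \<phi> ?F)"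
      by (rule linear_maps_compose[OF e' transport_linear(1)[OF F phi]])
    show "\<phi> (e' (e (inv_into (carrier ?F) \<phi> x))) = x" if "x \<in> carrier (transport \<phi> ?F)" for x
      using that phi ee by (auto simp: transport_simps[OF phi])
  qed
qed

lemma finitely_generated_transport_free:
  assumes R: "ring R" and nz: "\<one>\<^bsub>R\<^esub> \<noteq> \<zero>\<^bsub>R\<^esub>" and phi: "inj_on \<phi> (carrier (free_module R X))" and X: "finite X"
  shows "finitely_generated_module R (transport \<phi> (free_module R X))"
proof -
  let ?F = "free_module R X" and ?T = "transport \<phi> (free_module R X)"
  have F: "left_module R ?F" by (rule left_module_free_module[OF R])
  interpret F: left_module R ?F by (rule F)
  interpret T: left_module R ?T by (rule left_module_transport[OF F phi])
  define b where "b x = \<phi> (unit_vec R x)" for x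
  have u: "unit_vec R x \<in> carrier ?F" if "x \<in> X" for x by (rule unit_vec_carrier[OF R that])
  have bT: "b x \<in> carrier ?T" if "x \<in> X" for x using u[OF that] by (simp add: b_def transport_simps[OF phi])
  \<comment> \<open>The final reindexing from \<open>X\<close> to its image requires distinct basis
    elements to stay distinct; this is where the ring must be nonzero.\<close>
  have inj: "inj_on b X"
  proof (rule inj_onI)
    fix x y assume xy: "x \<in> X" "y \<in> X" "b x = b y"
    hence "unit_vec R x = unit_vec R y" using phi u unfolding b_def by (auto dest: inj_onD)
    hence "unit_vec R x x = unit_vec R y x" by simp
    thus "x = y" using nz by (auto simp: unit_vec_def split: if_splits)
  qed
  show ?thesis unfolding finitely_generated_module_def
  proof (intro exI[of _ "b ` X"] conjI ballI)
    fix y assume "y \<in> carrier ?T"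
    then obtain f where f: "f \<in> carrier ?F" "y = \<phi> f" by (auto simp: transport_simps[OF phi])
    have fR: "f x \<in> carrier R" for x using f(1) by (simp add: free_module_carrier)
    define c where "c z = f (inv_into X b z)" for z
    have c: "c (b x) = f x" if "x \<in> X" for x using that inj by (simp add: c_def)
    have "f = (\<Oplus>\<^bsub>?F\<^esub>x\<in>X. f x \<odot>\<^bsub>?F\<^esub> unit_vec R x)"
      using f(1) by (subst free_module_restrict[OF R X]) (auto simp: free_module_carrier fun_eq_iff)
    hence "y = \<phi> (\<Oplus>\<^bsub>?F\<^esub>x\<in>X. f x \<odot>\<^bsub>?F\<^esub> unit_vec R x)" using f(2) by simp
    also have "\<dots> = (\<Oplus>\<^bsub>?T\<^esub>x\<in>X. \<phi> (f x \<odot>\<^bsub>?F\<^esub> unit_vec R x))"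
      by (rule linear_map_finsum[OF F T.left_module_axioms transport_linear(1)[OF F phi] X])
        (use F.smult_closed[OF fR u] in auto)
    also have "\<dots> = (\<Oplus>\<^bsub>?T\<^esub>x\<in>X. c (b x) \<odot>\<^bsub>?T\<^esub> b x)"
      by (rule T.finsum_cong')
        (use T.smult_closed[OF fR bT] u c in \<open>auto simp: b_def transport_simps[OF phi]\<close>)
    also have "\<dots> = (\<Oplus>\<^bsub>?T\<^esub>z\<in>b ` X. c z \<odot>\<^bsub>?T\<^esub> z)"
      by (rule T.finsum_reindex[symmetric]) (use inj T.smult_closed[OF fR bT] c in auto)
    finally show "\<exists>c\<in>b ` X \<rightarrow> carrier R. y = (\<Oplus>\<^bsub>?T\<^esub>z\<in>b ` X. c z \<odot>\<^bsub>?T\<^esub> z)"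
      using c fR by (intro bexI[of _ c]) auto
  qed (use X bT in auto)
qed

definition kernel_module :: "('r, 'p) module \<Rightarrow> ('p \<Rightarrow> 'n) \<Rightarrow> 'n \<Rightarrow> ('r, 'p) module" where
  "kernel_module P f z = P\<lparr>carrier := {x \<in> carrier P. f x = z}\<rparr>"

lemma kernel_module_simps:
  "carrier (kernel_module P f z) = {x \<in> carrier P. f x = z}"
  "\<zero>\<^bsub>kernel_module P f z\<^esub> = \<zero>\<^bsub>P\<^esub>" "x \<oplus>\<^bsub>kernel_module P f z\<^esub> y = x \<oplus>\<^bsub>P\<^esub> y"
  "a \<odot>\<^bsub>kernel_module P f z\<^esub> x = a \<odot>\<^bsub>P\<^esub> x"
  by (simp_all add: kernel_module_def)

lemma left_module_kernel:
  assumes P: "left_module R P" and N: "left_module R N" and f: "f \<in> linear_maps R P N"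
  shows "left_module R (kernel_module P f \<zero>\<^bsub>N\<^esub>)"
proof -
  interpret P: left_module R P by fact
  interpret N: left_module R N by fact
  note simps = kernel_module_simps linear_mapsD[OF f]
  have f0: "f \<zero>\<^bsub>P\<^esub> = \<zero>\<^bsub>N\<^esub>" by (rule linear_map_zero[OF P N f])
  interpret K: abelian_group "kernel_module P f \<zero>\<^bsub>N\<^esub>"
  proof (rule abelian_groupI)
    fix x assume x: "x \<in> carrier (kernel_module P f \<zero>\<^bsub>N\<^esub>)"
    hence xP: "x \<in> carrier P" "f x = \<zero>\<^bsub>N\<^esub>" by (auto simp: simps)
    have "f (\<ominus>\<^bsub>P\<^esub> x) \<oplus>\<^bsub>N\<^esub> f x = \<zero>\<^bsub>N\<^esub>"
      using linear_mapsD(2)[OF f, of "\<ominus>\<^bsub>P\<^esub> x" x] xP(1) f0 by (simp add: P.l_neg)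
    hence "f (\<ominus>\<^bsub>P\<^esub> x) = \<zero>\<^bsub>N\<^esub>" using xP linear_mapsD(1)[OF f, of "\<ominus>\<^bsub>P\<^esub> x"] by simp
    thus "\<exists>y\<in>carrier (kernel_module P f \<zero>\<^bsub>N\<^esub>). y \<oplus>\<^bsub>kernel_module P f \<zero>\<^bsub>N\<^esub>\<^esub> x = \<zero>\<^bsub>kernel_module P f \<zero>\<^bsub>N\<^esub>\<^esub>"
      using xP by (intro bexI[of _ "\<ominus>\<^bsub>P\<^esub> x"]) (auto simp: kernel_module_simps P.l_neg)
  qed (auto simp: simps P.a_ac f0)
  show ?thesis
  proof (unfold_locales)
    fix a x assume "a \<in> carrier R" "x \<in> carrier (kernel_module P f \<zero>\<^bsub>N\<^esub>)"
    thus "a \<odot>\<^bsub>kernel_module P f \<zero>\<^bsub>N\<^esub>\<^esub> x \<in> carrier (kernel_module P f \<zero>\<^bsub>N\<^esub>)"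
      by (simp add: simps P.smult_closed N.smult_r_null)
  qed (simp_all add: simps P.smult_l_distr P.smult_r_distr P.smult_assoc1 P.smult_one)
qed

section \<open>Continuing a partial resolution\<close>

text \<open>The free module on all elements of \<open>N\<close>, coded in the type of
  \<open>N\<close> itself, so that covers can be iterated without leaving the type.\<close>

definition cover :: "('r, 'y) ring_scheme \<Rightarrow> (('n \<Rightarrow> 'r) \<Rightarrow> 'n) \<Rightarrow> ('r, 'n) module \<Rightarrow> ('r, 'n) module" where
  "cover R \<phi> N = transport \<phi> (free_module R (carrier N))"

definition cover_map :: "('r, 'y) ring_scheme \<Rightarrow> (('n \<Rightarrow> 'r) \<Rightarrow> 'n) \<Rightarrow> ('r, 'n) module \<Rightarrow> 'n \<Rightarrow> 'n" where
  "cover_map R \<phi> N x = free_lift R N (\<lambda>y. y) (inv_into (carrier (free_module R (carrier N))) \<phi> x)"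

lemma cover:
  assumes N: "left_module R N" and phi: "inj_on \<phi> (carrier (free_module R UNIV))"
  shows "projective_module R (cover R \<phi> N)" "cover_map R \<phi> N \<in> linear_maps R (cover R \<phi> N) N"
    "cover_map R \<phi> N ` carrier (cover R \<phi> N) = carrier N" "left_module R (cover R \<phi> N)"
proof -
  interpret N: left_module R N by fact
  have R: "ring R" by unfold_locales
  let ?F = "free_module R (carrier N)"
  have F: "left_module R ?F" by (rule left_module_free_module[OF R])
  have phi': "inj_on \<phi> (carrier ?F)"
    by (rule inj_on_subset[OF phi]) (auto simp: free_module_carrier)
  show P: "projective_module R (cover R \<phi> N)"
    unfolding cover_def by (rule projective_transport_free[OF R phi', of "\<lambda>x. x"]) simp
  show "left_module R (cover R \<phi> N)" using P by (simp add: projective_module_def)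
  have L: "free_lift R N (\<lambda>y. y) \<in> linear_maps R ?F N" by (rule free_lift_linear[OF N]) simp
  show cm: "cover_map R \<phi> N \<in> linear_maps R (cover R \<phi> N) N"
    unfolding cover_def cover_map_def[abs_def] by (rule linear_maps_compose[OF transport_linear(2)[OF F phi'] L])
  show "cover_map R \<phi> N ` carrier (cover R \<phi> N) = carrier N"
  proof
    show "carrier N \<subseteq> cover_map R \<phi> N ` carrier (cover R \<phi> N)"
    proof
      fix y assume y: "y \<in> carrier N"
      have u: "unit_vec R y \<in> carrier ?F" by (rule unit_vec_carrier[OF R y])
      have "cover_map R \<phi> N (\<phi> (unit_vec R y)) = y"
        unfolding cover_map_def inv_into_f_f[OF phi' u] by (rule free_lift_unit_vec[OF N _ y]) simp
      moreover have "\<phi> (unit_vec R y) \<in> carrier (cover R \<phi> N)"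
        using u by (simp add: cover_def transport_simps[OF phi'])
      ultimately show "y \<in> cover_map R \<phi> N ` carrier (cover R \<phi> N)" by force
    qed
  qed (use linear_mapsD(1)[OF cm] in auto)
qed

primrec syzygy :: "('r, 'y) ring_scheme \<Rightarrow> (('n \<Rightarrow> 'r) \<Rightarrow> 'n) \<Rightarrow> ('r, 'n) module \<Rightarrow> nat \<Rightarrow> ('r, 'n) module" where
  "syzygy R \<phi> K 0 = K"
| "syzygy R \<phi> K (Suc k) = kernel_module (cover R \<phi> (syzygy R \<phi> K k)) (cover_map R \<phi> (syzygy R \<phi> K k)) \<zero>\<^bsub>syzygy R \<phi> K k\<^esub>"

lemma left_module_syzygy:
  assumes "left_module R K" "inj_on \<phi> (carrier (free_module R UNIV))"
  shows "left_module R (syzygy R \<phi> K k)"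
proof (induction k)
  case (Suc k)
  show ?case unfolding syzygy.simps
    by (rule left_module_kernel[OF cover(4)[OF Suc assms(2)] Suc cover(2)[OF Suc assms(2)]])
qed (simp add: assms)

lemma linear_maps_submodule:
  "A \<subseteq> carrier P \<Longrightarrow> f \<in> linear_maps R Q (P\<lparr>carrier := A\<rparr>) \<Longrightarrow> f \<in> linear_maps R Q P"
  by (auto simp: linear_maps_def)

text \<open>Finite generation is demanded up to degree \<open>q\<close>, so beyond it any cover of
  the remaining kernel will do. That kernel \<open>K\<close> belongs to the last given differential,
  or to the augmentation if \<open>q = 0\<close>; degree \<open>q + 1 + k\<close> holds the cover of
  the \<open>k\<close>-th syzygy of \<open>K\<close>.\<close>

lemma extend_resolution:
  fixes P :: "nat \<Rightarrow> ('r, 'n) module" and M :: "('r, 'm, 'z) module_scheme" and \<phi> :: "('n \<Rightarrow> 'r) \<Rightarrow> 'n"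
  assumes M: "left_module R M" and phi: "inj_on \<phi> (carrier (free_module R (UNIV :: 'n set)))"
    and P: "\<And>i. i \<le> q \<Longrightarrow> projective_module R (P i)"
    and eps: "\<epsilon> \<in> linear_maps R (P 0) M" "\<epsilon> ` carrier (P 0) = carrier M"
    and d: "\<And>i. i < q \<Longrightarrow> d i \<in> linear_maps R (P (Suc i)) (P i)"
    and ex0: "0 < q \<Longrightarrow> d 0 ` carrier (P 1) = {x \<in> carrier (P 0). \<epsilon> x = \<zero>\<^bsub>M\<^esub>}"
    and ex: "\<And>i. Suc i < q \<Longrightarrow> d (Suc i) ` carrier (P (Suc (Suc i))) = {x \<in> carrier (P (Suc i)). d i x = \<zero>\<^bsub>P i\<^esub>}"
  shows "\<exists>P' d'. projective_resolution R M P' d' \<epsilon> \<and> (\<forall>i\<le>q. P' i = P i)"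
proof -
  have PL: "left_module R (P i)" if "i \<le> q" for i using P[OF that] by (simp add: projective_module_def)
  define K where "K = (case q of 0 \<Rightarrow> kernel_module (P 0) \<epsilon> \<zero>\<^bsub>M\<^esub> | Suc m \<Rightarrow> kernel_module (P q) (d m) \<zero>\<^bsub>P m\<^esub>)"
  have K: "left_module R K"
  proof (cases q)
    case 0
    thus ?thesis using left_module_kernel[OF PL M eps(1)] by (simp add: K_def)
  next
    case (Suc m)
    thus ?thesis using left_module_kernel[OF PL PL d[of m]] by (simp add: K_def)
  qed
  let ?S = "syzygy R \<phi> K"
  have S: "left_module R (?S k)" for k by (rule left_module_syzygy[OF K phi])
  define P' where "P' i = (if i \<le> q then P i else cover R \<phi> (?S (i - Suc q)))" for i
  define d' where "d' i = (if i < q then d i else cover_map R \<phi> (?S (i - q)))" for i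
  \<comment> \<open>A cover maps onto a syzygy, but the differential must be a map into the module
    containing it; hence each syzygy is exhibited as \<open>P' i\<close> with a smaller
    carrier.\<close>
  have Psub: "\<exists>A\<subseteq>carrier (P' i). ?S (i - q) = (P' i)\<lparr>carrier := A\<rparr>" if "i \<ge> q" for i
  proof (cases "i = q")
    case True
    show ?thesis
    proof (cases q)
      case 0
      show ?thesis
        by (rule exI[of _ "{x \<in> carrier (P 0). \<epsilon> x = \<zero>\<^bsub>M\<^esub>}"])
          (use True 0 in \<open>auto simp: K_def P'_def kernel_module_def\<close>)
    next
      case (Suc m)
      show ?thesis
        by (rule exI[of _ "{x \<in> carrier (P q). d m x = \<zero>\<^bsub>P m\<^esub>}"])
          (use True Suc in \<open>auto simp: K_def P'_def kernel_module_def\<close>)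
    qed
  next
    case False
    hence "i - q = Suc (i - Suc q)" using that by simp
    thus ?thesis using False that
      by (intro exI[of _ "carrier (?S (i - q))"]) (auto simp: P'_def kernel_module_def)
  qed
  have P'Suc: "P' (Suc i) = cover R \<phi> (?S (i - q))" if "i \<ge> q" for i
    using that by (simp add: P'_def)
  have img: "d' i ` carrier (P' (Suc i)) = carrier (?S (i - q))" if "i \<ge> q" for i
    using cover(3)[OF S phi] that by (simp add: d'_def P'Suc)
  show ?thesis
  proof (intro exI conjI)
    show "projective_resolution R M P' d' \<epsilon>"
      unfolding projective_resolution_def
    proof (intro conjI allI)
      fix n
      show "projective_module R (P' n)" using P cover(1)[OF S phi] by (simp add: P'_def)
      show "d' n \<in> linear_maps R (P' (n + 1)) (P' n)"
      proof (cases "n < q")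
        case True
        thus ?thesis using d by (simp add: d'_def P'_def)
      next
        case False
        hence n: "n \<ge> q" by simp
        obtain A where A: "A \<subseteq> carrier (P' n)" "?S (n - q) = (P' n)\<lparr>carrier := A\<rparr>" using Psub[OF n] by blast
        have "d' n \<in> linear_maps R (P' (Suc n)) (?S (n - q))"
          using cover(2)[OF S phi] n by (simp add: d'_def P'Suc)
        hence "d' n \<in> linear_maps R (P' (Suc n)) (P' n)" unfolding A(2) by (rule linear_maps_submodule[OF A(1)])
        thus ?thesis by simp
      qed
      show "d' (n + 1) ` carrier (P' (n + 2)) = {x \<in> carrier (P' (n + 1)). d' n x = \<zero>\<^bsub>P' n\<^esub>}"
      proof (cases "n + 1 < q")
        case True
        thus ?thesis using ex by (simp add: d'_def P'_def)
      next
        case False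
        hence n: "n + 1 \<ge> q" by simp
        have "d' (n + 1) ` carrier (P' (n + 2)) = carrier (?S (n + 1 - q))" using img[OF n] by simp
        also have "\<dots> = {x \<in> carrier (P' (n + 1)). d' n x = \<zero>\<^bsub>P' n\<^esub>}"
        proof (cases "n + 1 = q")
          case True
          hence q: "q = Suc n" by simp
          show ?thesis by (simp add: q K_def kernel_module_simps P'_def d'_def)
        next
          case False
          hence nq: "n \<ge> q" "n + 1 - q = Suc (n - q)" using n by auto
          obtain A where A: "?S (n - q) = (P' n)\<lparr>carrier := A\<rparr>" using Psub[OF nq(1)] by blast
          have "\<zero>\<^bsub>?S (n - q)\<^esub> = \<zero>\<^bsub>P' n\<^esub>" unfolding A by simp
          thus ?thesis using nq by (simp add: kernel_module_simps P'Suc d'_def)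
        qed
        finally show ?thesis .
      qed
    next
      show "d' 0 ` carrier (P' 1) = {x \<in> carrier (P' 0). \<epsilon> x = \<zero>\<^bsub>M\<^esub>}"
      proof (cases "q = 0")
        case True
        thus ?thesis using img[of 0] by (simp add: K_def kernel_module_simps P'_def)
      next
        case False
        thus ?thesis using ex0 by (simp add: d'_def P'_def)
      qed
    qed (use eps in \<open>auto simp: P'_def\<close>)
    show "\<forall>i\<le>q. P' i = P i" by (simp add: P'_def)
  qed
qed

text \<open>Finitely supported functions on lists are coded by lists: a list of pairs is written down with every
  symbol of an argument preceded by \<open>A\<close> and every value preceded by \<open>B\<close>.\<close>

fun code_pair :: "'a \<Rightarrow> 'a \<Rightarrow> 'a list \<times> 'a \<Rightarrow> 'a list" where
  "code_pair A B ([], r) = [B, r]"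
| "code_pair A B (x # xs, r) = A # x # code_pair A B (xs, r)"

lemma code_pair_inj:
  assumes "A \<noteq> B" "code_pair A B p @ u = code_pair A B p' @ u'"
  shows "p = p' \<and> u = u'"
  using assms
proof (induction A B p arbitrary: p' rule: code_pair.induct)
  case (1 A B r)
  thus ?case by (cases "(A, B, p')" rule: code_pair.cases) auto
next
  case (2 A B x xs r)
  obtain ys s where p': "p' = (ys, s)" by fastforce
  show ?case using 2 by (cases ys) (auto simp: p')
qed

lemma code_pairs_inj:
  assumes "A \<noteq> B" "concat (map (code_pair A B) ps) = concat (map (code_pair A B) ps')"
  shows "ps = ps'"
  using assms(2)
proof (induction ps arbitrary: ps')
  case Nil
  have "code_pair A B p \<noteq> []" for p by (cases "(A, B, p)" rule: code_pair.cases) auto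
  thus ?case using Nil by (cases ps') auto
next
  case (Cons p ps)
  have "code_pair A B p \<noteq> []" by (cases "(A, B, p)" rule: code_pair.cases) auto
  then obtain p' qs where ps': "ps' = p' # qs" using Cons.prems by (cases ps') auto
  thus ?case using code_pair_inj[OF assms(1), of p _ p'] Cons by auto
qed

text \<open>The two markers are the one and the zero of the ring, the only two elements known to
  differ.\<close>

lemma finite_support_code:
  assumes "\<one>\<^bsub>R\<^esub> \<noteq> \<zero>\<^bsub>R\<^esub>"
  shows "\<exists>\<phi> :: (('r + 'm) list \<Rightarrow> 'r) \<Rightarrow> ('r + 'm) list. inj_on \<phi> (carrier (free_module R UNIV))"
proof -
  define lst where "lst S = (SOME xs. set xs = S)" for S :: "('r + 'm) list set"
  have lst: "set (lst S) = S" if "finite S" for S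
    unfolding lst_def using finite_list[OF that] by (rule someI_ex)
  define ps :: "(('r + 'm) list \<Rightarrow> 'r) \<Rightarrow> (('r + 'm) list \<times> ('r + 'm)) list"
    where "ps f = map (\<lambda>t. (t, Inl (f t))) (lst {t. f t \<noteq> \<zero>\<^bsub>R\<^esub>})" for f
  define \<phi> where "\<phi> f = concat (map (code_pair (Inl \<one>\<^bsub>R\<^esub>) (Inl \<zero>\<^bsub>R\<^esub>)) (ps f))" for f
  have "f = g" if fg: "f \<in> carrier (free_module R UNIV)" "g \<in> carrier (free_module R UNIV)" "\<phi> f = \<phi> g" for f g
  proof -
    have "ps f = ps g" by (rule code_pairs_inj[of "Inl \<one>\<^bsub>R\<^esub>" "Inl \<zero>\<^bsub>R\<^esub>"]) (use assms fg(3) \<phi>_def in auto)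
    hence "set (ps f) = set (ps g)" by simp
    hence eq: "(\<lambda>t. (t, Inl (f t) :: 'r + 'm)) ` {t. f t \<noteq> \<zero>\<^bsub>R\<^esub>} = (\<lambda>t. (t, Inl (g t))) ` {t. g t \<noteq> \<zero>\<^bsub>R\<^esub>}"
      using fg(1,2) by (simp add: ps_def lst free_module_carrier)
    show "f = g"
    proof
      fix t
      have "f t \<noteq> \<zero>\<^bsub>R\<^esub> \<Longrightarrow> f t = g t" "g t \<noteq> \<zero>\<^bsub>R\<^esub> \<Longrightarrow> f t = g t"
        using eq by (auto simp: set_eq_iff image_iff)
      thus "f t = g t" by metis
    qed
  qed
  thus ?thesis by (intro exI[of _ \<phi>] inj_onI)
qed

text \<open>For a finite basis a function can be coded as the list of its values along a fixed
  enumeration. Exactness is required in degrees below \<open>q\<close>; from degree \<open>q\<close>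
  on the kernel is resolved by covers.\<close>

lemma type_FP_from_free:
  fixes M :: "('r, 'm, 'z) module_scheme" and X :: "nat \<Rightarrow> 'b set"
  assumes M: "left_module R M" and nz: "\<one>\<^bsub>R\<^esub> \<noteq> \<zero>\<^bsub>R\<^esub>" and X: "\<And>i. finite (X i)"
    and eps: "\<epsilon> \<in> linear_maps R (free_module R (X 0)) M" "\<epsilon> ` carrier (free_module R (X 0)) = carrier M"
    and d: "\<And>i. d i \<in> linear_maps R (free_module R (X (Suc i))) (free_module R (X i))"
    and ex0: "0 < q \<Longrightarrow> d 0 ` carrier (free_module R (X 1)) = {x \<in> carrier (free_module R (X 0)). \<epsilon> x = \<zero>\<^bsub>M\<^esub>}"
    and ex: "\<And>i. Suc i < q \<Longrightarrow> d (Suc i) ` carrier (free_module R (X (Suc (Suc i)))) =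
        {x \<in> carrier (free_module R (X (Suc i))). d i x = \<zero>\<^bsub>free_module R (X i)\<^esub>}"
  shows "type_FP q R M"
proof -
  interpret M: left_module R M by fact
  have R: "ring R" by unfold_locales
  define F where "F i = free_module R (X i)" for i
  have F: "left_module R (F i)" for i unfolding F_def by (rule left_module_free_module[OF R])
  obtain \<phi> :: "(('r + 'm) list \<Rightarrow> 'r) \<Rightarrow> ('r + 'm) list" where phi: "inj_on \<phi> (carrier (free_module R UNIV))"
    using finite_support_code[OF nz] by blast
  have "\<exists>xs. set xs = X i" for i using finite_list[OF X] by blast
  then obtain l where l: "\<And>i. set (l i) = X i" by metis
  define \<psi> :: "nat \<Rightarrow> ('b \<Rightarrow> 'r) \<Rightarrow> ('r + 'm) list" where "\<psi> i f = map (\<lambda>x. Inl (f x)) (l i)" for i f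
  have psi: "inj_on (\<psi> i) (carrier (F i))" for i
  proof (rule inj_onI)
    fix f g assume fg: "f \<in> carrier (F i)" "g \<in> carrier (F i)" "\<psi> i f = \<psi> i g"
    hence "\<forall>x\<in>X i. f x = g x" using l by (auto simp: \<psi>_def)
    moreover have "f x = \<zero>\<^bsub>R\<^esub>" "g x = \<zero>\<^bsub>R\<^esub>" if "x \<notin> X i" for x
      using fg(1,2) that by (auto simp: F_def free_module_carrier)
    ultimately show "f = g" by (metis ext)
  qed
  have kap: "\<exists>\<kappa> :: 'b \<Rightarrow> ('r + 'm) list. inj_on \<kappa> (X i)" for i
  proof -
    obtain h :: "'b \<Rightarrow> nat" where h: "inj_on h (X i)" using finite_imp_inj_to_nat_seg[OF X] by metis
    have "inj_on (\<lambda>x. replicate (h x) undefined :: ('r + 'm) list) (X i)"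
      using h by (auto simp: inj_on_def dest: arg_cong[of _ _ length])
    thus ?thesis by blast
  qed
  define P where "P i = transport (\<psi> i) (F i)" for i
  let ?inv = "\<lambda>i. inv_into (carrier (F i)) (\<psi> i)"
  note tl = transport_linear[OF F psi, folded P_def]
  have tc: "carrier (P i) = \<psi> i ` carrier (F i)" "\<zero>\<^bsub>P i\<^esub> = \<psi> i \<zero>\<^bsub>F i\<^esub>" for i
    using transport_simps[OF psi] by (auto simp: P_def)
  define D where "D i x = \<psi> i (d i (?inv (Suc i) x))" for i x
  have D: "D i \<in> linear_maps R (P (Suc i)) (P i)" for i
    unfolding D_def[abs_def]
    by (rule linear_maps_compose[OF linear_maps_compose[OF tl(2) d[of i, folded F_def]] tl(1)])
  have inv: "?inv i (\<psi> i x) = x" if "x \<in> carrier (F i)" for i x using psi that by simp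
  have Dpsi: "D i (\<psi> (Suc i) x) = \<psi> i (d i x)" if "x \<in> carrier (F (Suc i))" for i x
    using that by (simp add: D_def inv)
  have dF: "d i x \<in> carrier (F i)" if "x \<in> carrier (F (Suc i))" for i x
    using linear_mapsD(1)[OF d[of i, folded F_def] that] .
  have zF: "\<zero>\<^bsub>F i\<^esub> \<in> carrier (F i)" for i
  proof -
    interpret F: left_module R "F i" by (rule F)
    show ?thesis by simp
  qed
  have "\<exists>P' d'. projective_resolution R M P' d' (\<lambda>x. \<epsilon> (?inv 0 x)) \<and> (\<forall>i\<le>q. P' i = P i)"
  proof (rule extend_resolution[OF M phi])
    show "projective_module R (P i)" for i
    proof -
      obtain \<kappa> :: "'b \<Rightarrow> ('r + 'm) list" where "inj_on \<kappa> (X i)" using kap by blast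
      thus ?thesis using projective_transport_free[OF R psi[of i, unfolded F_def]] by (simp add: P_def F_def)
    qed
    show "(\<lambda>x. \<epsilon> (?inv 0 x)) \<in> linear_maps R (P 0) M"
      by (rule linear_maps_compose[OF tl(2) eps(1)[folded F_def]])
    show "(\<lambda>x. \<epsilon> (?inv 0 x)) ` carrier (P 0) = carrier M"
      using eps(2)[folded F_def] inv[of _ 0] by (simp add: tc image_image cong: image_cong)
    show "D i \<in> linear_maps R (P (Suc i)) (P i)" for i by (rule D)
    show "D 0 ` carrier (P 1) = {x \<in> carrier (P 0). \<epsilon> (?inv 0 x) = \<zero>\<^bsub>M\<^esub>}" if "0 < q"
    proof -
      have "D 0 ` carrier (P 1) = \<psi> 0 ` d 0 ` carrier (F 1)"
        using Dpsi[of _ 0] by (simp add: tc image_image cong: image_cong)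
      also have "\<dots> = \<psi> 0 ` {x \<in> carrier (F 0). \<epsilon> x = \<zero>\<^bsub>M\<^esub>}" using ex0[OF that] by (simp add: F_def)
      also have "\<dots> = {x \<in> carrier (P 0). \<epsilon> (?inv 0 x) = \<zero>\<^bsub>M\<^esub>}" using inv[of _ 0] by (auto simp: tc)
      finally show ?thesis .
    qed
    show "D (Suc i) ` carrier (P (Suc (Suc i))) = {x \<in> carrier (P (Suc i)). D i x = \<zero>\<^bsub>P i\<^esub>}" if "Suc i < q" for i
    proof -
      have "D (Suc i) ` carrier (P (Suc (Suc i))) = \<psi> (Suc i) ` d (Suc i) ` carrier (F (Suc (Suc i)))"
        using Dpsi[of _ "Suc i"] by (simp add: tc image_image cong: image_cong)
      also have "\<dots> = \<psi> (Suc i) ` {x \<in> carrier (F (Suc i)). d i x = \<zero>\<^bsub>F i\<^esub>}" using ex[OF that] by (simp add: F_def)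
      also have "\<dots> = {x \<in> carrier (P (Suc i)). D i x = \<zero>\<^bsub>P i\<^esub>}"
        using Dpsi[of _ i] dF zF psi[of i] by (auto simp: tc inj_on_eq_iff)
      finally show ?thesis .
    qed
  qed
  then obtain P' d' where "projective_resolution R M P' d' (\<lambda>x. \<epsilon> (?inv 0 x))" "\<forall>i\<le>q. P' i = P i" by blast
  moreover have "finitely_generated_module R (P i)" for i
    unfolding P_def F_def by (rule finitely_generated_transport_free[OF R nz psi[unfolded F_def] X])
  ultimately show ?thesis unfolding type_FP_def using M by metis
qed

section \<open>Chains over the monoid ring\<close>

abbreviation mring :: "('g, 'x) monoid_scheme \<Rightarrow> ('g \<Rightarrow> real) ring" where
  "mring M \<equiv> monoid_ring M"

lemma mring_carrier: "f \<in> carrier (mring M) \<longleftrightarrow> {g. f g \<noteq> 0} \<subseteq> carrier M \<and> finite {g. f g \<noteq> 0}"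
  by (simp add: monoid_ring_def)

lemma mring_simps:
  "\<zero>\<^bsub>mring M\<^esub> = (\<lambda>x. 0)" "f \<oplus>\<^bsub>mring M\<^esub> h = (\<lambda>x. f x + h x)" "\<one>\<^bsub>mring M\<^esub> = (\<lambda>x. if x = \<one>\<^bsub>M\<^esub> then 1 else 0)"
  by (simp_all add: monoid_ring_def)

text \<open>Indicator functions recover the values.\<close>

lemma pair_ext:
  fixes f h :: "'g \<Rightarrow> real"
  assumes "finite {g. f g \<noteq> 0}" "finite {g. h g \<noteq> 0}" "\<And>F. pair f F = pair h F"
  shows "f = h"
proof
  fix x
  have p: "pair k (\<lambda>g. of_bool (g = x)) = k x" if "finite {g. k g \<noteq> 0}" for k :: "'g \<Rightarrow> real"
  proof -
    have "pair k (\<lambda>g. of_bool (g = x)) = (\<Sum>g\<in>insert x {g. k g \<noteq> 0}. k g * of_bool (g = x))"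
      by (rule pair_superset) (use that in auto)
    also have "\<dots> = (\<Sum>g\<in>{x}. k g * of_bool (g = x))"
      by (rule sum.mono_neutral_right) (use that in auto)
    finally show ?thesis by simp
  qed
  show "f x = h x" using p[OF assms(1)] p[OF assms(2)] assms(3) by metis
qed

lemma mring_mult_support:
  "{x. (f \<otimes>\<^bsub>mring M\<^esub> h) x \<noteq> 0} \<subseteq> (\<lambda>(y, z). y \<otimes>\<^bsub>M\<^esub> z) ` ({g. f g \<noteq> 0} \<times> {g. h g \<noteq> 0})"
proof
  fix x assume "x \<in> {x. (f \<otimes>\<^bsub>mring M\<^esub> h) x \<noteq> 0}"
  moreover have "(f \<otimes>\<^bsub>mring M\<^esub> h) x = 0" if "{(y, z). f y \<noteq> 0 \<and> h z \<noteq> 0 \<and> y \<otimes>\<^bsub>M\<^esub> z = x} = {}"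
    by (simp add: monoid_ring_def that)
  ultimately have "{(y, z). f y \<noteq> 0 \<and> h z \<noteq> 0 \<and> y \<otimes>\<^bsub>M\<^esub> z = x} \<noteq> {}" by blast
  thus "x \<in> (\<lambda>(y, z). y \<otimes>\<^bsub>M\<^esub> z) ` ({g. f g \<noteq> 0} \<times> {g. h g \<noteq> 0})" by force
qed

lemma mring_mult_finite:
  assumes "finite {g. f g \<noteq> 0}" "finite {g. h g \<noteq> 0}"
  shows "finite {x. (f \<otimes>\<^bsub>mring M\<^esub> h) x \<noteq> 0}"
  by (rule finite_subset[OF mring_mult_support]) (use assms in auto)

text \<open>Groups the pairs \<open>(y, z)\<close> by their product. Convolution becomes an iterated
  pairing, so that the ring axioms, linearity of the boundary and multiplicativity of the evaluation
  follow without rearranging convolution sums.\<close>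

lemma pair_mult:
  assumes "finite {g. f g \<noteq> 0}" "finite {g. h g \<noteq> 0}"
  shows "pair (f \<otimes>\<^bsub>mring M\<^esub> h) F = pair f (\<lambda>y. pair h (\<lambda>z. F (y \<otimes>\<^bsub>M\<^esub> z)))"
proof -
  let ?P = "{g. f g \<noteq> 0} \<times> {g. h g \<noteq> 0}" and ?m = "\<lambda>(y, z). y \<otimes>\<^bsub>M\<^esub> z"
  have P: "finite ?P" using assms by simp
  have mult: "(f \<otimes>\<^bsub>mring M\<^esub> h) x = (\<Sum>p\<in>{p \<in> ?P. ?m p = x}. f (fst p) * h (snd p))" for x
    unfolding monoid_ring_def by (auto intro!: sum.cong)
  have "pair (f \<otimes>\<^bsub>mring M\<^esub> h) F = (\<Sum>x\<in>?m ` ?P. (f \<otimes>\<^bsub>mring M\<^esub> h) x * F x)"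
    by (rule pair_superset[OF _ mring_mult_support]) (use P in simp)
  also have "\<dots> = (\<Sum>x\<in>?m ` ?P. \<Sum>p\<in>{p \<in> ?P. ?m p = x}. f (fst p) * h (snd p) * F (?m p))"
    unfolding mult by (intro sum.cong HOL.refl) (auto simp: sum_distrib_right intro!: sum.cong)
  also have "\<dots> = (\<Sum>p\<in>?P. f (fst p) * h (snd p) * F (?m p))"
    by (rule sum.image_gen[OF P, symmetric])
  also have "\<dots> = (\<Sum>y\<in>{g. f g \<noteq> 0}. \<Sum>z\<in>{g. h g \<noteq> 0}. f y * h z * F (y \<otimes>\<^bsub>M\<^esub> z))"
    by (simp add: sum.cartesian_product case_prod_beta)
  finally show ?thesis by (simp add: pair_def sum_distrib_left mult.assoc)
qed

lemma pair_add_right: "pair f (\<lambda>x. F x + H x) = pair f F + pair f H"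
  by (simp add: pair_def distrib_left sum.distrib)

lemma pair_const: "pair f (\<lambda>_. c) = pair f (\<lambda>_. 1) * c"
  by (simp add: pair_def sum_distrib_right)

lemma pair_unit: "pair (\<lambda>x. if x = a then 1 else 0) F = F a"
proof -
  have "pair (\<lambda>x. if x = a then 1 else 0) F = (\<Sum>x\<in>{a}. (if x = a then 1 else 0) * F x)"
    by (rule pair_superset) auto
  thus ?thesis by simp
qed

lemma ring_mring:
  assumes "monoid M" shows "ring (mring M)"
proof -
  interpret M: monoid M by fact
  let ?R = "mring M"
  have fin: "finite {g. f g \<noteq> 0}" if "f \<in> carrier ?R" for f using that by (simp add: mring_carrier)
  have sup: "g \<in> carrier M" if "f \<in> carrier ?R" "f g \<noteq> 0" for f g using that by (auto simp: mring_carrier)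
  have add: "f \<oplus>\<^bsub>?R\<^esub> h \<in> carrier ?R" if "f \<in> carrier ?R" "h \<in> carrier ?R" for f h
  proof -
    have sub: "{x. f x + h x \<noteq> 0} \<subseteq> {g. f g \<noteq> 0} \<union> {g. h g \<noteq> 0}" by auto
    have "finite {x. f x + h x \<noteq> 0}"
      by (rule finite_subset[OF sub]) (use fin that in simp)
    moreover have "{x. f x + h x \<noteq> 0} \<subseteq> carrier M" using sub sup[OF that(1)] sup[OF that(2)] by auto
    ultimately show ?thesis by (simp add: mring_carrier mring_simps)
  qed
  have mult: "f \<otimes>\<^bsub>?R\<^esub> h \<in> carrier ?R" if "f \<in> carrier ?R" "h \<in> carrier ?R" for f h
    unfolding mring_carrier
  proof
    have "(\<lambda>(y, z). y \<otimes>\<^bsub>M\<^esub> z) ` ({g. f g \<noteq> 0} \<times> {g. h g \<noteq> 0}) \<subseteq> carrier M"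
      using sup[OF that(1)] sup[OF that(2)] by auto
    thus "{g. (f \<otimes>\<^bsub>?R\<^esub> h) g \<noteq> 0} \<subseteq> carrier M"      by (rule subset_trans[OF mring_mult_support])
  qed (rule mring_mult_finite[OF fin[OF that(1)] fin[OF that(2)]])
  have one: "\<one>\<^bsub>?R\<^esub> \<in> carrier ?R"
  proof -
    have "{g. (if g = \<one>\<^bsub>M\<^esub> then 1 else 0) \<noteq> (0::real)} = {\<one>\<^bsub>M\<^esub>}" by auto
    thus ?thesis by (simp add: mring_carrier mring_simps)
  qed
  show ?thesis
  proof (rule ringI)
    show "abelian_group ?R"
    proof (rule abelian_groupI)
      fix f assume f: "f \<in> carrier ?R"
      show "\<exists>y\<in>carrier ?R. y \<oplus>\<^bsub>?R\<^esub> f = \<zero>\<^bsub>?R\<^esub>"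
        by (rule bexI[of _ "\<lambda>x. - f x"]) (use f in \<open>auto simp: mring_simps mring_carrier\<close>)
    next
      fix f g assume "f \<in> carrier ?R" "g \<in> carrier ?R"
      thus "f \<oplus>\<^bsub>?R\<^esub> g \<in> carrier ?R" by (rule add)
    qed (auto simp: mring_simps mring_carrier)
    show "Group.monoid ?R"
    proof (rule monoidI)
      fix f g h assume fgh: "f \<in> carrier ?R" "g \<in> carrier ?R" "h \<in> carrier ?R"
      show "f \<otimes>\<^bsub>?R\<^esub> g \<otimes>\<^bsub>?R\<^esub> h = f \<otimes>\<^bsub>?R\<^esub> (g \<otimes>\<^bsub>?R\<^esub> h)"
      proof (rule pair_ext)
        fix F
        have "pair (f \<otimes>\<^bsub>?R\<^esub> g \<otimes>\<^bsub>?R\<^esub> h) F = pair f (\<lambda>x. pair g (\<lambda>y. pair h (\<lambda>z. F (x \<otimes>\<^bsub>M\<^esub> y \<otimes>\<^bsub>M\<^esub> z))))"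
          using fgh by (simp add: pair_mult fin mult)
        also have "\<dots> = pair f (\<lambda>x. pair g (\<lambda>y. pair h (\<lambda>z. F (x \<otimes>\<^bsub>M\<^esub> (y \<otimes>\<^bsub>M\<^esub> z)))))"
          using sup fgh by (intro pair_cong) (simp add: M.m_assoc)
        also have "\<dots> = pair (f \<otimes>\<^bsub>?R\<^esub> (g \<otimes>\<^bsub>?R\<^esub> h)) F"
          using fgh by (simp add: pair_mult fin mult)
        finally show "pair (f \<otimes>\<^bsub>?R\<^esub> g \<otimes>\<^bsub>?R\<^esub> h) F = pair (f \<otimes>\<^bsub>?R\<^esub> (g \<otimes>\<^bsub>?R\<^esub> h)) F" .
      qed (use fgh fin mult in auto)
    next
      fix f assume f: "f \<in> carrier ?R"
      show "\<one>\<^bsub>?R\<^esub> \<otimes>\<^bsub>?R\<^esub> f = f"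
      proof (rule pair_ext)
        show "pair (\<one>\<^bsub>?R\<^esub> \<otimes>\<^bsub>?R\<^esub> f) F = pair f F" for F
          unfolding pair_mult[OF fin[OF one] fin[OF f]] unfolding mring_simps pair_unit
          using sup[OF f] by (intro pair_cong) simp
      qed (use f fin mult one in auto)
      show "f \<otimes>\<^bsub>?R\<^esub> \<one>\<^bsub>?R\<^esub> = f"
      proof (rule pair_ext)
        show "pair (f \<otimes>\<^bsub>?R\<^esub> \<one>\<^bsub>?R\<^esub>) F = pair f F" for F
          unfolding pair_mult[OF fin[OF f] fin[OF one]] unfolding mring_simps pair_unit
          using sup[OF f] by (intro pair_cong) simp
      qed (use f fin mult one in auto)
    qed (use mult one in auto)
  next
    fix f g h assume fgh: "f \<in> carrier ?R" "g \<in> carrier ?R" "h \<in> carrier ?R"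
    show "(f \<oplus>\<^bsub>?R\<^esub> g) \<otimes>\<^bsub>?R\<^esub> h = f \<otimes>\<^bsub>?R\<^esub> h \<oplus>\<^bsub>?R\<^esub> g \<otimes>\<^bsub>?R\<^esub> h"
    proof (rule pair_ext)
      show "pair ((f \<oplus>\<^bsub>?R\<^esub> g) \<otimes>\<^bsub>?R\<^esub> h) F = pair (f \<otimes>\<^bsub>?R\<^esub> h \<oplus>\<^bsub>?R\<^esub> g \<otimes>\<^bsub>?R\<^esub> h) F" for F
        unfolding pair_mult[OF fin[OF add[OF fgh(1,2)]] fin[OF fgh(3)]] unfolding mring_simps
          pair_add[OF fin[OF fgh(1)] fin[OF fgh(2)]] pair_add[OF fin[OF mult[OF fgh(1,3)]] fin[OF mult[OF fgh(2,3)]]]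
        by (simp add: pair_mult fin fgh)
    qed (use fgh fin mult add in auto)
    show "h \<otimes>\<^bsub>?R\<^esub> (f \<oplus>\<^bsub>?R\<^esub> g) = h \<otimes>\<^bsub>?R\<^esub> f \<oplus>\<^bsub>?R\<^esub> h \<otimes>\<^bsub>?R\<^esub> g"
    proof (rule pair_ext)
      show "pair (h \<otimes>\<^bsub>?R\<^esub> (f \<oplus>\<^bsub>?R\<^esub> g)) F = pair (h \<otimes>\<^bsub>?R\<^esub> f \<oplus>\<^bsub>?R\<^esub> h \<otimes>\<^bsub>?R\<^esub> g) F" for F
        unfolding pair_mult[OF fin[OF fgh(3)] fin[OF add[OF fgh(1,2)]]] unfolding mring_simps
          pair_add[OF fin[OF fgh(1)] fin[OF fgh(2)]] pair_add[OF fin[OF mult[OF fgh(3,1)]] fin[OF mult[OF fgh(3,2)]]]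
        by (simp add: pair_mult fin fgh pair_add_right)
    qed (use fgh fin mult add in auto)
  qed
qed

lemma left_module_trivial:
  assumes "monoid M" shows "left_module (mring M) (trivial_module :: ('g \<Rightarrow> real, real) module)"
proof -
  interpret R: ring "mring M" by (rule ring_mring[OF assms])
  let ?T = "trivial_module :: ('g \<Rightarrow> real, real) module"
  have simps: "carrier ?T = UNIV" "\<zero>\<^bsub>?T\<^esub> = 0" "x \<oplus>\<^bsub>?T\<^esub> y = x + y" "f \<odot>\<^bsub>?T\<^esub> r = pair f (\<lambda>_. 1) * r" for x y f r
    by (simp_all add: trivial_module_def pair_def)
  have fin: "finite {g. f g \<noteq> 0}" if "f \<in> carrier (mring M)" for f using that by (simp add: mring_carrier)
  interpret T: abelian_group ?T
    by (rule abelian_groupI) (auto simp: simps intro: exI[of _ "- x" for x])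
  show ?thesis
  proof (unfold_locales)
    fix f g x assume fg: "f \<in> carrier (mring M)" "g \<in> carrier (mring M)" "x \<in> carrier ?T"
    show "(f \<oplus>\<^bsub>mring M\<^esub> g) \<odot>\<^bsub>?T\<^esub> x = f \<odot>\<^bsub>?T\<^esub> x \<oplus>\<^bsub>?T\<^esub> g \<odot>\<^bsub>?T\<^esub> x"
      unfolding simps mring_simps pair_add[OF fin[OF fg(1)] fin[OF fg(2)]] by (simp add: distrib_right)
    show "(f \<otimes>\<^bsub>mring M\<^esub> g) \<odot>\<^bsub>?T\<^esub> x = f \<odot>\<^bsub>?T\<^esub> (g \<odot>\<^bsub>?T\<^esub> x)"
      unfolding simps pair_mult[OF fin[OF fg(1)] fin[OF fg(2)]] pair_const[of f "pair g (\<lambda>_. 1)"] by simp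
  next
    fix x assume "x \<in> carrier ?T"
    show "\<one>\<^bsub>mring M\<^esub> \<odot>\<^bsub>?T\<^esub> x = x" unfolding simps mring_simps pair_unit by simp
  qed (auto simp: simps algebra_simps)
qed

lemma left_module_subring:
  assumes N: "left_module R N" and S: "ring S" and sub: "carrier S \<subseteq> carrier R"
    and ops: "\<And>x y. x \<oplus>\<^bsub>S\<^esub> y = x \<oplus>\<^bsub>R\<^esub> y" "\<And>x y. x \<otimes>\<^bsub>S\<^esub> y = x \<otimes>\<^bsub>R\<^esub> y" "\<one>\<^bsub>S\<^esub> = \<one>\<^bsub>R\<^esub>"
  shows "left_module S N"
proof -
  interpret N: left_module R N by fact
  interpret S: ring S by fact
  show ?thesis
    by unfold_locales
      (use sub in \<open>auto simp: ops N.smult_closed N.smult_one subset_iff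
         intro: N.smult_l_distr N.smult_r_distr N.smult_assoc1\<close>)
qed

section \<open>Chains as modules over the monoid ring\<close>

locale raag_character = raag_signed \<Gamma> idx sg for \<Gamma> :: "('v, 'e) pre_digraph" and idx sg +
  fixes \<chi> :: "'v word set \<Rightarrow> real"
  assumes chi_mult: "\<And>g h. g \<in> carrier G \<Longrightarrow> h \<in> carrier G \<Longrightarrow> \<chi> (g \<otimes>\<^bsub>G\<^esub> h) = \<chi> g + \<chi> h"
    and chi_gam: "\<And>v. v \<in> V \<Longrightarrow> \<chi> (gam v) \<ge> 0"
begin

abbreviation Gp where "Gp \<equiv> nonneg_submonoid G \<chi>"
abbreviation R where "R \<equiv> mring Gp"
abbreviation RG where "RG \<equiv> mring G"

lemma chi_one: "\<chi> \<one>\<^bsub>G\<^esub> = 0"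
  using chi_mult[of "\<one>\<^bsub>G\<^esub>" "\<one>\<^bsub>G\<^esub>"] by simp

lemma chi_inv: "g \<in> carrier G \<Longrightarrow> \<chi> (inv\<^bsub>G\<^esub> g) = - \<chi> g"
  using chi_mult[of g "inv\<^bsub>G\<^esub> g"] chi_one by simp

lemma Gp_simps: "carrier Gp = {g \<in> carrier G. \<chi> g \<ge> 0}" "x \<otimes>\<^bsub>Gp\<^esub> y = x \<otimes>\<^bsub>G\<^esub> y" "\<one>\<^bsub>Gp\<^esub> = \<one>\<^bsub>G\<^esub>"
  by (simp_all add: nonneg_submonoid_def)

lemma monoid_Gp: "Group.monoid Gp"
  by (rule monoidI) (auto simp: Gp_simps chi_mult chi_one G.m_assoc)

lemma ring_R: "ring R" by (rule ring_mring[OF monoid_Gp])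
lemma ring_RG: "ring RG" by (rule ring_mring) (rule G.monoid_axioms)

lemma R_mult: "f \<otimes>\<^bsub>R\<^esub> h = f \<otimes>\<^bsub>RG\<^esub> h"
  by (simp add: monoid_ring_def Gp_simps)

lemma R_carrier: "f \<in> carrier R \<longleftrightarrow> f \<in> carrier RG \<and> (\<forall>g. f g \<noteq> 0 \<longrightarrow> \<chi> g \<ge> 0)"
  by (auto simp: mring_carrier Gp_simps)

text \<open>Free over the group ring and used as an \<open>R\<close>-module by restriction of
  scalars. It is exact, but for nonzero \<chi> too large to be finitely generated over
  \<open>R\<close>; \<open>Cpos\<close>, the cubes based at height at least 0, is free of finite
  rank over \<open>R\<close> on the same basis.\<close>

definition Cmod :: "nat \<Rightarrow> ('v word set \<Rightarrow> real, 'v set \<Rightarrow> 'v word set \<Rightarrow> real) module" where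
  "Cmod n = free_module RG (cliques n)"

definition Cpos :: "nat \<Rightarrow> ('v word set \<Rightarrow> real, 'v set \<Rightarrow> 'v word set \<Rightarrow> real) module" where
  "Cpos n = free_module R (cliques n)"

lemma Cmod_carrier: "carrier (Cmod n) = chains n"
proof -
  have "finite {\<sigma>. x \<sigma> \<noteq> (\<lambda>_. 0)}" if "\<forall>\<sigma>. \<sigma> \<notin> cliques n \<longrightarrow> x \<sigma> = (\<lambda>_. 0)" for x :: "'v set \<Rightarrow> 'v word set \<Rightarrow> real"
    by (rule finite_subset[OF _ finite_cliques[of n]]) (use that in auto)
  thus ?thesis
    by (auto simp: Cmod_def free_module_carrier mring_carrier mring_simps chains_def subset_iff)
qed

lemma Cpos_carrier: "x \<in> carrier (Cpos n) \<longleftrightarrow> x \<in> chains n \<and> (\<forall>\<sigma> g. x \<sigma> g \<noteq> 0 \<longrightarrow> \<chi> g \<ge> 0)"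
  unfolding Cmod_carrier[symmetric] Cmod_def Cpos_def free_module_carrier R_carrier by (auto simp: mring_simps)

lemma Cmod_simps: "\<zero>\<^bsub>Cmod n\<^esub> = (\<lambda>_ _. 0)" "x \<oplus>\<^bsub>Cmod n\<^esub> y = (\<lambda>\<sigma> g. x \<sigma> g + y \<sigma> g)"
   "a \<odot>\<^bsub>Cmod n\<^esub> x = (\<lambda>\<sigma>. a \<otimes>\<^bsub>RG\<^esub> x \<sigma>)"
  by (auto simp: Cmod_def free_module_simps mring_simps)

lemma Cpos_simps: "\<zero>\<^bsub>Cpos n\<^esub> = (\<lambda>_ _. 0)" "x \<oplus>\<^bsub>Cpos n\<^esub> y = (\<lambda>\<sigma> g. x \<sigma> g + y \<sigma> g)"
   "a \<odot>\<^bsub>Cpos n\<^esub> x = (\<lambda>\<sigma>. a \<otimes>\<^bsub>RG\<^esub> x \<sigma>)"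
  by (auto simp: Cpos_def free_module_simps mring_simps R_mult)

lemma left_module_Cmod: "left_module R (Cmod n)"
  unfolding Cmod_def
  by (rule left_module_subring[OF left_module_free_module[OF ring_RG] ring_R])
    (auto simp: R_carrier R_mult, auto simp: mring_simps Gp_simps)

lemma left_module_T: "left_module R (trivial_module :: ('v word set \<Rightarrow> real, real) module)"
  by (rule left_module_trivial[OF monoid_Gp])

lemma fin_RG: "a \<in> carrier RG \<Longrightarrow> finite {g. a g \<noteq> 0}" by (simp add: mring_carrier)

lemma smult_chains: "a \<in> carrier RG \<Longrightarrow> x \<in> chains n \<Longrightarrow> (\<lambda>\<sigma>. a \<otimes>\<^bsub>RG\<^esub> x \<sigma>) \<in> chains n"
  using left_module.smult_closed[OF left_module_free_module[OF ring_RG, of "cliques n"], of a x]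
  by (simp add: Cmod_def[symmetric] Cmod_carrier Cmod_simps)

lemma dif_add: "dif (\<lambda>\<sigma> g. x \<sigma> g + y \<sigma> g) \<tau> g = dif x \<tau> g + dif y \<tau> g"
  using dif_diff[of "\<lambda>\<sigma> g. x \<sigma> g + y \<sigma> g" y \<tau> g] by simp

lemma pair_sum_right: "pair f (\<lambda>y. \<Sum>v\<in>A. H v y) = (\<Sum>v\<in>A. pair f (H v))"
  unfolding pair_def by (simp add: sum_distrib_left) (rule sum.swap)

lemma pair_scale_right: "pair f (\<lambda>y. c * H y) = c * pair f H"
  by (simp add: pair_def sum_distrib_left mult_ac)

lemma dif_smult:
  assumes a: "a \<in> carrier RG" and x: "x \<in> chains (Suc n)"
  shows "dif (\<lambda>\<sigma>. a \<otimes>\<^bsub>RG\<^esub> x \<sigma>) = (\<lambda>\<sigma>. a \<otimes>\<^bsub>RG\<^esub> dif x \<sigma>)"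
proof
  fix \<tau>
  have ax: "(\<lambda>\<sigma>. a \<otimes>\<^bsub>RG\<^esub> x \<sigma>) \<in> chains (Suc n)" by (rule smult_chains[OF a x])
  have dx: "dif x \<in> chains n" by (rule dif_chains[OF x])
  show "dif (\<lambda>\<sigma>. a \<otimes>\<^bsub>RG\<^esub> x \<sigma>) \<tau> = a \<otimes>\<^bsub>RG\<^esub> dif x \<tau>"
  proof (rule pair_ext)
    show "finite {g. dif (\<lambda>\<sigma>. a \<otimes>\<^bsub>RG\<^esub> x \<sigma>) \<tau> g \<noteq> 0}" by (rule chainsD(3)[OF dif_chains[OF ax]])
    show "finite {g. (a \<otimes>\<^bsub>RG\<^esub> dif x \<tau>) g \<noteq> 0}" by (rule chainsD(3)[OF smult_chains[OF a dx]])
    fix F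
    have "pair (dif (\<lambda>\<sigma>. a \<otimes>\<^bsub>RG\<^esub> x \<sigma>) \<tau>) F =
       (\<Sum>v\<in>V - \<tau>. eps v \<tau> * pair (a \<otimes>\<^bsub>RG\<^esub> x (insert v \<tau>)) (\<lambda>g. F (g \<otimes>\<^bsub>G\<^esub> gam v) - F g))"
      by (rule pair_dif[OF ax])
    also have "\<dots> = (\<Sum>v\<in>V - \<tau>. eps v \<tau> * pair a (\<lambda>y. pair (x (insert v \<tau>)) (\<lambda>z. F (y \<otimes>\<^bsub>G\<^esub> z \<otimes>\<^bsub>G\<^esub> gam v) - F (y \<otimes>\<^bsub>G\<^esub> z))))"
      by (simp add: pair_mult fin_RG[OF a] chainsD(3)[OF x])
    also have "\<dots> = (\<Sum>v\<in>V - \<tau>. eps v \<tau> * pair a (\<lambda>y. pair (x (insert v \<tau>)) (\<lambda>z. F (y \<otimes>\<^bsub>G\<^esub> (z \<otimes>\<^bsub>G\<^esub> gam v)) - F (y \<otimes>\<^bsub>G\<^esub> z))))"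
    proof (intro sum.cong arg_cong2[of _ _ _ _ times] pair_cong HOL.refl)
      fix v g z assume v: "v \<in> V - \<tau>" and g: "a g \<noteq> 0" and z: "x (insert v \<tau>) z \<noteq> 0"
      have "g \<in> carrier G" using a g by (auto simp: mring_carrier)
      moreover have "z \<in> carrier G" using chainsD(2)[OF x] z by blast
      ultimately show "F (g \<otimes>\<^bsub>G\<^esub> z \<otimes>\<^bsub>G\<^esub> gam v) - F (g \<otimes>\<^bsub>G\<^esub> z) = F (g \<otimes>\<^bsub>G\<^esub> (z \<otimes>\<^bsub>G\<^esub> gam v)) - F (g \<otimes>\<^bsub>G\<^esub> z)"
        using v gam_closed by (simp add: G.m_assoc)
    qed
    also have "\<dots> = pair a (\<lambda>y. pair (dif x \<tau>) (\<lambda>z. F (y \<otimes>\<^bsub>G\<^esub> z)))"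
      by (simp add: pair_dif[OF x] pair_sum_right pair_scale_right)
    also have "\<dots> = pair (a \<otimes>\<^bsub>RG\<^esub> dif x \<tau>) F"
      by (simp add: pair_mult fin_RG[OF a] chainsD(3)[OF dx])
    finally show "pair (dif (\<lambda>\<sigma>. a \<otimes>\<^bsub>RG\<^esub> x \<sigma>) \<tau>) F = pair (a \<otimes>\<^bsub>RG\<^esub> dif x \<tau>) F" .
  qed
qed

lemma dif_linear: "dif \<in> linear_maps R (Cmod (Suc n)) (Cmod n)"
  by (rule linear_mapsI)
    (auto simp: Cmod_carrier Cmod_simps dif_chains dif_add fun_eq_iff dif_smult[simplified] R_carrier)

text \<open>With the chosen orientation all generators have nonnegative height, so no vertex of a
  cube is lower than its base point.\<close>

lemma dif_pos:
  assumes "x \<in> carrier (Cpos (Suc n))" shows "dif x \<in> carrier (Cpos n)"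
proof -
  have x: "x \<in> chains (Suc n)" "\<And>\<sigma> g. x \<sigma> g \<noteq> 0 \<Longrightarrow> \<chi> g \<ge> 0" using assms by (auto simp: Cpos_carrier)
  have "\<chi> g \<ge> 0" if "dif x \<tau> g \<noteq> 0" for \<tau> g
  proof (rule ccontr)
    assume neg: "\<not> \<chi> g \<ge> 0"
    have g: "g \<in> carrier G" using that by (auto simp: dif_def split: if_splits)
    have "x (insert v \<tau>) (g \<otimes>\<^bsub>G\<^esub> inv\<^bsub>G\<^esub> gam v) = 0" if "v \<in> V" for v
    proof (rule ccontr)
      assume "x (insert v \<tau>) (g \<otimes>\<^bsub>G\<^esub> inv\<^bsub>G\<^esub> gam v) \<noteq> 0"
      from x(2)[OF this] show False
        using neg chi_gam[OF that] g gam_closed[OF that] by (simp add: chi_mult chi_inv)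
    qed
    moreover have "x (insert v \<tau>) g = 0" for v using x(2) neg by blast
    ultimately have "dif x \<tau> g = 0" by (simp add: dif_def)
    thus False using that by simp
  qed
  thus ?thesis using dif_chains[OF x(1)] by (simp add: Cpos_carrier)
qed

lemma dif_linear_pos: "dif \<in> linear_maps R (Cpos (Suc n)) (Cpos n)"
proof (rule linear_mapsI)
  fix a x assume "a \<in> carrier R" "x \<in> carrier (Cpos (Suc n))"
  thus "dif (a \<odot>\<^bsub>Cpos (Suc n)\<^esub> x) = a \<odot>\<^bsub>Cpos n\<^esub> dif x"
    using dif_smult[of a x n] by (simp add: Cpos_simps R_carrier Cpos_carrier)
qed (auto simp: Cpos_simps dif_pos dif_add fun_eq_iff)

lemma aug_smult: "a \<in> carrier RG \<Longrightarrow> x \<in> chains n \<Longrightarrow> aug (\<lambda>\<sigma>. a \<otimes>\<^bsub>RG\<^esub> x \<sigma>) = pair a (\<lambda>_. 1) * aug x"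
  unfolding aug_def by (simp add: pair_mult fin_RG chainsD(3) pair_const[of a "pair (x {}) (\<lambda>_. 1)"])

lemma aug_add: "x \<in> chains n \<Longrightarrow> y \<in> chains n \<Longrightarrow> aug (\<lambda>\<sigma> g. x \<sigma> g + y \<sigma> g) = aug x + aug y"
  unfolding aug_def by (rule pair_add) (rule chainsD(3), assumption)+

lemma trivial_simps:
  "carrier trivial_module = (UNIV :: real set)" "\<zero>\<^bsub>trivial_module\<^esub> = (0::real)" "x \<oplus>\<^bsub>trivial_module\<^esub> y = x + (y::real)"
  "f \<odot>\<^bsub>trivial_module\<^esub> r = pair f (\<lambda>_. 1) * r"
  by (simp_all add: trivial_module_def pair_def)

lemma aug_linear: "aug \<in> linear_maps R (Cmod 0) trivial_module"
  by (rule linear_mapsI) (auto simp: Cmod_carrier Cmod_simps trivial_simps aug_add aug_smult R_carrier)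

lemma aug_linear_pos: "aug \<in> linear_maps R (Cpos 0) trivial_module"
  by (rule linear_mapsI) (auto simp: Cpos_carrier Cpos_simps trivial_simps aug_add aug_smult R_carrier)

section \<open>Exactness from finiteness\<close>

text \<open>Commutes with the left action of scalars but in general not with \<open>dif\<close>. It
  identifies each degree of a half space with a free \<open>R\<close>-module, and lifting requires
  no more than that.\<close>

definition right_translate :: "'v word set \<Rightarrow> ('v set \<Rightarrow> 'v word set \<Rightarrow> real) \<Rightarrow> 'v set \<Rightarrow> 'v word set \<Rightarrow> real" where
  "right_translate a x \<sigma> g = (if g \<in> carrier G then x \<sigma> (g \<otimes>\<^bsub>G\<^esub> inv\<^bsub>G\<^esub> a) else 0)"

lemma right_translate_chains:
  assumes x: "x \<in> chains n" and a: "a \<in> carrier G"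
  shows "right_translate a x \<in> chains n"
proof (rule chainsI)
  fix \<sigma>
  show "finite {g. right_translate a x \<sigma> g \<noteq> 0}"
    by (rule finite_subset[OF _ finite_shift[OF chainsD(3)[OF x, of \<sigma>], of "inv\<^bsub>G\<^esub> a"]])
      (use a chainsD(2)[OF x] in \<open>auto simp: right_translate_def split: if_splits\<close>)
qed (use chainsD(1)[OF x] in \<open>auto simp: right_translate_def\<close>)

lemma pair_right_translate: "x \<in> chains n \<Longrightarrow> a \<in> carrier G \<Longrightarrow> pair (right_translate a x \<sigma>) F = pair (x \<sigma>) (\<lambda>g. F (g \<otimes>\<^bsub>G\<^esub> a))"
  unfolding right_translate_def[abs_def] by (rule pair_shift) (auto dest: chainsD(2))

lemma right_translate_smult:
  assumes c: "c \<in> carrier RG" and x: "x \<in> chains n" and a: "a \<in> carrier G"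
  shows "right_translate a (\<lambda>\<sigma>. c \<otimes>\<^bsub>RG\<^esub> x \<sigma>) = (\<lambda>\<sigma>. c \<otimes>\<^bsub>RG\<^esub> right_translate a x \<sigma>)"
proof
  fix \<sigma>
  have cx: "(\<lambda>\<sigma>. c \<otimes>\<^bsub>RG\<^esub> x \<sigma>) \<in> chains n" by (rule smult_chains[OF c x])
  have rx: "right_translate a x \<in> chains n" by (rule right_translate_chains[OF x a])
  show "right_translate a (\<lambda>\<sigma>. c \<otimes>\<^bsub>RG\<^esub> x \<sigma>) \<sigma> = c \<otimes>\<^bsub>RG\<^esub> right_translate a x \<sigma>"
  proof (rule pair_ext)
    fix F
    have "pair (right_translate a (\<lambda>\<sigma>. c \<otimes>\<^bsub>RG\<^esub> x \<sigma>) \<sigma>) F = pair c (\<lambda>y. pair (x \<sigma>) (\<lambda>z. F (y \<otimes>\<^bsub>G\<^esub> z \<otimes>\<^bsub>G\<^esub> a)))"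
      by (simp add: pair_right_translate[OF cx a] pair_mult fin_RG[OF c] chainsD(3)[OF x])
    also have "\<dots> = pair c (\<lambda>y. pair (x \<sigma>) (\<lambda>z. F (y \<otimes>\<^bsub>G\<^esub> (z \<otimes>\<^bsub>G\<^esub> a))))"
    proof (intro pair_cong)
      fix g z assume g: "c g \<noteq> 0" and z: "x \<sigma> z \<noteq> 0"
      have "g \<in> carrier G" using c g by (auto simp: mring_carrier)
      moreover have "z \<in> carrier G" using chainsD(2)[OF x] z by blast
      ultimately show "F (g \<otimes>\<^bsub>G\<^esub> z \<otimes>\<^bsub>G\<^esub> a) = F (g \<otimes>\<^bsub>G\<^esub> (z \<otimes>\<^bsub>G\<^esub> a))" using a by (simp add: G.m_assoc)
    qed
    also have "\<dots> = pair (c \<otimes>\<^bsub>RG\<^esub> right_translate a x \<sigma>) F"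
      by (simp add: pair_right_translate[OF x a] pair_mult fin_RG[OF c] chainsD(3)[OF rx])
    finally show "pair (right_translate a (\<lambda>\<sigma>. c \<otimes>\<^bsub>RG\<^esub> x \<sigma>) \<sigma>) F = pair (c \<otimes>\<^bsub>RG\<^esub> right_translate a x \<sigma>) F" .
  qed (use chainsD(3)[OF right_translate_chains[OF cx a]] chainsD(3)[OF smult_chains[OF c rx]] in auto)
qed

definition above :: "real \<Rightarrow> ('v set \<Rightarrow> 'v word set \<Rightarrow> real) \<Rightarrow> bool" where
  "above r x \<longleftrightarrow> (\<forall>\<sigma> g. x \<sigma> g \<noteq> 0 \<longrightarrow> \<chi> g \<ge> r)"

lemma above_add: "above r x \<Longrightarrow> above r y \<Longrightarrow> above r (\<lambda>\<sigma> g. x \<sigma> g + y \<sigma> g)"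
  unfolding above_def by (metis add_0)

lemma above_smult:
  assumes "a \<in> carrier RG" "\<And>g. a g \<noteq> 0 \<Longrightarrow> \<chi> g \<ge> s" "above r x" "x \<in> chains n"
  shows "above (s + r) (\<lambda>\<sigma>. a \<otimes>\<^bsub>RG\<^esub> x \<sigma>)"
  unfolding above_def
proof (intro allI impI)
  fix \<sigma> g assume "(a \<otimes>\<^bsub>RG\<^esub> x \<sigma>) g \<noteq> 0"
  then obtain y z where yz: "a y \<noteq> 0" "x \<sigma> z \<noteq> 0" "g = y \<otimes>\<^bsub>G\<^esub> z"
    using mring_mult_support[where f = a and h = "x \<sigma>" and M = G] by auto
  have "y \<in> carrier G" using assms(1) yz(1) by (auto simp: mring_carrier)
  moreover have "z \<in> carrier G" using chainsD(2)[OF assms(4)] yz(2) by blast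
  ultimately show "\<chi> g \<ge> s + r" using assms(2)[OF yz(1)] assms(3) yz by (auto simp: chi_mult above_def intro: add_mono)
qed

lemma above_dif:
  assumes "above r x" "x \<in> chains (Suc n)"
  shows "above r (dif x)"
  unfolding above_def
proof (intro allI impI, rule ccontr)
  fix \<tau> g assume nz: "dif x \<tau> g \<noteq> 0" and neg: "\<not> \<chi> g \<ge> r"
  have g: "g \<in> carrier G" using nz by (auto simp: dif_def split: if_splits)
  have "x (insert v \<tau>) (g \<otimes>\<^bsub>G\<^esub> inv\<^bsub>G\<^esub> gam v) = 0" if "v \<in> V" for v
    using assms(1) neg chi_gam[OF that] g gam_closed[OF that]
    by (force simp: above_def chi_mult chi_inv)
  moreover have "x (insert v \<tau>) g = 0" for v using assms(1) neg by (auto simp: above_def)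
  ultimately have "dif x \<tau> g = 0" by (simp add: dif_def)
  thus False using nz by simp
qed

lemma above_finsum:
  assumes "finite A" "h \<in> A \<rightarrow> chains n" "\<And>a. a \<in> A \<Longrightarrow> above r (h a)"
  shows "above r (\<Oplus>\<^bsub>Cmod n\<^esub>a\<in>A. h a)"
proof -
  interpret C: left_module R "Cmod n" by (rule left_module_Cmod)
  show ?thesis using assms
  proof (induction A rule: finite_induct)
    case empty
    show ?case by (simp add: Cmod_simps above_def)
  next
    case (insert a A)
    have "h \<in> A \<rightarrow> carrier (Cmod n)" "h a \<in> carrier (Cmod n)" using insert.prems(1) by (auto simp: Cmod_carrier)
    hence "(\<Oplus>\<^bsub>Cmod n\<^esub>a\<in>insert a A. h a) = (\<lambda>\<sigma> g. h a \<sigma> g + (\<Oplus>\<^bsub>Cmod n\<^esub>a\<in>A. h a) \<sigma> g)"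
      using insert.hyps by (simp add: C.finsum_insert Cmod_simps)
    thus ?case using insert above_add[of r "h a"] by simp
  qed
qed

text \<open>The chains over \<open>\<chi> \<ge> - \<chi> t\<close>: a subcomplex, free over
  \<open>R\<close> in each degree by \<open>Cabove_retract\<close>, which contains the translates of
  the basis cubes by the inverse of \<open>t\<close>.\<close>

definition Cabove :: "'v word set \<Rightarrow> nat \<Rightarrow> ('v word set \<Rightarrow> real, 'v set \<Rightarrow> 'v word set \<Rightarrow> real) module" where
  "Cabove t n = (Cmod n)\<lparr>carrier := {x \<in> chains n. above (- \<chi> t) x}\<rparr>"

lemma Cabove_simps: "carrier (Cabove t n) = {x \<in> chains n. above (- \<chi> t) x}"
  "\<zero>\<^bsub>Cabove t n\<^esub> = (\<lambda>_ _. 0)" "x \<oplus>\<^bsub>Cabove t n\<^esub> y = (\<lambda>\<sigma> g. x \<sigma> g + y \<sigma> g)"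
  "a \<odot>\<^bsub>Cabove t n\<^esub> x = (\<lambda>\<sigma>. a \<otimes>\<^bsub>RG\<^esub> x \<sigma>)"
  by (simp_all add: Cabove_def Cmod_simps)

lemma left_module_Cabove: "left_module R (Cabove t n)"
  unfolding Cabove_def
proof (rule left_module_submodule[OF left_module_Cmod])
  fix a x assume "a \<in> carrier R" "x \<in> {x \<in> chains n. above (- \<chi> t) x}"
  thus "a \<odot>\<^bsub>Cmod n\<^esub> x \<in> {x \<in> chains n. above (- \<chi> t) x}"
    using above_smult[of a 0 "- \<chi> t" x n] by (simp add: Cmod_simps smult_chains R_carrier)
next
  fix x assume "x \<in> {x \<in> chains n. above (- \<chi> t) x}"
  thus "\<exists>y\<in>{x \<in> chains n. above (- \<chi> t) x}. y \<oplus>\<^bsub>Cmod n\<^esub> x = \<zero>\<^bsub>Cmod n\<^esub>"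
    using chains_scale[of x n "-1"] by (intro bexI[of _ "\<lambda>\<sigma> g. - x \<sigma> g"]) (auto simp: Cmod_simps above_def)
qed (auto simp: Cmod_simps Cmod_carrier chains_zero chains_add above_add, simp add: above_def)

lemma Cabove_retract:
  assumes t: "t \<in> carrier G"
  shows "right_translate t \<in> linear_maps R (Cabove t n) (free_module R (cliques n))"
    "right_translate (inv\<^bsub>G\<^esub> t) \<in> linear_maps R (free_module R (cliques n)) (Cabove t n)"
    "x \<in> carrier (Cabove t n) \<Longrightarrow> right_translate (inv\<^bsub>G\<^esub> t) (right_translate t x) = x"
proof -
  have add: "right_translate a (\<lambda>\<sigma> g. x \<sigma> g + y \<sigma> g) = (\<lambda>\<sigma> g. right_translate a x \<sigma> g + right_translate a y \<sigma> g)" for a x y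
    by (auto simp: right_translate_def fun_eq_iff)
  have ab: "above (r + \<chi> a) (right_translate a x)" if "above r x" "a \<in> carrier G" for r a x
    unfolding above_def
  proof (intro allI impI)
    fix \<sigma> g assume "right_translate a x \<sigma> g \<noteq> 0"
    hence g: "g \<in> carrier G" "x \<sigma> (g \<otimes>\<^bsub>G\<^esub> inv\<^bsub>G\<^esub> a) \<noteq> 0" by (auto simp: right_translate_def split: if_splits)
    hence "\<chi> (g \<otimes>\<^bsub>G\<^esub> inv\<^bsub>G\<^esub> a) \<ge> r" using that(1) by (auto simp: above_def)
    thus "\<chi> g \<ge> r + \<chi> a" using g(1) that(2) by (simp add: chi_mult chi_inv)
  qed
  show "right_translate t \<in> linear_maps R (Cabove t n) (free_module R (cliques n))"
  proof (rule linear_mapsI, fold Cpos_def)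
    fix x assume "x \<in> carrier (Cabove t n)"
    thus "right_translate t x \<in> carrier (Cpos n)"
      using ab[of "- \<chi> t" x t] t by (auto simp: Cabove_simps Cpos_carrier right_translate_chains above_def)
  qed (auto simp: Cabove_simps Cpos_simps add right_translate_smult[OF _ _ t] R_carrier)
  show "right_translate (inv\<^bsub>G\<^esub> t) \<in> linear_maps R (free_module R (cliques n)) (Cabove t n)"
  proof (rule linear_mapsI, fold Cpos_def)
    fix x assume "x \<in> carrier (Cpos n)"
    thus "right_translate (inv\<^bsub>G\<^esub> t) x \<in> carrier (Cabove t n)"
      using ab[of 0 x "inv\<^bsub>G\<^esub> t"] t by (auto simp: Cabove_simps Cpos_carrier right_translate_chains above_def chi_inv)
  qed (auto simp: Cabove_simps Cpos_simps Cpos_carrier add right_translate_smult[of _ _ n] t R_carrier)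
  show "right_translate (inv\<^bsub>G\<^esub> t) (right_translate t x) = x" if "x \<in> carrier (Cabove t n)"
  proof (intro ext)
    fix \<sigma> g
    have "x \<in> chains n" using that by (simp add: Cabove_simps)
    thus "right_translate (inv\<^bsub>G\<^esub> t) (right_translate t x) \<sigma> g = x \<sigma> g"
      using t chainsD(2)[of x n g \<sigma>] by (simp add: right_translate_def G.m_assoc)
  qed
qed

lemma Cmod_exact: "x \<in> carrier (Cmod (Suc n)) \<Longrightarrow> dif x = \<zero>\<^bsub>Cmod n\<^esub> \<Longrightarrow> x \<in> dif ` carrier (Cmod (Suc (Suc n)))"
  using chains_acyclic[of x "Suc n"] by (force simp: Cmod_carrier Cmod_simps)

lemma Cmod_exact_0: "x \<in> carrier (Cmod 0) \<Longrightarrow> aug x = \<zero>\<^bsub>trivial_module\<^esub> \<Longrightarrow> x \<in> dif ` carrier (Cmod 1)"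
  using chains_acyclic[of x 0] dif_chains_0[of x] by (force simp: Cmod_carrier trivial_simps)

section \<open>Evaluation at exponentials\<close>

text \<open>On the group ring this is the ring homomorphism that sends \<open>g\<close> to
  \<open>exp (- s * \<chi> g)\<close>. \<open>Ev\<close> applies it to all coefficients, that is, it
  tensors the complex of cubes with a one-dimensional real representation.\<close>

definition ev :: "real \<Rightarrow> ('v word set \<Rightarrow> real) \<Rightarrow> real" where
  "ev s f = pair f (\<lambda>g. exp (- s * \<chi> g))"

definition Ev :: "real \<Rightarrow> ('v set \<Rightarrow> 'v word set \<Rightarrow> real) \<Rightarrow> 'v set \<Rightarrow> real" where
  "Ev s x \<sigma> = ev s (x \<sigma>)"

lemma Ev_space: "x \<in> chains n \<Longrightarrow> Ev s x \<in> cochain_space n"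
  by (auto simp: Ev_def ev_def cochain_space_def pair_def chainsD(1))

lemma Ev_add: "x \<in> chains n \<Longrightarrow> y \<in> chains n \<Longrightarrow> Ev s (\<lambda>\<sigma> g. x \<sigma> g + y \<sigma> g) \<sigma> = Ev s x \<sigma> + Ev s y \<sigma>"
  unfolding Ev_def ev_def by (rule pair_add) (rule chainsD(3), assumption)+

lemma ev_mult:
  assumes "a \<in> carrier RG" "b \<in> carrier RG"
  shows "ev s (a \<otimes>\<^bsub>RG\<^esub> b) = ev s a * ev s b"
proof -
  have "ev s (a \<otimes>\<^bsub>RG\<^esub> b) = pair a (\<lambda>y. pair b (\<lambda>z. exp (- s * \<chi> (y \<otimes>\<^bsub>G\<^esub> z))))"
    unfolding ev_def by (rule pair_mult) (use assms fin_RG in auto)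
  also have "\<dots> = pair a (\<lambda>y. pair b (\<lambda>z. exp (- s * \<chi> y) * exp (- s * \<chi> z)))"
  proof (intro pair_cong)
    fix y z assume "a y \<noteq> 0" "b z \<noteq> 0"
    hence "y \<in> carrier G" "z \<in> carrier G" using assms by (auto simp: mring_carrier)
    thus "exp (- s * \<chi> (y \<otimes>\<^bsub>G\<^esub> z)) = exp (- s * \<chi> y) * exp (- s * \<chi> z)"
      by (simp add: chi_mult algebra_simps exp_add[symmetric])
  qed
  also have "\<dots> = pair a (\<lambda>y. exp (- s * \<chi> y) * ev s b)" by (simp add: pair_scale_right ev_def)
  also have "\<dots> = ev s a * ev s b" by (simp add: pair_def ev_def sum_distrib_right mult.assoc)
  finally show ?thesis .
qed

lemma chains_RG: "x \<in> chains n \<Longrightarrow> x \<sigma> \<in> carrier RG"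
  by (auto simp: mring_carrier chains_def)

lemma Ev_smult: "a \<in> carrier RG \<Longrightarrow> x \<in> chains n \<Longrightarrow> Ev s (\<lambda>\<sigma>. a \<otimes>\<^bsub>RG\<^esub> x \<sigma>) \<sigma> = ev s a * Ev s x \<sigma>"
  by (simp add: Ev_def ev_mult chains_RG)

lemma Ev_dif:
  assumes x: "x \<in> chains n"
  shows "Ev s (dif x) = bd (\<lambda>v. exp (- s * \<chi> (gam v)) - 1) (Ev s x)"
proof
  fix \<tau>
  have "Ev s (dif x) \<tau> = (\<Sum>v\<in>V - \<tau>. eps v \<tau> * pair (x (insert v \<tau>)) (\<lambda>g. exp (- s * \<chi> (g \<otimes>\<^bsub>G\<^esub> gam v)) - exp (- s * \<chi> g)))"
    unfolding Ev_def ev_def by (rule pair_dif[OF x])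
  also have "\<dots> = (\<Sum>v\<in>V - \<tau>. eps v \<tau> * pair (x (insert v \<tau>)) (\<lambda>g. (exp (- s * \<chi> (gam v)) - 1) * exp (- s * \<chi> g)))"
  proof (intro sum.cong arg_cong2[of _ _ _ _ times] pair_cong HOL.refl)
    fix v g assume v: "v \<in> V - \<tau>" and z: "x (insert v \<tau>) g \<noteq> 0"
    have "g \<in> carrier G" using chainsD(2)[OF x] z by blast
    thus "exp (- s * \<chi> (g \<otimes>\<^bsub>G\<^esub> gam v)) - exp (- s * \<chi> g) = (exp (- s * \<chi> (gam v)) - 1) * exp (- s * \<chi> g)"
      using v gam_closed by (simp add: chi_mult algebra_simps exp_add[symmetric])
  qed
  finally show "Ev s (dif x) \<tau> = bd (\<lambda>v. exp (- s * \<chi> (gam v)) - 1) (Ev s x) \<tau>"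
    by (simp add: bd_def pair_scale_right Ev_def ev_def mult.assoc)
qed

lemma Ev_finsum:
  assumes "finite A" "h \<in> A \<rightarrow> chains n"
  shows "Ev s (\<Oplus>\<^bsub>Cmod n\<^esub>a\<in>A. h a) \<sigma> = (\<Sum>a\<in>A. Ev s (h a) \<sigma>)"
proof -
  interpret C: left_module R "Cmod n" by (rule left_module_Cmod)
  show ?thesis using assms
  proof (induction A rule: finite_induct)
    case empty
    show ?case by (simp add: Cmod_simps Ev_def ev_def)
  next
    case (insert a A)
    have h: "h \<in> A \<rightarrow> carrier (Cmod n)" "h a \<in> carrier (Cmod n)" using insert.prems(1) by (auto simp: Cmod_carrier)
    hence "(\<Oplus>\<^bsub>Cmod n\<^esub>a\<in>insert a A. h a) = (\<lambda>\<sigma> g. h a \<sigma> g + (\<Oplus>\<^bsub>Cmod n\<^esub>a\<in>A. h a) \<sigma> g)"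
      using insert.hyps by (simp add: C.finsum_insert Cmod_simps)
    moreover have "(\<Oplus>\<^bsub>Cmod n\<^esub>a\<in>A. h a) \<in> chains n" using C.finsum_closed[OF h(1)] by (simp add: Cmod_carrier)
    ultimately show ?case using insert h(2) Ev_add[of "h a" n] by (simp add: Cmod_carrier)
  qed
qed

text \<open>A linear map on \<open>Cpos\<close> is determined by its values on unit vectors, so
  evaluation turns it into a real matrix. In particular, chains in \<open>Cpos\<close> whose
  evaluation vanishes are sent to such chains again.\<close>

lemma Ev_linear_map:
  assumes f: "f \<in> linear_maps R (Cpos n) (Cmod m)" and y: "y \<in> carrier (Cpos n)"
  shows "Ev s (f y) \<sigma> = (\<Sum>\<tau>\<in>cliques n. Ev s y \<tau> * Ev s (f (unit_vec R \<tau>)) \<sigma>)"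
proof -
  have u: "unit_vec R \<tau> \<in> carrier (Cpos n)" if "\<tau> \<in> cliques n" for \<tau>
    unfolding Cpos_def by (rule unit_vec_carrier[OF ring_R that])
  have fu: "f (unit_vec R \<tau>) \<in> chains m" if "\<tau> \<in> cliques n" for \<tau>
    using linear_mapsD(1)[OF f u[OF that]] by (simp add: Cmod_carrier)
  have yR: "y \<tau> \<in> carrier R" for \<tau> using y by (simp add: Cpos_def free_module_carrier)
  have "f y = free_lift R (Cmod m) (\<lambda>\<tau>. f (unit_vec R \<tau>)) y"
    by (rule linear_map_free_eq[OF left_module_Cmod f[unfolded Cpos_def] y[unfolded Cpos_def]])
  also have "\<dots> = (\<Oplus>\<^bsub>Cmod m\<^esub>\<tau>\<in>cliques n. y \<tau> \<odot>\<^bsub>Cmod m\<^esub> f (unit_vec R \<tau>))"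
    by (rule free_lift_superset[OF left_module_Cmod _ y[unfolded Cpos_def] finite_cliques])
      (use y fu in \<open>auto simp: Cpos_def free_module_carrier Cmod_carrier\<close>)
  finally have "Ev s (f y) \<sigma> = (\<Sum>\<tau>\<in>cliques n. Ev s (y \<tau> \<odot>\<^bsub>Cmod m\<^esub> f (unit_vec R \<tau>)) \<sigma>)"
    using Ev_finsum[OF finite_cliques[of n], of "\<lambda>\<tau>. y \<tau> \<odot>\<^bsub>Cmod m\<^esub> f (unit_vec R \<tau>)" m s \<sigma>] fu yR
    by (auto simp: Cmod_simps smult_chains R_carrier)
  also have "\<dots> = (\<Sum>\<tau>\<in>cliques n. Ev s y \<tau> * Ev s (f (unit_vec R \<tau>)) \<sigma>)"
  proof (intro sum.cong HOL.refl)
    fix \<tau> assume "\<tau> \<in> cliques n"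
    thus "Ev s (y \<tau> \<odot>\<^bsub>Cmod m\<^esub> f (unit_vec R \<tau>)) \<sigma> = Ev s y \<tau> * Ev s (f (unit_vec R \<tau>)) \<sigma>"
      using Ev_smult[OF _ fu, of "y \<tau>" \<tau> s \<sigma>] yR[of \<tau>] by (simp add: Cmod_simps R_carrier Ev_def[of s y])
  qed
  finally show ?thesis .
qed

lemma chi_pow: "g \<in> carrier G \<Longrightarrow> \<chi> (g [^]\<^bsub>G\<^esub> (n::nat)) = n * \<chi> g"
  by (induction n) (auto simp: chi_one chi_mult algebra_simps)

lemma chi_unbounded:
  assumes "\<exists>g\<in>carrier G. \<chi> g \<noteq> 0"
  obtains t where "t \<in> carrier G" "\<chi> t > r"
proof -
  obtain g where g: "g \<in> carrier G" "\<chi> g \<noteq> 0" using assms by blast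
  obtain h where h: "h \<in> carrier G" "\<chi> h > 0"
  proof (cases "\<chi> g > 0")
    case False
    thus ?thesis using that[of "inv\<^bsub>G\<^esub> g"] g by (simp add: chi_inv)
  qed (use that g in blast)
  obtain n :: nat where "r < n * \<chi> h" using reals_Archimedean3[OF h(2)] by blast
  thus ?thesis using that[of "h [^]\<^bsub>G\<^esub> n"] h by (simp add: chi_pow)
qed

lemma ev_tendsto_0:
  assumes "finite {g. f g \<noteq> 0}" "\<And>g. f g \<noteq> 0 \<Longrightarrow> \<chi> g > 0"
  shows "((\<lambda>s. ev s f) \<longlongrightarrow> 0) at_top"
proof -
  have "((\<lambda>s. \<Sum>g\<in>{g. f g \<noteq> 0}. f g * exp (- s * \<chi> g)) \<longlongrightarrow> (\<Sum>g\<in>{g. f g \<noteq> 0}. 0)) at_top"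
  proof (rule tendsto_sum)
    fix g assume "g \<in> {g. f g \<noteq> 0}"
    hence p: "\<chi> g > 0" using assms(2) by simp
    have "filterlim (\<lambda>s. s * \<chi> g) at_top at_top"
      by (rule filterlim_at_top_mult_tendsto_pos[OF tendsto_const p filterlim_ident])
    hence "filterlim (\<lambda>s. - (s * \<chi> g)) at_bot at_top" by (simp add: filterlim_uminus_at_bot)
    hence "((\<lambda>s. exp (- (s * \<chi> g))) \<longlongrightarrow> 0) at_top" by (rule filterlim_compose[OF exp_at_bot])
    hence "((\<lambda>s. f g * exp (- (s * \<chi> g))) \<longlongrightarrow> f g * 0) at_top" by (rule tendsto_mult_left)
    thus "((\<lambda>s. f g * exp (- s * \<chi> g)) \<longlongrightarrow> 0) at_top" by simp
  qed
  thus ?thesis by (simp add: ev_def pair_def)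
qed

lemma translate_unit:
  assumes t: "t \<in> carrier G"
  shows "(\<lambda>g. if g = t then 1 else 0) \<otimes>\<^bsub>RG\<^esub> (\<lambda>g. if g = inv\<^bsub>G\<^esub> t then 1 else 0) = \<one>\<^bsub>R\<^esub>"
    "(\<lambda>g. if g = t then 1 else 0) \<otimes>\<^bsub>RG\<^esub> (\<lambda>g. 0) = (\<lambda>g. 0)"
proof -
  have f: "finite {g. (if g = a then 1 else (0::real)) \<noteq> 0}" for a :: "'v word set"
    by (rule finite_subset[of _ "{a}"]) auto
  show "(\<lambda>g. if g = t then 1 else 0) \<otimes>\<^bsub>RG\<^esub> (\<lambda>g. if g = inv\<^bsub>G\<^esub> t then 1 else 0) = \<one>\<^bsub>R\<^esub>"
  proof (rule pair_ext)
    show "pair ((\<lambda>g. if g = t then 1 else 0) \<otimes>\<^bsub>RG\<^esub> (\<lambda>g. if g = inv\<^bsub>G\<^esub> t then 1 else 0)) F = pair \<one>\<^bsub>R\<^esub> F" for F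
      unfolding pair_mult[OF f f] mring_simps(3) pair_unit using t by (simp add: Gp_simps)
  qed (use mring_mult_finite[OF f f, where M = G] f in \<open>auto simp: mring_simps(3)\<close>)
  interpret RG: ring RG by (rule ring_RG)
  have "(\<lambda>g. if g = t then 1 else 0) \<in> carrier RG" using t f by (auto simp: mring_carrier)
  from RG.r_null[OF this] show "(\<lambda>g. if g = t then 1 else 0) \<otimes>\<^bsub>RG\<^esub> (\<lambda>g. 0) = (\<lambda>g. 0)"
    by (simp add: mring_simps)
qed

text \<open>A harmonic \<open>x\<close> is spread over the cubes at the identity as the chain
  \<open>Y\<close>, which the homotopy writes as \<open>ph i Y\<close> plus a boundary plus a term
  coming from \<open>dif Y\<close>. After evaluation the last term vanishes since
  \<open>bd lam x = 0\<close>, and the boundary is orthogonal to \<open>x\<close> since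
  \<open>cod lam x = 0\<close>. What is left bounds the norm of \<open>x\<close> by a fraction of
  itself.\<close>

theorem FP_imp_exact:
  assumes FP: "type_FP q R (trivial_module :: ('v word set \<Rightarrow> real, real) module)"
    and nz: "\<exists>g\<in>carrier G. \<chi> g \<noteq> 0" and iq: "i \<le> q"
  shows "exact_at (\<lambda>v. \<chi> (gam v)) i"
proof -
  let ?T = "trivial_module :: ('v word set \<Rightarrow> real, real) module"
  obtain P :: "nat \<Rightarrow> ('v word set \<Rightarrow> real, (('v word set \<Rightarrow> real) + real) list) module" and d \<epsilon>
    where res: "projective_resolution R ?T P d \<epsilon>" and fg: "\<And>i. i \<le> q \<Longrightarrow> finitely_generated_module R (P i)"
    using FP unfolding type_FP_def by blast
  have Pp: "projective_module R (P n)" and e: "\<epsilon> \<in> linear_maps R (P 0) ?T"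
    and d: "d n \<in> linear_maps R (P (Suc n)) (P n)" and es: "\<epsilon> ` carrier (P 0) = carrier ?T"
    and d0: "d 0 ` carrier (P 1) = {x \<in> carrier (P 0). \<epsilon> x = \<zero>\<^bsub>?T\<^esub>}"
    and dd: "d (Suc n) ` carrier (P (Suc (Suc n))) = {x \<in> carrier (P (Suc n)). d n x = \<zero>\<^bsub>P n\<^esub>}" for n
    using res unfolding projective_resolution_def by auto
  have PL: "left_module R (P n)" for n using Pp[of n] by (simp add: projective_module_def)
  have surj: "r \<in> aug ` carrier (Cmod 0)" for r :: real
  proof -
    define x0 where "x0 \<sigma> g = (if \<sigma> = {} \<and> g = \<one>\<^bsub>G\<^esub> then r else 0)" for \<sigma> :: "'v set" and g
    have fin: "finite {g. x0 \<sigma> g \<noteq> 0}" for \<sigma>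
      by (rule finite_subset[of _ "{\<one>\<^bsub>G\<^esub>}"]) (auto simp: x0_def split: if_splits)
    have "x0 \<in> chains 0" using fin by (intro chainsI) (auto simp: cliques_0 x0_def)
    moreover have "aug x0 = r"
    proof -
      have "{g. x0 {} g \<noteq> 0} \<subseteq> {\<one>\<^bsub>G\<^esub>}" by (auto simp: x0_def split: if_splits)
      thus ?thesis using pair_superset[of "{\<one>\<^bsub>G\<^esub>}" "x0 {}" "\<lambda>_. 1"] by (simp add: aug_def) (simp add: x0_def)
    qed
    ultimately show ?thesis by (force simp: Cmod_carrier)
  qed
  have "\<exists>g. (\<forall>n. g n \<in> linear_maps R (P n) (Cmod n)) \<and> (\<forall>x\<in>carrier (P 0). aug (g 0 x) = \<epsilon> x) \<and>
     (\<forall>n. \<forall>x\<in>carrier (P (Suc n)). dif (g (Suc n) x) = g n (d n x))"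
  proof (rule comparison[OF PL left_module_Cmod left_module_T projective_retract[OF Pp] e aug_linear d dif_linear surj])
    fix n x
    show "\<epsilon> (d 0 x) = \<zero>\<^bsub>?T\<^esub>" if "x \<in> carrier (P 1)"
      using imageI[OF that, of "d 0"] unfolding d0 by simp
    show "d n (d (Suc n) x) = \<zero>\<^bsub>P n\<^esub>" if "x \<in> carrier (P (Suc (Suc n)))"
      using imageI[OF that, of "d (Suc n)"] unfolding dd by simp
  qed (rule Cmod_exact_0 Cmod_exact, assumption, assumption)+
  then obtain g where g: "\<And>n. g n \<in> linear_maps R (P n) (Cmod n)" "\<And>x. x \<in> carrier (P 0) \<Longrightarrow> aug (g 0 x) = \<epsilon> x"
     "\<And>n x. x \<in> carrier (P (Suc n)) \<Longrightarrow> dif (g (Suc n) x) = g n (d n x)" by blast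
  \<comment> \<open>Finitely many generators have images of finite support, and scalars from
    \<open>R\<close> do not lower the height. The bound depends on \<open>g\<close> alone, so
    \<open>t\<close> can be chosen after it.\<close>
  have "\<exists>r. \<forall>x\<in>carrier (P i). above r (g i x)"
  proof -
    interpret P: left_module R "P i" by (rule PL)
    obtain B where B: "finite B" "B \<subseteq> carrier (P i)"
      "\<And>x. x \<in> carrier (P i) \<Longrightarrow> \<exists>c\<in>B \<rightarrow> carrier R. x = (\<Oplus>\<^bsub>P i\<^esub>b\<in>B. c b \<odot>\<^bsub>P i\<^esub> b)"
      using fg[OF iq] unfolding finitely_generated_module_def by blast
    have gB: "g i b \<in> chains i" if "b \<in> B" for b using linear_mapsD(1)[OF g(1)] B(2) that by (auto simp: Cmod_carrier)
    define S where "S = (\<Union>b\<in>B. \<Union>\<sigma>\<in>cliques i. \<chi> ` {h. g i b \<sigma> h \<noteq> 0})"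
    have S: "finite S" unfolding S_def using B(1) finite_cliques chainsD(3)[OF gB] by auto
    define r where "r = Min (insert 0 S)"
    have gr: "above r (g i b)" if "b \<in> B" for b
      unfolding above_def
    proof (intro allI impI)
      fix \<sigma> h assume nz: "g i b \<sigma> h \<noteq> 0"
      hence "\<sigma> \<in> cliques i" using chainsD(1)[OF gB[OF that]] by blast
      hence "\<chi> h \<in> S" using that nz by (auto simp: S_def)
      thus "\<chi> h \<ge> r" unfolding r_def using S by (intro Min_le) auto
    qed
    have "above r (g i x)" if x: "x \<in> carrier (P i)" for x
    proof -
      obtain c where c: "c \<in> B \<rightarrow> carrier R" "x = (\<Oplus>\<^bsub>P i\<^esub>b\<in>B. c b \<odot>\<^bsub>P i\<^esub> b)" using B(3)[OF x] by blast
      have cb: "(\<lambda>b. c b \<odot>\<^bsub>P i\<^esub> b) \<in> B \<rightarrow> carrier (P i)"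
      proof (rule funcsetI)
        fix b assume "b \<in> B"
        hence "c b \<in> carrier R" "b \<in> carrier (P i)" using c(1) B(2) by auto
        thus "c b \<odot>\<^bsub>P i\<^esub> b \<in> carrier (P i)" by (rule P.smult_closed)
      qed
      have "g i x = (\<Oplus>\<^bsub>Cmod i\<^esub>b\<in>B. g i (c b \<odot>\<^bsub>P i\<^esub> b))"
        unfolding c(2) by (rule linear_map_finsum[OF PL left_module_Cmod g(1) B(1) cb])
      moreover have "above r (\<Oplus>\<^bsub>Cmod i\<^esub>b\<in>B. g i (c b \<odot>\<^bsub>P i\<^esub> b))"
      proof (rule above_finsum[OF B(1)])
        show "(\<lambda>b. g i (c b \<odot>\<^bsub>P i\<^esub> b)) \<in> B \<rightarrow> chains i"
          using linear_mapsD(1)[OF g(1)] cb by (auto simp: Cmod_carrier)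
        fix b assume b: "b \<in> B"
        have cR: "c b \<in> carrier R" using c(1) b by auto
        have "g i (c b \<odot>\<^bsub>P i\<^esub> b) = (\<lambda>\<sigma>. c b \<otimes>\<^bsub>RG\<^esub> g i b \<sigma>)"
          using linear_mapsD(3)[OF g(1) cR] b B(2) by (auto simp: Cmod_simps)
        thus "above r (g i (c b \<odot>\<^bsub>P i\<^esub> b))"
          using above_smult[of "c b" 0 r "g i b" i] cR gr[OF b] gB[OF b] by (simp add: R_carrier)
      qed
      ultimately show ?thesis by simp
    qed
    thus ?thesis by blast
  qed
  then obtain r where r: "\<And>x. x \<in> carrier (P i) \<Longrightarrow> above r (g i x)" by blast
  \<comment> \<open>\<open>\<chi> t > - r\<close> will lift images above height 0;
    \<open>\<chi> t > 0\<close> makes \<open>Cpos\<close> part of the half space.\<close>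
  obtain t where t: "t \<in> carrier G" "\<chi> t > max 0 (- r)" by (rule chi_unbounded[OF nz])
  let ?D = "Cabove t"
  have DC: "x \<in> carrier (Cmod n)" if "x \<in> carrier (?D n)" for n x
    using that by (simp add: Cabove_simps Cmod_carrier)
  have auD: "aug \<in> linear_maps R (?D 0) ?T"
    using aug_linear by (auto simp: linear_maps_def Cabove_simps Cmod_simps Cmod_carrier)
  have diD: "dif \<in> linear_maps R (?D (Suc n)) (?D n)" for n
    using dif_linear[of n] above_dif by (auto simp: linear_maps_def Cabove_simps Cmod_simps Cmod_carrier)
  have retD: "\<exists>(X :: 'v set set) \<iota> \<pi>. \<iota> \<in> linear_maps R (?D n) (free_module R X) \<and>
      \<pi> \<in> linear_maps R (free_module R X) (?D n) \<and> (\<forall>x\<in>carrier (?D n). \<pi> (\<iota> x) = x)" for n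
    by (rule exI[of _ "cliques n"], rule exI[of _ "right_translate t"], rule exI[of _ "right_translate (inv\<^bsub>G\<^esub> t)"])
      (use Cabove_retract[OF t(1), where n = n] in blast)
  have "\<exists>f. (\<forall>n. f n \<in> linear_maps R (?D n) (P n)) \<and> (\<forall>x\<in>carrier (?D 0). \<epsilon> (f 0 x) = aug x) \<and>
     (\<forall>n. \<forall>x\<in>carrier (?D (Suc n)). d n (f (Suc n) x) = f n (dif x))"
  proof (rule comparison[OF left_module_Cabove PL left_module_T retD auD e diD d])
    fix x
    show "aug x \<in> \<epsilon> ` carrier (P 0)" using es by (simp add: trivial_simps)
    show "aug (dif x) = \<zero>\<^bsub>?T\<^esub>" if "x \<in> carrier (?D 1)"
      using that aug_dif[of x 1] by (simp add: Cabove_simps trivial_simps)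
    show "dif (dif x) = \<zero>\<^bsub>?D n\<^esub>" if "x \<in> carrier (?D (Suc (Suc n)))" for n
      using that dif_dif[of x "Suc (Suc n)"] by (auto simp: Cabove_simps fun_eq_iff)
  next
    fix y
    show "y \<in> d 0 ` carrier (P 1)" if "y \<in> carrier (P 0)" "\<epsilon> y = \<zero>\<^bsub>?T\<^esub>" using that d0 by blast
    show "y \<in> d (Suc n) ` carrier (P (Suc (Suc n)))" if "y \<in> carrier (P (Suc n))" "d n y = \<zero>\<^bsub>P n\<^esub>" for n
      using that dd by blast
  qed
  then obtain f where f: "\<And>n. f n \<in> linear_maps R (?D n) (P n)" "\<And>x. x \<in> carrier (?D 0) \<Longrightarrow> \<epsilon> (f 0 x) = aug x"
     "\<And>n x. x \<in> carrier (?D (Suc n)) \<Longrightarrow> d n (f (Suc n) x) = f n (dif x)" by blast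
  define ph where "ph n x = g n (f n x)" for n x
  have ph: "ph n \<in> linear_maps R (?D n) (Cmod n)" for n
    unfolding ph_def[abs_def] by (rule linear_maps_compose[OF f(1) g(1)])
  have ph0: "aug (ph 0 x) = aug x" if "x \<in> carrier (?D 0)" for x
    unfolding ph_def using f(2)[OF that] g(2)[OF linear_mapsD(1)[OF f(1) that]] by simp
  have phd: "dif (ph (Suc n) x) = ph n (dif x)" if "x \<in> carrier (?D (Suc n))" for n x
    unfolding ph_def using f(3)[OF that] g(3)[OF linear_mapsD(1)[OF f(1) that]] by simp
  \<comment> \<open>\<open>s\<close> is to be a homotopy from the inclusion to \<open>ph\<close>.
    The equation on cycles is what solvability in the next degree requires; in degree 0 it holds for
    all chains.\<close>
  define good where "good n s \<longleftrightarrow> s \<in> linear_maps R (?D n) (Cmod (Suc n)) \<and>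
    (n = 0 \<longrightarrow> (\<forall>x\<in>carrier (?D 0). dif (s x) = (\<lambda>\<sigma> h. x \<sigma> h - ph 0 x \<sigma> h))) \<and>
    (\<forall>x\<in>carrier (?D n). dif x = (\<lambda>_ _. 0) \<longrightarrow> dif (s x) = (\<lambda>\<sigma> h. x \<sigma> h - ph n x \<sigma> h))" for n s
  have lin_diff: "(\<lambda>x \<sigma> h. a x \<sigma> h - b x \<sigma> h) \<in> linear_maps R (?D n) (Cmod m)"
    if a: "a \<in> linear_maps R (?D n) (Cmod m)" and b: "b \<in> linear_maps R (?D n) (Cmod m)" for a b n m
  proof (rule linear_mapsI)
    fix c x assume c: "c \<in> carrier R" and x: "x \<in> carrier (?D n)"
    have ax: "a x \<in> chains m" "b x \<in> chains m"
      using linear_mapsD(1)[OF a x] linear_mapsD(1)[OF b x] by (auto simp: Cmod_carrier)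
    have cR: "c \<in> carrier RG" using c by (simp add: R_carrier)
    interpret C: left_module R "Cmod m" by (rule left_module_Cmod)
    have "c \<odot>\<^bsub>Cmod m\<^esub> a x = c \<odot>\<^bsub>Cmod m\<^esub> ((\<lambda>\<sigma> h. a x \<sigma> h - b x \<sigma> h) \<oplus>\<^bsub>Cmod m\<^esub> b x)"
      by (simp add: Cmod_simps)
    also have "\<dots> = c \<odot>\<^bsub>Cmod m\<^esub> (\<lambda>\<sigma> h. a x \<sigma> h - b x \<sigma> h) \<oplus>\<^bsub>Cmod m\<^esub> c \<odot>\<^bsub>Cmod m\<^esub> b x"
      by (rule C.smult_r_distr[OF c]) (use ax chains_diff in \<open>auto simp: Cmod_carrier\<close>)
    finally show "(\<lambda>\<sigma> h. a (c \<odot>\<^bsub>?D n\<^esub> x) \<sigma> h - b (c \<odot>\<^bsub>?D n\<^esub> x) \<sigma> h) = c \<odot>\<^bsub>Cmod m\<^esub> (\<lambda>\<sigma> h. a x \<sigma> h - b x \<sigma> h)"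
      unfolding linear_mapsD(3)[OF a c x] linear_mapsD(3)[OF b c x] by (auto simp: Cmod_simps fun_eq_iff)
  qed (use linear_mapsD[OF a] linear_mapsD[OF b] in \<open>auto simp: Cmod_simps Cmod_carrier chains_diff fun_eq_iff\<close>)
  have idD: "(\<lambda>x. x) \<in> linear_maps R (?D n) (Cmod n)" for n
    by (rule linear_mapsI) (auto simp: Cabove_simps Cmod_simps Cmod_carrier)
  have liftD: "\<exists>w\<in>linear_maps R (?D n) (Cmod (Suc m)). \<forall>x\<in>carrier (?D n). dif (w x) = u x"
    if "u \<in> linear_maps R (?D n) (Cmod m)" "\<And>x. x \<in> carrier (?D n) \<Longrightarrow> u x \<in> dif ` carrier (Cmod (Suc m))" for u n m
    by (rule retract_lift[OF left_module_Cabove left_module_Cmod left_module_Cmod Cabove_retract(1,2)[OF t(1)] _ that(1) dif_linear that(2)])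
      (rule Cabove_retract(3)[OF t(1)])
  have "\<exists>s. \<forall>n. good n (s n) \<and> (\<forall>x\<in>carrier (?D (Suc n)). dif (s (Suc n) x) = (\<lambda>\<sigma> h. x \<sigma> h - ph (Suc n) x \<sigma> h - s n (dif x) \<sigma> h))"
  proof (rule dependent_nat_choice)
    have im: "(\<lambda>\<sigma> h. x \<sigma> h - ph 0 x \<sigma> h) \<in> dif ` carrier (Cmod (Suc 0))" if x: "x \<in> carrier (?D 0)" for x
    proof -
      have px: "ph 0 x \<in> chains 0" "x \<in> chains 0" using linear_mapsD(1)[OF ph x] x by (auto simp: Cmod_carrier Cabove_simps)
      have "aug (\<lambda>\<sigma> h. x \<sigma> h - ph 0 x \<sigma> h) = 0"
        using ph0[OF x] pair_diff[OF chainsD(3)[OF px(2)] chainsD(3)[OF px(1)]] by (simp add: aug_def)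
      thus ?thesis using Cmod_exact_0[of "\<lambda>\<sigma> h. x \<sigma> h - ph 0 x \<sigma> h"] chains_diff[OF px(2,1)]
        by (simp add: Cmod_carrier trivial_simps)
    qed
    obtain s where "s \<in> linear_maps R (?D 0) (Cmod (Suc 0))" "\<forall>x\<in>carrier (?D 0). dif (s x) = (\<lambda>\<sigma> h. x \<sigma> h - ph 0 x \<sigma> h)"
      using liftD[OF lin_diff[OF idD ph] im] by blast
    thus "\<exists>s. good 0 s" by (auto simp: good_def)
  next
    fix s n assume gs: "good n s"
    hence s: "s \<in> linear_maps R (?D n) (Cmod (Suc n))"
      and s0: "dif y = (\<lambda>_ _. 0) \<Longrightarrow> y \<in> carrier (?D n) \<Longrightarrow> dif (s y) = (\<lambda>\<sigma> h. y \<sigma> h - ph n y \<sigma> h)" for y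
      by (auto simp: good_def)
    have sd: "(\<lambda>x. s (dif x)) \<in> linear_maps R (?D (Suc n)) (Cmod (Suc n))" by (rule linear_maps_compose[OF diD s])
    have im: "(\<lambda>\<sigma> h. x \<sigma> h - ph (Suc n) x \<sigma> h - s (dif x) \<sigma> h) \<in> dif ` carrier (Cmod (Suc (Suc n)))"
      if x: "x \<in> carrier (?D (Suc n))" for x
    proof (rule Cmod_exact)
      show "(\<lambda>\<sigma> h. x \<sigma> h - ph (Suc n) x \<sigma> h - s (dif x) \<sigma> h) \<in> carrier (Cmod (Suc n))"
        by (rule linear_mapsD(1)[OF lin_diff[OF lin_diff[OF idD ph] sd] x])
      have dx: "dif x \<in> carrier (?D n)" by (rule linear_mapsD(1)[OF diD x])
      have "dif (dif x) = (\<lambda>_ _. 0)" using dif_dif[of x "Suc n"] x by (auto simp: Cabove_simps fun_eq_iff)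
      from s0[OF this dx] show "dif (\<lambda>\<sigma> h. x \<sigma> h - ph (Suc n) x \<sigma> h - s (dif x) \<sigma> h) = \<zero>\<^bsub>Cmod n\<^esub>"
        by (intro ext) (simp add: dif_diff phd[OF x] Cmod_simps)
    qed
    obtain s' where s': "s' \<in> linear_maps R (?D (Suc n)) (Cmod (Suc (Suc n)))"
      "\<forall>x\<in>carrier (?D (Suc n)). dif (s' x) = (\<lambda>\<sigma> h. x \<sigma> h - ph (Suc n) x \<sigma> h - s (dif x) \<sigma> h)"
      using liftD[OF lin_diff[OF lin_diff[OF idD ph] sd] im] by blast
    have "s (\<lambda>_ _. 0) = (\<lambda>_ _. 0)"
      using linear_map_zero[OF left_module_Cabove left_module_Cmod s] by (simp add: Cabove_simps Cmod_simps)
    hence "good (Suc n) s'" using s' by (auto simp: good_def)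
    thus "\<exists>s'. good (Suc n) s' \<and> (\<forall>x\<in>carrier (?D (Suc n)). dif (s' x) = (\<lambda>\<sigma> h. x \<sigma> h - ph (Suc n) x \<sigma> h - s (dif x) \<sigma> h))"
      using s' by blast
  qed
  then obtain s where s: "\<And>n. good n (s n)"
    and sS: "\<And>n x. x \<in> carrier (?D (Suc n)) \<Longrightarrow> dif (s (Suc n) x) = (\<lambda>\<sigma> h. x \<sigma> h - ph (Suc n) x \<sigma> h - s n (dif x) \<sigma> h)"
    by blast
  have sl: "s n \<in> linear_maps R (?D n) (Cmod (Suc n))" for n using s[of n] by (simp add: good_def)
  have s0: "x \<in> carrier (?D 0) \<Longrightarrow> dif (s 0 x) = (\<lambda>\<sigma> h. x \<sigma> h - ph 0 x \<sigma> h)" for x using s[of 0] by (simp add: good_def)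
  have posD: "x \<in> carrier (?D n)" if "x \<in> carrier (Cpos n)" for n x
    using that t(2) by (force simp: Cpos_carrier Cabove_simps above_def)
  have restrict: "a \<in> linear_maps R (Cpos n) (Cmod m)" if "a \<in> linear_maps R (?D n) (Cmod m)" for a n m
    using that posD[of _ n] by (auto simp: linear_maps_def Cpos_simps Cabove_simps)
  have u: "unit_vec R \<tau> \<in> carrier (Cpos n)" if "\<tau> \<in> cliques n" for \<tau> n
    unfolding Cpos_def by (rule unit_vec_carrier[OF ring_R that])
  define c where "c \<tau> = ph i (unit_vec R \<tau>)" for \<tau>
  have cch: "c \<tau> \<in> chains i" if "\<tau> \<in> cliques i" for \<tau>
    using linear_mapsD(1)[OF ph posD[OF u[OF that]]] by (simp add: c_def Cmod_carrier)
  \<comment> \<open>The unit vector is \<open>t\<close> times the cube \<open>?y\<close> at the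
    inverse of \<open>t\<close>, which lies in the half space. Linearity makes its image
    \<open>t\<close> times an element of height at least \<open>r\<close>, so its height is at least
    \<open>\<chi> t + r > 0\<close>.\<close>
  have cpos: "\<chi> h > 0" if tau: "\<tau> \<in> cliques i" and nz: "c \<tau> \<sigma> h \<noteq> 0" for \<tau> \<sigma> h
  proof -
    let ?b = "\<lambda>h. if h = t then 1 else (0::real)" and ?b' = "\<lambda>h. if h = inv\<^bsub>G\<^esub> t then 1 else (0::real)"
    let ?y = "\<lambda>\<sigma>. if \<sigma> = \<tau> then ?b' else (\<lambda>_. 0)"
    have b: "?b \<in> carrier R" using t by (auto simp: mring_carrier Gp_simps)
    have fin: "finite {h. ?y \<rho> h \<noteq> 0}" for \<rho> by (rule finite_subset[of _ "{inv\<^bsub>G\<^esub> t}"]) auto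
    have "?y \<in> chains i" by (rule chainsI) (use tau t fin in auto)
    hence y: "?y \<in> carrier (?D i)" using t by (auto simp: Cabove_simps above_def chi_inv)
    have "unit_vec R \<tau> = ?b \<odot>\<^bsub>?D i\<^esub> ?y"
      using translate_unit[OF t(1)] by (auto simp: Cabove_simps unit_vec_def fun_eq_iff mring_simps)
    hence "c \<tau> = ?b \<odot>\<^bsub>Cmod i\<^esub> ph i ?y" unfolding c_def by (simp only: linear_mapsD(3)[OF ph b y])
    hence cy: "c \<tau> = (\<lambda>\<sigma>. ?b \<otimes>\<^bsub>RG\<^esub> ph i ?y \<sigma>)" by (simp add: Cmod_simps)
    have "above (\<chi> t + r) (c \<tau>)"
      unfolding cy
    proof (rule above_smult)
      show "?b \<in> carrier RG" using b by (simp add: R_carrier)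
      show "above r (ph i ?y)" unfolding ph_def by (rule r[OF linear_mapsD(1)[OF f(1) y]])
      show "ph i ?y \<in> chains i" using linear_mapsD(1)[OF ph y] by (simp add: Cmod_carrier)
    qed (auto split: if_splits)
    hence "\<chi> h \<ge> \<chi> t + r" using nz by (auto simp: above_def)
    thus ?thesis using t(2) by simp
  qed
  \<comment> \<open>Finitely many entries, each supported at positive height, so their sum
    eventually drops below 1.\<close>
  have "((\<lambda>s. \<Sum>\<tau>\<in>cliques i. \<Sum>\<sigma>\<in>cliques i. \<bar>Ev s (c \<tau>) \<sigma>\<bar>) \<longlongrightarrow> (\<Sum>\<tau>\<in>cliques i. \<Sum>\<sigma>\<in>cliques i. \<bar>0\<bar>)) at_top"
    unfolding Ev_def
    by (intro tendsto_sum tendsto_rabs ev_tendsto_0) (use chainsD(3)[OF cch] cpos in auto)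
  hence "eventually (\<lambda>s. (\<Sum>\<tau>\<in>cliques i. \<Sum>\<sigma>\<in>cliques i. \<bar>Ev s (c \<tau>) \<sigma>\<bar>) < 1) at_top"
    by (auto dest: order_tendstoD(2)[where a = 1])
  moreover have "eventually (\<lambda>s::real. s > 0) at_top" by (rule eventually_gt_at_top)
  ultimately have "eventually (\<lambda>s. (\<Sum>\<tau>\<in>cliques i. \<Sum>\<sigma>\<in>cliques i. \<bar>Ev s (c \<tau>) \<sigma>\<bar>) < 1 \<and> s > 0) at_top"
    by (rule eventually_conj)
  then obtain z where z: "(\<Sum>\<tau>\<in>cliques i. \<Sum>\<sigma>\<in>cliques i. \<bar>Ev z (c \<tau>) \<sigma>\<bar>) < 1" "z > 0"
    by (auto dest: eventually_happens)
  define lam where "lam v = exp (- z * \<chi> (gam v)) - 1" for v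
  have "no_harmonic lam i" unfolding no_harmonic_def
  proof (intro ballI impI)
    fix x assume x: "x \<in> cochain_space i" and cx: "cod lam x = (\<lambda>_. 0)" and bx: "bd lam x = (\<lambda>_. 0)"
    define Y where "Y \<sigma> h = (if h = \<one>\<^bsub>G\<^esub> then x \<sigma> else 0)" for \<sigma> h
    have "finite {h. Y \<sigma> h \<noteq> 0}" for \<sigma> by (rule finite_subset[of _ "{\<one>\<^bsub>G\<^esub>}"]) (auto simp: Y_def)
    hence Yc: "Y \<in> chains i" by (intro chainsI) (use x in \<open>auto simp: Y_def cochain_space_def\<close>)
    have Y: "Y \<in> carrier (Cpos i)" using Yc by (auto simp: Cpos_carrier Y_def chi_one)
    have EY: "Ev z Y = x"
    proof
      fix \<sigma>
      have "Ev z Y \<sigma> = (\<Sum>h\<in>{\<one>\<^bsub>G\<^esub>}. Y \<sigma> h * exp (- z * \<chi> h))"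
        unfolding Ev_def ev_def by (rule pair_superset) (auto simp: Y_def)
      thus "Ev z Y \<sigma> = x \<sigma>" by (simp add: Y_def chi_one)
    qed
    have YD: "Y \<in> carrier (?D i)" by (rule posD[OF Y])
    have sY: "s i Y \<in> chains (Suc i)" using linear_mapsD(1)[OF sl YD] by (simp add: Cmod_carrier)
    have pY: "ph i Y \<in> chains i" using linear_mapsD(1)[OF ph YD] by (simp add: Cmod_carrier)
    \<comment> \<open>The homotopy term through \<open>dif Y\<close>, absent in degree 0.\<close>
    define w where "w = (case i of 0 \<Rightarrow> (\<lambda>_ _. 0) | Suc m \<Rightarrow> s m (dif Y))"
    have w: "w \<in> chains i" "Ev z w = (\<lambda>_. 0)"
    proof -
      have "w \<in> chains i \<and> (\<forall>\<sigma>. Ev z w \<sigma> = 0)"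
      proof (cases i)
        case 0 thus ?thesis by (simp add: w_def chains_zero Ev_def ev_def)
      next
        case (Suc m)
        have dY: "dif Y \<in> carrier (Cpos m)" using dif_pos Y Suc by simp
        have "Ev z (dif Y) = (\<lambda>_. 0)" using Ev_dif[OF Yc, of z] bx by (simp add: EY lam_def[abs_def])
        hence "Ev z (s m (dif Y)) \<sigma> = 0" for \<sigma> using Ev_linear_map[OF restrict[OF sl] dY, of z \<sigma>] by simp
        moreover have "s m (dif Y) \<in> chains (Suc m)" using linear_mapsD(1)[OF sl posD[OF dY]] by (simp add: Cmod_carrier)
        ultimately show ?thesis using Suc by (simp add: w_def)
      qed
      thus "w \<in> chains i" "Ev z w = (\<lambda>_. 0)" by auto
    qed
    have dec: "Y = (\<lambda>\<sigma> h. (\<lambda>\<sigma> h. ph i Y \<sigma> h + dif (s i Y) \<sigma> h) \<sigma> h + w \<sigma> h)"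
    proof (cases i)
      case 0 thus ?thesis using s0[of Y] YD by (auto simp: w_def fun_eq_iff)
    next
      case (Suc m) thus ?thesis using sS[of Y m] YD by (auto simp: w_def fun_eq_iff)
    qed
    have xd: "x \<sigma> = Ev z (ph i Y) \<sigma> + bd lam (Ev z (s i Y)) \<sigma>" for \<sigma>
    proof -
      have "Ev z Y \<sigma> = Ev z (\<lambda>\<sigma> h. ph i Y \<sigma> h + dif (s i Y) \<sigma> h) \<sigma> + Ev z w \<sigma>"
        by (subst dec, rule Ev_add[OF chains_add[OF pY dif_chains[OF sY]] w(1)])
      also have "\<dots> = Ev z (ph i Y) \<sigma> + Ev z (dif (s i Y)) \<sigma>"
        using Ev_add[OF pY dif_chains[OF sY]] w(2) by simp
      finally show ?thesis using Ev_dif[OF sY, of z] by (simp add: EY lam_def[abs_def])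
    qed
    have p: "Ev z (ph i Y) \<sigma> = (\<Sum>\<tau>\<in>cliques i. x \<tau> * Ev z (c \<tau>) \<sigma>)" for \<sigma>
      using Ev_linear_map[OF restrict[OF ph] Y, of z \<sigma>] by (simp add: EY c_def)
    have xx: "\<bar>x \<sigma> * x \<tau>\<bar> \<le> ip i x x" if st: "\<sigma> \<in> cliques i" "\<tau> \<in> cliques i" for \<sigma> \<tau>
    proof -
      have le: "x \<rho> * x \<rho> \<le> ip i x x" if "\<rho> \<in> cliques i" for \<rho>
        unfolding ip_def using member_le_sum[of \<rho> "cliques i" "\<lambda>\<rho>. x \<rho> * x \<rho>"] that finite_cliques by auto
      have "(\<bar>x \<sigma>\<bar> - \<bar>x \<tau>\<bar>) * (\<bar>x \<sigma>\<bar> - \<bar>x \<tau>\<bar>) \<ge> 0" by (rule zero_le_square)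
      hence "2 * (\<bar>x \<sigma>\<bar> * \<bar>x \<tau>\<bar>) \<le> \<bar>x \<sigma>\<bar> * \<bar>x \<sigma>\<bar> + \<bar>x \<tau>\<bar> * \<bar>x \<tau>\<bar>" by (simp only: algebra_simps)
      hence "2 * \<bar>x \<sigma> * x \<tau>\<bar> \<le> x \<sigma> * x \<sigma> + x \<tau> * x \<tau>" by (simp only: abs_mult abs_mult_self)
      thus ?thesis using le[OF st(1)] le[OF st(2)] by linarith
    qed
    have "x \<sigma> * x \<sigma> = x \<sigma> * Ev z (ph i Y) \<sigma> + x \<sigma> * bd lam (Ev z (s i Y)) \<sigma>" for \<sigma>
      using arg_cong[OF xd[of \<sigma>], of "\<lambda>r. x \<sigma> * r"] by (simp only: distrib_left)
    hence "ip i x x = ip i x (Ev z (ph i Y)) + ip i x (bd lam (Ev z (s i Y)))"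
      unfolding ip_def by (simp only: sum.distrib)
    also have "ip i x (bd lam (Ev z (s i Y))) = 0"
      using ip_adjoint[OF x Ev_space[OF sY], of lam z] cx by (simp add: ip_def)
    also have "ip i x (Ev z (ph i Y)) = (\<Sum>\<sigma>\<in>cliques i. \<Sum>\<tau>\<in>cliques i. (x \<sigma> * x \<tau>) * Ev z (c \<tau>) \<sigma>)"
      by (simp add: ip_def p sum_distrib_left mult.assoc)
    finally have eq: "ip i x x = (\<Sum>\<sigma>\<in>cliques i. \<Sum>\<tau>\<in>cliques i. (x \<sigma> * x \<tau>) * Ev z (c \<tau>) \<sigma>)" by simp
    also have "\<dots> \<le> (\<Sum>\<sigma>\<in>cliques i. \<Sum>\<tau>\<in>cliques i. ip i x x * \<bar>Ev z (c \<tau>) \<sigma>\<bar>)"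
    proof (intro sum_mono)
      fix \<sigma> \<tau> assume st: "\<sigma> \<in> cliques i" "\<tau> \<in> cliques i"
      have "(x \<sigma> * x \<tau>) * Ev z (c \<tau>) \<sigma> \<le> \<bar>x \<sigma> * x \<tau>\<bar> * \<bar>Ev z (c \<tau>) \<sigma>\<bar>"
        unfolding abs_mult[symmetric] by (rule abs_ge_self)
      also have "\<dots> \<le> ip i x x * \<bar>Ev z (c \<tau>) \<sigma>\<bar>" by (rule mult_right_mono[OF xx[OF st]]) simp
      finally show "(x \<sigma> * x \<tau>) * Ev z (c \<tau>) \<sigma> \<le> ip i x x * \<bar>Ev z (c \<tau>) \<sigma>\<bar>" .
    qed
    also have "\<dots> = ip i x x * (\<Sum>\<tau>\<in>cliques i. \<Sum>\<sigma>\<in>cliques i. \<bar>Ev z (c \<tau>) \<sigma>\<bar>)"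
      by (subst sum.swap) (simp add: sum_distrib_left)
    finally have "ip i x x * (1 - (\<Sum>\<tau>\<in>cliques i. \<Sum>\<sigma>\<in>cliques i. \<bar>Ev z (c \<tau>) \<sigma>\<bar>)) \<le> 0"
      by (simp add: algebra_simps)
    hence "ip i x x \<le> 0" using z(1) by (simp add: mult_le_0_iff)
    hence "ip i x x = 0" using ip_self_nonneg[of i x] by simp
    thus "x = (\<lambda>_. 0)" using ip_self_zero[OF x] by blast
  qed
  hence "exact_at lam i" by (rule no_harmonic_imp_exact)
  thus ?thesis
    by (rule exact_at_support[rotated]) (use z(2) in \<open>auto simp: lam_def\<close>)
qed

section \<open>Finiteness from exactness\<close>

text \<open>The \<open>-1\<close> is the coefficient of the face at the base point. For a generator
  of height 0 that face is left to \<open>rest\<close>, because pushing along it would gain no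
  height.\<close>

definition low :: "'v \<Rightarrow> real" where "low v = (if \<chi> (gam v) = 0 then 0 else -1)"

text \<open>A term at \<open>g\<close> comes from a cube with one more direction \<open>v\<close>,
  based lower by \<open>\<chi> (gam v)\<close>. Either this is strictly lower, or the height is
  equal and the cube has one more vertex counted by \<open>dead low\<close>. Every push gains in one
  of these two ways.\<close>

definition rest :: "('v set \<Rightarrow> 'v word set \<Rightarrow> real) \<Rightarrow> 'v set \<Rightarrow> 'v word set \<Rightarrow> real" where
  "rest x \<tau> g = (\<Sum>v\<in>V - \<tau>. eps v \<tau> *
     (x (insert v \<tau>) (g \<otimes>\<^bsub>G\<^esub> inv\<^bsub>G\<^esub> gam v) - (if \<chi> (gam v) = 0 then x (insert v \<tau>) g else 0)))"

lemma dif_split: "g \<in> carrier G \<Longrightarrow> dif x \<tau> g = bd low (\<lambda>\<rho>. x \<rho> g) \<tau> + rest x \<tau> g"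
  unfolding dif_def bd_def rest_def low_def
  by (simp add: sum.distrib[symmetric]) (intro sum.cong, auto simp: algebra_simps)

definition apply_contraction where
  "apply_contraction S w \<sigma> g = (\<Sum>\<tau>\<in>Pow V. S \<sigma> \<tau> * w \<tau> g)" for S :: "'v set \<Rightarrow> 'v set \<Rightarrow> real" and w \<sigma> and g :: "'v word set"

lemma apply_contraction_nonzero:
  assumes "apply_contraction S w \<sigma> g \<noteq> 0"
  obtains \<tau> where "S \<sigma> \<tau> \<noteq> 0" "w \<tau> g \<noteq> 0"
  using assms unfolding apply_contraction_def
  by (metis (mono_tags, lifting) mult_eq_0_iff sum.neutral)

lemma rest_nonzero:
  assumes "rest x \<tau> g \<noteq> 0" "g \<in> carrier G"
  obtains v h where "v \<in> V - \<tau>" "h \<in> carrier G" "x (insert v \<tau>) h \<noteq> 0" "\<chi> h = \<chi> g - \<chi> (gam v)"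
proof -
  obtain v where v: "v \<in> V - \<tau>" "x (insert v \<tau>) (g \<otimes>\<^bsub>G\<^esub> inv\<^bsub>G\<^esub> gam v) - (if \<chi> (gam v) = 0 then x (insert v \<tau>) g else 0) \<noteq> 0"
    using assms(1) unfolding rest_def by (metis (no_types, lifting) mult_zero_right sum.neutral)
  have c: "g \<otimes>\<^bsub>G\<^esub> inv\<^bsub>G\<^esub> gam v \<in> carrier G" "\<chi> (g \<otimes>\<^bsub>G\<^esub> inv\<^bsub>G\<^esub> gam v) = \<chi> g - \<chi> (gam v)"
    using assms(2) v(1) gam_closed by (auto simp: chi_mult chi_inv)
  show thesis
  proof (cases "x (insert v \<tau>) (g \<otimes>\<^bsub>G\<^esub> inv\<^bsub>G\<^esub> gam v) = 0")
    case False
    thus ?thesis using that[OF v(1) c(1)] c(2) by blast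
  next
    case True
    hence "\<chi> (gam v) = 0" "x (insert v \<tau>) g \<noteq> 0" using v(2) by (auto split: if_splits)
    thus ?thesis using that[OF v(1) assms(2)] by simp
  qed
qed

text \<open>\<open>m\<close> decreases to 0 in the iteration below, when the support has moved up by \<open>\<delta>\<close> or into \<open>\<chi> \<ge> 0\<close>.\<close>

definition filtered :: "real \<Rightarrow> real \<Rightarrow> nat \<Rightarrow> ('v set \<Rightarrow> 'v word set \<Rightarrow> real) \<Rightarrow> bool" where
  "filtered \<delta> r m x \<longleftrightarrow> (\<forall>\<sigma> g. x \<sigma> g \<noteq> 0 \<longrightarrow> r \<le> \<chi> g \<and> (min (r + \<delta>) 0 \<le> \<chi> g \<or> dead low \<sigma> < m))"

text \<open>\<open>S\<close> is a contraction as supplied by \<open>contraction\<close>, and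
  \<delta> bounds the nonzero heights of generators from below, so that pushing along such a
  generator gains at least \<delta>.\<close>

context
  fixes S :: "'v set \<Rightarrow> 'v set \<Rightarrow> real" and q :: nat and \<delta> :: real
  assumes S1: "\<And>\<sigma> \<tau>. S \<sigma> \<tau> \<noteq> 0 \<Longrightarrow> dead low \<sigma> = dead low \<tau> \<and> (\<exists>i\<le>q. \<tau> \<in> cliques i \<and> \<sigma> \<in> cliques (Suc i))"
    and S2: "\<And>i x \<sigma>. i \<le> q \<Longrightarrow> x \<in> cochain_space i \<Longrightarrow>
       bd low (\<lambda>\<rho>. \<Sum>\<tau>\<in>Pow V. S \<rho> \<tau> * x \<tau>) \<sigma> + (\<Sum>\<tau>\<in>Pow V. S \<sigma> \<tau> * bd low x \<tau>) = x \<sigma>"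
    and delta: "\<delta> > 0" "\<And>v. v \<in> V \<Longrightarrow> \<chi> (gam v) \<noteq> 0 \<Longrightarrow> \<chi> (gam v) \<ge> \<delta>"
begin

lemma contraction_chains:
  assumes w: "w \<in> chains i"
  shows "apply_contraction S w \<in> chains (Suc i)"
proof (rule chainsI)
  fix \<sigma> g assume "\<sigma> \<notin> cliques (Suc i)"
  show "apply_contraction S w \<sigma> g = 0"
  proof (rule ccontr)
    assume "apply_contraction S w \<sigma> g \<noteq> 0"
    then obtain \<tau> where t: "S \<sigma> \<tau> \<noteq> 0" "w \<tau> g \<noteq> 0" by (rule apply_contraction_nonzero)
    have "\<tau> \<in> cliques i" using chainsD(1)[OF w] t(2) by blast
    thus False using S1[OF t(1)] \<open>\<sigma> \<notin> cliques (Suc i)\<close> by (auto simp: cliques_def)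
  qed
next
  fix \<sigma>
  have "{g. apply_contraction S w \<sigma> g \<noteq> 0} \<subseteq> (\<Union>\<tau>\<in>cliques i. {g. w \<tau> g \<noteq> 0})"
  proof
    fix g assume "g \<in> {g. apply_contraction S w \<sigma> g \<noteq> 0}"
    then obtain \<tau> where "w \<tau> g \<noteq> 0" using apply_contraction_nonzero by blast
    thus "g \<in> (\<Union>\<tau>\<in>cliques i. {g. w \<tau> g \<noteq> 0})" using chainsD(1)[OF w] by blast
  qed
  thus "finite {g. apply_contraction S w \<sigma> g \<noteq> 0}"
    by (rule finite_subset) (use finite_cliques chainsD(3)[OF w] in auto)
qed (use chainsD(2)[OF w] in \<open>auto simp: apply_contraction_def\<close>)

text \<open>At negative heights \<open>dif w\<close> vanishes, hence
  \<open>bd low w = - rest w\<close>, and the homotopy formula leaves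
  \<open>- S (rest w) - rest (S w)\<close>. Both terms come from cubes of \<open>w\<close> that are
  lower or have one more dead direction, and \<open>S\<close> does not change the number of dead
  directions.\<close>

lemma filtered_step:
  assumes w: "w \<in> chains (Suc j)" and j: "Suc j \<le> q" and P: "filtered \<delta> r (Suc m) w" and r: "r \<le> 0"
    and pos: "above 0 (dif w)"
  shows "filtered \<delta> r m (\<lambda>\<sigma> g. w \<sigma> g - dif (apply_contraction S w) \<sigma> g)"
  unfolding filtered_def
proof (intro allI impI)
  fix \<sigma> g
  let ?y = "apply_contraction S w"
  assume nz: "w \<sigma> g - dif ?y \<sigma> g \<noteq> 0"
  have y: "?y \<in> chains (Suc (Suc j))" by (rule contraction_chains[OF w])
  have "(\<lambda>\<sigma> g. w \<sigma> g - dif ?y \<sigma> g) \<in> chains (Suc j)" by (rule chains_diff[OF w dif_chains[OF y]])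
  hence g: "g \<in> carrier G" and s: "\<sigma> \<in> cliques (Suc j)" using nz chainsD(1,2) by blast+
  \<comment> \<open>Here \<open>(h, \<rho>)\<close> is the source of a term and
    \<open>(g, \<tau>)\<close> its target. A direction of positive height would place
    \<open>g\<close> at height \<open>r + \<delta>\<close> or above, so the direction is dead and
    the count drops by one.\<close>
  have key: "r \<le> \<chi> g \<and> dead low \<tau> < m"
    if v: "v \<in> V - \<tau>" and h: "\<chi> h = \<chi> g - \<chi> (gam v)" and nz: "w \<rho> h \<noteq> 0" and d: "dead low \<rho> = dead low (insert v \<tau>)"
      and fin: "finite \<tau>" and left_translate: "\<chi> g < min (r + \<delta>) 0" for v \<tau> \<rho> h
  proof -
    have h': "r \<le> \<chi> h" "min (r + \<delta>) 0 \<le> \<chi> h \<or> dead low \<rho> < Suc m" using P nz by (auto simp: filtered_def)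
    have dv: "\<chi> (gam v) = 0"
      using delta(2)[of v] v h h'(1) left_translate by fastforce
    hence "dead low (insert v \<tau>) = Suc (dead low \<tau>)"
      using dead_insert_zero[of low v \<tau>] fin v by (simp add: low_def)
    thus ?thesis using h h' dv left_translate d by auto
  qed
  show "r \<le> \<chi> g \<and> (min (r + \<delta>) 0 \<le> \<chi> g \<or> dead low \<sigma> < m)"
  proof (cases "min (r + \<delta>) 0 \<le> \<chi> g")
    case True
    thus ?thesis using r delta(1) by auto
  next
    case False
    hence left_translate: "\<chi> g < min (r + \<delta>) 0" by (simp only: not_le)
    have dw: "bd low (\<lambda>\<rho>. w \<rho> g) \<tau> = - rest w \<tau> g" for \<tau>
    proof -
      have "dif w \<tau> g = 0" using pos left_translate by (force simp: above_def)
      thus ?thesis using dif_split[OF g, of w \<tau>] by simp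
    qed
    have wg: "(\<lambda>\<rho>. w \<rho> g) \<in> cochain_space (Suc j)" using chainsD(1)[OF w] by (auto simp: cochain_space_def)
    have "w \<sigma> g = bd low (\<lambda>\<rho>. ?y \<rho> g) \<sigma> + (\<Sum>\<tau>\<in>Pow V. S \<sigma> \<tau> * bd low (\<lambda>\<rho>. w \<rho> g) \<tau>)"
      using S2[OF j wg, of \<sigma>] by (simp add: apply_contraction_def)
    hence eq: "w \<sigma> g - dif ?y \<sigma> g = - (\<Sum>\<tau>\<in>Pow V. S \<sigma> \<tau> * rest w \<tau> g) - rest ?y \<sigma> g"
      using dif_split[OF g, of ?y \<sigma>] by (simp add: dw sum_negf)
    have fins: "finite \<sigma>" using s clique_finite by (simp add: cliques_def)
    show ?thesis
    proof (cases "rest ?y \<sigma> g = 0")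
      case False
      then obtain v h where v: "v \<in> V - \<sigma>" "?y (insert v \<sigma>) h \<noteq> 0" "\<chi> h = \<chi> g - \<chi> (gam v)"
        using rest_nonzero g by metis
      obtain \<rho> where "S (insert v \<sigma>) \<rho> \<noteq> 0" "w \<rho> h \<noteq> 0" using v(2) by (rule apply_contraction_nonzero)
      thus ?thesis using key[OF v(1,3) _ _ fins left_translate] S1 by auto
    next
      case True
      hence "(\<Sum>\<tau>\<in>Pow V. S \<sigma> \<tau> * rest w \<tau> g) \<noteq> 0" using nz eq by simp
      then obtain \<tau> where t: "\<tau> \<in> Pow V" "S \<sigma> \<tau> * rest w \<tau> g \<noteq> 0" by (metis (no_types, lifting) sum.neutral)
      hence t': "S \<sigma> \<tau> \<noteq> 0" "rest w \<tau> g \<noteq> 0" by auto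
      obtain v h where v: "v \<in> V - \<tau>" "w (insert v \<tau>) h \<noteq> 0" "\<chi> h = \<chi> g - \<chi> (gam v)"
        using rest_nonzero[OF t'(2) g] by metis
      have "finite \<tau>" using t(1) finite_V finite_subset by blast
      thus ?thesis using key[OF v(1,3,2) HOL.refl _ left_translate] S1[OF t'(1)] by auto
    qed
  qed
qed

lemma filtered_iterate:
  assumes "w \<in> chains (Suc j)" "Suc j \<le> q" "filtered \<delta> r m w" "r \<le> 0" "above 0 (dif w)"
  shows "\<exists>w'\<in>chains (Suc j). dif w' = dif w \<and> above (min (r + \<delta>) 0) w'"
  using assms
proof (induction m arbitrary: w)
  case 0
  thus ?case by (intro bexI[of _ w]) (auto simp: filtered_def above_def)
next
  case (Suc m)
  let ?w = "\<lambda>\<sigma> g. w \<sigma> g - dif (apply_contraction S w) \<sigma> g"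
  have y: "apply_contraction S w \<in> chains (Suc (Suc j))" by (rule contraction_chains[OF Suc.prems(1)])
  have w': "?w \<in> chains (Suc j)" by (rule chains_diff[OF Suc.prems(1) dif_chains[OF y]])
  have d: "dif ?w = dif w" using dif_dif[OF y] by (auto simp: dif_diff fun_eq_iff)
  have "filtered \<delta> r m ?w" by (rule filtered_step[OF Suc.prems])
  from Suc.IH[OF w' Suc.prems(2) this Suc.prems(4)] show ?case using Suc.prems(5) by (simp add: d)
qed

text \<open>Start from any filling; its finite support gives a lower bound \<open>r\<close>. As
  \<open>dead\<close> is at most \<open>card V\<close>, a round of \<open>card V + 1\<close> pushes
  raises the bound by \<delta>, and enough rounds reach 0. The condition on \<open>j\<close>
  reflects that \<open>S\<close> acts on the filling, one degree above \<open>x\<close>.\<close>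

lemma positive_acyclic:
  assumes x: "x \<in> chains j" "above 0 x" and j: "Suc j \<le> q"
    and cyc: "\<And>\<tau> g. dif x \<tau> g = 0" "j = 0 \<Longrightarrow> aug x = 0"
  shows "\<exists>w\<in>chains (Suc j). above 0 w \<and> dif w = x"
proof -
  obtain w where w: "w \<in> chains (Suc j)" "dif w = x" using chains_acyclic[OF x(1) cyc] by blast
  define T where "T = (\<Union>\<sigma>\<in>cliques (Suc j). \<chi> ` {g. w \<sigma> g \<noteq> 0})"
  have T: "finite T" unfolding T_def using finite_cliques chainsD(3)[OF w(1)] by auto
  define r where "r = Min (insert 0 T)"
  have r: "r \<le> 0" unfolding r_def using T by (intro Min_le) auto
  have ab: "above r w"
    unfolding above_def
  proof (intro allI impI)
    fix \<sigma> h assume nz: "w \<sigma> h \<noteq> 0"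
    hence "\<sigma> \<in> cliques (Suc j)" using chainsD(1)[OF w(1)] by blast
    hence "\<chi> h \<in> T" using nz by (auto simp: T_def)
    thus "\<chi> h \<ge> r" unfolding r_def using T by (intro Min_le) auto
  qed
  have ind: "\<exists>w\<in>chains (Suc j). dif w = x \<and> above (min (r + k * \<delta>) 0) w" for k :: nat
  proof (induction k)
    case 0
    show ?case using w ab r by (auto simp: min_def)
  next
    case (Suc k)
    then obtain u where u: "u \<in> chains (Suc j)" "dif u = x" "above (min (r + k * \<delta>) 0) u" by blast
    let ?r = "min (r + k * \<delta>) 0"
    have "dead low \<sigma> < Suc (card V)" if "u \<sigma> g \<noteq> 0" for \<sigma> g
    proof -
      have "clique \<sigma>" using chainsD(1)[OF u(1)] that by (auto simp: cliques_def)
      hence sub: "{v \<in> \<sigma>. low v = 0} \<subseteq> V" using clique_V by blast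
      show ?thesis using card_mono[OF finite_V sub] by (simp add: dead_def)
    qed
    hence "filtered \<delta> ?r (Suc (card V)) u" using u(3) by (auto simp: filtered_def above_def)
    from filtered_iterate[OF u(1) j this] obtain u' where
      u': "u' \<in> chains (Suc j)" "dif u' = x" "above (min (?r + \<delta>) 0) u'" using u(2) x(2) by auto
    have "min (r + Suc k * \<delta>) 0 \<le> min (?r + \<delta>) 0" using delta(1) by (auto simp: min_def algebra_simps)
    hence "above (min (r + Suc k * \<delta>) 0) u'" using u'(3) unfolding above_def by (meson order_trans)
    thus ?case using u' by blast
  qed

  obtain k :: nat where "- r < k * \<delta>" using reals_Archimedean3[OF delta(1)] by blast
  hence "min (r + k * \<delta>) 0 = 0" by (simp add: min_def)
  thus ?thesis using ind[of k] by auto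
qed

end

text \<open>The complex \<open>Cpos\<close> is free of finite rank, and
  \<open>positive_acyclic\<close> gives exactness in all degrees below \<open>q\<close>.\<close>

theorem exact_imp_FP:
  assumes ex: "\<And>i. i \<le> q \<Longrightarrow> exact_at (\<lambda>v. \<chi> (gam v)) i"
  shows "type_FP q R (trivial_module :: ('v word set \<Rightarrow> real, real) module)"
proof -
  have exl: "exact_at low i" if "i \<le> q" for i
    by (rule exact_at_support[OF _ ex[OF that]]) (simp add: low_def)
  obtain S where S: "\<And>\<sigma> \<tau>. S \<sigma> \<tau> \<noteq> 0 \<Longrightarrow> dead low \<sigma> = dead low \<tau> \<and> (\<exists>i\<le>q. \<tau> \<in> cliques i \<and> \<sigma> \<in> cliques (Suc i))"
    "\<And>i x \<sigma>. i \<le> q \<Longrightarrow> x \<in> cochain_space i \<Longrightarrow>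
       bd low (\<lambda>\<rho>. \<Sum>\<tau>\<in>Pow V. S \<rho> \<tau> * x \<tau>) \<sigma> + (\<Sum>\<tau>\<in>Pow V. S \<sigma> \<tau> * bd low x \<tau>) = x \<sigma>"
    using contraction[OF exl] by blast
  \<comment> \<open>The element 1 keeps the minimum defined when all generators have height
    0.\<close>
  define L where "L = insert 1 ((\<lambda>v. \<chi> (gam v)) ` {v \<in> V. \<chi> (gam v) \<noteq> 0})"
  have L: "finite L" "L \<noteq> {}" using finite_V by (auto simp: L_def)
  have "\<forall>l\<in>L. l > 0" using chi_gam by (force simp: L_def)
  hence d1: "Min L > 0" using L by simp
  have d2: "\<chi> (gam v) \<ge> Min L" if "v \<in> V" "\<chi> (gam v) \<noteq> 0" for v
    using that L by (intro Min_le) (auto simp: L_def)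
  have CA: "x \<in> carrier (Cpos n) \<longleftrightarrow> x \<in> chains n \<and> above 0 x" for x n
    by (simp add: Cpos_carrier above_def)
  have acyc: "x \<in> dif ` carrier (Cpos (Suc j))"
    if "x \<in> carrier (Cpos j)" "Suc j \<le> q" "\<And>\<tau> g. dif x \<tau> g = 0" "j = 0 \<Longrightarrow> aug x = 0" for x j
  proof -
    have x: "x \<in> chains j" "above 0 x" using that(1) by (auto simp: CA)
    have "\<exists>w\<in>chains (Suc j). above 0 w \<and> dif w = x"
      by (rule positive_acyclic[of S q "Min L" x j]) (fact S d1 d2 x that)+
    thus ?thesis unfolding image_def by (auto simp: CA)
  qed
  have surj: "r \<in> aug ` carrier (Cpos 0)" for r :: real
  proof -
    define x0 where "x0 \<sigma> g = (if \<sigma> = {} \<and> g = \<one>\<^bsub>G\<^esub> then r else 0)" for \<sigma> :: "'v set" and g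
    have fin: "finite {g. x0 \<sigma> g \<noteq> 0}" for \<sigma>
      by (rule finite_subset[of _ "{\<one>\<^bsub>G\<^esub>}"]) (auto simp: x0_def split: if_splits)
    have "x0 \<in> chains 0" using fin by (intro chainsI) (auto simp: cliques_0 x0_def)
    hence "x0 \<in> carrier (Cpos 0)" by (auto simp: Cpos_carrier x0_def chi_one)
    moreover have "aug x0 = r"
    proof -
      have "{g. x0 {} g \<noteq> 0} \<subseteq> {\<one>\<^bsub>G\<^esub>}" by (auto simp: x0_def split: if_splits)
      thus ?thesis using pair_superset[of "{\<one>\<^bsub>G\<^esub>}" "x0 {}" "\<lambda>_. 1"] by (simp add: aug_def) (simp add: x0_def)
    qed
    ultimately show ?thesis by force
  qed
  show ?thesis
  proof (rule type_FP_from_free[where R = R and d = "\<lambda>_. dif" and \<epsilon> = aug and X = cliques, folded Cpos_def])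
    show "\<one>\<^bsub>R\<^esub> \<noteq> \<zero>\<^bsub>R\<^esub>" by (auto simp: mring_simps fun_eq_iff)
    show "aug ` carrier (Cpos 0) = carrier trivial_module" using surj by (auto simp: trivial_simps)
    show "dif ` carrier (Cpos 1) = {x \<in> carrier (Cpos 0). aug x = \<zero>\<^bsub>trivial_module\<^esub>}" if "0 < q"
    proof (intro equalityI subsetI)
      fix x assume "x \<in> dif ` carrier (Cpos 1)"
      thus "x \<in> {x \<in> carrier (Cpos 0). aug x = \<zero>\<^bsub>trivial_module\<^esub>}"
        using dif_pos[of _ 0] aug_dif by (auto simp: trivial_simps CA)
    next
      fix x assume "x \<in> {x \<in> carrier (Cpos 0). aug x = \<zero>\<^bsub>trivial_module\<^esub>}"
      thus "x \<in> dif ` carrier (Cpos 1)"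
        using acyc[of x 0] that dif_chains_0[of x] by (simp add: trivial_simps CA)
    qed
    show "dif ` carrier (Cpos (Suc (Suc i))) = {x \<in> carrier (Cpos (Suc i)). dif x = \<zero>\<^bsub>Cpos i\<^esub>}" if "Suc i < q" for i
    proof (intro equalityI subsetI)
      fix x assume "x \<in> dif ` carrier (Cpos (Suc (Suc i)))"
      thus "x \<in> {x \<in> carrier (Cpos (Suc i)). dif x = \<zero>\<^bsub>Cpos i\<^esub>}"
        using dif_pos[of _ "Suc i"] dif_dif by (auto simp: Cpos_simps CA fun_eq_iff)
    next
      fix x assume "x \<in> {x \<in> carrier (Cpos (Suc i)). dif x = \<zero>\<^bsub>Cpos i\<^esub>}"
      thus "x \<in> dif ` carrier (Cpos (Suc (Suc i)))"
        using acyc[of x "Suc i"] that by (simp add: Cpos_simps)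
    qed
  qed (use left_module_T finite_cliques aug_linear_pos dif_linear_pos in auto)
qed

end

section \<open>Cohomology and resonance\<close>

text \<open>The simplicial coboundary, an alternating sum over omitted entries. Recursion on the
  head replaces the index arithmetic of \<open>codifferential\<close> by list induction.\<close>

fun bar_dif :: "('g list \<Rightarrow> real) \<Rightarrow> 'g list \<Rightarrow> real" where
  "bar_dif F [] = 0"
| "bar_dif F (h # ys) = F ys - bar_dif (\<lambda>zs. F (h # zs)) ys"

lemma bar_dif_cong:
  "(\<And>zs. set zs \<subseteq> set ys \<Longrightarrow> Suc (length zs) = length ys \<Longrightarrow> F zs = F' zs) \<Longrightarrow> bar_dif F ys = bar_dif F' ys"
proof (induction ys arbitrary: F F')
  case (Cons h ys)
  have "F ys = F' ys" by (rule Cons.prems) auto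
  moreover have "bar_dif (\<lambda>zs. F (h # zs)) ys = bar_dif (\<lambda>zs. F' (h # zs)) ys"
    by (rule Cons.IH, rule Cons.prems) auto
  ultimately show ?case by simp
qed simp

lemma bar_dif_diff: "bar_dif (\<lambda>z. F z - F' z) ys = bar_dif F ys - bar_dif F' ys"
  by (induction ys arbitrary: F F') simp_all

lemma bar_dif_zero [simp]: "bar_dif (\<lambda>_. 0) ys = 0"
  using bar_dif_diff[of "\<lambda>_. 0" "\<lambda>_. 0" ys] by simp

lemma bar_dif_sum: "bar_dif (\<lambda>z. \<Sum>i\<in>A. F i z) ys = (\<Sum>i\<in>A. bar_dif (F i) ys)"
  by (induction ys arbitrary: F) (simp_all add: sum_subtractf)

lemma bar_dif_bar_dif: "bar_dif (bar_dif F) ys = 0"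
  by (induction ys arbitrary: F) (simp_all add: bar_dif_diff)

lemma bar_dif_map: "bar_dif F (map f ys) = bar_dif (\<lambda>zs. F (map f zs)) ys"
  by (induction ys arbitrary: F) simp_all

context raag_signed begin

text \<open>The value of a homogeneous cochain on the standard triangulation of the cube spanned at \<open>h\<close> by \<open>\<sigma>\<close>.\<close>

fun cube_eval :: "nat \<Rightarrow> ('v word set list \<Rightarrow> real) \<Rightarrow> 'v word set \<Rightarrow> 'v set \<Rightarrow> real" where
  "cube_eval 0 F h \<sigma> = F [h]"
| "cube_eval (Suc n) F h \<sigma> = (\<Sum>v\<in>\<sigma>. eps v (\<sigma> - {v}) * cube_eval n (\<lambda>zs. F (h # zs)) (h \<otimes>\<^bsub>G\<^esub> gam v) (\<sigma> - {v}))"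

lemma cube_eval_cong:
  assumes "h \<in> carrier G" "\<sigma> \<subseteq> V"
    "\<And>zs. set zs \<subseteq> carrier G \<Longrightarrow> length zs = n \<Longrightarrow> F (h # zs) = F' (h # zs)"
  shows "cube_eval n F h \<sigma> = cube_eval n F' h \<sigma>"
  using assms
proof (induction n arbitrary: F F' h \<sigma>)
  case (Suc n)
  have "cube_eval n (\<lambda>zs. F (h # zs)) (h \<otimes>\<^bsub>G\<^esub> gam v) (\<sigma> - {v}) = cube_eval n (\<lambda>zs. F' (h # zs)) (h \<otimes>\<^bsub>G\<^esub> gam v) (\<sigma> - {v})"
    if v: "v \<in> \<sigma>" for v
  proof (rule Suc.IH)
    show "h \<otimes>\<^bsub>G\<^esub> gam v \<in> carrier G" using Suc.prems v gam_closed by auto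
    fix zs assume "set zs \<subseteq> carrier G" "length zs = n"
    thus "F (h # h \<otimes>\<^bsub>G\<^esub> gam v # zs) = F' (h # h \<otimes>\<^bsub>G\<^esub> gam v # zs)"
      using Suc.prems v gam_closed by (intro Suc.prems(3)) auto
  qed (use Suc.prems in auto)
  thus ?case by simp
qed simp

lemma cube_eval_diff: "cube_eval n (\<lambda>z. F z - F' z) h \<sigma> = cube_eval n F h \<sigma> - cube_eval n F' h \<sigma>"
proof (induction n arbitrary: F F' h \<sigma>)
  case (Suc n)
  show ?case by (simp add: Suc right_diff_distrib sum_subtractf)
qed simp

lemma cube_eval_translate:
  assumes "g \<in> carrier G" "h \<in> carrier G" "\<sigma> \<subseteq> V"
  shows "cube_eval n (\<lambda>zs. F (map ((\<otimes>\<^bsub>G\<^esub>) g) zs)) h \<sigma> = cube_eval n F (g \<otimes>\<^bsub>G\<^esub> h) \<sigma>"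
  using assms
proof (induction n arbitrary: F h \<sigma>)
  case (Suc n)
  have "cube_eval n (\<lambda>zs. F (g \<otimes>\<^bsub>G\<^esub> h # map ((\<otimes>\<^bsub>G\<^esub>) g) zs)) (h \<otimes>\<^bsub>G\<^esub> gam v) (\<sigma> - {v}) =
     cube_eval n (\<lambda>zs. F (g \<otimes>\<^bsub>G\<^esub> h # zs)) (g \<otimes>\<^bsub>G\<^esub> h \<otimes>\<^bsub>G\<^esub> gam v) (\<sigma> - {v})" if "v \<in> \<sigma>" for v
  proof -
    have v: "gam v \<in> carrier G" using that Suc.prems gam_closed by auto
    show ?thesis
      using Suc.IH[of "h \<otimes>\<^bsub>G\<^esub> gam v" "\<sigma> - {v}" "\<lambda>zs. F (g \<otimes>\<^bsub>G\<^esub> h # zs)"] Suc.prems v by (auto simp: G.m_assoc)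
  qed
  thus ?case by simp
qed simp

text \<open>Stokes' theorem for the triangulated cube. Simplices with an intermediate vertex omitted
  cancel in pairs, since two commuting steps may be made in either order (\<open>X\<close>). The
  terms \<open>Y\<close>, reordered with a sign by \<open>Ys\<close>, assemble to the faces at the
  base point.\<close>

lemma cube_eval_bar_dif:
  assumes "h \<in> carrier G" "clique \<sigma>"
  shows "cube_eval (Suc n) (bar_dif F) h \<sigma> = (\<Sum>v\<in>\<sigma>. eps v (\<sigma> - {v}) * (cube_eval n F (h \<otimes>\<^bsub>G\<^esub> gam v) (\<sigma> - {v}) - cube_eval n F h (\<sigma> - {v})))"
  using assms
proof (induction n arbitrary: F h \<sigma>)
  case (Suc n)
  have sV: "\<sigma> \<subseteq> V" by (rule clique_V[OF Suc.prems(2)])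
  define X where "X v w = cube_eval n (\<lambda>zs. F (h # zs)) (h \<otimes>\<^bsub>G\<^esub> gam v \<otimes>\<^bsub>G\<^esub> gam w) (\<sigma> - {v} - {w})" for v w
  define Y where "Y v w = cube_eval n (\<lambda>zs. F (h # zs)) (h \<otimes>\<^bsub>G\<^esub> gam v) (\<sigma> - {v} - {w})" for v w
  have hv: "h \<otimes>\<^bsub>G\<^esub> gam v \<in> carrier G" if "v \<in> \<sigma>" for v using Suc.prems(1) sV that gam_closed by auto
  have sets: "\<sigma> - {v} - {w} = \<sigma> - {w} - {v}" for v w by auto
  have Xs: "(\<Sum>v\<in>\<sigma>. \<Sum>w\<in>\<sigma> - {v}. eps v (\<sigma> - {v}) * eps w (\<sigma> - {v} - {w}) * X v w) = 0"
  proof (rule sum_faces_zero[OF sV])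
    fix v w assume vw: "v \<in> \<sigma>" "w \<in> \<sigma>" "v \<noteq> w"
    have "gam v \<otimes>\<^bsub>G\<^esub> gam w = gam w \<otimes>\<^bsub>G\<^esub> gam v" by (rule gam_commute[OF clique_adj[OF Suc.prems(2) vw]])
    moreover have "gam v \<in> carrier G" "gam w \<in> carrier G" using vw sV gam_closed by auto
    ultimately show "X v w = X w v" using Suc.prems(1) sets[of v w] by (simp add: X_def G.m_assoc)
  qed
  have Ys: "(\<Sum>v\<in>\<sigma>. \<Sum>w\<in>\<sigma> - {v}. eps v (\<sigma> - {v}) * eps w (\<sigma> - {v} - {w}) * (Y v w + Y w v)) = 0"
    by (rule sum_faces_zero[OF sV]) simp
  have "cube_eval (Suc (Suc n)) (bar_dif F) h \<sigma> = (\<Sum>v\<in>\<sigma>. eps v (\<sigma> - {v}) *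
      (cube_eval (Suc n) F (h \<otimes>\<^bsub>G\<^esub> gam v) (\<sigma> - {v}) - cube_eval (Suc n) (bar_dif (\<lambda>zs. F (h # zs))) (h \<otimes>\<^bsub>G\<^esub> gam v) (\<sigma> - {v})))"
    by (subst cube_eval.simps(2)) (simp only: bar_dif.simps cube_eval_diff)
  also have "\<dots> = (\<Sum>v\<in>\<sigma>. eps v (\<sigma> - {v}) * (cube_eval (Suc n) F (h \<otimes>\<^bsub>G\<^esub> gam v) (\<sigma> - {v}) -
      (\<Sum>w\<in>\<sigma> - {v}. eps w (\<sigma> - {v} - {w}) * (X v w - Y v w))))"
  proof (intro sum.cong HOL.refl)
    fix v assume v: "v \<in> \<sigma>"
    have "cube_eval (Suc n) (bar_dif (\<lambda>zs. F (h # zs))) (h \<otimes>\<^bsub>G\<^esub> gam v) (\<sigma> - {v}) =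
       (\<Sum>w\<in>\<sigma> - {v}. eps w (\<sigma> - {v} - {w}) * (X v w - Y v w))"
      unfolding X_def Y_def by (rule Suc.IH[OF hv[OF v] clique_subset[OF Suc.prems(2)]]) auto
    thus "eps v (\<sigma> - {v}) * (cube_eval (Suc n) F (h \<otimes>\<^bsub>G\<^esub> gam v) (\<sigma> - {v}) - cube_eval (Suc n) (bar_dif (\<lambda>zs. F (h # zs))) (h \<otimes>\<^bsub>G\<^esub> gam v) (\<sigma> - {v})) =
       eps v (\<sigma> - {v}) * (cube_eval (Suc n) F (h \<otimes>\<^bsub>G\<^esub> gam v) (\<sigma> - {v}) - (\<Sum>w\<in>\<sigma> - {v}. eps w (\<sigma> - {v} - {w}) * (X v w - Y v w)))"
      by (simp only:)
  qed
  also have "\<dots> = (\<Sum>v\<in>\<sigma>. eps v (\<sigma> - {v}) * cube_eval (Suc n) F (h \<otimes>\<^bsub>G\<^esub> gam v) (\<sigma> - {v})) -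
      (\<Sum>v\<in>\<sigma>. \<Sum>w\<in>\<sigma> - {v}. eps v (\<sigma> - {v}) * eps w (\<sigma> - {v} - {w}) * X v w) +
      (\<Sum>v\<in>\<sigma>. \<Sum>w\<in>\<sigma> - {v}. eps v (\<sigma> - {v}) * eps w (\<sigma> - {v} - {w}) * Y v w)"
    by (simp add: right_diff_distrib sum_subtractf sum_distrib_left mult.assoc)
  also have "(\<Sum>v\<in>\<sigma>. \<Sum>w\<in>\<sigma> - {v}. eps v (\<sigma> - {v}) * eps w (\<sigma> - {v} - {w}) * Y v w) =
      - (\<Sum>v\<in>\<sigma>. \<Sum>w\<in>\<sigma> - {v}. eps v (\<sigma> - {v}) * eps w (\<sigma> - {v} - {w}) * Y w v)"
    using Ys by (simp add: distrib_left sum.distrib)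
  also have "(\<Sum>v\<in>\<sigma>. \<Sum>w\<in>\<sigma> - {v}. eps v (\<sigma> - {v}) * eps w (\<sigma> - {v} - {w}) * Y w v) =
      (\<Sum>v\<in>\<sigma>. eps v (\<sigma> - {v}) * cube_eval (Suc n) F h (\<sigma> - {v}))"
    by (simp add: Y_def sum_distrib_left mult.assoc sets)
  finally show ?case by (simp add: Xs right_diff_distrib sum_subtractf)
qed simp

section \<open>The bar resolution maps to the complex of cubes\<close>

definition left_translate :: "'v word set \<Rightarrow> ('v set \<Rightarrow> 'v word set \<Rightarrow> real) \<Rightarrow> 'v set \<Rightarrow> 'v word set \<Rightarrow> real" where
  "left_translate g x \<sigma> h = (if h \<in> carrier G then x \<sigma> (inv\<^bsub>G\<^esub> g \<otimes>\<^bsub>G\<^esub> h) else 0)"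

lemma left_translate_chains:
  assumes x: "x \<in> chains n" and g: "g \<in> carrier G"
  shows "left_translate g x \<in> chains n"
proof (rule chainsI)
  fix \<sigma>
  have "{h. left_translate g x \<sigma> h \<noteq> 0} \<subseteq> (\<lambda>h. g \<otimes>\<^bsub>G\<^esub> h) ` {h. x \<sigma> h \<noteq> 0}"
  proof
    fix h assume h: "h \<in> {h. left_translate g x \<sigma> h \<noteq> 0}"
    hence "h = g \<otimes>\<^bsub>G\<^esub> (inv\<^bsub>G\<^esub> g \<otimes>\<^bsub>G\<^esub> h)" using g by (auto simp: left_translate_def G.m_assoc[symmetric] split: if_splits)
    thus "h \<in> (\<lambda>h. g \<otimes>\<^bsub>G\<^esub> h) ` {h. x \<sigma> h \<noteq> 0}" using h by (auto simp: left_translate_def split: if_splits)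
  qed
  thus "finite {h. left_translate g x \<sigma> h \<noteq> 0}" by (rule finite_subset) (use chainsD(3)[OF x] in auto)
qed (use chainsD(1)[OF x] in \<open>auto simp: left_translate_def\<close>)

lemma dif_left_translate:
  assumes g: "g \<in> carrier G"
  shows "dif (left_translate g x) \<tau> h = left_translate g (dif x) \<tau> h"
proof (cases "h \<in> carrier G")
  case True
  have "inv\<^bsub>G\<^esub> g \<otimes>\<^bsub>G\<^esub> (h \<otimes>\<^bsub>G\<^esub> inv\<^bsub>G\<^esub> gam v) = inv\<^bsub>G\<^esub> g \<otimes>\<^bsub>G\<^esub> h \<otimes>\<^bsub>G\<^esub> inv\<^bsub>G\<^esub> gam v" if "v \<in> V" for v
    using True g gam_closed[OF that] by (simp add: G.m_assoc)
  thus ?thesis using True g gam_closed by (auto simp: dif_def left_translate_def intro!: sum.cong)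
qed (simp add: dif_def left_translate_def)

lemma left_translate_left_translate:
  "g \<in> carrier G \<Longrightarrow> k \<in> carrier G \<Longrightarrow> left_translate g (left_translate k x) = left_translate (g \<otimes>\<^bsub>G\<^esub> k) x"
  by (auto simp: left_translate_def fun_eq_iff G.inv_mult_group G.m_assoc)

lemma pair_left_translate:
  assumes x: "x \<in> chains n" and g: "g \<in> carrier G"
  shows "pair (left_translate g x \<sigma>) F = pair (x \<sigma>) (\<lambda>h. F (g \<otimes>\<^bsub>G\<^esub> h))"
  unfolding pair_def
proof (rule sum.reindex_bij_witness[of _ "\<lambda>h. g \<otimes>\<^bsub>G\<^esub> h" "\<lambda>h. inv\<^bsub>G\<^esub> g \<otimes>\<^bsub>G\<^esub> h"], goal_cases)
  case (3 b)
  hence "b \<in> carrier G" using chainsD(2)[OF x] by blast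
  thus ?case using g by (simp add: G.m_assoc[symmetric])
next
  case (4 b)
  hence "b \<in> carrier G" using chainsD(2)[OF x] by blast
  thus ?case using 4 g by (simp add: left_translate_def G.m_assoc[symmetric])
qed (use g in \<open>auto simp: left_translate_def G.m_assoc[symmetric] split: if_splits\<close>)

lemma bar_dif_chains:
  assumes "\<And>zs. set zs \<subseteq> set gs \<Longrightarrow> Suc (length zs) = length gs \<Longrightarrow> x zs \<in> chains n"
  shows "(\<lambda>\<sigma> h. bar_dif (\<lambda>zs. x zs \<sigma> h) gs) \<in> chains n"
  using assms
proof (induction gs arbitrary: x)
  case (Cons g gs)
  have "(\<lambda>\<sigma> h. bar_dif (\<lambda>zs. x (g # zs) \<sigma> h) gs) \<in> chains n" by (rule Cons.IH, rule Cons.prems) auto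
  moreover have "x gs \<in> chains n" by (rule Cons.prems) auto
  ultimately show ?case using chains_diff by simp
qed (simp add: chains_zero)

lemma dif_bar_dif: "dif (\<lambda>\<sigma> h. bar_dif (\<lambda>zs. x zs \<sigma> h) gs) \<tau> g = bar_dif (\<lambda>zs. dif (x zs) \<tau> g) gs"
  by (induction gs arbitrary: x) (simp_all add: dif_diff, simp add: dif_def)

lemma pair_bar_dif:
  assumes "\<And>zs. set zs \<subseteq> set gs \<Longrightarrow> Suc (length zs) = length gs \<Longrightarrow> x zs \<in> chains n"
  shows "pair (\<lambda>h. bar_dif (\<lambda>zs. x zs \<sigma> h) gs) F = bar_dif (\<lambda>zs. pair (x zs \<sigma>) F) gs"
  using assms
proof (induction gs arbitrary: x)
  case (Cons g gs)
  have c: "(\<lambda>\<sigma> h. bar_dif (\<lambda>zs. x (g # zs) \<sigma> h) gs) \<in> chains n" by (rule bar_dif_chains, rule Cons.prems) auto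
  have "x gs \<in> chains n" by (rule Cons.prems) auto
  moreover have "pair (\<lambda>h. bar_dif (\<lambda>zs. x (g # zs) \<sigma> h) gs) F = bar_dif (\<lambda>zs. pair (x (g # zs) \<sigma>) F) gs"
    by (rule Cons.IH, rule Cons.prems) auto
  ultimately show ?case using chainsD(3)[OF c] chainsD(3)[of "x gs" n] by (simp add: pair_diff)
qed simp

text \<open>A \<open>G\<close>-equivariant chain map from the homogeneous bar resolution to the complex of cubes.\<close>

fun bar :: "nat \<Rightarrow> 'v word set list \<Rightarrow> 'v set \<Rightarrow> 'v word set \<Rightarrow> real" where
  "bar 0 gs = (\<lambda>\<sigma> h. if \<sigma> = {} \<and> h = hd gs then 1 else 0)"
| "bar (Suc n) gs = left_translate (hd gs) (SOME y. y \<in> chains (Suc n) \<and>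
     dif y = (\<lambda>\<sigma> h. bar_dif (\<lambda>zs. bar n zs \<sigma> h) (map ((\<otimes>\<^bsub>G\<^esub>) (inv\<^bsub>G\<^esub> (hd gs))) gs)))"

text \<open>One joint induction: a filling exists in degree \<open>n + 1\<close> because the chain
  map property (or the augmentation) in degree \<open>n\<close> makes the prescribed boundary a
  cycle, and equivariance in degree \<open>n\<close> carries the boundary formula from the
  normalised list to the given one.\<close>

lemma bar_props:
  "(\<forall>gs. set gs \<subseteq> carrier G \<longrightarrow> length gs = Suc n \<longrightarrow> bar n gs \<in> chains n \<and>
     (\<forall>g\<in>carrier G. bar n (map ((\<otimes>\<^bsub>G\<^esub>) g) gs) = left_translate g (bar n gs)) \<and>
     (case n of 0 \<Rightarrow> aug (bar 0 gs) = 1 | Suc m \<Rightarrow> dif (bar n gs) = (\<lambda>\<sigma> h. bar_dif (\<lambda>zs. bar m zs \<sigma> h) gs)))"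
proof (induction n)
  case 0
  show ?case
  proof (intro allI impI)
    fix gs assume gs: "set gs \<subseteq> carrier G" "length gs = Suc 0"
    then obtain k where k: "gs = [k]" "k \<in> carrier G" by (auto simp: length_Suc_conv)
    have "finite {h. bar 0 gs \<sigma> h \<noteq> 0}" for \<sigma> by (rule finite_subset[of _ "{k}"]) (auto simp: k split: if_splits)
    hence "bar 0 gs \<in> chains 0" by (intro chainsI) (use k in \<open>auto simp: cliques_0\<close>)
    moreover have "bar 0 (map ((\<otimes>\<^bsub>G\<^esub>) g) gs) = left_translate g (bar 0 gs)" if g: "g \<in> carrier G" for g
    proof -
      have "inv\<^bsub>G\<^esub> g \<otimes>\<^bsub>G\<^esub> h = k \<longleftrightarrow> h = g \<otimes>\<^bsub>G\<^esub> k" if "h \<in> carrier G" for h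
        using g k that by (metis G.inv_solve_left')
      thus ?thesis using g k by (auto simp: left_translate_def fun_eq_iff)
    qed
    moreover have "aug (bar 0 gs) = 1"
    proof -
      have "{h. bar 0 gs {} h \<noteq> 0} \<subseteq> {k}" by (auto simp: k split: if_splits)
      thus ?thesis using pair_superset[of "{k}" "bar 0 gs {}" "\<lambda>_. 1"] by (simp add: aug_def) (simp add: k)
    qed
    ultimately show "bar 0 gs \<in> chains 0 \<and> (\<forall>g\<in>carrier G. bar 0 (map ((\<otimes>\<^bsub>G\<^esub>) g) gs) = left_translate g (bar 0 gs)) \<and>
       (case 0 of 0 \<Rightarrow> aug (bar 0 gs) = 1 | Suc m \<Rightarrow> dif (bar 0 gs) = (\<lambda>\<sigma> h. bar_dif (\<lambda>zs. bar m zs \<sigma> h) gs))" by simp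
  qed
next
  case (Suc n)
  have bc: "bar n zs \<in> chains n" if "set zs \<subseteq> carrier G" "length zs = Suc n" for zs
    using Suc that by blast
  have be: "bar n (map ((\<otimes>\<^bsub>G\<^esub>) g) zs) = left_translate g (bar n zs)" if "set zs \<subseteq> carrier G" "length zs = Suc n" "g \<in> carrier G" for g zs
    using Suc that by blast
  have b0: "aug (bar 0 zs) = 1" if "set zs \<subseteq> carrier G" "length zs = Suc 0" "n = 0" for zs
    using Suc that by simp
  have bS: "dif (bar n zs) = (\<lambda>\<sigma> h. bar_dif (\<lambda>zs. bar m zs \<sigma> h) zs)" if "set zs \<subseteq> carrier G" "length zs = Suc n" "n = Suc m" for zs m
    using Suc that by simp
  show ?case
  proof (intro allI impI)
    fix gs assume gs: "set gs \<subseteq> carrier G" "length gs = Suc (Suc n)"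
    let ?g = "hd gs"
    have g: "?g \<in> carrier G" using gs by (cases gs) auto
    let ?gs = "map ((\<otimes>\<^bsub>G\<^esub>) (inv\<^bsub>G\<^esub> ?g)) gs"
    have gs': "set ?gs \<subseteq> carrier G" "length ?gs = Suc (Suc n)" using gs g by auto
    let ?r = "\<lambda>\<sigma> h. bar_dif (\<lambda>zs. bar n zs \<sigma> h) ?gs"
    have rc: "?r \<in> chains n" by (rule bar_dif_chains, rule bc) (use gs' in auto)
    have "\<exists>w\<in>chains (Suc n). dif w = ?r"
    proof (rule chains_acyclic[OF rc])
      fix \<tau> h
      show "dif ?r \<tau> h = 0"
      proof (cases n)
        case 0
        thus ?thesis using dif_chains_0[of ?r] rc by simp
      next
        case (Suc m)
        have "dif ?r \<tau> h = bar_dif (\<lambda>zs. dif (bar n zs) \<tau> h) ?gs" by (rule dif_bar_dif)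
        also have "\<dots> = bar_dif (bar_dif (\<lambda>zs. bar m zs \<tau> h)) ?gs"
          by (rule bar_dif_cong, subst bS[OF _ _ Suc]) (use gs' in auto)
        also have "\<dots> = 0" by (rule bar_dif_bar_dif)
        finally show ?thesis .
      qed
    next
      assume n: "n = 0"
      obtain a b where ab: "?gs = [a, b]" using gs' n by (auto simp: length_Suc_conv simp del: length_map)
      have "aug ?r = bar_dif (\<lambda>zs. pair (bar n zs {}) (\<lambda>_. 1)) ?gs"
        unfolding aug_def by (rule pair_bar_dif, rule bc) (use gs' in auto)
      also have "\<dots> = bar_dif (\<lambda>zs. 1) ?gs"
        by (rule bar_dif_cong) (use b0[unfolded aug_def] gs' n in auto)
      finally show "aug ?r = 0" by (simp add: ab)
    qed
    define y where "y = (SOME y. y \<in> chains (Suc n) \<and> dif y = ?r)"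
    have y: "y \<in> chains (Suc n)" "dif y = ?r"
      using someI_ex[of "\<lambda>y. y \<in> chains (Suc n) \<and> dif y = ?r"] \<open>\<exists>w\<in>chains (Suc n). dif w = ?r\<close>
      unfolding y_def by blast+
    have bar: "bar (Suc n) gs = left_translate ?g y" by (simp add: y_def)
    have 1: "bar (Suc n) gs \<in> chains (Suc n)" unfolding bar by (rule left_translate_chains[OF y(1) g])
    \<comment> \<open>Normalising by the head erases the translation, so both lists lead to the same
      chosen filling \<open>y\<close>.\<close>
    have 2: "bar (Suc n) (map ((\<otimes>\<^bsub>G\<^esub>) k) gs) = left_translate k (bar (Suc n) gs)" if k: "k \<in> carrier G" for k
    proof -
      have hd: "hd (map ((\<otimes>\<^bsub>G\<^esub>) k) gs) = k \<otimes>\<^bsub>G\<^esub> ?g" using gs by (cases gs) auto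
      have "map ((\<otimes>\<^bsub>G\<^esub>) (inv\<^bsub>G\<^esub> (k \<otimes>\<^bsub>G\<^esub> ?g))) (map ((\<otimes>\<^bsub>G\<^esub>) k) gs) = ?gs"
        unfolding map_map
      proof (rule map_cong[OF HOL.refl])
        fix x assume "x \<in> set gs"
        hence x: "x \<in> carrier G" using gs by auto
        have "inv\<^bsub>G\<^esub> k \<otimes>\<^bsub>G\<^esub> (k \<otimes>\<^bsub>G\<^esub> x) = x" using k x by (simp add: G.m_assoc[symmetric])
        thus "((\<otimes>\<^bsub>G\<^esub>) (inv\<^bsub>G\<^esub> (k \<otimes>\<^bsub>G\<^esub> ?g)) \<circ> (\<otimes>\<^bsub>G\<^esub>) k) x = inv\<^bsub>G\<^esub> ?g \<otimes>\<^bsub>G\<^esub> x"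
          using k g x by (simp add: G.inv_mult_group G.m_assoc)
      qed
      hence "bar (Suc n) (map ((\<otimes>\<^bsub>G\<^esub>) k) gs) = left_translate (k \<otimes>\<^bsub>G\<^esub> ?g) y" by (simp only: bar.simps hd y_def)
      thus ?thesis using left_translate_left_translate[OF k g] bar by simp
    qed
    have 3: "dif (bar (Suc n) gs) = (\<lambda>\<sigma> h. bar_dif (\<lambda>zs. bar n zs \<sigma> h) gs)"
    proof (intro ext)
      fix \<sigma> h
      show "dif (bar (Suc n) gs) \<sigma> h = bar_dif (\<lambda>zs. bar n zs \<sigma> h) gs"
      proof (cases "h \<in> carrier G")
        case True
        have "dif (bar (Suc n) gs) \<sigma> h = bar_dif (\<lambda>zs. bar n zs \<sigma> (inv\<^bsub>G\<^esub> ?g \<otimes>\<^bsub>G\<^esub> h)) ?gs"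
          unfolding bar dif_left_translate[OF g] y(2) using True by (simp add: left_translate_def)
        also have "\<dots> = bar_dif (\<lambda>zs. bar n (map ((\<otimes>\<^bsub>G\<^esub>) (inv\<^bsub>G\<^esub> ?g)) zs) \<sigma> (inv\<^bsub>G\<^esub> ?g \<otimes>\<^bsub>G\<^esub> h)) gs"
          by (rule bar_dif_map)
        also have "\<dots> = bar_dif (\<lambda>zs. bar n zs \<sigma> h) gs"
        proof (rule bar_dif_cong)
          fix zs assume zs: "set zs \<subseteq> set gs" "Suc (length zs) = length gs"
          have "bar n (map ((\<otimes>\<^bsub>G\<^esub>) (inv\<^bsub>G\<^esub> ?g)) zs) = left_translate (inv\<^bsub>G\<^esub> ?g) (bar n zs)"
            by (rule be) (use zs gs g in auto)
          thus "bar n (map ((\<otimes>\<^bsub>G\<^esub>) (inv\<^bsub>G\<^esub> ?g)) zs) \<sigma> (inv\<^bsub>G\<^esub> ?g \<otimes>\<^bsub>G\<^esub> h) = bar n zs \<sigma> h"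
            using True g by (simp add: left_translate_def G.m_assoc[symmetric])
        qed
        finally show ?thesis .
      next
        case False
        have "bar_dif (\<lambda>zs. bar n zs \<sigma> h) gs = bar_dif (\<lambda>zs. 0) gs"
          by (rule bar_dif_cong, rule chainsD(2)[OF bc False]) (use gs in auto)
        thus ?thesis using False by (simp add: dif_def)
      qed
    qed
    show "bar (Suc n) gs \<in> chains (Suc n) \<and> (\<forall>g\<in>carrier G. bar (Suc n) (map ((\<otimes>\<^bsub>G\<^esub>) g) gs) = left_translate g (bar (Suc n) gs)) \<and>
       (case Suc n of 0 \<Rightarrow> aug (bar 0 gs) = 1 | Suc m \<Rightarrow> dif (bar (Suc n) gs) = (\<lambda>\<sigma> h. bar_dif (\<lambda>zs. bar m zs \<sigma> h) gs))"
      using 1 2 3 by (simp del: bar.simps)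
  qed
qed

lemma bar_chains: "set gs \<subseteq> carrier G \<Longrightarrow> length gs = Suc n \<Longrightarrow> bar n gs \<in> chains n"
  using bar_props[of n] by blast

lemma bar_translate: "set gs \<subseteq> carrier G \<Longrightarrow> length gs = Suc n \<Longrightarrow> g \<in> carrier G \<Longrightarrow>
    bar n (map ((\<otimes>\<^bsub>G\<^esub>) g) gs) = left_translate g (bar n gs)"
  using bar_props[of n] by blast

lemma dif_bar: "set gs \<subseteq> carrier G \<Longrightarrow> length gs = Suc (Suc n) \<Longrightarrow>
    dif (bar (Suc n) gs) = (\<lambda>\<sigma> h. bar_dif (\<lambda>zs. bar n zs \<sigma> h) gs)"
  using bar_props[of "Suc n"] by (simp del: bar.simps)

text \<open>\<open>F\<close> pulled back along the round trip from simplices to cubes by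
  \<open>bar\<close> and back by triangulation.\<close>

definition W :: "nat \<Rightarrow> ('v word set list \<Rightarrow> real) \<Rightarrow> 'v word set list \<Rightarrow> real" where
  "W n F gs = (\<Sum>\<sigma>\<in>cliques n. pair (bar n gs \<sigma>) (\<lambda>h. cube_eval n F h \<sigma>))"

lemma W_diff: "W n (\<lambda>z. F z - F' z) gs = W n F gs - W n F' gs"
proof -
  have "pair f (\<lambda>h. A h - B h) = pair f A - pair f B" for f A B :: "'v word set \<Rightarrow> real"
    by (simp add: pair_def right_diff_distrib sum_subtractf)
  thus ?thesis by (simp add: W_def cube_eval_diff sum_subtractf)
qed

lemma W_cong:
  assumes gs: "set gs \<subseteq> carrier G" "length gs = Suc n"
    and eq: "\<And>zs. set zs \<subseteq> carrier G \<Longrightarrow> length zs = Suc n \<Longrightarrow> F zs = F' zs"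
  shows "W n F gs = W n F' gs"
  unfolding W_def
proof (intro sum.cong pair_cong HOL.refl)
  fix \<sigma> h assume s: "\<sigma> \<in> cliques n" and "bar n gs \<sigma> h \<noteq> 0"
  hence "h \<in> carrier G" using chainsD(2)[OF bar_chains[OF gs]] by blast
  thus "cube_eval n F h \<sigma> = cube_eval n F' h \<sigma>"
    using s clique_V by (intro cube_eval_cong eq) (auto simp: cliques_def)
qed

lemma W_translate:
  assumes gs: "set gs \<subseteq> carrier G" "length gs = Suc n" and g: "g \<in> carrier G"
  shows "W n (\<lambda>zs. F (map ((\<otimes>\<^bsub>G\<^esub>) g) zs)) gs = W n F (map ((\<otimes>\<^bsub>G\<^esub>) g) gs)"
  unfolding W_def bar_translate[OF gs g] pair_left_translate[OF bar_chains[OF gs] g]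
proof (intro sum.cong pair_cong HOL.refl)
  fix \<sigma> h assume s: "\<sigma> \<in> cliques n" and "bar n gs \<sigma> h \<noteq> 0"
  hence "h \<in> carrier G" using chainsD(2)[OF bar_chains[OF gs]] by blast
  thus "cube_eval n (\<lambda>zs. F (map ((\<otimes>\<^bsub>G\<^esub>) g) zs)) h \<sigma> = cube_eval n F (g \<otimes>\<^bsub>G\<^esub> h) \<sigma>"
    using s clique_V g by (intro cube_eval_translate) (auto simp: cliques_def)
qed

lemma W_0: "set gs \<subseteq> carrier G \<Longrightarrow> length gs = Suc 0 \<Longrightarrow> W 0 F gs = F gs"
proof -
  assume "set gs \<subseteq> carrier G" "length gs = Suc 0"
  then obtain k where k: "gs = [k]" by (auto simp: length_Suc_conv)
  have "{h. bar 0 gs {} h \<noteq> 0} \<subseteq> {k}" by (auto simp: k split: if_splits)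
  thus ?thesis using pair_superset[of "{k}" "bar 0 gs {}" "\<lambda>h. F [h]"] by (simp add: W_def cliques_0) (simp add: k)
qed

text \<open>Both halves of the round trip respect boundaries, by \<open>cube_eval_bar_dif\<close>
  and \<open>dif_bar\<close>; in between, a sum over cubes and their directions is rewritten as a
  sum over faces.\<close>

lemma W_bar_dif:
  assumes gs: "set gs \<subseteq> carrier G" "length gs = Suc (Suc n)"
  shows "W (Suc n) (bar_dif F) gs = bar_dif (W n F) gs"
proof -
  let ?b = "bar (Suc n) gs"
  have b: "?b \<in> chains (Suc n)" by (rule bar_chains[OF gs])
  define f where "f v \<tau> = eps v \<tau> * pair (?b (insert v \<tau>)) (\<lambda>h. cube_eval n F (h \<otimes>\<^bsub>G\<^esub> gam v) \<tau> - cube_eval n F h \<tau>)" for v \<tau>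
  have "W (Suc n) (bar_dif F) gs = (\<Sum>\<sigma>\<in>cliques (Suc n). \<Sum>v\<in>\<sigma>. f v (\<sigma> - {v}))"
    unfolding W_def
  proof (rule sum.cong[OF HOL.refl])
    fix \<sigma> assume s: "\<sigma> \<in> cliques (Suc n)"
    have "pair (?b \<sigma>) (\<lambda>h. cube_eval (Suc n) (bar_dif F) h \<sigma>) = pair (?b \<sigma>) (\<lambda>h. \<Sum>v\<in>\<sigma>. eps v (\<sigma> - {v}) *
        (cube_eval n F (h \<otimes>\<^bsub>G\<^esub> gam v) (\<sigma> - {v}) - cube_eval n F h (\<sigma> - {v})))"
    proof (rule pair_cong)
      fix h assume "?b \<sigma> h \<noteq> 0"
      hence "h \<in> carrier G" using chainsD(2)[OF b] by blast
      thus "cube_eval (Suc n) (bar_dif F) h \<sigma> = (\<Sum>v\<in>\<sigma>. eps v (\<sigma> - {v}) * (cube_eval n F (h \<otimes>\<^bsub>G\<^esub> gam v) (\<sigma> - {v}) - cube_eval n F h (\<sigma> - {v})))"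
        using s by (intro cube_eval_bar_dif) (auto simp: cliques_def)
    qed
    also have "\<dots> = (\<Sum>v\<in>\<sigma>. f v (\<sigma> - {v}))"
    proof -
      have "pair k (\<lambda>h. \<Sum>v\<in>\<sigma>. c v * H v h) = (\<Sum>v\<in>\<sigma>. c v * pair k (H v))" for k c and H :: "'v \<Rightarrow> 'v word set \<Rightarrow> real"
        unfolding pair_def sum_distrib_left by (subst sum.swap) (simp add: mult_ac)
      hence "pair (?b \<sigma>) (\<lambda>h. \<Sum>v\<in>\<sigma>. eps v (\<sigma> - {v}) * (cube_eval n F (h \<otimes>\<^bsub>G\<^esub> gam v) (\<sigma> - {v}) - cube_eval n F h (\<sigma> - {v}))) =
         (\<Sum>v\<in>\<sigma>. eps v (\<sigma> - {v}) * pair (?b \<sigma>) (\<lambda>h. cube_eval n F (h \<otimes>\<^bsub>G\<^esub> gam v) (\<sigma> - {v}) - cube_eval n F h (\<sigma> - {v})))" .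
      also have "\<dots> = (\<Sum>v\<in>\<sigma>. f v (\<sigma> - {v}))"
        by (intro sum.cong HOL.refl) (simp add: f_def insert_absorb del: bar.simps)
      finally show ?thesis .
    qed
    finally show "pair (?b \<sigma>) (\<lambda>h. cube_eval (Suc n) (bar_dif F) h \<sigma>) = (\<Sum>v\<in>\<sigma>. f v (\<sigma> - {v}))" .
  qed
  also have "\<dots> = (\<Sum>\<tau>\<in>cliques n. \<Sum>v\<in>{v \<in> V - \<tau>. insert v \<tau> \<in> cliques (Suc n)}. f v \<tau>)"
    by (rule sum_faces_reindex)
  also have "\<dots> = (\<Sum>\<tau>\<in>cliques n. \<Sum>v\<in>V - \<tau>. f v \<tau>)"
  proof (rule sum.cong[OF HOL.refl], rule sum.mono_neutral_left)
    fix \<tau>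
    show "\<forall>v\<in>V - \<tau> - {v \<in> V - \<tau>. insert v \<tau> \<in> cliques (Suc n)}. f v \<tau> = 0"
    proof
      fix v assume "v \<in> V - \<tau> - {v \<in> V - \<tau>. insert v \<tau> \<in> cliques (Suc n)}"
      hence "insert v \<tau> \<notin> cliques (Suc n)" by blast
      hence "?b (insert v \<tau>) h = 0" for h using chainsD(1)[OF b] by blast
      thus "f v \<tau> = 0" by (simp add: f_def pair_def del: bar.simps)
    qed
  qed (use finite_V in auto)
  also have "\<dots> = (\<Sum>\<tau>\<in>cliques n. pair (dif ?b \<tau>) (\<lambda>h. cube_eval n F h \<tau>))"
    unfolding f_def pair_dif[OF b] ..
  also have "\<dots> = (\<Sum>\<tau>\<in>cliques n. bar_dif (\<lambda>zs. pair (bar n zs \<tau>) (\<lambda>h. cube_eval n F h \<tau>)) gs)"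
  proof (rule sum.cong[OF HOL.refl])
    fix \<tau>
    show "pair (dif ?b \<tau>) (\<lambda>h. cube_eval n F h \<tau>) = bar_dif (\<lambda>zs. pair (bar n zs \<tau>) (\<lambda>h. cube_eval n F h \<tau>)) gs"
      unfolding dif_bar[OF gs] by (rule pair_bar_dif, rule bar_chains) (use gs in auto)
  qed
  also have "\<dots> = bar_dif (W n F) gs" unfolding W_def[abs_def] by (rule bar_dif_sum[symmetric])
  finally show ?thesis .
qed

text \<open>\<open>T\<close> is the homotopy from the identity of the bar complex to the composite \<open>W\<close> through the complex of
  cubes; it inserts the first entry once more, which is the equivariant form of the standard contraction.\<close>

fun T :: "nat \<Rightarrow> ('v word set list \<Rightarrow> real) \<Rightarrow> 'v word set list \<Rightarrow> real" where
  "T 0 F gs = 0"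
| "T (Suc n) F gs = F (hd gs # gs) - W (Suc n) (\<lambda>ys. F (hd gs # ys)) gs - bar_dif (T n (\<lambda>ys. F (hd gs # ys))) gs"

lemma T_diff: "T n (\<lambda>z. F z - F' z) gs = T n F gs - T n F' gs"
proof (induction n arbitrary: F F' gs)
  case (Suc n)
  have "T n (\<lambda>ys. F (hd gs # ys) - F' (hd gs # ys)) = (\<lambda>zs. T n (\<lambda>ys. F (hd gs # ys)) zs - T n (\<lambda>ys. F' (hd gs # ys)) zs)"
    by (rule ext) (rule Suc)
  thus ?case by (simp add: W_diff bar_dif_diff)
qed simp

lemma T_cong:
  assumes "set gs \<subseteq> carrier G" "length gs = Suc n"
    "\<And>zs. set zs \<subseteq> carrier G \<Longrightarrow> length zs = Suc (Suc n) \<Longrightarrow> F zs = F' zs"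
  shows "T n F gs = T n F' gs"
  using assms
proof (induction n arbitrary: F F' gs)
  case (Suc n)
  have h: "hd gs \<in> carrier G" using Suc.prems by (cases gs) auto
  have 1: "F (hd gs # gs) = F' (hd gs # gs)" by (rule Suc.prems(3)) (use Suc.prems h in auto)
  have 2: "W (Suc n) (\<lambda>ys. F (hd gs # ys)) gs = W (Suc n) (\<lambda>ys. F' (hd gs # ys)) gs"
    by (rule W_cong[OF Suc.prems(1,2)], rule Suc.prems(3)) (use h in auto)
  have 3: "bar_dif (T n (\<lambda>ys. F (hd gs # ys))) gs = bar_dif (T n (\<lambda>ys. F' (hd gs # ys))) gs"
    by (rule bar_dif_cong, rule Suc.IH, use Suc.prems in fastforce, use Suc.prems in simp, rule Suc.prems(3)) (use h in auto)
  show ?case using 1 2 3 by simp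
qed simp

lemma T_translate:
  assumes "set gs \<subseteq> carrier G" "length gs = Suc n" "g \<in> carrier G"
  shows "T n (\<lambda>zs. F (map ((\<otimes>\<^bsub>G\<^esub>) g) zs)) gs = T n F (map ((\<otimes>\<^bsub>G\<^esub>) g) gs)"
  using assms
proof (induction n arbitrary: F gs)
  case (Suc n)
  have hd: "hd (map ((\<otimes>\<^bsub>G\<^esub>) g) gs) = g \<otimes>\<^bsub>G\<^esub> hd gs" using Suc.prems by (cases gs) auto
  have 1: "W (Suc n) (\<lambda>ys. F (g \<otimes>\<^bsub>G\<^esub> hd gs # map ((\<otimes>\<^bsub>G\<^esub>) g) ys)) gs = W (Suc n) (\<lambda>ys. F (g \<otimes>\<^bsub>G\<^esub> hd gs # ys)) (map ((\<otimes>\<^bsub>G\<^esub>) g) gs)"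
    by (rule W_translate[OF Suc.prems])
  have 2: "bar_dif (T n (\<lambda>ys. F (g \<otimes>\<^bsub>G\<^esub> hd gs # map ((\<otimes>\<^bsub>G\<^esub>) g) ys))) gs = bar_dif (T n (\<lambda>ys. F (g \<otimes>\<^bsub>G\<^esub> hd gs # ys))) (map ((\<otimes>\<^bsub>G\<^esub>) g) gs)"
    unfolding bar_dif_map by (rule bar_dif_cong, rule Suc.IH) (use Suc.prems in auto)
  show ?case unfolding T.simps hd using 1 2 by simp
qed simp

text \<open>The recursion of \<open>T\<close> reduces degree \<open>n + 1\<close> to degree
  \<open>n\<close> for the cochain whose first argument is frozen at the head. The remainder is
  \<open>bar_dif\<close> of the induction hypothesis and vanishes because \<open>bar_dif\<close>
  squares to zero.\<close>

lemma homotopy: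
  assumes "set gs \<subseteq> carrier G" "length gs = Suc n"
  shows "F gs - W n F gs = (case n of 0 \<Rightarrow> 0 | Suc m \<Rightarrow> bar_dif (T m F) gs) + T n (bar_dif F) gs"
  using assms
proof (induction n arbitrary: F gs)
  case 0 thus ?case by (simp add: W_0)
next
  case (Suc n)
  let ?g = "hd gs"
  let ?F = "\<lambda>ys. F (?g # ys)"
  have IH: "?F zs - W n ?F zs - T n (bar_dif ?F) zs = (case n of 0 \<Rightarrow> 0 | Suc m \<Rightarrow> bar_dif (T m ?F) zs)"
    if "set zs \<subseteq> set gs" "Suc (length zs) = length gs" for zs
    using Suc.IH[of zs ?F] that Suc.prems by (simp add: algebra_simps)
  have z: "bar_dif (\<lambda>zs. ?F zs - W n ?F zs - T n (bar_dif ?F) zs) gs = 0"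
  proof -
    have "bar_dif (\<lambda>zs. ?F zs - W n ?F zs - T n (bar_dif ?F) zs) gs = bar_dif (\<lambda>zs. case n of 0 \<Rightarrow> 0 | Suc m \<Rightarrow> bar_dif (T m ?F) zs) gs"
      by (rule bar_dif_cong, rule IH)
    also have "\<dots> = 0" by (cases n) (simp_all add: bar_dif_bar_dif)
    finally show ?thesis .
  qed
  have TT: "T n (\<lambda>ys. F ys - bar_dif ?F ys) = (\<lambda>zs. T n F zs - T n (bar_dif ?F) zs)" by (rule ext) (rule T_diff)
  have "T (Suc n) (bar_dif F) gs = (F gs - bar_dif ?F gs) - (W (Suc n) F gs - W (Suc n) (bar_dif ?F) gs) - (bar_dif (T n F) gs - bar_dif (T n (bar_dif ?F)) gs)"
    by (simp add: W_diff TT bar_dif_diff)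
  also have "W (Suc n) (bar_dif ?F) gs = bar_dif (W n ?F) gs" by (rule W_bar_dif[OF Suc.prems])
  finally show ?case using z by (simp add: bar_dif_diff)
qed

end

section \<open>Homogeneous and inhomogeneous coordinates\<close>

fun diffs :: "('g, 'x) monoid_scheme \<Rightarrow> 'g list \<Rightarrow> 'g list" where
  "diffs G (g # h # gs) = (inv\<^bsub>G\<^esub> g \<otimes>\<^bsub>G\<^esub> h) # diffs G (h # gs)"
| "diffs G [g] = []"
| "diffs G [] = []"

fun partial_products :: "('g, 'x) monoid_scheme \<Rightarrow> 'g \<Rightarrow> 'g list \<Rightarrow> 'g list" where
  "partial_products G g [] = [g]"
| "partial_products G g (x # xs) = g # partial_products G (g \<otimes>\<^bsub>G\<^esub> x) xs"

lemma length_partial_products [simp]: "length (partial_products G g xs) = Suc (length xs)"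
  by (induction G g xs rule: partial_products.induct) auto

context group begin

lemma diffs_tuples: "set gs \<subseteq> carrier G \<Longrightarrow> length gs = Suc n \<Longrightarrow> diffs G gs \<in> tuples G n"
proof (induction gs arbitrary: n rule: induct_list012)
  case (3 g h gs)
  thus ?case by (cases n) (auto simp: tuples_def)
qed (auto simp: tuples_def)

lemma partial_products_carrier: "set xs \<subseteq> carrier G \<Longrightarrow> g \<in> carrier G \<Longrightarrow> set (partial_products G g xs) \<subseteq> carrier G"
  by (induction xs arbitrary: g) auto

lemma diffs_partial_products:
  "set xs \<subseteq> carrier G \<Longrightarrow> g \<in> carrier G \<Longrightarrow> diffs G (partial_products G g xs) = xs"
proof (induction xs arbitrary: g)
  case (Cons x xs)
  have "inv g \<otimes> (g \<otimes> x) = x" using Cons.prems by (simp add: m_assoc[symmetric])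
  thus ?case using Cons.IH[of "g \<otimes> x"] Cons.prems by (cases xs) auto
qed simp

lemma partial_products_diffs:
  "set gs \<subseteq> carrier G \<Longrightarrow> gs \<noteq> [] \<Longrightarrow> partial_products G (hd gs) (diffs G gs) = gs"
proof (induction gs rule: induct_list012)
  case (3 g h gs)
  have "g \<otimes> (inv g \<otimes> h) = h" using 3 by (simp add: m_assoc[symmetric])
  thus ?case using 3 by simp
qed auto

lemma map_partial_products:
  "set xs \<subseteq> carrier G \<Longrightarrow> g \<in> carrier G \<Longrightarrow> h \<in> carrier G \<Longrightarrow>
    map ((\<otimes>) g) (partial_products G h xs) = partial_products G (g \<otimes> h) xs"
  by (induction xs arbitrary: h) (auto simp: m_assoc)

lemma diffs_translate:
  assumes "set gs \<subseteq> carrier G" "g \<in> carrier G"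
  shows "diffs G (map ((\<otimes>) g) gs) = diffs G gs"
  using assms(1)
proof (induction gs rule: induct_list012)
  case (3 a b gs)
  have "inv g \<otimes> (g \<otimes> b) = b" using 3 assms by (simp add: m_assoc[symmetric])
  thus ?case using 3 assms(2) by (simp add: inv_mult_group m_assoc)
qed auto

text \<open>The faces that keep the starting point \<open>g\<close>; the face omitting it is added
  in \<open>codifferential_bar_dif\<close>. This form survives peeling off a letter, since the
  letters already read are absorbed into \<open>f\<close>.\<close>

lemma bar_dif_diffs:
  assumes "g \<in> carrier G" "x \<in> carrier G" "set xs \<subseteq> carrier G"
  shows "bar_dif (\<lambda>zs. f (diffs G (g # zs))) (partial_products G (g \<otimes> x) xs) =
    (\<Sum>i<length xs. (-1) ^ i * f (take i (x # xs) @ [(x # xs) ! i \<otimes> (x # xs) ! (i + 1)] @ drop (i + 2) (x # xs)))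
      + (-1) ^ length xs * f (butlast (x # xs))"
  using assms
proof (induction xs arbitrary: f g x)
  case (Cons y ys)
  have gx: "g \<otimes> x \<in> carrier G" "inv g \<otimes> (g \<otimes> x) = x" using Cons.prems by (auto simp: m_assoc[symmetric])
  have hd: "\<exists>zs. partial_products G (g \<otimes> x \<otimes> y) ys = (g \<otimes> x \<otimes> y) # zs"
    by (cases ys) auto
  have xy: "inv g \<otimes> (g \<otimes> x \<otimes> y) = x \<otimes> y" using Cons.prems gx by (simp add: m_assoc[symmetric])
  have "diffs G (partial_products G (g \<otimes> x \<otimes> y) ys) = ys"
    by (rule diffs_partial_products) (use Cons.prems in auto)
  hence 1: "diffs G (g # partial_products G (g \<otimes> x \<otimes> y) ys) = (x \<otimes> y) # ys"
    using hd xy by (cases "partial_products G (g \<otimes> x \<otimes> y) ys") auto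
  have 2: "diffs G (g # g \<otimes> x # zs) = x # diffs G (g \<otimes> x # zs)" for zs
    using gx by simp
  show ?case
    unfolding partial_products.simps(2) bar_dif.simps 1 2
    by (subst Cons.IH[OF gx(1), of y "\<lambda>w. f (x # w)"])
      (use Cons.prems in \<open>auto simp: sum.lessThan_Suc_shift sum_negf simp del: sum.lessThan_Suc\<close>)
qed simp

lemma codifferential_bar_dif:
  assumes "xs \<in> tuples G (Suc n)" "g \<in> carrier G"
  shows "codifferential G n f xs = bar_dif (\<lambda>zs. f (diffs G zs)) (partial_products G g xs)"
proof -
  obtain x ys where xs: "xs = x # ys" "length ys = n" "x \<in> carrier G" "set ys \<subseteq> carrier G"
    using assms(1) by (auto simp: tuples_def length_Suc_conv)
  have "diffs G (partial_products G (g \<otimes> x) ys) = ys"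
    by (rule diffs_partial_products) (use xs assms in auto)
  moreover note bar_dif_diffs[OF assms(2) xs(3,4), of f]
  ultimately show ?thesis using assms(1) xs(2)
    by (simp add: codifferential_def xs(1) sum_negf)
qed

lemma codifferential_tuples: "xs \<notin> tuples G (Suc n) \<Longrightarrow> codifferential G n f xs = 0"
  by (simp add: codifferential_def)

lemma codifferential_diffs:
  assumes "set gs \<subseteq> carrier G" "length gs = Suc (Suc n)"
  shows "codifferential G n f (diffs G gs) = bar_dif (\<lambda>zs. f (diffs G zs)) gs"
proof -
  have ne: "gs \<noteq> []" "hd gs \<in> carrier G" using assms by (cases gs; auto)+
  show ?thesis
    using codifferential_bar_dif[OF diffs_tuples[OF assms] ne(2), of f] partial_products_diffs[OF assms(1) ne(1)] by simp
qed

lemma codifferential_codifferential: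
  "codifferential G (Suc n) (codifferential G n f) xs = 0"
proof (cases "xs \<in> tuples G (Suc (Suc n))")
  case True
  let ?p = "partial_products G \<one> xs"
  have p: "set ?p \<subseteq> carrier G" "length ?p = Suc (Suc (Suc n))"
    using True partial_products_carrier[of xs] by (auto simp: tuples_def)
  have "codifferential G (Suc n) (codifferential G n f) xs = bar_dif (\<lambda>zs. codifferential G n f (diffs G zs)) ?p"
    by (rule codifferential_bar_dif[OF True]) simp
  also have "\<dots> = bar_dif (bar_dif (\<lambda>zs. f (diffs G zs))) ?p"
    by (rule bar_dif_cong, rule codifferential_diffs) (use p in auto)
  finally show ?thesis by (simp add: bar_dif_bar_dif)
qed (rule codifferential_tuples)

text \<open>The Leibniz rule for a 1-cocycle on the right. The face that multiplies the last two
  entries contributes \<open>\<chi> a + \<chi> b\<close>, the face that drops the last entry cancels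
  the part with \<open>\<chi> a\<close>, and the rest is the last face of \<open>f\<close>.\<close>

lemma codifferential_cup:
  assumes chi: "\<And>g h. g \<in> carrier G \<Longrightarrow> h \<in> carrier G \<Longrightarrow> \<chi> (g \<otimes> h) = \<chi> g + (\<chi> h :: real)"
    and k: "\<And>x. x \<in> carrier G \<Longrightarrow> k [x] = \<chi> x"
  shows "codifferential G (Suc n) (cup_cochain G n 1 f k) = cup_cochain G (Suc n) 1 (codifferential G n f) k"
proof
  fix xs
  show "codifferential G (Suc n) (cup_cochain G n 1 f k) xs = cup_cochain G (Suc n) 1 (codifferential G n f) k xs"
  proof (cases "xs \<in> tuples G (Suc (Suc n))")
    case True
    hence l: "length xs = Suc (Suc n)" by (simp add: tuples_def)
    obtain zs b where 1: "xs = zs @ [b]" using l by (cases xs rule: rev_cases) auto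
    obtain ys a where 2: "zs = ys @ [a]" using l 1 by (cases zs rule: rev_cases) auto
    have xs: "xs = ys @ [a, b]" using 1 2 by simp
    have ys: "length ys = n" "set ys \<subseteq> carrier G" "a \<in> carrier G" "b \<in> carrier G" using True by (auto simp: tuples_def xs)
    let ?m = "\<lambda>i xs. take i xs @ [xs ! i \<otimes> xs ! (i + 1)] @ drop (i + 2) xs"
    let ?c = "cup_cochain G n 1 f k"
    have c: "?c (zs @ [x]) = f zs * \<chi> x" if "length zs = n" "set zs \<subseteq> carrier G" "x \<in> carrier G" for zs x
      using that k by (simp add: cup_cochain_def tuples_def)
    have m: "?m i xs = ?m i (ys @ [a]) @ [b]" if "i < n" for i
    proof (cases "Suc i < n")
      case False
      hence "length ys = Suc i" using that ys(1) by simp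
      thus ?thesis by (simp add: xs nth_append)
    qed (use ys(1) in \<open>auto simp: xs nth_append\<close>)
    have mc: "set (?m i zs) \<subseteq> carrier G" if "set zs \<subseteq> carrier G" "i + 1 < length zs" for i zs
    proof -
      have "zs ! i \<in> carrier G" "zs ! (i + 1) \<in> carrier G" using that by (auto simp: subset_iff)
      thus ?thesis using that set_take_subset[of i zs] set_drop_subset[of "i + 2" zs] by auto
    qed
    have cm: "?c (?m i xs) = f (?m i (ys @ [a])) * \<chi> b" if "i < n" for i
      unfolding m[OF that]
      by (rule c, use that ys in simp, rule mc) (use that ys in auto)
    have mn: "?m n xs = ys @ [a \<otimes> b]" using ys(1) by (simp add: xs nth_append)
    have t: "?c (tl xs) = f (tl (ys @ [a])) * \<chi> b"
    proof -
      have "tl xs = tl (ys @ [a]) @ [b]" by (cases ys) (auto simp: xs)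
      thus ?thesis using ys by (simp only:, intro c) (cases ys; auto)+
    qed
    have "codifferential G (Suc n) ?c xs = f (tl (ys @ [a])) * \<chi> b
        + ((\<Sum>i<n. (-1) ^ (i + 1) * (f (?m i (ys @ [a])) * \<chi> b)) + (-1) ^ (n + 1) * (f ys * (\<chi> a + \<chi> b)))
        + (-1) ^ (n + 2) * (f ys * \<chi> a)"
    proof -
      have "?c (ys @ [a \<otimes> b]) = f ys * (\<chi> a + \<chi> b)" using c[of ys "a \<otimes> b"] ys chi by simp
      moreover have "?c (butlast xs) = f ys * \<chi> a" using c[of ys a] ys by (simp add: xs butlast_append)
      moreover have "(\<Sum>i<Suc n. (-1) ^ (i + 1) * ?c (?m i xs)) = (\<Sum>i<n. (-1) ^ (i + 1) * ?c (?m i xs)) + (-1) ^ (n + 1) * ?c (?m n xs)"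
        by (rule sum.lessThan_Suc)
      moreover have "(\<Sum>i<n. (-1) ^ (i + 1) * ?c (?m i xs)) = (\<Sum>i<n. (-1) ^ (i + 1) * (f (?m i (ys @ [a])) * \<chi> b))"
        by (rule sum.cong[OF HOL.refl]) (use cm in simp)
      ultimately show ?thesis using True by (simp only: codifferential_def t mn) simp
    qed
    also have "\<dots> = (f (tl (ys @ [a])) + (\<Sum>i<n. (-1) ^ (i + 1) * f (?m i (ys @ [a]))) + (-1) ^ (n + 1) * f ys) * \<chi> b"
      by (simp add: algebra_simps sum_distrib_left sum_distrib_right)
    also have "\<dots> = cup_cochain G (Suc n) 1 (codifferential G n f) k xs"
      using ys True by (simp add: cup_cochain_def xs codifferential_def tuples_def k)
    finally show ?thesis .
  qed (simp add: codifferential_def cup_cochain_def)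
qed

end

context raag_signed begin

section \<open>Values on the tori of cliques\<close>

text \<open>For an \<open>n\<close>-clique this evaluates a cochain on the fundamental class of the
  torus: a signed sum over all orderings of its generators.\<close>

fun torus_eval :: "nat \<Rightarrow> ('v word set list \<Rightarrow> real) \<Rightarrow> 'v set \<Rightarrow> real" where
  "torus_eval 0 f \<sigma> = f []"
| "torus_eval (Suc n) f \<sigma> = (\<Sum>v\<in>\<sigma>. eps v (\<sigma> - {v}) * torus_eval n (\<lambda>xs. f (gam v # xs)) (\<sigma> - {v}))"

lemma torus_eval_cong:
  assumes "\<sigma> \<subseteq> V" "\<And>xs. xs \<in> tuples G n \<Longrightarrow> f xs = f' xs"
  shows "torus_eval n f \<sigma> = torus_eval n f' \<sigma>"
  using assms
proof (induction n arbitrary: f f' \<sigma>)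
  case (Suc n)
  have "torus_eval n (\<lambda>xs. f (gam v # xs)) (\<sigma> - {v}) = torus_eval n (\<lambda>xs. f' (gam v # xs)) (\<sigma> - {v})" if "v \<in> \<sigma>" for v
    by (rule Suc.IH) (use Suc.prems that gam_closed in \<open>auto simp: tuples_def\<close>)
  thus ?case by simp
qed (simp add: tuples_def)

lemma torus_eval_add: "torus_eval n (\<lambda>xs. f xs + f' xs) \<sigma> = torus_eval n f \<sigma> + torus_eval n f' \<sigma>"
proof (induction n arbitrary: f f' \<sigma>)
  case (Suc n)
  show ?case by (simp add: Suc distrib_left sum.distrib)
qed simp

lemma torus_eval_scale: "torus_eval n (\<lambda>xs. c * f xs) \<sigma> = c * torus_eval n f \<sigma>"
proof (induction n arbitrary: f \<sigma>)
  case (Suc n)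
  show ?case by (simp add: Suc sum_distrib_left mult_ac)
qed simp

lemma cube_eval_diffs:
  assumes "h \<in> carrier G" "\<sigma> \<subseteq> V"
  shows "cube_eval n (\<lambda>zs. f (diffs G zs)) h \<sigma> = torus_eval n f \<sigma>"
  using assms
proof (induction n arbitrary: f h \<sigma>)
  case (Suc n)
  have "cube_eval n (\<lambda>zs. f (diffs G (h # zs))) (h \<otimes>\<^bsub>G\<^esub> gam v) (\<sigma> - {v}) = torus_eval n (\<lambda>xs. f (gam v # xs)) (\<sigma> - {v})"
    if "v \<in> \<sigma>" for v
  proof -
    have v: "gam v \<in> carrier G" "h \<otimes>\<^bsub>G\<^esub> gam v \<in> carrier G" using that Suc.prems gam_closed by auto
    hence c: "inv\<^bsub>G\<^esub> h \<otimes>\<^bsub>G\<^esub> (h \<otimes>\<^bsub>G\<^esub> gam v) = gam v" using Suc.prems by (simp add: G.m_assoc[symmetric])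
    have "cube_eval n (\<lambda>zs. f (diffs G (h # zs))) (h \<otimes>\<^bsub>G\<^esub> gam v) (\<sigma> - {v}) =
        cube_eval n (\<lambda>zs. f (gam v # diffs G zs)) (h \<otimes>\<^bsub>G\<^esub> gam v) (\<sigma> - {v})"
      by (rule cube_eval_cong[OF v(2)]) (use Suc.prems c in auto)
    also have "\<dots> = torus_eval n (\<lambda>xs. f (gam v # xs)) (\<sigma> - {v})"
      by (rule Suc.IH[OF v(2)]) (use Suc.prems in auto)
    finally show ?thesis .
  qed
  thus ?case by simp
qed simp

text \<open>Opposite faces of a cube have equal values, because an inhomogeneous cochain does not
  see the base point.\<close>

lemma torus_eval_codifferential:
  assumes "clique \<sigma>"
  shows "torus_eval (Suc n) (codifferential G n f) \<sigma> = 0"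
proof -
  have s: "\<sigma> \<subseteq> V" by (rule clique_V[OF assms])
  have "torus_eval (Suc n) (codifferential G n f) \<sigma> = cube_eval (Suc n) (\<lambda>zs. codifferential G n f (diffs G zs)) \<one>\<^bsub>G\<^esub> \<sigma>"
    by (rule cube_eval_diffs[symmetric]) (use s in auto)
  also have "\<dots> = cube_eval (Suc n) (bar_dif (\<lambda>zs. f (diffs G zs))) \<one>\<^bsub>G\<^esub> \<sigma>"
    by (rule cube_eval_cong[OF G.one_closed s], rule G.codifferential_diffs) auto
  also have "\<dots> = (\<Sum>v\<in>\<sigma>. eps v (\<sigma> - {v}) * (cube_eval n (\<lambda>zs. f (diffs G zs)) (\<one>\<^bsub>G\<^esub> \<otimes>\<^bsub>G\<^esub> gam v) (\<sigma> - {v}) - cube_eval n (\<lambda>zs. f (diffs G zs)) \<one>\<^bsub>G\<^esub> (\<sigma> - {v})))"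
    by (rule cube_eval_bar_dif[OF G.one_closed assms])
  also have "\<dots> = 0"
  proof (rule sum.neutral, rule ballI)
    fix v assume v: "v \<in> \<sigma>"
    have "cube_eval n (\<lambda>zs. f (diffs G zs)) (\<one>\<^bsub>G\<^esub> \<otimes>\<^bsub>G\<^esub> gam v) (\<sigma> - {v}) = cube_eval n (\<lambda>zs. f (diffs G zs)) \<one>\<^bsub>G\<^esub> (\<sigma> - {v})"
      by (subst (1 2) cube_eval_diffs) (use v s gam_closed in auto)
    thus "eps v (\<sigma> - {v}) * (cube_eval n (\<lambda>zs. f (diffs G zs)) (\<one>\<^bsub>G\<^esub> \<otimes>\<^bsub>G\<^esub> gam v) (\<sigma> - {v}) - cube_eval n (\<lambda>zs. f (diffs G zs)) \<one>\<^bsub>G\<^esub> (\<sigma> - {v})) = 0"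
      by simp
  qed
  finally show ?thesis .
qed

abbreviation Z where "Z \<equiv> cocycles (cochains G) (codifferential G)"
abbreviation B where "B \<equiv> coboundaries (cochains G) (codifferential G)"

lemma Z_iff: "f \<in> Z n \<longleftrightarrow> (\<forall>xs. xs \<notin> tuples G n \<longrightarrow> f xs = 0) \<and> (\<forall>xs. codifferential G n f xs = 0)"
  by (auto simp: cocycles_def kernel_def cochains_def)

lemma T_zero: "T n (\<lambda>_. 0) gs = 0"
  using T_diff[of n "\<lambda>_. 0" "\<lambda>_. 0" gs] by simp

text \<open>Vanishing torus values make \<open>W\<close> vanish, and for a cocycle the homotopy
  formula exhibits the homogeneous cochain as the coboundary of its \<open>T\<close>.\<close>

lemma cocycle_coboundary:
  assumes f: "f \<in> Z n" and torus_eval: "\<And>\<sigma>. \<sigma> \<in> cliques n \<Longrightarrow> torus_eval n f \<sigma> = 0"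
  shows "f \<in> B n"
proof -
  let ?F = "\<lambda>zs. f (diffs G zs)"
  have W: "W n ?F gs = 0" if gs: "set gs \<subseteq> carrier G" "length gs = Suc n" for gs
    unfolding W_def
  proof (rule sum.neutral, rule ballI)
    fix \<sigma> assume s: "\<sigma> \<in> cliques n"
    have "pair (bar n gs \<sigma>) (\<lambda>h. cube_eval n ?F h \<sigma>) = pair (bar n gs \<sigma>) (\<lambda>h. 0)"
    proof (rule pair_cong)
      fix h assume "bar n gs \<sigma> h \<noteq> 0"
      hence "h \<in> carrier G" using chainsD(2)[OF bar_chains[OF gs]] by blast
      thus "cube_eval n ?F h \<sigma> = 0" using cube_eval_diffs[of h \<sigma> n f] torus_eval[OF s] s clique_V by (auto simp: cliques_def)
    qed
    thus "pair (bar n gs \<sigma>) (\<lambda>h. cube_eval n ?F h \<sigma>) = 0" by (simp add: pair_def)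
  qed
  have Td: "T n (bar_dif ?F) gs = 0" if gs: "set gs \<subseteq> carrier G" "length gs = Suc n" for gs
  proof -
    have "T n (bar_dif ?F) gs = T n (\<lambda>_. 0) gs"
    proof (rule T_cong[OF gs])
      fix zs assume "set zs \<subseteq> carrier G" "length zs = Suc (Suc n)"
      thus "bar_dif ?F zs = 0" using f by (simp add: G.codifferential_diffs[symmetric] Z_iff)
    qed
    thus ?thesis by (simp add: T_zero)
  qed
  have F: "?F gs = (case n of 0 \<Rightarrow> 0 | Suc m \<Rightarrow> bar_dif (T m ?F) gs)" if gs: "set gs \<subseteq> carrier G" "length gs = Suc n" for gs
    using homotopy[OF gs, of ?F] W[OF gs] Td[OF gs] by simp
  show ?thesis
  proof (cases n)
    case 0
    have "f xs = 0" for xs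
    proof (cases "xs \<in> tuples G 0")
      case True
      thus ?thesis using F[of "[\<one>\<^bsub>G\<^esub>]"] 0 by (simp add: tuples_def)
    qed (use f 0 in \<open>auto simp: Z_iff\<close>)
    thus ?thesis by (simp add: 0 coboundaries_def cochains_def fun_eq_iff)
  next
    case (Suc m)
    define h where "h xs = (if xs \<in> tuples G m then T m ?F (partial_products G \<one>\<^bsub>G\<^esub> xs) else 0)" for xs
    \<comment> \<open>\<open>?F\<close> is translation invariant, hence so is \<open>T m ?F\<close>;
      it depends on the differences only and descends to \<open>h\<close>.\<close>
    have hd: "h (diffs G zs) = T m ?F zs" if zs: "set zs \<subseteq> carrier G" "length zs = Suc m" for zs
    proof -
      have d: "diffs G zs \<in> tuples G m" by (rule G.diffs_tuples[OF zs])
      let ?p = "partial_products G \<one>\<^bsub>G\<^esub> (diffs G zs)"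
      have ds: "set (diffs G zs) \<subseteq> carrier G" using d by (simp add: tuples_def)
      have z0: "zs \<noteq> []" "hd zs \<in> carrier G" using zs by (cases zs; auto)+
      have p: "set ?p \<subseteq> carrier G" "length ?p = Suc m"
        using G.partial_products_carrier[OF ds] d by (auto simp: tuples_def)
      have "map ((\<otimes>\<^bsub>G\<^esub>) (hd zs)) ?p = zs"
        using G.map_partial_products[OF ds z0(2) G.one_closed] G.partial_products_diffs[OF zs(1) z0(1)] z0(2) by simp
      hence "T m ?F zs = T m (\<lambda>ys. ?F (map ((\<otimes>\<^bsub>G\<^esub>) (hd zs)) ys)) ?p"
        using T_translate[OF p z0(2), of ?F] by simp
      also have "\<dots> = T m ?F ?p"
        by (rule T_cong[OF p]) (simp add: G.diffs_translate z0(2))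
      finally show ?thesis using d by (simp add: h_def)
    qed
    have "f xs = codifferential G m h xs" for xs
    proof (cases "xs \<in> tuples G n")
      case True
      let ?p = "partial_products G \<one>\<^bsub>G\<^esub> xs"
      have xs: "set xs \<subseteq> carrier G" "length xs = n" using True by (auto simp: tuples_def)
      have p: "set ?p \<subseteq> carrier G" "length ?p = Suc n"
        using G.partial_products_carrier[OF xs(1)] xs by auto
      have "codifferential G m h xs = bar_dif (\<lambda>zs. h (diffs G zs)) ?p"
        by (rule G.codifferential_bar_dif) (use True Suc in auto)
      also have "\<dots> = bar_dif (T m ?F) ?p"
        by (rule bar_dif_cong, rule hd) (use p Suc in auto)
      also have "\<dots> = f xs" using F[OF p] Suc G.diffs_partial_products[OF xs(1) G.one_closed] by simp
      finally show ?thesis by simp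
    next
      case False
      thus ?thesis using f Suc by (simp add: Z_iff G.codifferential_tuples)
    qed
    moreover have "h \<in> carrier (cochains G m)" by (simp add: cochains_def h_def)
    ultimately show ?thesis by (auto simp: Suc coboundaries_def intro!: image_eqI[of f _ h])
  qed
qed

lemma B_iff: "f \<in> B n \<longleftrightarrow> f \<in> Z n \<and> (\<forall>\<sigma>\<in>cliques n. torus_eval n f \<sigma> = 0)"
proof (intro iffI)
  assume f: "f \<in> B n"
  show "f \<in> Z n \<and> (\<forall>\<sigma>\<in>cliques n. torus_eval n f \<sigma> = 0)"
  proof (cases n)
    case 0
    hence "f = (\<lambda>_. 0)" using f by (simp add: coboundaries_def cochains_def)
    thus ?thesis by (simp add: 0 Z_iff codifferential_def)
  next
    case (Suc m)
    then obtain h where "f = codifferential G m h" using f by (auto simp: coboundaries_def)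
    thus ?thesis using Suc G.codifferential_codifferential[of m h] G.codifferential_tuples torus_eval_codifferential[of _ m h]
      by (auto simp: Z_iff cliques_def simp del: torus_eval.simps)
  qed
qed (use cocycle_coboundary in blast)

text \<open>\<open>torus_eval\<close> unfolds at the first entry, whereas the cup product with a
  1-cochain acts on the last one. Moving a vertex past \<open>n\<close> others costs
  \<open>(-1) ^ n\<close>.\<close>

lemma torus_eval_snoc:
  assumes "\<sigma> \<subseteq> V"
  shows "torus_eval (Suc n) (\<lambda>xs. f (butlast xs) * \<kappa> (last xs)) \<sigma> =
    (-1) ^ n * (\<Sum>w\<in>\<sigma>. eps w (\<sigma> - {w}) * \<kappa> (gam w) * torus_eval n f (\<sigma> - {w}))"
  using assms
proof (induction n arbitrary: f \<sigma>)
  case 0 thus ?case by (simp add: mult_ac)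
next
  case (Suc n)
  let ?e = "\<lambda>v w. eps v (\<sigma> - {v}) * eps w (\<sigma> - {v} - {w})"
  let ?t = "\<lambda>v w. torus_eval n (\<lambda>xs. f (gam v # xs)) (\<sigma> - {v} - {w})"
  have fin: "finite \<sigma>" using Suc.prems finite_V finite_subset by blast
  have tc: "torus_eval (Suc n) (\<lambda>xs. f (butlast (gam v # xs)) * \<kappa> (last (gam v # xs))) (\<sigma> - {v}) =
      (-1) ^ n * (\<Sum>w\<in>\<sigma> - {v}. eps w (\<sigma> - {v} - {w}) * \<kappa> (gam w) * ?t v w)" if v: "v \<in> \<sigma>" for v
  proof -
    have "torus_eval (Suc n) (\<lambda>xs. f (butlast (gam v # xs)) * \<kappa> (last (gam v # xs))) (\<sigma> - {v}) =
        torus_eval (Suc n) (\<lambda>xs. f (gam v # butlast xs) * \<kappa> (last xs)) (\<sigma> - {v})"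
      by (rule torus_eval_cong) (use Suc.prems in \<open>auto simp: tuples_def\<close>)
    also have "\<dots> = (-1) ^ n * (\<Sum>w\<in>\<sigma> - {v}. eps w (\<sigma> - {v} - {w}) * \<kappa> (gam w) * ?t v w)"
      by (rule Suc.IH[of "\<sigma> - {v}" "\<lambda>xs. f (gam v # xs)"]) (use Suc.prems in auto)
    finally show ?thesis .
  qed
  have sw: "?e v w = - ?e w v" if "v \<in> \<sigma>" "w \<in> \<sigma>" "v \<noteq> w" for v w
  proof -
    have s: "\<sigma> - {v} = insert w (\<sigma> - {v, w})" "\<sigma> - {v} - {w} = \<sigma> - {v, w}"
       "\<sigma> - {w} = insert v (\<sigma> - {v, w})" "\<sigma> - {w} - {v} = \<sigma> - {v, w}" using that by auto
    have "eps v (insert w (\<sigma> - {v, w})) * eps w (\<sigma> - {v, w}) = - (eps w (insert v (\<sigma> - {v, w})) * eps v (\<sigma> - {v, w}))"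
      by (rule eps_swap) (use that Suc.prems fin in auto)
    thus ?thesis unfolding s(2,4) unfolding s(1,3) .
  qed
  have D: "{w \<in> \<sigma>. v \<noteq> w} = \<sigma> - {v}" "{w \<in> \<sigma>. w \<noteq> v} = \<sigma> - {v}" for v by auto
  have swap: "(\<Sum>v\<in>\<sigma>. \<Sum>w\<in>\<sigma> - {v}. g v w) = (\<Sum>w\<in>\<sigma>. \<Sum>v\<in>\<sigma> - {w}. g v w)" for g :: "'v \<Rightarrow> 'v \<Rightarrow> real"
    using sum.swap_restrict[OF fin fin, of g "\<lambda>v w. v \<noteq> w"] by (simp only: D)
  have "torus_eval (Suc (Suc n)) (\<lambda>xs. f (butlast xs) * \<kappa> (last xs)) \<sigma> =
     (\<Sum>v\<in>\<sigma>. eps v (\<sigma> - {v}) * ((-1) ^ n * (\<Sum>w\<in>\<sigma> - {v}. eps w (\<sigma> - {v} - {w}) * \<kappa> (gam w) * ?t v w)))"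
    unfolding torus_eval.simps(2)[of "Suc n"] by (rule sum.cong[OF HOL.refl]) (simp only: tc)
  also have "\<dots> = (-1) ^ n * (\<Sum>v\<in>\<sigma>. \<Sum>w\<in>\<sigma> - {v}. ?e v w * \<kappa> (gam w) * ?t v w)"
    by (simp add: sum_distrib_left mult_ac)
  also have "(\<Sum>v\<in>\<sigma>. \<Sum>w\<in>\<sigma> - {v}. ?e v w * \<kappa> (gam w) * ?t v w) = (\<Sum>v\<in>\<sigma>. \<Sum>w\<in>\<sigma> - {v}. - ?e w v * \<kappa> (gam w) * ?t v w)"
    by (intro sum.cong HOL.refl) (use sw in auto)
  also have "\<dots> = (\<Sum>w\<in>\<sigma>. \<Sum>v\<in>\<sigma> - {w}. - ?e w v * \<kappa> (gam w) * ?t v w)"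
    by (rule swap)
  also have "\<dots> = (\<Sum>w\<in>\<sigma>. - (eps w (\<sigma> - {w}) * \<kappa> (gam w) * torus_eval (Suc n) f (\<sigma> - {w})))"
  proof (rule sum.cong[OF HOL.refl])
    fix w
    have "\<sigma> - {v} - {w} = \<sigma> - {w} - {v}" for v by auto
    thus "(\<Sum>v\<in>\<sigma> - {w}. - ?e w v * \<kappa> (gam w) * ?t v w) = - (eps w (\<sigma> - {w}) * \<kappa> (gam w) * torus_eval (Suc n) f (\<sigma> - {w}))"
      by (simp add: sum_distrib_left sum_negf mult_ac)
  qed
  finally show ?case by (simp add: sum_negf)
qed

definition one_cochain :: "('v word set \<Rightarrow> real) \<Rightarrow> 'v word set list \<Rightarrow> real" where
  "one_cochain \<kappa> xs = (if xs \<in> tuples G 1 then \<kappa> (hd xs) else 0)"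

lemma torus_eval_cup:
  assumes "clique \<sigma>"
  shows "torus_eval (Suc n) (cup_cochain G n 1 f (one_cochain \<kappa>)) \<sigma> = (-1) ^ n * cod (\<lambda>v. \<kappa> (gam v)) (torus_eval n f) \<sigma>"
proof -
  have s: "\<sigma> \<subseteq> V" by (rule clique_V[OF assms])
  have "torus_eval (Suc n) (cup_cochain G n 1 f (one_cochain \<kappa>)) \<sigma> = torus_eval (Suc n) (\<lambda>xs. f (butlast xs) * \<kappa> (last xs)) \<sigma>"
  proof (rule torus_eval_cong[OF s])
    fix xs assume xs: "xs \<in> tuples G (Suc n)"
    then obtain zs b where z: "xs = zs @ [b]" by (cases xs rule: rev_cases) (auto simp: tuples_def)
    show "cup_cochain G n 1 f (one_cochain \<kappa>) xs = f (butlast xs) * \<kappa> (last xs)"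
      using xs by (auto simp: cup_cochain_def one_cochain_def z tuples_def)
  qed
  thus ?thesis using assms by (simp add: torus_eval_snoc[OF s] cod_def del: torus_eval.simps)
qed

lemma cup_cocycle:
  assumes f: "f \<in> Z n" and \<kappa>: "\<And>g h. g \<in> carrier G \<Longrightarrow> h \<in> carrier G \<Longrightarrow> \<kappa> (g \<otimes>\<^bsub>G\<^esub> h) = \<kappa> g + \<kappa> h"
  shows "cup_cochain G n 1 f (one_cochain \<kappa>) \<in> Z (Suc n)"
proof -
  have "codifferential G (Suc n) (cup_cochain G n 1 f (one_cochain \<kappa>)) =
      cup_cochain G (Suc n) 1 (codifferential G n f) (one_cochain \<kappa>)"
    by (rule G.codifferential_cup[OF \<kappa>]) (auto simp: one_cochain_def tuples_def)
  moreover have "codifferential G n f = (\<lambda>_. 0)" using f by (auto simp: Z_iff)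
  ultimately show ?thesis by (auto simp: Z_iff cup_cochain_def)
qed

text \<open>The exponent sum of \<open>v\<close>, counted relative to the orientation
  \<open>sg\<close>, so that \<open>dual v\<close> takes the value 1 on
  \<open>gam v\<close>.\<close>

definition exponent :: "'v \<Rightarrow> 'v word \<Rightarrow> real" where
  "exponent v w = (\<Sum>a\<leftarrow>w. if fst a = v then (if snd a = sg v then 1 else -1) else 0)"

lemma exponent_append: "exponent v (u @ w) = exponent v u + exponent v w"
  by (simp add: exponent_def)

lemma exponent_cong: "(u, w) \<in> presentation_cong V relators \<Longrightarrow> exponent v u = exponent v w"
  by (induction rule: presentation_cong.induct) (auto simp: exponent_def)

definition dual :: "'v \<Rightarrow> 'v word set \<Rightarrow> real" where
  "dual v g = exponent v (SOME w. w \<in> g)"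

lemma dual_cls: "w \<in> words V \<Longrightarrow> dual v (cls w) = exponent v w"
proof -
  assume w: "w \<in> words V"
  have "(SOME w'. w' \<in> cls w) \<in> cls w"
    unfolding cls_def using wcls_self[OF w] by (rule someI)
  hence "(w, SOME w'. w' \<in> cls w) \<in> presentation_cong V relators" by (simp add: cls_def wcls_def)
  thus ?thesis using exponent_cong by (simp add: dual_def)
qed

lemma dual_mult: "g \<in> carrier G \<Longrightarrow> h \<in> carrier G \<Longrightarrow> dual v (g \<otimes>\<^bsub>G\<^esub> h) = dual v g + dual v h"
  by (auto simp: carrier_G cls_mult dual_cls words_append_iff exponent_append)

lemma dual_gam: "w \<in> V \<Longrightarrow> dual v (gam w) = of_bool (w = v)"
  by (simp add: gam_def letter_def dual_cls letter_words exponent_def)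

text \<open>Cup the cocycle of \<open>\<sigma> - {w}\<close> with the character dual to
  \<open>w\<close>: only cliques containing \<open>w\<close> survive, and among them only \<sigma>.
  The constant collects signs, of which just the nonvanishing is recorded.\<close>

lemma ex_dual_cocycle:
  "\<sigma> \<in> cliques n \<Longrightarrow> \<exists>z\<in>Z n. \<exists>c. c \<noteq> 0 \<and> (\<forall>\<tau>\<in>cliques n. torus_eval n z \<tau> = (if \<tau> = \<sigma> then c else 0))"
proof (induction n arbitrary: \<sigma>)
  case 0
  have "(\<lambda>xs. of_bool (xs = [])) \<in> Z 0"
    by (auto simp: Z_iff codifferential_def tuples_def length_Suc_conv)
  thus ?case using 0 by (intro bexI[of _ "\<lambda>xs. of_bool (xs = [])"] exI[of _ 1]) (auto simp: cliques_0)
next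
  case (Suc n)
  have "card \<sigma> = Suc n" "clique \<sigma>" using Suc.prems by (auto simp: cliques_def)
  then obtain w where w: "w \<in> \<sigma>" by (metis card.empty equals0I nat.distinct(1))
  obtain z c where z: "z \<in> Z n" "c \<noteq> 0" "\<And>\<tau>. \<tau> \<in> cliques n \<Longrightarrow> torus_eval n z \<tau> = (if \<tau> = \<sigma> - {w} then c else 0)"
    using Suc.IH[OF cliques_remove[OF Suc.prems w]] by blast
  let ?z = "cup_cochain G n 1 z (one_cochain (dual w))"
  let ?c = "(-1) ^ n * eps w (\<sigma> - {w}) * c"
  have "torus_eval (Suc n) ?z \<tau> = (if \<tau> = \<sigma> then ?c else 0)" if t: "\<tau> \<in> cliques (Suc n)" for \<tau>
  proof -
    have ct: "clique \<tau>" and fin: "finite \<tau>" using t clique_finite by (auto simp: cliques_def)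
    have "(\<Sum>v\<in>\<tau>. eps v (\<tau> - {v}) * dual w (gam v) * torus_eval n z (\<tau> - {v})) =
       (\<Sum>v\<in>\<tau>. if v = w then eps w (\<tau> - {w}) * torus_eval n z (\<tau> - {w}) else 0)"
      by (rule sum.cong[OF HOL.refl]) (use clique_V[OF ct] in \<open>auto simp: dual_gam\<close>)
    also have "\<dots> = (if w \<in> \<tau> then eps w (\<tau> - {w}) * torus_eval n z (\<tau> - {w}) else 0)"
      using fin by simp
    also have "\<dots> = (if \<tau> = \<sigma> then eps w (\<sigma> - {w}) * c else 0)"
    proof (cases "w \<in> \<tau>")
      case True
      have "\<tau> - {w} = \<sigma> - {w} \<longleftrightarrow> \<tau> = \<sigma>" using True w by blast
      thus ?thesis using z(3)[OF cliques_remove[OF t True]] True by auto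
    qed (use w in auto)
    finally show ?thesis using torus_eval_cup[OF ct, of n z "dual w"] ct by (simp add: cod_def del: torus_eval.simps)
  qed
  moreover have "?z \<in> Z (Suc n)" by (rule cup_cocycle[OF z(1) dual_mult])
  moreover have "?c \<noteq> 0" using z(2) eps_nonzero by simp
  ultimately show ?case by blast
qed

lemma codifferential_add: "codifferential G n (\<lambda>xs. f xs + f' xs) xs = codifferential G n f xs + codifferential G n f' xs"
  by (simp add: codifferential_def distrib_left sum.distrib sum_negf sum_subtractf)

lemma codifferential_scale: "codifferential G n (\<lambda>xs. c * f xs) xs = c * codifferential G n f xs"
  by (simp add: codifferential_def distrib_left right_diff_distrib sum_distrib_left sum_negf mult_ac)

lemma Z_add: "f \<in> Z n \<Longrightarrow> f' \<in> Z n \<Longrightarrow> (\<lambda>xs. f xs + f' xs) \<in> Z n"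
  by (simp add: Z_iff codifferential_add)

lemma Z_scale: "f \<in> Z n \<Longrightarrow> (\<lambda>xs. c * f xs) \<in> Z n"
  by (simp add: Z_iff codifferential_scale)

lemma ex_cocycle: "\<exists>z\<in>Z n. \<forall>\<tau>\<in>cliques n. torus_eval n z \<tau> = y \<tau>"
proof -
  have "\<exists>z\<in>Z n. \<forall>\<tau>\<in>cliques n. torus_eval n z \<tau> = (if \<tau> \<in> S then y \<tau> else 0)" if "finite S" "S \<subseteq> cliques n" for S
    using that
  proof (induction S rule: finite_induct)
    case empty
    have "(\<lambda>_. 0) \<in> Z n" by (simp add: Z_iff codifferential_def)
    thus ?case using torus_eval_scale[of n 0 "\<lambda>_. 0"] by (intro bexI[of _ "\<lambda>_. 0"]) auto
  next
    case (insert \<sigma> S)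
    obtain z where z: "z \<in> Z n" "\<forall>\<tau>\<in>cliques n. torus_eval n z \<tau> = (if \<tau> \<in> S then y \<tau> else 0)"
      using insert by blast
    obtain z' c where z': "z' \<in> Z n" "c \<noteq> 0" "\<forall>\<tau>\<in>cliques n. torus_eval n z' \<tau> = (if \<tau> = \<sigma> then c else 0)"
      using ex_dual_cocycle[of \<sigma> n] insert.prems by blast
    have "(\<lambda>xs. z xs + (y \<sigma> / c) * z' xs) \<in> Z n" by (intro Z_add Z_scale z z')
    moreover have "torus_eval n (\<lambda>xs. z xs + (y \<sigma> / c) * z' xs) \<tau> = (if \<tau> \<in> insert \<sigma> S then y \<tau> else 0)"
      if t: "\<tau> \<in> cliques n" for \<tau>
      unfolding torus_eval_add torus_eval_scale using z(2) z'(2,3) t insert.hyps by auto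
    ultimately show ?case by blast
  qed
  from this[OF finite_cliques subset_refl] show ?thesis by auto
qed

section \<open>Cohomology described by functions on cliques\<close>

text \<open>The cohomology class with prescribed torus values. \<open>y\<close> may be any function;
  its values on \<open>n\<close>-cliques alone determine the class, which spares restrictions in
  later formulas.\<close>

definition coho_class :: "nat \<Rightarrow> ('v set \<Rightarrow> real) \<Rightarrow> ('v word set list \<Rightarrow> real) set" where
  "coho_class n y = {f \<in> Z n. \<forall>\<sigma>\<in>cliques n. torus_eval n f \<sigma> = y \<sigma>}"

lemma coho_class_nonempty: "coho_class n y \<noteq> {}"
  using ex_cocycle[of n y] by (auto simp: coho_class_def)

lemma coho_class_eq_iff: "coho_class n y = coho_class n y' \<longleftrightarrow> (\<forall>\<sigma>\<in>cliques n. y \<sigma> = y' \<sigma>)"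
proof
  assume e: "coho_class n y = coho_class n y'"
  obtain f where "f \<in> coho_class n y" using coho_class_nonempty by blast
  moreover from this have "f \<in> coho_class n y'" using e by simp
  ultimately show "\<forall>\<sigma>\<in>cliques n. y \<sigma> = y' \<sigma>" by (auto simp: coho_class_def)
qed (auto simp: coho_class_def)

lemma B_coho_class: "B n = coho_class n (\<lambda>_. 0)"
  by (auto simp: coho_class_def B_iff)

lemma cocycle_minus:
  assumes "f \<in> Z n" "z \<in> Z n"
  shows "(\<lambda>xs. f xs - z xs) \<in> Z n" "torus_eval n (\<lambda>xs. f xs - z xs) \<sigma> = torus_eval n f \<sigma> - torus_eval n z \<sigma>"
  using Z_add[OF assms(1) Z_scale[OF assms(2), of "-1"]] torus_eval_add[of n f "\<lambda>xs. -1 * z xs" \<sigma>] torus_eval_scale[of n "-1" z \<sigma>]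
  by simp_all

lemma mult_coho_class: "coho_class n y <#>\<^bsub>cochains G n\<^esub> coho_class n y' = coho_class n (\<lambda>\<sigma>. y \<sigma> + y' \<sigma>)"
proof
  show "coho_class n y <#>\<^bsub>cochains G n\<^esub> coho_class n y' \<subseteq> coho_class n (\<lambda>\<sigma>. y \<sigma> + y' \<sigma>)"
    by (auto simp: set_mult_def cochains_def coho_class_def Z_add torus_eval_add)
  show "coho_class n (\<lambda>\<sigma>. y \<sigma> + y' \<sigma>) \<subseteq> coho_class n y <#>\<^bsub>cochains G n\<^esub> coho_class n y'"
  proof
    fix f assume f: "f \<in> coho_class n (\<lambda>\<sigma>. y \<sigma> + y' \<sigma>)"
    obtain z where z: "z \<in> coho_class n y'" using coho_class_nonempty by blast
    have "(\<lambda>xs. f xs - z xs) \<in> coho_class n y" using f z by (auto simp: coho_class_def cocycle_minus)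
    moreover have "f = (\<lambda>xs. (f xs - z xs) + z xs)" by simp
    ultimately show "f \<in> coho_class n y <#>\<^bsub>cochains G n\<^esub> coho_class n y'"
      using z unfolding set_mult_def cochains_def by (intro UN_I) auto
  qed
qed

lemma coset_coho_class:
  assumes z: "z \<in> Z n"
  shows "B n #>\<^bsub>cochains G n\<^esub> z = coho_class n (torus_eval n z)"
proof
  show "B n #>\<^bsub>cochains G n\<^esub> z \<subseteq> coho_class n (torus_eval n z)"
    using z by (auto simp: r_coset_def cochains_def coho_class_def B_coho_class Z_add torus_eval_add)
  show "coho_class n (torus_eval n z) \<subseteq> B n #>\<^bsub>cochains G n\<^esub> z"
  proof
    fix f assume f: "f \<in> coho_class n (torus_eval n z)"
    have "(\<lambda>xs. f xs - z xs) \<in> B n" using f z by (auto simp: coho_class_def B_coho_class cocycle_minus)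
    moreover have "f = (\<lambda>xs. (f xs - z xs) + z xs)" by simp
    ultimately show "f \<in> B n #>\<^bsub>cochains G n\<^esub> z"
      unfolding r_coset_def cochains_def by (intro UN_I) auto
  qed
qed

lemma carrier_cohomology: "carrier (group_cohomology G n) = range (coho_class n)"
proof -
  have "carrier (group_cohomology G n) = (\<lambda>z. B n #>\<^bsub>cochains G n\<^esub> z) ` Z n"
    by (auto simp: group_cohomology_def cohomology_def FactGroup_def RCOSETS_def r_coset_def)
  also have "\<dots> = (\<lambda>z. coho_class n (torus_eval n z)) ` Z n"
    by (rule image_cong) (simp_all add: coset_coho_class)
  also have "\<dots> = range (coho_class n)"
  proof
    show "range (coho_class n) \<subseteq> (\<lambda>z. coho_class n (torus_eval n z)) ` Z n"
    proof clarify
      fix y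
      obtain z where "z \<in> Z n" "\<forall>\<tau>\<in>cliques n. torus_eval n z \<tau> = y \<tau>" using ex_cocycle by blast
      thus "coho_class n y \<in> (\<lambda>z. coho_class n (torus_eval n z)) ` Z n" by (intro image_eqI[of _ _ z]) (auto simp: coho_class_eq_iff)
    qed
  qed auto
  finally show ?thesis .
qed

lemma mult_cohomology: "coho_class n y \<otimes>\<^bsub>group_cohomology G n\<^esub> coho_class n y' = coho_class n (\<lambda>\<sigma>. y \<sigma> + y' \<sigma>)"
  using mult_coho_class[of n y y'] by (simp add: group_cohomology_def cohomology_def FactGroup_def set_mult_def)

lemma one_cohomology: "\<one>\<^bsub>group_cohomology G n\<^esub> = coho_class n (\<lambda>_. 0)"
  by (simp add: group_cohomology_def cohomology_def FactGroup_def B_coho_class)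

lemma cod_cong:
  assumes "\<sigma> \<in> cliques (Suc n)" "\<And>\<tau>. \<tau> \<in> cliques n \<Longrightarrow> y \<tau> = y' \<tau>"
  shows "cod lam y \<sigma> = cod lam y' \<sigma>"
  using cliques_remove[OF assms(1)] assms by (simp add: cod_def)

lemma cod_scale: "cod lam (\<lambda>\<sigma>. c * y \<sigma>) \<tau> = c * cod lam y \<tau>"
  by (simp add: cod_def sum_distrib_left mult_ac)

text \<open>With trivial coefficients both faces of a 0-cochain agree, so a class in degree 1 is a
  single cocycle.\<close>

lemma B_1: "B 1 = {\<lambda>_. 0}"
proof
  show "B 1 \<subseteq> {\<lambda>_. 0}"
    by (auto simp: coboundaries_def codifferential_def tuples_def fun_eq_iff length_Suc_conv)
  show "{\<lambda>_. 0} \<subseteq> B 1" by (simp add: B_coho_class coho_class_def Z_iff codifferential_def)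
qed

lemma character_class_eq: "character_class G \<kappa> = {one_cochain \<kappa>}"
  unfolding character_class_def B_1 by (simp add: r_coset_def cochains_def one_cochain_def fun_eq_iff)

context
  fixes \<kappa> :: "'v word set \<Rightarrow> real"
  assumes \<kappa>: "\<And>g h. g \<in> carrier G \<Longrightarrow> h \<in> carrier G \<Longrightarrow> \<kappa> (g \<otimes>\<^bsub>G\<^esub> h) = \<kappa> g + \<kappa> h"
begin

lemma one_cochain_Z: "one_cochain \<kappa> \<in> Z 1"
  using \<kappa> by (auto simp: Z_iff codifferential_def one_cochain_def tuples_def length_Suc_conv)

lemma character_class_carrier: "character_class G \<kappa> \<in> carrier (group_cohomology G 1)"
proof -
  have "character_class G \<kappa> = B 1 #>\<^bsub>cochains G 1\<^esub> one_cochain \<kappa>"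
    unfolding character_class_eq B_1 by (simp add: r_coset_def cochains_def)
  thus ?thesis unfolding coset_coho_class[OF one_cochain_Z] carrier_cohomology by blast
qed

text \<open>The torus values of the product depend on those of the factor only, so all
  representatives give one coset and the union in \<open>cup\<close> collapses.\<close>

lemma cup_coho_class: "cup G n 1 (coho_class n y) (character_class G \<kappa>) = coho_class (Suc n) (\<lambda>\<sigma>. (-1) ^ n * cod (\<lambda>v. \<kappa> (gam v)) y \<sigma>)"
proof -
  have "B (Suc n) #>\<^bsub>cochains G (Suc n)\<^esub> cup_cochain G n 1 f (one_cochain \<kappa>) =
      coho_class (Suc n) (\<lambda>\<sigma>. (-1) ^ n * cod (\<lambda>v. \<kappa> (gam v)) y \<sigma>)" if f: "f \<in> coho_class n y" for f
  proof -
    have fZ: "f \<in> Z n" using f by (simp add: coho_class_def)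
    have "torus_eval (Suc n) (cup_cochain G n 1 f (one_cochain \<kappa>)) \<sigma> = (-1) ^ n * cod (\<lambda>v. \<kappa> (gam v)) y \<sigma>"
      if s: "\<sigma> \<in> cliques (Suc n)" for \<sigma>
    proof -
      have "cod (\<lambda>v. \<kappa> (gam v)) (torus_eval n f) \<sigma> = cod (\<lambda>v. \<kappa> (gam v)) y \<sigma>"
        by (rule cod_cong[OF s]) (use f in \<open>auto simp: coho_class_def\<close>)
      thus ?thesis using torus_eval_cup[of \<sigma> n f \<kappa>] s by (simp add: cliques_def del: torus_eval.simps)
    qed
    hence "coho_class (Suc n) (torus_eval (Suc n) (cup_cochain G n 1 f (one_cochain \<kappa>))) = coho_class (Suc n) (\<lambda>\<sigma>. (-1) ^ n * cod (\<lambda>v. \<kappa> (gam v)) y \<sigma>)"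
      unfolding coho_class_eq_iff by blast
    moreover have "cup_cochain G n 1 f (one_cochain \<kappa>) \<in> Z (Suc n)" by (rule cup_cocycle[OF fZ \<kappa>])
    ultimately show ?thesis using coset_coho_class by blast
  qed
  thus ?thesis using coho_class_nonempty[of n y] by (simp add: cup_def character_class_eq)
qed

text \<open>Functions whose classes are the image of the preceding map; as with
  \<open>coho_class\<close>, arguments of \<open>cod\<close> are not confined to the cochain
  space.\<close>

definition exact_classes :: "nat \<Rightarrow> ('v set \<Rightarrow> real) set" where
  "exact_classes n = (case n of 0 \<Rightarrow> {\<lambda>_. 0} | Suc m \<Rightarrow> range (cod (\<lambda>v. \<kappa> (gam v))))"

lemma exact_classes_add:
  "y \<in> exact_classes n \<Longrightarrow> y' \<in> exact_classes n \<Longrightarrow> (\<lambda>\<sigma>. y \<sigma> + c * y' \<sigma>) \<in> exact_classes n"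
proof (cases n)
  case (Suc m)
  have "(\<lambda>\<sigma>. cod lam u \<sigma> + c * cod lam u' \<sigma>) = cod lam (\<lambda>\<sigma>. u \<sigma> + c * u' \<sigma>)" for lam u u'
    by (simp add: fun_eq_iff cod_add cod_scale)
  thus "y \<in> exact_classes n \<Longrightarrow> y' \<in> exact_classes n \<Longrightarrow> ?thesis"
    using Suc by (auto simp: exact_classes_def)
qed (simp add: exact_classes_def)

lemma exact_classes_zero: "(\<lambda>_. 0) \<in> exact_classes n"
proof -
  have "cod lam (\<lambda>_. 0) = (\<lambda>_. 0)" for lam by (auto simp: cod_def)
  thus ?thesis by (auto simp: exact_classes_def image_iff split: nat.splits intro!: exI[of _ "\<lambda>_. 0"])
qed

text \<open>The restriction \<open>r\<close> to cliques mediates between the cochain spaces used in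
  \<open>exact_at\<close> and the unrestricted functions that name classes.\<close>

lemma exact_at_classes:
  "exact_at (\<lambda>v. \<kappa> (gam v)) n \<longleftrightarrow>
    (\<forall>y. (\<forall>\<sigma>\<in>cliques (Suc n). cod (\<lambda>v. \<kappa> (gam v)) y \<sigma> = 0) \<longrightarrow> coho_class n y \<in> coho_class n ` exact_classes n)"
  (is "_ \<longleftrightarrow> ?R")
proof -
  let ?d = "cod (\<lambda>v. \<kappa> (gam v))"
  define r where "r k y \<sigma> = (if \<sigma> \<in> cliques k then y \<sigma> else 0)" for k and y :: "'v set \<Rightarrow> real" and \<sigma>
  have r: "r k y \<in> cochain_space k" for k y by (simp add: r_def cochain_space_def)
  have dr: "?d (r k y) \<sigma> = ?d y \<sigma>" if "\<sigma> \<in> cliques (Suc k)" for k y \<sigma>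
    using that by (rule cod_cong) (simp add: r_def)
  show ?thesis
  proof (intro iffI allI impI)
    fix y assume ex: "exact_at (\<lambda>v. \<kappa> (gam v)) n" and y: "\<forall>\<sigma>\<in>cliques (Suc n). ?d y \<sigma> = 0"
    have "?d (r n y) \<sigma> = 0" for \<sigma>
      using y dr[of \<sigma> n y] cochain_spaceD[OF cod_space[OF r]] by (cases "\<sigma> \<in> cliques (Suc n)") auto
    hence c: "case n of 0 \<Rightarrow> r n y = (\<lambda>_. 0) | Suc m \<Rightarrow> \<exists>z\<in>cochain_space m. r n y = ?d z"
      using ex r unfolding exact_at_def by blast
    have "\<exists>e\<in>exact_classes n. r n y = e"
      using c by (cases n) (auto simp: exact_classes_def)
    moreover have "coho_class n y = coho_class n (r n y)" by (simp add: coho_class_eq_iff r_def)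
    ultimately show "coho_class n y \<in> coho_class n ` exact_classes n" by blast
  next
    assume R: ?R
    show "exact_at (\<lambda>v. \<kappa> (gam v)) n"
      unfolding exact_at_def
    proof (intro ballI impI)
      fix y assume y: "y \<in> cochain_space n" "?d y = (\<lambda>_. 0)"
      have "coho_class n y \<in> coho_class n ` exact_classes n" using R y(2) by simp
      then obtain e where e: "e \<in> exact_classes n" "\<forall>\<sigma>\<in>cliques n. y \<sigma> = e \<sigma>" by (auto simp: coho_class_eq_iff)
      show "case n of 0 \<Rightarrow> y = (\<lambda>_. 0) | Suc m \<Rightarrow> \<exists>z\<in>cochain_space m. y = ?d z"
      proof (cases n)
        case 0
        thus ?thesis using e y(1) by (auto simp: exact_classes_def cochain_space_def fun_eq_iff)
      next
        case (Suc m)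
        then obtain u where u: "e = ?d u" using e(1) by (auto simp: exact_classes_def)
        have "y \<sigma> = ?d (r m u) \<sigma>" for \<sigma>
          using e(2) u dr[of \<sigma> m u] cochain_spaceD[OF y(1)] cochain_spaceD[OF cod_space[OF r]] Suc
          by (cases "\<sigma> \<in> cliques n") auto
        thus ?thesis using Suc r by auto
      qed
    qed
  qed
qed

text \<open>The sign of the cup product is absorbed into the argument of \<open>cod\<close> and does
  not change the image.\<close>

lemma coboundaries_cohomology:
  "coboundaries (group_cohomology G) (\<lambda>n b. cup G n 1 b (character_class G \<kappa>)) n = coho_class n ` exact_classes n"
proof (cases n)
  case 0
  thus ?thesis by (simp add: coboundaries_def one_cohomology exact_classes_def)
next
  case (Suc m)
  let ?d = "cod (\<lambda>v. \<kappa> (gam v))"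
  have s: "(\<lambda>\<sigma>. (-1) ^ m * ?d y \<sigma>) = ?d (\<lambda>\<sigma>. (-1) ^ m * y \<sigma>)" for y
    by (simp add: fun_eq_iff cod_scale)
  have "(\<lambda>y. (\<lambda>\<sigma>. (-1) ^ m * ?d y \<sigma>)) ` UNIV = range ?d"
  proof
    show "range ?d \<subseteq> (\<lambda>y. (\<lambda>\<sigma>. (-1) ^ m * ?d y \<sigma>)) ` UNIV"
    proof clarify
      fix u
      have "(\<lambda>\<sigma>. (-1) ^ m * ?d (\<lambda>\<sigma>. (-1) ^ m * u \<sigma>) \<sigma>) = ?d u"
        unfolding cod_scale by (simp add: mult.assoc[symmetric] power_add[symmetric])
      thus "?d u \<in> range (\<lambda>y \<sigma>. (-1) ^ m * ?d y \<sigma>)" by (intro image_eqI[OF HOL.sym]) auto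
    qed
  qed (use s in auto)
  moreover have "coboundaries (group_cohomology G) (\<lambda>n b. cup G n 1 b (character_class G \<kappa>)) n =
      coho_class n ` (\<lambda>y. (\<lambda>\<sigma>. (-1) ^ m * ?d y \<sigma>)) ` UNIV"
    unfolding Suc coboundaries_def nat.case carrier_cohomology image_image cup_coho_class by (rule HOL.refl)
  ultimately show ?thesis by (simp add: exact_classes_def Suc)
qed

lemma cocycles_cohomology:
  "cocycles (group_cohomology G) (\<lambda>n b. cup G n 1 b (character_class G \<kappa>)) n =
    coho_class n ` {y. \<forall>\<sigma>\<in>cliques (Suc n). cod (\<lambda>v. \<kappa> (gam v)) y \<sigma> = 0}"
proof -
  have "cup G n 1 (coho_class n y) (character_class G \<kappa>) = \<one>\<^bsub>group_cohomology G (n + 1)\<^esub> \<longleftrightarrow>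
     (\<forall>\<sigma>\<in>cliques (Suc n). cod (\<lambda>v. \<kappa> (gam v)) y \<sigma> = 0)" for y
    unfolding cup_coho_class one_cohomology by (simp add: coho_class_eq_iff)
  thus ?thesis by (auto simp: cocycles_def kernel_def carrier_cohomology)
qed

text \<open>Elements of the quotient are the cosets \<open>?t y\<close>, and such a coset is trivial
  exactly if the class of \<open>y\<close> lies in \<open>?D\<close>, which is the condition in
  \<open>exact_at_classes\<close>.\<close>

theorem resonance_iff:
  "character_class G \<kappa> \<in> resonance_variety n G \<longleftrightarrow> \<not> exact_at (\<lambda>v. \<kappa> (gam v)) n"
proof -
  let ?H = "cohomology (group_cohomology G) (\<lambda>n b. cup G n 1 b (character_class G \<kappa>)) n"
  let ?D = "coho_class n ` exact_classes n"
  let ?K = "{y. \<forall>\<sigma>\<in>cliques (Suc n). cod (\<lambda>v. \<kappa> (gam v)) y \<sigma> = 0}"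
  let ?t = "\<lambda>y. (\<lambda>e. coho_class n (\<lambda>\<sigma>. e \<sigma> + y \<sigma>)) ` exact_classes n"
  have one: "\<one>\<^bsub>?H\<^esub> = ?D"
    unfolding cohomology_def FactGroup_def coboundaries_cohomology by simp
  have "carrier ?H = (\<lambda>X. \<Union>d\<in>?D. {d \<otimes>\<^bsub>group_cohomology G n\<^esub> X}) ` coho_class n ` ?K"
    unfolding cohomology_def FactGroup_def RCOSETS_def r_coset_def coboundaries_cohomology cocycles_cohomology by auto
  also have "\<dots> = ?t ` ?K"
    unfolding image_image by (rule image_cong[OF HOL.refl]) (auto simp: mult_cohomology)
  finally have carrier: "carrier ?H = ?t ` ?K" .
  have t: "?t y = ?D \<longleftrightarrow> coho_class n y \<in> ?D" for y
  proof
    assume "?t y = ?D"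
    moreover have "coho_class n (\<lambda>\<sigma>. 0 + y \<sigma>) \<in> ?t y"
      by (rule image_eqI[OF HOL.refl exact_classes_zero])
    ultimately show "coho_class n y \<in> ?D" by simp
  next
    assume "coho_class n y \<in> ?D"
    then obtain e where e: "e \<in> exact_classes n" "\<forall>\<sigma>\<in>cliques n. y \<sigma> = e \<sigma>" by (auto simp: coho_class_eq_iff)
    show "?t y = ?D"
    proof
      show "?t y \<subseteq> ?D"
      proof clarify
        fix e' assume "e' \<in> exact_classes n"
        hence "(\<lambda>\<sigma>. e' \<sigma> + 1 * e \<sigma>) \<in> exact_classes n" using e(1) by (rule exact_classes_add)
        moreover have "coho_class n (\<lambda>\<sigma>. e' \<sigma> + y \<sigma>) = coho_class n (\<lambda>\<sigma>. e' \<sigma> + 1 * e \<sigma>)" using e(2) by (simp add: coho_class_eq_iff)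
        ultimately show "coho_class n (\<lambda>\<sigma>. e' \<sigma> + y \<sigma>) \<in> ?D" by blast
      qed
      show "?D \<subseteq> ?t y"
      proof clarify
        fix e' assume "e' \<in> exact_classes n"
        hence "(\<lambda>\<sigma>. e' \<sigma> + (-1) * e \<sigma>) \<in> exact_classes n" using e(1) by (rule exact_classes_add)
        moreover have "coho_class n e' = coho_class n (\<lambda>\<sigma>. (e' \<sigma> + (-1) * e \<sigma>) + y \<sigma>)" using e(2) by (simp add: coho_class_eq_iff)
        ultimately show "coho_class n e' \<in> ?t y" by (intro image_eqI)
      qed
    qed
  qed
  have "(\<exists>x\<in>carrier ?H. x \<noteq> \<one>\<^bsub>?H\<^esub>) \<longleftrightarrow> (\<exists>y\<in>?K. coho_class n y \<notin> ?D)"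
    unfolding carrier one using t by auto
  also have "\<dots> \<longleftrightarrow> \<not> exact_at (\<lambda>v. \<kappa> (gam v)) n"
    unfolding exact_at_classes by blast
  finally show ?thesis using character_class_carrier unfolding resonance_variety_def by simp
qed

end
end

context raag_character begin

text \<open>That the character is nonzero is already exactness in degree 0: for the zero character,
  the function supported on the empty clique is a nonzero cocycle.\<close>

lemma Sigma_iff:
  "(\<exists>g\<in>carrier G. \<chi> g \<noteq> 0) \<and> type_FP q R (trivial_module :: ('v word set \<Rightarrow> real, real) module) \<longleftrightarrow>
    (\<forall>i\<le>q. exact_at (\<lambda>v. \<chi> (gam v)) i)"
proof
  assume ex: "\<forall>i\<le>q. exact_at (\<lambda>v. \<chi> (gam v)) i"
  have "\<exists>g\<in>carrier G. \<chi> g \<noteq> 0"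
  proof (rule ccontr)
    assume "\<not> (\<exists>g\<in>carrier G. \<chi> g \<noteq> 0)"
    hence "\<chi> (gam v) = 0" if "v \<in> V" for v using gam_closed[OF that] by blast
    hence "cod (\<lambda>v. \<chi> (gam v)) y \<sigma> = 0" for y \<sigma>
      using clique_V[of \<sigma>] by (cases "clique \<sigma>") (auto simp: cod_def subset_iff intro!: sum.neutral)
    hence "cod (\<lambda>v. \<chi> (gam v)) (\<lambda>\<sigma>. of_bool (\<sigma> = {})) = (\<lambda>_. 0)" by (intro ext)
    moreover have "(\<lambda>\<sigma>. of_bool (\<sigma> = {})) \<in> cochain_space 0" by (simp add: cochain_space_def cliques_0)
    ultimately have "(\<lambda>\<sigma> :: 'v set. of_bool (\<sigma> = {})) = (\<lambda>_. 0 :: real)"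
      using ex[rule_format, of 0] unfolding exact_at_def by (auto dest: bspec)
    hence "of_bool (({} :: 'v set) = {}) = (0 :: real)" by (rule fun_cong)
    thus False by simp
  qed
  thus "(\<exists>g\<in>carrier G. \<chi> g \<noteq> 0) \<and> type_FP q R (trivial_module :: ('v word set \<Rightarrow> real, real) module)"
    using exact_imp_FP ex by blast
next
  assume "(\<exists>g\<in>carrier G. \<chi> g \<noteq> 0) \<and> type_FP q R (trivial_module :: ('v word set \<Rightarrow> real, real) module)"
  thus "\<forall>i\<le>q. exact_at (\<lambda>v. \<chi> (gam v)) i" using FP_imp_exact[of q] by (elim conjE) (intro allI impI)
qed

end

theorem corollary14p6:
  fixes \<Gamma> :: "('v, 'e) pre_digraph" and q :: nat
  assumes "graph \<Gamma>"
  shows "Sigma_invariant q (raag \<Gamma>) =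
    characters (raag \<Gamma>) - character_class (raag \<Gamma>) -` (\<Union>i\<le>q. resonance_variety i (raag \<Gamma>))"
proof -
  interpret graph \<Gamma> by (rule assms)
  obtain idx :: "'v \<Rightarrow> nat" where idx: "inj_on idx (verts \<Gamma>)"
    using finite_imp_inj_to_nat_seg[OF finite_verts] by blast
  interpret raag: raag_setup \<Gamma> idx by (rule raag_setup.intro[OF assms idx])
  have G: "raag.G = raag \<Gamma>" by (rule raag.G_def)
  have "\<chi> \<in> Sigma_invariant q (raag \<Gamma>) \<longleftrightarrow> (\<forall>i\<le>q. character_class (raag \<Gamma>) \<chi> \<notin> resonance_variety i (raag \<Gamma>))"
    if \<chi>: "\<chi> \<in> characters (raag \<Gamma>)" for \<chi>
  proof -
    \<comment> \<open>The orientation depends on the character, so the signed locale is interpreted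
      anew for each \<chi>; \<open>exact_at\<close> belongs to the unoriented clique
      complex.\<close>
    define sg where "sg v \<longleftrightarrow> \<chi> (raag.letter (v, True)) \<ge> 0" for v
    interpret signed: raag_signed \<Gamma> idx sg by unfold_locales
    have mult: "\<chi> (g \<otimes>\<^bsub>raag.G\<^esub> h) = \<chi> g + \<chi> h" if "g \<in> carrier raag.G" "h \<in> carrier raag.G" for g h
      using \<chi> that by (simp add: characters_def hom_def real_additive_group_def G)
    have one: "\<chi> \<one>\<^bsub>raag.G\<^esub> = 0" using mult[of "\<one>\<^bsub>raag.G\<^esub>" "\<one>\<^bsub>raag.G\<^esub>"] by simp
    have gam: "\<chi> (signed.gam v) \<ge> 0" if v: "v \<in> verts \<Gamma>" for v
    proof -
      have "\<chi> (raag.letter (v, True)) + \<chi> (raag.letter (v, False)) = 0"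
        using mult[of "raag.letter (v, True)" "raag.letter (v, False)"] raag.letter_closed v
          raag.letter_cancel[of "(v, True)"] one by (simp add: inv_letter_def)
      thus ?thesis by (cases "sg v") (simp_all add: signed.gam_def sg_def)
    qed
    interpret raag_character \<Gamma> idx sg \<chi>
      by (intro raag_character.intro raag_character_axioms.intro signed.raag_signed_axioms mult gam)
    have "\<chi> \<in> Sigma_invariant q (raag \<Gamma>) \<longleftrightarrow> (\<forall>i\<le>q. raag.exact_at (\<lambda>v. \<chi> (signed.gam v)) i)"
      using \<chi> Sigma_iff[of q] by (simp add: Sigma_invariant_def G)
    thus ?thesis using signed.resonance_iff[OF mult] by (simp add: G)
  qed
  moreover have "Sigma_invariant q (raag \<Gamma>) \<subseteq> characters (raag \<Gamma>)"
    by (auto simp: Sigma_invariant_def)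
  ultimately show ?thesis by auto
qed

end
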